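(* Let $G$ be a pseudofinite group which is finite-dimensional with additive and fine dimension $\dim$. If $\dim(G)=2$, then $G$ is soluble-by-finite. Moreover, if $G$ is not finite-by-abelian-by-finite, then there is a definable normal subgroup $N$ of $G$ with $\dim(N)=1$.
   Context: A pseudofinite group is an infinite group satisfying every first-order sentence in the language of groups that is true in all finite groups. A group $G$ is finite-dimensional if there is a function $\dim$ from the collection of all interpretable sets in models of $\mathrm{Th}(G)$ to $\mathbb N\cup\{-\infty\}$ such that for every formula $\phi(x,y)$ and all interpretable sets $X,Y$: (1) if $a\equiv a'$ then $\dim(\phi(x,a))=\dim(\phi(x,a'))$; (2) $\dim(\emptyset)=-\infty$, and $\dim(X)=0$ if $X\neq\emptyset$ is finite; (3) $\dim(X\cup Y)=\max\{\dim X,\dim Y\}$; (4) if $f:X\to Y$ is an interpretable map with $\dim(f^{-1}(y))\ge d$ for all $y\in Y$, then $\dim(X)\ge\dim(Y)+d$. For a tuple $a$ and a set $B$, $\dim(a/B):=\inf\{\dim(\phi(x)):\phi\in\mathrm{tp}(a/B)\}$. The dimension is additive if $\dim(a,b/C)=\dim(a/b,C)+\dim(b/C)$ for all tuples $a,b$ and sets $C$; it is fine if $\dim(X)=0$ implies that $X$ is finite. For properties $P,Q$ of groups, a group is $P$-by-$Q$ if it has a normal subgroup $N$ with property $P$ such that the quotient by $N$ has property $Q$. Finite-by-abelian-by-finite means having a normal subgroup $A$ of finite index such that $A$ has a finite normal subgroup with abelian quotient (equivalently, finite-by-(abelian-by-finite)). *)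

theory Defs
  imports "HOL-Algebra.Solvable_Groups" "HOL-Library.Extended_Real"
begin

section \<open>First-order logic in the language of groups\<close>

datatype gterm = Var nat | One | Mult gterm gterm | Inv gterm

datatype gform = Eq gterm gterm | Neg gform | Conj gform gform | All nat gform

fun eval_term :: "'a monoid \<Rightarrow> (nat \<Rightarrow> 'a) \<Rightarrow> gterm \<Rightarrow> 'a" where
  "eval_term M s (Var i) = s i"
| "eval_term M s One = \<one>\<^bsub>M\<^esub>"
| "eval_term M s (Mult t u) = eval_term M s t \<otimes>\<^bsub>M\<^esub> eval_term M s u"
| "eval_term M s (Inv t) = inv\<^bsub>M\<^esub> (eval_term M s t)"

fun sat :: "'a monoid \<Rightarrow> (nat \<Rightarrow> 'a) \<Rightarrow> gform \<Rightarrow> bool" where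
  "sat M s (Eq t u) \<longleftrightarrow> eval_term M s t = eval_term M s u"
| "sat M s (Neg p) \<longleftrightarrow> \<not> sat M s p"
| "sat M s (Conj p q) \<longleftrightarrow> sat M s p \<and> sat M s q"
| "sat M s (All i p) \<longleftrightarrow> (\<forall>x\<in>carrier M. sat M (s(i := x)) p)"

fun fv_term :: "gterm \<Rightarrow> nat set" where
  "fv_term (Var i) = {i}"
| "fv_term One = {}"
| "fv_term (Mult t u) = fv_term t \<union> fv_term u"
| "fv_term (Inv t) = fv_term t"

fun fv :: "gform \<Rightarrow> nat set" where
  "fv (Eq t u) = fv_term t \<union> fv_term u"
| "fv (Neg p) = fv p"
| "fv (Conj p q) = fv p \<union> fv q"
| "fv (All i p) = fv p - {i}"

definition sentence :: "gform \<Rightarrow> bool" where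
  "sentence p \<longleftrightarrow> fv p = {}"

text \<open>
  Truth of a formula at a finite tuple: variable \<open>i\<close> denotes the \<open>i\<close>-th entry, and every
  variable beyond the length of the tuple denotes the neutral element.  As the latter is named by
  the term \<^const>\<open>One\<close>, this yields the same definable relations as restricting
  to formulas whose free variables are below the length of the tuple.
\<close>

definition holds :: "'a monoid \<Rightarrow> gform \<Rightarrow> 'a list \<Rightarrow> bool" where
  "holds M p xs \<longleftrightarrow> sat M (\<lambda>i. if i < length xs then xs ! i else \<one>\<^bsub>M\<^esub>) p"

text \<open>Every finite group is isomorphic to one whose elements are natural numbers.\<close>

definition pseudofinite :: "'a monoid \<Rightarrow> bool" where
  "pseudofinite G \<longleftrightarrow> group G \<and> infinite (carrier G) \<and>
     (\<forall>p. sentence p \<and> (\<forall>H :: nat monoid. group H \<and> finite (carrier H) \<longrightarrow> holds H p [])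
          \<longrightarrow> holds G p [])"

text \<open>
  Models of the theory of \<open>G\<close>.  The type \<open>'a\<close> serves as the universe in which
  \<open>G\<close> and all models live; it may be arbitrarily large compared with
  \<open>G\<close>.  When \<open>G\<close> is infinite, every complete type of its theory (in finitely many
  variables, without parameters) is realised in a countable model and hence in a model inside
  \<open>'a\<close>, so a dimension satisfying the axioms below for these models extends uniquely to the
  models of any larger universe.
\<close>

definition model_of_Th :: "'a monoid \<Rightarrow> 'a monoid \<Rightarrow> bool" where
  "model_of_Th G M \<longleftrightarrow> group M \<and> (\<forall>p. sentence p \<and> holds G p [] \<longrightarrow> holds M p [])"


section \<open>Imaginaries and interpretable sets\<close>

definition tuples :: "'a monoid \<Rightarrow> nat \<Rightarrow> 'a list set" where
  "tuples M n = {xs. length xs = n \<and> set xs \<subseteq> carrier M}"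

text \<open>
  A sort of \<open>M\<close>-eq is the quotient of the \<open>n\<close>-tuples by an equivalence relation
  defined, without parameters, by a formula \<open>e\<close>.  An imaginary is an element of a sort, that
  is, an equivalence class.
\<close>

definition sort_rel :: "'a monoid \<Rightarrow> nat \<Rightarrow> gform \<Rightarrow> ('a list \<times> 'a list) set" where
  "sort_rel M n e = {(u, v). u \<in> tuples M n \<and> v \<in> tuples M n \<and> holds M e (u @ v)}"

definition is_sort :: "'a monoid \<Rightarrow> nat \<Rightarrow> gform \<Rightarrow> bool" where
  "is_sort M n e \<longleftrightarrow> equiv (tuples M n) (sort_rel M n e)"

definition sort_elems :: "'a monoid \<Rightarrow> nat \<Rightarrow> gform \<Rightarrow> 'a list set set" where
  "sort_elems M n e = tuples M n // sort_rel M n e"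

definition imaginaries :: "'a monoid \<Rightarrow> 'a list set set" where
  "imaginaries M = {x. \<exists>n e. is_sort M n e \<and> x \<in> sort_elems M n e}"

text \<open>
  A finite tuple of imaginaries is again an imaginary, an element of the product sort: the tuple
  \<open>(x, y)\<close> is the class \<open>pair_imag x y\<close>.
\<close>

definition pair_imag :: "'a list set \<Rightarrow> 'a list set \<Rightarrow> 'a list set" where
  "pair_imag x y = {u @ v | u v. u \<in> x \<and> v \<in> y}"

definition concat_imag :: "'a list set list \<Rightarrow> 'a list set" where
  "concat_imag cs = foldr pair_imag cs {[]}"

text \<open>
  Formulas over imaginary variables: \<open>p\<close> stands for the formula saying that some
  representative of the tuple of imaginaries satisfies \<open>p\<close>.  Up to equivalence these are all
  the formulas of the language of \<open>M\<close>-eq.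
\<close>

definition holds_eq :: "'a monoid \<Rightarrow> gform \<Rightarrow> 'a list set \<Rightarrow> bool" where
  "holds_eq M p x \<longleftrightarrow> (\<exists>u\<in>x. holds M p u)"

text \<open>The set \<open>p(M, a)\<close>, where the variable of \<open>p(x, y)\<close> ranges over the sort \<open>(n, e)\<close>.\<close>

definition eq_set :: "'a monoid \<Rightarrow> nat \<Rightarrow> gform \<Rightarrow> gform \<Rightarrow> 'a list set \<Rightarrow> 'a list set set" where
  "eq_set M n e p a = {x \<in> sort_elems M n e. holds_eq M p (pair_imag x a)}"

definition interpretable_over :: "'a monoid \<Rightarrow> 'a list set set \<Rightarrow> 'a list set set \<Rightarrow> bool" where
  "interpretable_over M B X \<longleftrightarrow>
     (\<exists>n e p cs. is_sort M n e \<and> set cs \<subseteq> B \<and> X = eq_set M n e p (concat_imag cs))"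

definition interpretable :: "'a monoid \<Rightarrow> 'a list set set \<Rightarrow> bool" where
  "interpretable M X \<longleftrightarrow> interpretable_over M (imaginaries M) X"

definition interpretable_map ::
    "'a monoid \<Rightarrow> 'a list set set \<Rightarrow> 'a list set set \<Rightarrow> ('a list set \<Rightarrow> 'a list set) \<Rightarrow> bool" where
  "interpretable_map M X Y f \<longleftrightarrow>
     f ` X \<subseteq> Y \<and> interpretable M {pair_imag x (f x) | x. x \<in> X}"

definition definable :: "'a monoid \<Rightarrow> 'a set \<Rightarrow> bool" where
  "definable M A \<longleftrightarrow>
     (\<exists>p cs. set cs \<subseteq> carrier M \<and> A = {x \<in> carrier M. holds M p (x # cs)})"

text \<open>A subset of \<open>M\<close> as a set of imaginaries: the home sort is the sort of equality on 1-tuples.\<close>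

definition home :: "'a set \<Rightarrow> 'a list set set" where
  "home A = (\<lambda>x. {[x]}) ` A"


section \<open>Dimension\<close>

definition same_type :: "'a monoid \<Rightarrow> 'a list set \<Rightarrow> 'a monoid \<Rightarrow> 'a list set \<Rightarrow> bool" where
  "same_type M a M' a' \<longleftrightarrow>
     (\<exists>k d. is_sort M k d \<and> is_sort M' k d \<and> a \<in> sort_elems M k d \<and> a' \<in> sort_elems M' k d) \<and>
     (\<forall>p. holds_eq M p a \<longleftrightarrow> holds_eq M' p a')"

text \<open>
  A dimension assigns a value to each pair of a model \<open>M\<close> and an interpretable set of
  \<open>M\<close>; its values on other arguments are irrelevant.
  In the clause for unions, the union is assumed interpretable because two interpretable sets need
  not lie in a common sort.
\<close>

definition dimension :: "'a monoid \<Rightarrow> ('a monoid \<Rightarrow> 'a list set set \<Rightarrow> ereal) \<Rightarrow> bool" where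
  "dimension G dm \<longleftrightarrow>
     (\<forall>M X. model_of_Th G M \<and> interpretable M X \<longrightarrow>
        dm M X = -\<infinity> \<or> (\<exists>k::nat. dm M X = ereal (real k))) \<and>
     (\<forall>M M' n e p a a'. model_of_Th G M \<and> model_of_Th G M' \<and> is_sort M n e \<and>
        same_type M a M' a' \<longrightarrow>
        dm M (eq_set M n e p a) = dm M' (eq_set M' n e p a')) \<and>
     (\<forall>M. model_of_Th G M \<longrightarrow> dm M {} = -\<infinity>) \<and>
     (\<forall>M X. model_of_Th G M \<and> interpretable M X \<and> X \<noteq> {} \<and> finite X \<longrightarrow> dm M X = 0) \<and>
     (\<forall>M X Y. model_of_Th G M \<and> interpretable M X \<and> interpretable M Y \<and>
        interpretable M (X \<union> Y) \<longrightarrow> dm M (X \<union> Y) = max (dm M X) (dm M Y)) \<and>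
     (\<forall>M X Y f (d::nat). model_of_Th G M \<and> interpretable M X \<and> interpretable M Y \<and>
        interpretable_map M X Y f \<and>
        (\<forall>y\<in>Y. dm M {x \<in> X. f x = y} \<ge> ereal (real d)) \<longrightarrow>
        dm M X \<ge> dm M Y + ereal (real d))"

text \<open>The formulas in \<open>tp(a/B)\<close> define exactly the sets interpretable over \<open>B\<close> that contain \<open>a\<close>.\<close>

definition dim_type ::
    "('a monoid \<Rightarrow> 'a list set set \<Rightarrow> ereal) \<Rightarrow> 'a monoid \<Rightarrow> 'a list set \<Rightarrow> 'a list set set \<Rightarrow> ereal" where
  "dim_type dm M a B = Inf {dm M X | X. interpretable_over M B X \<and> a \<in> X}"

definition additive_dim :: "'a monoid \<Rightarrow> ('a monoid \<Rightarrow> 'a list set set \<Rightarrow> ereal) \<Rightarrow> bool" where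
  "additive_dim G dm \<longleftrightarrow>
     (\<forall>M a b C. model_of_Th G M \<and> a \<in> imaginaries M \<and> b \<in> imaginaries M \<and>
        C \<subseteq> imaginaries M \<longrightarrow>
        dim_type dm M (pair_imag a b) C = dim_type dm M a (insert b C) + dim_type dm M b C)"

definition fine_dim :: "'a monoid \<Rightarrow> ('a monoid \<Rightarrow> 'a list set set \<Rightarrow> ereal) \<Rightarrow> bool" where
  "fine_dim G dm \<longleftrightarrow>
     (\<forall>M X. model_of_Th G M \<and> interpretable M X \<and> dm M X = 0 \<longrightarrow> finite X)"


section \<open>Group-theoretic properties\<close>

definition P_by_Q ::
    "('a monoid \<Rightarrow> bool) \<Rightarrow> ('a set monoid \<Rightarrow> bool) \<Rightarrow> 'a monoid \<Rightarrow> bool" where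
  "P_by_Q P Q G \<longleftrightarrow> (\<exists>N. N \<lhd> G \<and> P (G\<lparr>carrier := N\<rparr>) \<and> Q (G Mod N))"

definition finite_group :: "'a monoid \<Rightarrow> bool" where
  "finite_group G \<longleftrightarrow> group G \<and> finite (carrier G)"

definition soluble_by_finite :: "'a monoid \<Rightarrow> bool" where
  "soluble_by_finite = P_by_Q solvable finite_group"

definition finite_by_abelian_by_finite :: "'a monoid \<Rightarrow> bool" where
  "finite_by_abelian_by_finite = P_by_Q (P_by_Q finite_group comm_group) finite_group"

end

theory Submission
  imports Defs "HOL-Library.Countable" "HOL-Library.Diagonal_Subsequence"
begin

text \<open>
  The proof follows the analysis of centralisers in pseudofinite groups of dimension 2. Compactness
  bounds the chains of centralisers \<open>C(x) \<inter> C(y) < C(x) < G\<close>, so the elements with finitely many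
  conjugates form a definable normal subgroup \<open>Z\<close>. If \<open>Z\<close> has finite index, then its
  conjugacy classes are bounded and its derived subgroup is finite by a theorem of Neumann. If \<open>Z\<close>
  is infinite of infinite index, it has dimension 1. If \<open>Z\<close> is finite, the elements outside
  \<open>Z\<close> with infinite centraliser fall into lines: \<open>A(x)\<close> consists of the elements that centralise a
  subgroup of finite index in \<open>C(x)\<close>, is a subgroup of dimension 1, and two lines agree or meet in
  \<open>Z\<close>. Unless some line is normal, there are only finitely many lines and classes up to conjugacy, as
  each of these conjugacy classes has dimension 2. In the finite groups approximating \<open>G\<close> the class
  equation then expresses a fixed rational number by terms tending to 0, which is impossible.

  Given a normal subgroup \<open>N\<close> of dimension 1, the class equation shows in the same way that in the sections
  \<open>N/1\<close> and \<open>G/N\<close> the elements with finitely many conjugates form a subgroup of finite index.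
  Neumann's theorem bounds the derived subgroups of both, and centralising them yields a soluble
  subgroup of finite index.
\<close>

section \<open>First-order predicates\<close>

text \<open>Axiom (4) bounds the dimension of a total space from below, so an upper bound on
  dimension is exploited by exhibiting a set that would be too large. The one place where an image
  must be bounded from below, a conjugacy class with finite centraliser, is where additivity is
  used. The axioms speak about all models inside the type \<open>'a\<close>, compactness passes from
  \<open>G\<close> to such models, and the class equations are evaluated in finite groups; hence
  definability must be uniform in the structure, and predicates of a structure and an environment
  are handled rather than subsets of \<open>G\<close>. In the class equations most summands are
  reciprocals of indices that are finite in \<open>G\<close>, hence constant in almost all
  approximating groups. The other summands have as numerator the size of the finite set of elements
  with few conjugates and a growing denominator. Collecting the constants on one side makes a
  constant equal to a nonzero quantity that tends to 0. For sections this quantity is a single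
  positive fraction. For lines it has terms of both signs, and it is nonzero because the normaliser
  of each line is smaller than the group.\<close>

definition push :: "'a \<Rightarrow> (nat \<Rightarrow> 'a) \<Rightarrow> nat \<Rightarrow> 'a" (infixr "##" 65) where
  "x ## s = (\<lambda>i. case i of 0 \<Rightarrow> x | Suc j \<Rightarrow> s j)"

lemma push_0 [simp]: "(x ## s) 0 = x"
  and push_Suc [simp]: "(x ## s) (Suc i) = s i"
  and push_Suc_eta [simp]: "(\<lambda>i. (x ## s) (Suc i)) = s"
  by (simp_all add: push_def)

lemma push_numeral [simp]: "(x ## s) (numeral k) = s (pred_numeral k)"
  and push_One [simp]: "(x ## s) 1 = s 0"
  by (simp_all add: numeral_eq_Suc del: One_nat_def) (simp add: One_nat_def)

definition env :: "'a monoid \<Rightarrow> (nat \<Rightarrow> 'a) \<Rightarrow> bool" where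
  "env M s \<longleftrightarrow> (\<forall>i. s i \<in> carrier M)"

lemma env_push [simp]: "env M (x ## s) \<longleftrightarrow> x \<in> carrier M \<and> env M s"
proof
  assume *: "env M (x ## s)"
  have "x \<in> carrier M" using *[unfolded env_def, rule_format, of 0] by simp
  moreover have "s i \<in> carrier M" for i using *[unfolded env_def, rule_format, of "Suc i"] by simp
  ultimately show "x \<in> carrier M \<and> env M s" by (auto simp: env_def)
qed (auto simp: env_def push_def split: nat.split)

lemma env_comp [simp]: "env M s \<Longrightarrow> env M (\<lambda>i. s (f i))"
  by (auto simp: env_def)

lemma env_carrier [simp]: "env M s \<Longrightarrow> s i \<in> carrier M"
  by (auto simp: env_def)

text \<open>Terms and formulas are represented by the functions and predicates that they define, uniformly
  in the group and in an environment of de Bruijn variables. The rule \<open>fo_cong\<close> ignores junk values on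
  structures that are not groups.\<close>

inductive ft :: "('a monoid \<Rightarrow> (nat \<Rightarrow> 'a) \<Rightarrow> 'a) \<Rightarrow> bool" where
  ft_var: "ft (\<lambda>M s. s i)"
| ft_one: "ft (\<lambda>M s. \<one>\<^bsub>M\<^esub>)"
| ft_mult: "ft t \<Longrightarrow> ft u \<Longrightarrow> ft (\<lambda>M s. t M s \<otimes>\<^bsub>M\<^esub> u M s)"
| ft_inv: "ft t \<Longrightarrow> ft (\<lambda>M s. inv\<^bsub>M\<^esub> (t M s))"

inductive fo :: "('a monoid \<Rightarrow> (nat \<Rightarrow> 'a) \<Rightarrow> bool) \<Rightarrow> bool" where
  fo_eq: "ft t \<Longrightarrow> ft u \<Longrightarrow> fo (\<lambda>M s. t M s = u M s)"
| fo_neg: "fo P \<Longrightarrow> fo (\<lambda>M s. \<not> P M s)"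
| fo_conj: "fo P \<Longrightarrow> fo Q \<Longrightarrow> fo (\<lambda>M s. P M s \<and> Q M s)"
| fo_all_push: "fo P \<Longrightarrow> fo (\<lambda>M s. \<forall>x\<in>carrier M. P M (x ## s))"
| fo_cong: "fo P \<Longrightarrow> (\<And>M s. group M \<Longrightarrow> env M s \<Longrightarrow> P M s = Q M s) \<Longrightarrow> fo Q"

lemma ft_closed: "ft t \<Longrightarrow> group M \<Longrightarrow> env M s \<Longrightarrow> t M s \<in> carrier M"
  by (induction rule: ft.induct) (auto simp: monoid.one_closed group.is_monoid monoid.m_closed group.inv_closed)

lemma ft_subst:
  assumes "ft t" "\<And>i. ft (\<lambda>M s. u M s i)"
  shows "ft (\<lambda>M s. t M (u M s))"
  using assms(1)
proof (induction rule: ft.induct)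
  case (ft_var i) show ?case by (rule assms(2))
next
  case ft_one show ?case by (rule ft.ft_one)
next
  case (ft_mult t v) show ?case by (rule ft.ft_mult) fact+
next
  case (ft_inv t) show ?case by (rule ft.ft_inv) fact
qed

lemma ft_shift: "ft t \<Longrightarrow> ft (\<lambda>M s. t M (\<lambda>i. s (f i)))"
  by (rule ft_subst[of t "\<lambda>M s i. s (f i)", OF _ ft_var])

lemma ft_push:
  assumes "ft t" "\<And>i. ft (\<lambda>M s. u M s i)" shows "ft (\<lambda>M s. (t M s ## u M s) i)"
  using assms by (cases i) simp_all

text \<open>The quantifier case lifts the substitution below the binder, keeping variable 0 fixed.
  The case of \<open>fo_cong\<close> works because terms send environments of a group to
  environments of the same group.\<close>

lemma fo_subst:
  assumes "fo P" "\<And>i. ft (\<lambda>M s. u M s i)"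
  shows "fo (\<lambda>M s. P M (u M s))"
  using assms
proof (induction arbitrary: u rule: fo.induct)
  case (fo_eq t v) show ?case by (intro fo.fo_eq ft_subst[OF fo_eq.hyps(1) fo_eq.prems] ft_subst[OF fo_eq.hyps(2) fo_eq.prems])
next
  case (fo_neg P)
  show ?case by (rule fo.fo_neg) (rule fo_neg.IH[of u, OF fo_neg.prems])
next
  case (fo_conj P Q)
  show ?case by (rule fo.fo_conj) (rule fo_conj.IH(1)[of u, OF fo_conj.prems], rule fo_conj.IH(2)[of u, OF fo_conj.prems])
next
  case (fo_all_push P)
  let ?v = "\<lambda>M s. s 0 ## u M (\<lambda>i. s (Suc i))"
  have v: "ft (\<lambda>M s. (s 0 ## u M (\<lambda>i. s (Suc i))) i)" for i
  proof (cases i)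
    case 0 then show ?thesis using ft_var[of 0] by simp
  next
    case (Suc j) then show ?thesis using ft_shift[OF fo_all_push.prems[of j], of Suc] by simp
  qed
  have "fo (\<lambda>M s. P M (?v M s))"
    by (rule fo_all_push.IH[of ?v, OF v])
  from fo.fo_all_push[OF this] show ?case by simp
next
  case (fo_cong P Q)
  have *: "P M (u M s) = Q M (u M s)" if "group M" "env M s" for M s
  proof -
    have "env M (u M s)" unfolding env_def using ft_closed[OF fo_cong.prems that] by blast
    with that(1) show ?thesis by (rule fo_cong.hyps(2))
  qed
  show ?case
    by (rule fo.fo_cong[where P = "\<lambda>M s. P M (u M s)", OF fo_cong.IH[of u, OF fo_cong.prems] *])
qed

lemma fo_shift: "fo P \<Longrightarrow> fo (\<lambda>M s. P M (\<lambda>i. s (f i)))"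
  by (rule fo_subst[of P "\<lambda>M s i. s (f i)", OF _ ft_var])

text \<open>In this form higher-order unification reads off \<open>P\<close> from the goal, and
  \<open>intro\<close> can descend below binders. The rules \<open>fo_ex\<close>,
  \<open>fo_nge\<close> and \<open>fof_Collect\<close> follow the same pattern.\<close>

lemma fo_all:
  "fo (\<lambda>M s. P M (\<lambda>i. s (Suc i)) (s 0)) \<Longrightarrow> fo (\<lambda>M s. \<forall>x\<in>carrier M. P M s x)"
  using fo_all_push[of "\<lambda>M s. P M (\<lambda>i. s (Suc i)) (s 0)"] by simp

lemma fo_disj: "fo P \<Longrightarrow> fo Q \<Longrightarrow> fo (\<lambda>M s. P M s \<or> Q M s)"
  using fo_neg[OF fo_conj[OF fo_neg fo_neg], of P Q] by simp

lemma fo_imp: "fo P \<Longrightarrow> fo Q \<Longrightarrow> fo (\<lambda>M s. P M s \<longrightarrow> Q M s)"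
  using fo_neg[OF fo_conj[OF _ fo_neg], of P Q] by simp

lemma fo_iff: "fo P \<Longrightarrow> fo Q \<Longrightarrow> fo (\<lambda>M s. P M s \<longleftrightarrow> Q M s)"
  using fo_conj[OF fo_imp fo_imp, of P Q Q P] by (simp add: iff_conv_conj_imp)

lemma fo_ex:
  assumes "fo (\<lambda>M s. P M (\<lambda>i. s (Suc i)) (s 0))" shows "fo (\<lambda>M s. \<exists>x\<in>carrier M. P M s x)"
  using fo_neg[OF fo_all[of "\<lambda>M s x. \<not> P M s x"]] fo_neg[OF assms] by simp

lemma fo_const: "fo (\<lambda>M s. b)"
proof -
  have "fo (\<lambda>M s. \<one>\<^bsub>M\<^esub> = \<one>\<^bsub>M\<^esub>)" by (intro fo_eq ft_one)
  then have "fo (\<lambda>M s. True)" by simp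
  then show ?thesis using fo_neg[of "\<lambda>M s. True"] by (cases b) simp_all
qed

lemma fo_carrier: "ft t \<Longrightarrow> fo (\<lambda>M s. t M s \<in> carrier M)"
  by (rule fo_cong[where P = "\<lambda>M s. True", OF fo_const]) (simp add: ft_closed)

lemma fo_all_less:
  "(\<And>i. i < (n::nat) \<Longrightarrow> fo (P i)) \<Longrightarrow> fo (\<lambda>M s. \<forall>i<n. P i M s)"
proof (induction n)
  case 0 show ?case using fo_const[of True] by simp
next
  case (Suc n)
  then have "fo (\<lambda>M s. P n M s \<and> (\<forall>i<n. P i M s))" by (intro fo_conj) simp_all
  then show ?case by (simp add: All_less_Suc)
qed

lemma fo_ex_less:
  "(\<And>i. i < (n::nat) \<Longrightarrow> fo (P i)) \<Longrightarrow> fo (\<lambda>M s. \<exists>i<n. P i M s)"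
  using fo_neg[OF fo_all_less[of n "\<lambda>i M s. \<not> P i M s"]] fo_neg[of "P _"] by simp

section \<open>Translation between uniform predicates and formulas\<close>

instance gterm :: countable by countable_datatype
instance gform :: countable by countable_datatype

lemma eval_term_cong: "(\<And>i. i \<in> fv_term t \<Longrightarrow> s i = s' i) \<Longrightarrow> eval_term M s t = eval_term M s' t"
  by (induction t) auto

lemma sat_cong: "(\<And>i. i \<in> fv p \<Longrightarrow> s i = s' i) \<Longrightarrow> sat M s p = sat M s' p"
proof (induction p arbitrary: s s')
  case (Eq t u)
  then show ?case by (simp, metis eval_term_cong UnCI)
next
  case (All i p)
  have "sat M (s(i := x)) p = sat M (s'(i := x)) p" for x
    by (rule All.IH) (use All.prems in auto)
  then show ?case by simp
next
  case (Conj p q)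
  have "sat M s p = sat M s' p" by (rule Conj.IH(1)) (use Conj.prems in auto)
  moreover have "sat M s q = sat M s' q" by (rule Conj.IH(2)) (use Conj.prems in auto)
  ultimately show ?case by simp
next
  case (Neg p)
  have "sat M s p = sat M s' p" by (rule Neg.IH) (use Neg.prems in auto)
  then show ?case by simp
qed

lemma finite_fv_term: "finite (fv_term t)" by (induction t) auto
lemma finite_fv: "finite (fv p)" by (induction p) (auto simp: finite_fv_term)

lemma fv_bound: "\<exists>n. fv p \<subseteq> {..<n}"
  using finite_nat_iff_bounded[of "fv p"] finite_fv by auto

primrec ren_term :: "(nat \<Rightarrow> nat) \<Rightarrow> gterm \<Rightarrow> gterm" where
  "ren_term f (Var i) = Var (f i)"
| "ren_term f One = One"
| "ren_term f (Mult t u) = Mult (ren_term f t) (ren_term f u)"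
| "ren_term f (Inv t) = Inv (ren_term f t)"

primrec ren :: "(nat \<Rightarrow> nat) \<Rightarrow> gform \<Rightarrow> gform" where
  "ren f (Eq t u) = Eq (ren_term f t) (ren_term f u)"
| "ren f (Neg p) = Neg (ren f p)"
| "ren f (Conj p q) = Conj (ren f p) (ren f q)"
| "ren f (All i p) = All (f i) (ren f p)"

lemma eval_ren_term: "eval_term M s (ren_term f t) = eval_term M (\<lambda>i. s (f i)) t"
  by (induction t) auto

text \<open>Bound variables are renamed together with the free ones, and injectivity excludes
  capture.\<close>

lemma sat_ren: "inj f \<Longrightarrow> sat M s (ren f p) = sat M (\<lambda>i. s (f i)) p"
proof (induction p arbitrary: s)
  case (All i p)
  have "(\<lambda>j. (s(f i := x)) (f j)) = (\<lambda>j. s (f j))(i := x)" for x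
    using All.prems by (auto simp: fun_eq_iff inj_eq)
  then show ?case using All by simp
qed (auto simp: eval_ren_term)

lemma ft_gterm: "ft t \<Longrightarrow> \<exists>u. \<forall>M s. eval_term M s u = t M s"
proof (induction rule: ft.induct)
  case (ft_var i) show ?case by (rule exI[of _ "Var i"]) simp
next
  case ft_one show ?case by (rule exI[of _ "One"]) simp
next
  case (ft_mult t u) then show ?case by (metis eval_term.simps(3))
next
  case (ft_inv t) then show ?case by (metis eval_term.simps(4))
qed

lemma ft_eval_term: "ft (\<lambda>M s. eval_term M s t)"
  by (induction t) (simp_all add: ft.intros)

text \<open>The converse of \<open>fo_gform\<close>, for formulas that are given from outside, such
  as those defining a sort or a set of imaginaries.\<close>

lemma fo_sat: "fo (\<lambda>M s. sat M s p)"
proof (induction p)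
  case (All i p)
  \<comment> \<open>Updating the named variable \<open>i\<close> is a push followed by the renaming
    that sends \<open>i\<close> to 0 and every other \<open>j\<close> to
    \<open>Suc j\<close>.\<close>
  have *: "s(i := x) = (\<lambda>j. (x ## s) (if j = i then 0 else Suc j))" for s :: "nat \<Rightarrow> 'a" and x
    by auto
  show ?case using fo_all_push[OF fo_shift[OF All, of "\<lambda>j. if j = i then 0 else Suc j"]]
    by (simp add: *)
qed (simp_all add: fo_eq fo_neg fo_conj ft_eval_term)

text \<open>The cyclic renaming turns the de Bruijn binder into a named one.\<close>

lemma fo_gform: "fo P \<Longrightarrow> \<exists>p. \<forall>M s. group M \<longrightarrow> env M s \<longrightarrow> sat M s p = P M s"
proof (induction rule: fo.induct)
  case (fo_eq t u)
  then obtain t' u' where "\<forall>M s. eval_term M s t' = t M s" "\<forall>M s. eval_term M s u' = u M s"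
    using ft_gterm by meson
  then show ?case by (intro exI[of _ "Eq t' u'"]) simp
next
  case (fo_neg P) then show ?case by (metis sat.simps(2))
next
  case (fo_conj P Q) then show ?case by (metis sat.simps(3))
next
  case (fo_all_push P)
  then obtain p where p: "\<forall>M s. group M \<longrightarrow> env M s \<longrightarrow> sat M s p = P M s" by auto
  obtain K where K: "fv p \<subseteq> {..<K}" using fv_bound by auto
  define f where "f i = (if i = 0 then K else if i \<le> K then i - 1 else i)" for i
  have f: "inj f" by (auto simp: inj_def f_def)
  have "sat M s (All K (ren f p)) = (\<forall>x\<in>carrier M. P M (x ## s))" if "group M" "env M s" for M s
  proof -
    have "sat M (s(K := x)) (ren f p) = sat M (x ## s) p" for x
      unfolding sat_ren[OF f]
    proof (rule sat_cong)
      fix i assume "i \<in> fv p" then have "i < K" using K by auto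
      then show "(s(K := x)) (f i) = (x ## s) i" by (cases i) (auto simp: f_def)
    qed
    moreover have "sat M (x ## s) p = P M (x ## s)" if "x \<in> carrier M" for x
      using p[rule_format, of M "x ## s"] that \<open>group M\<close> \<open>env M s\<close> by simp
    ultimately show ?thesis by simp
  qed
  then show ?case by blast
next
  case (fo_cong P Q) then show ?case by (metis)
qed

text \<open>This allows the classes of a definable relation to be coded by tuples of one fixed
  length.\<close>

lemma fo_finite_support:
  assumes "fo P"
  shows "\<exists>n. \<forall>M s s'. group M \<longrightarrow> env M s \<longrightarrow> env M s' \<longrightarrow> (\<forall>i<n. s i = s' i) \<longrightarrow> P M s = P M s'"
proof -
  obtain p where p: "\<forall>M s. group M \<longrightarrow> env M s \<longrightarrow> sat M s p = P M s" using fo_gform[OF assms] by auto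
  obtain n where n: "fv p \<subseteq> {..<n}" using fv_bound by auto
  have "P M s = P M s'" if "group M" "env M s" "env M s'" "\<forall>i<n. s i = s' i" for M s s'
    using sat_cong[of p s s' M] p n that by auto
  then show ?thesis by blast
qed

section \<open>Elementary extensions and finite approximations\<close>

text \<open>An assignment that reads its values from a finite list of variables of \<open>t\<close>.
  There are only countably many formulas with such lists, as both the Henkin enumeration and the
  diagonal subsequence require.\<close>

definition lst :: "'a monoid \<Rightarrow> (nat \<Rightarrow> 'a) \<Rightarrow> nat list \<Rightarrow> nat \<Rightarrow> 'a" where
  "lst M t l = (\<lambda>v. if v < length l then t (l ! v) else \<one>\<^bsub>M\<^esub>)"

text \<open>The first component is padding: it gives each triple infinitely many codes, so one of
  them lies beyond all variables in \<open>l\<close>.\<close>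

lemma henkin_index:
  "\<exists>j. \<exists>r. from_nat j = (r::nat, i::nat, p::gform, l::nat list) \<and> (\<forall>v\<in>set l. v \<le> j)"
proof -
  let ?f = "\<lambda>r. to_nat (r::nat, i, p, l)"
  have "inj ?f" by (auto simp: inj_def)
  then have "infinite (range ?f)" using range_inj_infinite by blast
  then obtain j where j: "j \<in> range ?f" "j > Max (insert 0 (set l))"
    by (meson finite_nat_set_iff_bounded_le not_le)
  then have "\<forall>v\<in>set l. v \<le> j" by (auto simp: less_imp_le)
  moreover from j(1) obtain r where "j = ?f r" by auto
  ultimately show ?thesis by (metis from_nat_to_nat)
qed

text \<open>Henkin witnesses. The position of the witness depends on the statement only, so that one choice
  serves a whole sequence of environments.\<close>

lemma henkin_env:
  "\<exists>c. \<forall>(M::'a monoid) s. group M \<longrightarrow> env M s \<longrightarrow> (\<exists>t. env M t \<and> (\<forall>v. t (2 * v) = s v) \<and>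
     (\<forall>i p l. (\<exists>x\<in>carrier M. sat M ((lst M t l)(i := x)) p) \<longrightarrow>
        sat M ((lst M t l)(i := t (c i p l))) p))"
proof -
  define w where "w i p l = (SOME j. \<exists>r::nat. from_nat j = (r, i, p, l) \<and> (\<forall>v\<in>set l. v \<le> j))"
    for i :: nat and p :: gform and l :: "nat list"
  have w: "\<exists>r::nat. from_nat (w i p l) = (r, i, p, l) \<and> (\<forall>v\<in>set l. v \<le> w i p l)" for i p l
      unfolding w_def by (rule someI_ex[OF henkin_index])
  define c where "c i p l = 2 * w i p l + 1" for i p l
  have "\<exists>t. env M t \<and> (\<forall>v. t (2 * v) = s v) \<and>
     (\<forall>i p l. (\<exists>x\<in>carrier M. sat M ((lst M t l)(i := x)) p) \<longrightarrow>
        sat M ((lst M t l)(i := t (c i p l))) p)"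
    if M: "group M" and s: "env M s" for M :: "'a monoid" and s
  proof -
    define W where "W t i p l = (SOME x. x \<in> carrier M \<and>
      ((\<exists>x\<in>carrier M. sat M ((lst M t l)(i := x)) p) \<longrightarrow> sat M ((lst M t l)(i := x)) p))"
      for t i p l
    have one: "\<one>\<^bsub>M\<^esub> \<in> carrier M" using M by (simp add: group.is_monoid monoid.one_closed)
    have W: "W t i p l \<in> carrier M \<and>
      ((\<exists>x\<in>carrier M. sat M ((lst M t l)(i := x)) p) \<longrightarrow> sat M ((lst M t l)(i := W t i p l)) p)"
      for t i p l
      unfolding W_def by (rule someI_ex) (use one in blast)
    \<comment> \<open>Even positions keep \<open>s\<close>. Stage \<open>j\<close> fills position
      \<open>2 * j + 1\<close> with a witness for the statement coded by \<open>j\<close>. For the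
      codes chosen by \<open>w\<close>, this statement mentions only positions up to
      \<open>j\<close>, and these no longer change.\<close>
    define e where "e = rec_nat (\<lambda>v. if even v then s (v div 2) else \<one>\<^bsub>M\<^esub>)
      (\<lambda>j t. t(2 * j + 1 := (case from_nat j of (r::nat, i, p, l) \<Rightarrow> W t i p l)))"
    have e0: "e 0 = (\<lambda>v. if even v then s (v div 2) else \<one>\<^bsub>M\<^esub>)"
      and eS: "e (Suc j) = (e j)(2 * j + 1 := (case from_nat j of (r::nat, i, p, l) \<Rightarrow> W (e j) i p l))" for j
      by (simp_all add: e_def)
    have e_env: "env M (e j)" for j
    proof (induction j)
      case 0 show ?case using s one by (auto simp: e0 env_def)
    next
      case (Suc j) show ?case using Suc W unfolding eS by (auto simp: env_def split: prod.split)
    qed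
    have even: "e j (2 * v) = s v" for j v
    proof (induction j)
      case (Suc j)
      have "2 * v \<noteq> 2 * j + 1" by presburger
      with Suc show ?case by (simp add: eS)
    qed (simp add: e0)
    have stab: "e (v + d) v = e v v" for v d
    proof (induction d)
      case (Suc d)
      have "v \<noteq> 2 * (v + d) + 1" by presburger
      with Suc show ?case by (simp add: eS)
    qed simp
    define t where "t v = e v v" for v
    have t: "t v = e j v" if "v \<le> j" for v j
      using stab[of v "j - v"] that by (simp add: t_def)
    have "env M t" using e_env by (auto simp: env_def t_def)
    moreover have "\<forall>v. t (2 * v) = s v" by (simp add: t_def even)
    moreover have "sat M ((lst M t l)(i := t (c i p l))) p"
      if ex: "\<exists>x\<in>carrier M. sat M ((lst M t l)(i := x)) p" for i p l
    proof -
      define j where "j = w i p l"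
      obtain r where r: "from_nat j = (r::nat, i, p, l)" "\<forall>v\<in>set l. v \<le> j"
        using w[of i p l] by (auto simp: j_def)
      have l: "lst M t l = lst M (e j) l"
        using r(2) t by (auto simp: lst_def fun_eq_iff)
      have "t (c i p l) = e (c i p l + 0) (c i p l)" by (simp add: t_def)
      also have "\<dots> = e (Suc j) (c i p l)"
      proof -
        have *: "e (Suc j + d) (2 * j + 1) = e (Suc j) (2 * j + 1)" for d
        proof (induction d)
          case (Suc d)
          have "2 * j + 1 \<noteq> 2 * (Suc j + d) + 1" by presburger
          with Suc show ?case by (simp add: eS[of "Suc j + d"] del: add_Suc)
        qed simp
        have "c i p l = Suc j + j" by (simp add: c_def j_def)
        then show ?thesis using *[of j] by (simp add: c_def j_def mult_2)
      qed
      also have "\<dots> = W (e j) i p l" using r(1) by (simp add: eS c_def j_def)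
      finally show ?thesis using W[of "e j" i p l] ex unfolding l by simp
    qed
    ultimately show ?thesis by blast
  qed
  then show ?thesis by blast
qed

text \<open>The subsequence takes the place of an ultrafilter: along it, \<open>eventually\<close>
  commutes with negation for each of the countably many \<open>Q n\<close>.\<close>

lemma decisive_subsequence:
  fixes Q :: "nat \<Rightarrow> nat \<Rightarrow> bool"
  shows "\<exists>r::nat \<Rightarrow> nat. strict_mono r \<and>
    (\<forall>n. eventually (\<lambda>k. Q n (r k)) sequentially \<or> eventually (\<lambda>k. \<not> Q n (r k)) sequentially)"
proof -
  define P where "P n (s::nat\<Rightarrow>nat) \<longleftrightarrow> (\<forall>k. Q n (s k)) \<or> (\<forall>k. \<not> Q n (s k))" for n s
  interpret subseqs P
  proof
    fix n and s :: "nat \<Rightarrow> nat" assume "strict_mono s"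
    have "infinite {k. Q n (s k)} \<or> infinite {k. \<not> Q n (s k)}"
    proof (rule ccontr)
      assume "\<not> ?thesis"
      then have "finite ({k. Q n (s k)} \<union> {k. \<not> Q n (s k)})" by blast
      moreover have "{k. Q n (s k)} \<union> {k. \<not> Q n (s k)} = UNIV" by auto
      ultimately show False by simp
    qed
    then show "\<exists>r'. strict_mono r' \<and> P n (s \<circ> r')"
    proof
      assume "infinite {k. Q n (s k)}"
      then obtain r' :: "nat \<Rightarrow> nat" where "strict_mono r'" "\<forall>k. r' k \<in> {k. Q n (s k)}"
        using infinite_enumerate by blast
      then show ?thesis by (auto simp: P_def)
    next
      assume "infinite {k. \<not> Q n (s k)}"
      then obtain r' :: "nat \<Rightarrow> nat" where "strict_mono r'" "\<forall>k. r' k \<in> {k. \<not> Q n (s k)}"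
        using infinite_enumerate by blast
      then show ?thesis by (auto simp: P_def)
    qed
  qed
  have P: "P k (diagseq \<circ> ((+) (Suc k)))" for k
    by (rule diagseq_holds) (auto simp: P_def)
  have "eventually (\<lambda>k. Q n (diagseq (k + Suc n))) sequentially \<or>
      eventually (\<lambda>k. \<not> Q n (diagseq (k + Suc n))) sequentially" for n
    using P[of n] by (auto simp: P_def add.commute)
  then have "eventually (\<lambda>k. Q n (diagseq k)) sequentially \<or>
      eventually (\<lambda>k. \<not> Q n (diagseq k)) sequentially" for n
    using sequentially_offset eventually_sequentially_seg[of "\<lambda>k. Q n (diagseq k)" "Suc n"]
      eventually_sequentially_seg[of "\<lambda>k. \<not> Q n (diagseq k)" "Suc n"] by auto
  with subseq_diagseq show ?thesis by blast
qed

text \<open>A subsequence decides all of the countably many formulas, and the elements of the extension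
  are the classes of variables that eventually agree; Henkin witnesses make the quantifiers work,
  and an injection of the variables into the given type codes the extension there.\<close>

lemma elementary_extension:
  fixes M :: "'a monoid" and S :: "nat \<Rightarrow> nat \<Rightarrow> 'a"
  assumes M: "group M" "infinite (carrier M)" and S: "\<And>k. env M (S k)"
  shows "\<exists>M' s'. group M' \<and> env M' s' \<and>
    (\<forall>P. fo P \<longrightarrow> eventually (\<lambda>k. P M (S k)) sequentially \<longrightarrow> P M' s')"
proof -
  interpret G: group M by fact
  obtain c where "\<forall>(M::'a monoid) s. group M \<longrightarrow> env M s \<longrightarrow> (\<exists>t. env M t \<and> (\<forall>v. t (2 * v) = s v) \<and>
     (\<forall>i p l. (\<exists>x\<in>carrier M. sat M ((lst M t l)(i := x)) p) \<longrightarrow>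
        sat M ((lst M t l)(i := t (c i p l))) p))"
    using henkin_env by blast
  then have "\<exists>t. env M t \<and> (\<forall>v. t (2 * v) = S k v) \<and>
     (\<forall>i p l. (\<exists>x\<in>carrier M. sat M ((lst M t l)(i := x)) p) \<longrightarrow>
        sat M ((lst M t l)(i := t (c i p l))) p)" for k
    using M(1) S by blast
  then obtain t where t: "\<And>k. env M (t k)" "\<And>k v. t k (2 * v) = S k v"
    "\<And>k i p l. \<exists>x\<in>carrier M. sat M ((lst M (t k) l)(i := x)) p \<Longrightarrow>
        sat M ((lst M (t k) l)(i := t k (c i p l))) p"
    by metis
  obtain r where r: "strict_mono r" "\<And>n. eventually (\<lambda>k. (\<lambda>(p, l). sat M (lst M (t (r k)) l) p) (from_nat n)) sequentially \<or>
     eventually (\<lambda>k. \<not> (\<lambda>(p, l). sat M (lst M (t (r k)) l) p) (from_nat n)) sequentially"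
    using decisive_subsequence[of "\<lambda>n k. (\<lambda>(p, l). sat M (lst M (t k) l) p) (from_nat n)"] by auto
  have r': "eventually (\<lambda>k. sat M (lst M (t (r k)) l) p) sequentially \<or>
     eventually (\<lambda>k. \<not> sat M (lst M (t (r k)) l) p) sequentially" for p l
    using r(2)[of "to_nat (p, l)"] by simp
  define u where "u k = t (r k)" for k
  have u: "env M (u k)" for k by (simp add: u_def t)
  have uc [simp]: "u k a \<in> carrier M" for k a using u by (simp add: env_def)
  have lst: "sat M (lst M (u k) (map \<sigma> [0..<n])) p \<longleftrightarrow> sat M (\<lambda>v. u k (\<sigma> v)) p" if "fv p \<subseteq> {..<n}" for \<sigma> n p k
    by (rule sat_cong) (use that in \<open>auto simp: lst_def\<close>)
  have dec: "eventually (\<lambda>k. \<not> sat M (\<lambda>v. u k (\<sigma> v)) p) sequentially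
    \<longleftrightarrow> \<not> eventually (\<lambda>k. sat M (\<lambda>v. u k (\<sigma> v)) p) sequentially" for \<sigma> p
  proof -
    obtain n where n: "fv p \<subseteq> {..<n}" using fv_bound by auto
    have "\<not> (eventually (\<lambda>k. sat M (\<lambda>v. u k (\<sigma> v)) p) sequentially \<and>
        eventually (\<lambda>k. \<not> sat M (\<lambda>v. u k (\<sigma> v)) p) sequentially)"
      by (auto simp: eventually_sequentially) (metis nat_le_linear)
    moreover have "eventually (\<lambda>k. sat M (\<lambda>v. u k (\<sigma> v)) p) sequentially \<or>
        eventually (\<lambda>k. \<not> sat M (\<lambda>v. u k (\<sigma> v)) p) sequentially"
      using r'[of "map \<sigma> [0..<n]" p] lst[OF n, of _ \<sigma>] by (simp add: u_def)
    ultimately show ?thesis by blast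
  qed
  \<comment> \<open>A single variable \<open>b\<close> witnesses the existential statement for all
    \<open>k\<close> simultaneously; the quantifier step of \<open>Los\<close> relies on this
    uniformity.\<close>
  have wit: "\<exists>b. \<forall>k. (\<exists>x\<in>carrier M. sat M ((\<lambda>v. u k (\<sigma> v))(i := x)) p) \<longrightarrow>
      sat M ((\<lambda>v. u k (\<sigma> v))(i := u k b)) p" for \<sigma> i p
  proof -
    obtain n where n: "fv p \<subseteq> {..<n}" using fv_bound by auto
    let ?l = "map \<sigma> [0..<n]"
    have *: "sat M ((lst M (u k) ?l)(i := x)) p \<longleftrightarrow> sat M ((\<lambda>v. u k (\<sigma> v))(i := x)) p" for k x
      by (rule sat_cong) (use n in \<open>auto simp: lst_def\<close>)
    show ?thesis
      by (rule exI[of _ "c i p ?l"]) (use t(3)[where i = i and p = p and l =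
          ?l, of "r _", folded u_def] * in blast)
  qed
  define R where "R a b \<longleftrightarrow> eventually (\<lambda>k. u k a = u k b) sequentially" for a b
  have R_refl: "R a a" for a by (simp add: R_def)
  have R_sym: "R a b \<Longrightarrow> R b a" for a b by (simp add: R_def eq_commute)
  have R_trans: "R a b \<Longrightarrow> R b d \<Longrightarrow> R a d" for a b d
    unfolding R_def by (erule (1) eventually_elim2) simp
  \<comment> \<open>With canonical representatives, a class of variables can be coded by an element
    of the type \<open>'a\<close> through the injection \<open>j\<close>.\<close>
  define rep where "rep a = (LEAST b. R a b)" for a
  have rep1: "R a (rep a)" for a unfolding rep_def by (rule LeastI) (rule R_refl)
  have rep: "rep a = rep b \<longleftrightarrow> R a b" for a b
  proof
    assume "rep a = rep b" then show "R a b" by (metis rep1 R_sym R_trans)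
  next
    assume "R a b"
    then have "R a d = R b d" for d by (metis R_sym R_trans)
    then show "rep a = rep b" by (simp add: rep_def)
  qed
  obtain j :: "nat \<Rightarrow> 'a" where j: "inj j"
    using M(2) infinite_countable_subset[of "carrier M"] by blast
  define h where "h a = j (rep a)" for a
  have h: "h a = h b \<longleftrightarrow> R a b" for a b using j rep by (auto simp: h_def inj_eq)
  \<comment> \<open>Henkin witnesses for product, inverse and neutral element make the group
    operations available on variables.\<close>
  have "\<exists>b. \<forall>k. u k b = u k a \<otimes>\<^bsub>M\<^esub> u k a'" for a a'
    using wit[of "\<lambda>v. if v = 0 then a else a'" 2 "Eq (Var 2) (Mult (Var 0) (Var 1))"] by auto
  then obtain mi where mi: "\<And>a a' k. u k (mi a a') = u k a \<otimes>\<^bsub>M\<^esub> u k a'" by metis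
  have "\<exists>b. \<forall>k. u k b = inv\<^bsub>M\<^esub> (u k a)" for a
    using wit[of "\<lambda>v. a" 1 "Eq (Var 1) (Inv (Var 0))"] by auto
  then obtain ii where ii: "\<And>a k. u k (ii a) = inv\<^bsub>M\<^esub> (u k a)" by metis
  have "\<exists>b. \<forall>k. u k b = \<one>\<^bsub>M\<^esub>"
    using wit[of "\<lambda>v. 0" 0 "Eq (Var 0) One"] by auto
  then obtain oi where oi: "\<And>k. u k oi = \<one>\<^bsub>M\<^esub>" by metis
  define hi where "hi = inv_into UNIV h"
  have hi: "R (hi (h a)) a" for a using h[of "hi (h a)" a] by (simp add: hi_def f_inv_into_f)
  define M' where "M' = \<lparr>carrier = range h, mult = (\<lambda>x y. h (mi (hi x) (hi y))), one = h oi\<rparr>"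
  have carr: "carrier M' = range h" and one: "\<one>\<^bsub>M'\<^esub> = h oi" by (simp_all add: M'_def)
  have mult: "h a \<otimes>\<^bsub>M'\<^esub> h b = h (mi a b)" for a b
  proof -
    have "eventually (\<lambda>k. u k (mi (hi (h a)) (hi (h b))) = u k (mi a b)) sequentially"
      using hi[of a, unfolded R_def] hi[of b, unfolded R_def]
      by (rule eventually_elim2) (simp add: mi)
    then show ?thesis by (simp add: M'_def h R_def)
  qed
  have M': "group M'"
  proof (rule groupI)
    fix x y z assume "x \<in> carrier M'" "y \<in> carrier M'" "z \<in> carrier M'"
    then obtain a b d where "x = h a" "y = h b" "z = h d" by (auto simp: carr)
    then show "x \<otimes>\<^bsub>M'\<^esub> y \<in> carrier M'" "x \<otimes>\<^bsub>M'\<^esub> y \<otimes>\<^bsub>M'\<^esub> z = x \<otimes>\<^bsub>M'\<^esub> (y \<otimes>\<^bsub>M'\<^esub> z)"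
      by (auto simp: carr mult h R_def mi G.m_assoc)
  next
    show "\<one>\<^bsub>M'\<^esub> \<in> carrier M'" by (simp add: carr one)
  next
    fix x assume "x \<in> carrier M'"
    then obtain a where x: "x = h a" by (auto simp: carr)
    show "\<one>\<^bsub>M'\<^esub> \<otimes>\<^bsub>M'\<^esub> x = x" by (simp add: x one mult h R_def mi oi)
    have "h (ii a) \<otimes>\<^bsub>M'\<^esub> x = \<one>\<^bsub>M'\<^esub>" by (simp add: x one mult h R_def mi oi ii)
    then show "\<exists>y\<in>carrier M'. y \<otimes>\<^bsub>M'\<^esub> x = \<one>\<^bsub>M'\<^esub>" by (auto simp: carr)
  qed
  interpret H: group M' by fact
  have invh: "inv\<^bsub>M'\<^esub> (h a) = h (ii a)" for a
    by (rule H.inv_equality) (auto simp: carr one mult h R_def mi oi ii)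
  have ev: "\<exists>a. eval_term M' (\<lambda>v. h (\<sigma> v)) q = h a \<and> (\<forall>k. u k a = eval_term M (\<lambda>v. u k (\<sigma> v)) q)" for \<sigma> q
  proof (induction q)
    case (Mult q q')
    then obtain a b where "eval_term M' (\<lambda>v. h (\<sigma> v)) q = h a" "\<forall>k. u k a = eval_term M (\<lambda>v. u k (\<sigma> v)) q"
      "eval_term M' (\<lambda>v. h (\<sigma> v)) q' = h b" "\<forall>k. u k b = eval_term M (\<lambda>v. u k (\<sigma> v)) q'" by blast
    then show ?case by (intro exI[of _ "mi a b"]) (simp add: mult mi)
  next
    case (Inv q)
    then obtain a where "eval_term M' (\<lambda>v. h (\<sigma> v)) q = h a" "\<forall>k. u k a = eval_term M (\<lambda>v. u k (\<sigma> v)) q"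
      by blast
    then show ?case by (intro exI[of _ "ii a"]) (simp add: invh ii)
  next
    case One show ?case by (intro exI[of _ oi]) (simp add: one oi)
  next
    case (Var i) show ?case by auto
  qed
  have Los: "sat M' (\<lambda>v. h (\<sigma> v)) p \<longleftrightarrow> eventually (\<lambda>k. sat M (\<lambda>v. u k (\<sigma> v)) p) sequentially" for \<sigma> p
  proof (induction p arbitrary: \<sigma>)
    case (Eq q q')
    obtain a b where "eval_term M' (\<lambda>v. h (\<sigma> v)) q = h a" "\<forall>k. u k a = eval_term M (\<lambda>v. u k (\<sigma> v)) q"
      "eval_term M' (\<lambda>v. h (\<sigma> v)) q' = h b" "\<forall>k. u k b = eval_term M (\<lambda>v. u k (\<sigma> v)) q'"
      using ev by meson
    then show ?case by (simp add: h R_def)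
  next
    case (Neg p) then show ?case using dec[of \<sigma> p] by simp
  next
    case (Conj p q) then show ?case by (simp add: eventually_conj_iff)
  next
    case (All i p)
    have upd: "(\<lambda>v. h (\<sigma> v))(i := h a) = (\<lambda>v. h ((\<sigma>(i := a)) v))" for a by auto
    have upd': "(\<lambda>v. u k ((\<sigma>(i := a)) v)) = (\<lambda>v. u k (\<sigma> v))(i := u k a)" for a k by auto
    have IH: "sat M' ((\<lambda>v. h (\<sigma> v))(i := h a)) p \<longleftrightarrow>
      eventually (\<lambda>k. sat M ((\<lambda>v. u k (\<sigma> v))(i := u k a)) p) sequentially" for a
      unfolding upd All.IH upd' ..
    show ?case
    proof
      assume L: "sat M' (\<lambda>v. h (\<sigma> v)) (gform.All i p)"
      \<comment> \<open>A witness for the negation: at every index where \<open>p\<close> holds at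
        \<open>b\<close>, it holds at all elements.\<close>
      obtain b where b: "\<forall>k. (\<exists>x\<in>carrier M. sat M ((\<lambda>v. u k (\<sigma> v))(i := x)) (Neg p)) \<longrightarrow>
         sat M ((\<lambda>v. u k (\<sigma> v))(i := u k b)) (Neg p)" using wit[of \<sigma> i "Neg p"] by blast
      have "eventually (\<lambda>k. sat M ((\<lambda>v. u k (\<sigma> v))(i := u k b)) p) sequentially"
        using L IH[of b] by (simp add: carr)
      then show "eventually (\<lambda>k. sat M (\<lambda>v. u k (\<sigma> v)) (gform.All i p)) sequentially"
        by (rule eventually_mono) (use b in auto)
    next
      assume Rr: "eventually (\<lambda>k. sat M (\<lambda>v. u k (\<sigma> v)) (gform.All i p)) sequentially"
      have "sat M' ((\<lambda>v. h (\<sigma> v))(i := h a)) p" for a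
        unfolding IH using Rr by (rule eventually_mono) simp
      then show "sat M' (\<lambda>v. h (\<sigma> v)) (gform.All i p)" by (auto simp: carr)
    qed
  qed
  define s' where "s' = (\<lambda>v. h (2 * v))"
  have "P M' s'" if P: "fo P" and evP: "eventually (\<lambda>k. P M (S k)) sequentially" for P
  proof -
    obtain p where p: "\<And>M s. group M \<Longrightarrow> env M s \<Longrightarrow> sat M s p = P M s" using fo_gform[OF P] by blast
    have "eventually (\<lambda>k. P M (S (r k))) sequentially"
      using evP filterlim_subseq[OF r(1)] by (rule eventually_compose_filterlim)
    moreover have "(\<lambda>v. u k (2 * v)) = S (r k)" for k by (simp add: u_def t)
    ultimately have "eventually (\<lambda>k. sat M (\<lambda>v. u k (2 * v)) p) sequentially"
      by (simp add: p[OF M(1) S])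
    then have "sat M' s' p" using Los[of "\<lambda>v. 2 * v" p] by (simp add: s'_def)
    moreover have "env M' s'" by (simp add: env_def s'_def carr)
    ultimately show ?thesis using p[OF M'] by simp
  qed
  moreover have "env M' s'" by (simp add: env_def s'_def carr)
  ultimately show ?thesis using M' by blast
qed

section \<open>Approximation of a pseudofinite group by finite groups\<close>

primrec ex_closure :: "nat \<Rightarrow> gform \<Rightarrow> gform" where
  "ex_closure 0 p = p"
| "ex_closure (Suc n) p = ex_closure n (Neg (gform.All n (Neg p)))"

lemma fv_ex_closure: "fv (ex_closure n p) = fv p - {..<n}"
  by (induction n arbitrary: p) (auto simp: less_Suc_eq)

lemma sat_ex_closure:
  "sat M t (ex_closure n p) \<longleftrightarrow> (\<exists>t'. (\<forall>i<n. t' i \<in> carrier M) \<and> (\<forall>i\<ge>n. t' i = t i) \<and> sat M t' p)"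
proof (induction n arbitrary: p)
  case 0
  have "t' = t" if "\<forall>i. t' i = t i" for t' using that by auto
  then show ?case by auto
next
  case (Suc n)
  show ?case
  proof
    assume "sat M t (ex_closure (Suc n) p)"
    then obtain t' x where t': "\<forall>i<n. t' i \<in> carrier M" "\<forall>i\<ge>n. t' i =
        t i" "x \<in> carrier M" "sat M (t'(n := x)) p"
      using Suc by auto
    then show "\<exists>t'. (\<forall>i<Suc n. t' i \<in> carrier M) \<and> (\<forall>i\<ge>Suc n. t' i = t i) \<and> sat M t' p"
      by (intro exI[of _ "t'(n := x)"]) (auto simp: less_Suc_eq)
  next
    assume "\<exists>t'. (\<forall>i<Suc n. t' i \<in> carrier M) \<and> (\<forall>i\<ge>Suc n. t' i = t i) \<and> sat M t' p"
    then obtain t' where t': "\<forall>i<Suc n. t' i \<in> carrier M" "\<forall>i\<ge>Suc n. t' i = t i" "sat M t' p" by auto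
    have "(\<forall>i<n. (t'(n := t n)) i \<in> carrier M) \<and> (\<forall>i\<ge>n. (t'(n := t n)) i = t i) \<and>
       sat M (t'(n := t n)) (Neg (gform.All n (Neg p)))"
      using t' by (auto intro!: bexI[of _ "t' n"])
    then show "sat M t (ex_closure (Suc n) p)" unfolding ex_closure.simps Suc by blast
  qed
qed

lemma sat_iso:
  assumes M: "group M" and N: "group N" and h: "h \<in> iso M N" and s: "\<And>i. s i \<in> carrier M"
  shows "sat N (\<lambda>i. h (s i)) p \<longleftrightarrow> sat M s p"
proof -
  interpret group_hom M N h using M N h by (simp add: group_hom_def group_hom_axioms_def iso_def)
  have inj: "inj_on h (carrier M)" and surj: "h ` carrier M = carrier N"
    using h by (auto simp: iso_def bij_betw_def)
  have ev: "eval_term M s t \<in> carrier M \<and> eval_term N (\<lambda>i. h (s i)) t = h (eval_term M s t)"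
    if "\<And>i. s i \<in> carrier M" for s t
    using that by (induction t) auto
  show ?thesis using s
  proof (induction p arbitrary: s)
    case (Eq t u) then show ?case using ev[of s t] ev[of s u] inj_on_eq_iff[OF inj] by simp
  next
    case (Neg p) then show ?case by simp
  next
    case (Conj p q) then show ?case by simp
  next
    case (All i p)
    have "sat N ((\<lambda>j. h (s j))(i := h x)) p = sat M (s(i := x)) p" if x: "x \<in> carrier M" for x
    proof -
      have *: "(\<lambda>j. h (s j))(i := h x) = (\<lambda>j. h ((s(i := x)) j))" by auto
      show ?thesis unfolding * by (rule All.IH) (use All.prems x in auto)
    qed
    then show ?case by (simp flip: surj)
  qed
qed

lemma group_copy:
  assumes H: "group (H::'b monoid)" and j: "inj (j::'b \<Rightarrow> 'a)"
  shows "\<exists>N::'a monoid. group N \<and> carrier N = j ` carrier H \<and> j \<in> iso H N"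
proof -
  interpret group H by fact
  define N where "N = \<lparr>carrier = j ` carrier H,
    mult = (\<lambda>x y. j (inv_into UNIV j x \<otimes>\<^bsub>H\<^esub> inv_into UNIV j y)), one = j \<one>\<^bsub>H\<^esub>\<rparr>"
  have N: "carrier N = j ` carrier H" "\<one>\<^bsub>N\<^esub> = j \<one>\<^bsub>H\<^esub>" "\<And>x y. j x \<otimes>\<^bsub>N\<^esub> j y = j (x \<otimes>\<^bsub>H\<^esub> y)"
    using j by (simp_all add: N_def)
  have "group N"
  proof (rule groupI)
    show "\<And>x. x \<in> carrier N \<Longrightarrow> \<exists>y\<in>carrier N. y \<otimes>\<^bsub>N\<^esub> x = \<one>\<^bsub>N\<^esub>"
      unfolding N(1) by clarify (auto simp: N(2,3) intro!: bexI[of _ "inv\<^bsub>H\<^esub> _"])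
  qed (auto simp: N m_assoc)
  moreover have "j \<in> iso H N"
    using j by (auto simp: iso_def hom_def N bij_betw_def inj_on_def)
  ultimately show ?thesis using N(1) by blast
qed

text \<open>If a formula true at \<open>s\<close> were satisfiable in no finite group, the negation
  of its existential closure would be a sentence true in all finite groups, hence in
  \<open>G\<close>. The groups \<open>H k\<close> satisfy longer and longer initial segments of an
  enumeration of the type of \<open>s\<close>. They are copied into \<open>'a\<close> so that
  uniform predicates apply to them.\<close>

lemma finite_approximation:
  fixes G :: "'a monoid"
  assumes G: "pseudofinite G" and s: "env G s"
  shows "\<exists>(H :: nat \<Rightarrow> 'a monoid) s'. (\<forall>k. group (H k) \<and> finite (carrier (H k)) \<and> env (H k) (s' k)) \<and>
    (\<forall>P. fo P \<longrightarrow> P G s \<longrightarrow> eventually (\<lambda>k. P (H k) (s' k)) sequentially)"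
proof -
  have gr: "group G" and inf: "infinite (carrier G)"
    and pf: "\<And>p. sentence p \<Longrightarrow> (\<And>H :: nat monoid. group H \<Longrightarrow> finite (carrier H) \<Longrightarrow> holds H p []) \<Longrightarrow>
        holds G p []"
    using G by (auto simp: pseudofinite_def)
  obtain j :: "nat \<Rightarrow> 'a" where j: "inj j" using inf infinite_countable_subset[of "carrier G"] by blast
  have one: "\<exists>(H :: 'a monoid) s'. group H \<and> finite (carrier H) \<and> env H s' \<and> sat H s' p"
    if p: "sat G s p" for p
  proof -
    obtain n where n: "fv p \<subseteq> {..<n}" using fv_bound by auto
    have "sat G (\<lambda>i. \<one>\<^bsub>G\<^esub>) (ex_closure n p)"
      unfolding sat_ex_closure
      by (rule exI[of _ "\<lambda>i. if i < n then s i else \<one>\<^bsub>G\<^esub>"])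
        (use p n s in \<open>auto simp: env_def cong: sat_cong elim!: iffD1[OF sat_cong, rotated]\<close>)
    then have "\<not> holds G (Neg (ex_closure n p)) []" by (simp add: holds_def)
    moreover have "sentence (Neg (ex_closure n p))"
      using n by (auto simp: sentence_def fv_ex_closure)
    ultimately obtain H :: "nat monoid" where H: "group H" "finite (carrier H)" "\<not> holds H (Neg (ex_closure n p)) []"
      using pf by blast
    then obtain t where t: "\<forall>i<n. t i \<in> carrier H" "\<forall>i\<ge>n. t i = \<one>\<^bsub>H\<^esub>" "sat H t p"
      by (auto simp: holds_def sat_ex_closure)
    have t': "t i \<in> carrier H" for i
      using t(1,2) H(1) by (cases "i < n") (auto simp: group.is_monoid monoid.one_closed)
    obtain N :: "'a monoid" where N: "group N" "carrier N = j ` carrier H" "j \<in> iso H N"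
      using group_copy[OF H(1) j] by blast
    have "sat N (\<lambda>i. j (t i)) p" using sat_iso[OF H(1) N(1,3) t'] t(3) by simp
    then show ?thesis using N(1,2) H(2) t'
        by (intro exI[of _ N] exI[of _ "\<lambda>i. j (t i)"]) (auto simp: env_def)
  qed
  define q where "q n = (if sat G s (from_nat n) then from_nat n else Neg (from_nat n))" for n
  have q: "sat G s (q n)" for n by (simp add: q_def)
  define psi where "psi = rec_nat (q 0) (\<lambda>k p. Conj (q (Suc k)) p)"
  have psi: "psi 0 = q 0" "psi (Suc k) = Conj (q (Suc k)) (psi k)" for k by (simp_all add: psi_def)
  have "sat G s (psi k)" for k by (induction k) (simp_all add: psi q)
  then have "\<forall>k. \<exists>X. group (fst X) \<and> finite (carrier (fst X)) \<and> env (fst X) (snd X) \<and>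
      sat (fst X :: 'a monoid) (snd X) (psi k)"
    using one by auto
  then obtain X where X: "\<forall>k. group (fst (X k)) \<and> finite (carrier (fst (X k))) \<and>
      env (fst (X k)) (snd (X k)) \<and>
      sat (fst (X k) :: 'a monoid) (snd (X k)) (psi k)" by (metis (no_types, lifting))
  define H where "H k = fst (X k)" for k
  define s' where "s' k = snd (X k)" for k
  from X have H: "\<And>k. group (H k)" "\<And>k. finite (carrier (H k))"
      "\<And>k. env (H k) (s' k)" "\<And>k. sat (H k) (s' k) (psi k)"
    by (auto simp: H_def s'_def)
  have psi_q: "sat M t (psi k) \<Longrightarrow> n \<le> k \<Longrightarrow> sat M t (q n)" for M :: "'a monoid" and t k n
    by (induction k) (auto simp: psi le_Suc_eq)
  have "eventually (\<lambda>k. P (H k) (s' k)) sequentially" if P: "fo P" "P G s" for P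
  proof -
    obtain p where p: "\<And>M s. group M \<Longrightarrow> env M s \<Longrightarrow> sat M s p = P M s" using fo_gform[OF P(1)] by blast
    have "q (to_nat p) = p" using p[OF gr s] P(2) by (simp add: q_def)
    then have "sat (H k) (s' k) p" if "k \<ge> to_nat p" for k using psi_q[OF H(4) that] by simp
    then show ?thesis using p[OF H(1,3)] by (auto simp: eventually_sequentially)
  qed
  then show ?thesis using H by blast
qed

lemma ft_if: "ft t \<Longrightarrow> ft u \<Longrightarrow> ft (\<lambda>M s. if b then t M s else u M s)"
  by (cases b) simp_all

section \<open>Definable sets and dimension\<close>

definition app :: "'a list \<Rightarrow> (nat \<Rightarrow> 'a) \<Rightarrow> nat \<Rightarrow> 'a" where
  "app u b = (\<lambda>i. if i < length u then u ! i else b (i - length u))"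

lemma app_Nil [simp]: "app [] b = b" by (simp add: app_def)

lemma app_Cons [simp]: "app (x # u) b = x ## app u b"
  by (auto simp: app_def push_def fun_eq_iff split: nat.split)

lemma app_append: "app (u @ v) b = app u (app v b)"
  by (induction u) auto

definition tdef :: "'a monoid \<Rightarrow> nat \<Rightarrow> 'a list set \<Rightarrow> bool" where
  "tdef M n S \<longleftrightarrow> (\<exists>p bs. set bs \<subseteq> carrier M \<and> S = {u \<in> tuples M n. holds M p (u @ bs)})"

lemma group_one: "group M \<Longrightarrow> \<one>\<^bsub>M\<^esub> \<in> carrier M"
  by (simp add: group.is_monoid monoid.one_closed)

lemma env_app: "set u \<subseteq> carrier M \<Longrightarrow> env M b \<Longrightarrow> env M (app u b)"
  by (auto simp: env_def app_def)

lemma holds_app: "holds M p xs \<longleftrightarrow> sat M (app xs (\<lambda>i. \<one>\<^bsub>M\<^esub>)) p"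
  by (simp add: holds_def app_def cong: if_cong)

lemma fo_holds:
  assumes "fo P"
  shows "\<exists>p K. \<forall>M u b. group M \<longrightarrow> set u \<subseteq> carrier M \<longrightarrow> env M b \<longrightarrow>
    holds M p (u @ map b [0..<K]) = P M (app u b)"
proof -
  obtain p where p: "\<And>M s. group M \<Longrightarrow> env M s \<Longrightarrow> sat M s p = P M s" using fo_gform[OF assms] by blast
  obtain K where K: "fv p \<subseteq> {..<K}" using fv_bound by auto
  have "holds M p (u @ map b [0..<K]) = P M (app u b)"
    if "group M" "set u \<subseteq> carrier M" "env M b" for M u b
  proof -
    have "sat M (app (u @ map b [0..<K]) (\<lambda>i. \<one>\<^bsub>M\<^esub>)) p = sat M (app u b) p"
      by (rule sat_cong) (use K in \<open>auto simp: app_def nth_append subset_iff\<close>)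
    then show ?thesis using p[OF that(1) env_app[OF that(2,3)]] by (simp add: holds_app)
  qed
  then show ?thesis by blast
qed

lemma tdef_fo:
  assumes "fo P" "group M" "env M b"
  shows "tdef M n {u \<in> tuples M n. P M (app u b)}"
proof -
  obtain p K where p: "\<And>M u b. group M \<Longrightarrow> set u \<subseteq> carrier M \<Longrightarrow> env M b \<Longrightarrow>
    holds M p (u @ map b [0..<K]) = P M (app u b)" using fo_holds[OF assms(1)] by blast
  have "{u \<in> tuples M n. P M (app u b)} = {u \<in> tuples M n. holds M p (u @ map b [0..<K])}"
    using p[OF assms(2) _ assms(3)] by (auto simp: tuples_def)
  moreover have "set (map b [0..<K]) \<subseteq> carrier M" using assms(3) by auto
  ultimately show ?thesis unfolding tdef_def by blast
qed

section \<open>Sorts, and interpretable sets as images of definable sets of tuples\<close>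

definition cl :: "'a monoid \<Rightarrow> nat \<Rightarrow> gform \<Rightarrow> 'a list \<Rightarrow> 'a list set" where
  "cl M n e u = sort_rel M n e `` {u}"

lemma pair_imag_singleton: "pair_imag {u} y = (\<lambda>v. u @ v) ` y" "pair_imag y {v} = (\<lambda>u. u @ v) ` y"
  by (auto simp: pair_imag_def)

text \<open>The formula \<open>eqf n n\<close> defines the sort of real \<open>n\<close>-tuples,
  whose elements are singletons.\<close>

primrec eqf :: "nat \<Rightarrow> nat \<Rightarrow> gform" where
  "eqf 0 n = Eq One One"
| "eqf (Suc k) n = Conj (Eq (Var k) (Var (n + k))) (eqf k n)"

lemma sat_eqf: "sat M s (eqf k n) \<longleftrightarrow> (\<forall>i<k. s i = s (n + i))"
  by (induction k) (auto simp: less_Suc_eq)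

lemma holds_eqf: "length u = n \<Longrightarrow> length v = n \<Longrightarrow> holds M (eqf n n) (u @ v) \<longleftrightarrow> u = v"
proof -
  assume len: "length u = n" "length v = n"
  have "app u b i = u ! i" "app u b (n + i) = b i" "app v b i = v ! i" if "i < n" for b i
    using len that by (simp_all add: app_def)
  then show ?thesis using len by (simp add: holds_app sat_eqf app_append list_eq_iff_nth_eq)
qed

lemma sort_rel_eqf: "sort_rel M n (eqf n n) = Id_on (tuples M n)"
proof -
  have "(u, v) \<in> sort_rel M n (eqf n n) \<longleftrightarrow> u \<in> tuples M n \<and> u = v" for u v
    using holds_eqf[of u n v M] by (auto simp: sort_rel_def tuples_def)
  then show ?thesis by (auto simp: Id_on_iff)
qed

lemma is_sort_eqf: "is_sort M n (eqf n n)"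
  unfolding is_sort_def sort_rel_eqf
  by (rule equivI) (auto simp: refl_on_def sym_Id_on trans_Id_on)

lemma sort_elems_eqf: "sort_elems M n (eqf n n) = (\<lambda>u. {u}) ` tuples M n"
proof -
  have "Id_on (tuples M n) `` {u} = {u}" if "u \<in> tuples M n" for u using that by auto
  then show ?thesis by (simp add: sort_elems_def sort_rel_eqf quotient_def set_eq_iff image_iff)
qed

lemma cl_eqf: "u \<in> tuples M n \<Longrightarrow> cl M n (eqf n n) u = {u}"
  by (auto simp: cl_def sort_rel_eqf)

lemma imag_tuple: "set u \<subseteq> carrier M \<Longrightarrow> {u} \<in> imaginaries M"
  unfolding imaginaries_def
  by (rule CollectI, rule exI[of _ "length u"], rule exI[of _ "eqf (length u) (length u)"])
    (auto simp: is_sort_eqf sort_elems_eqf tuples_def)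

lemma concat_imag_singletons: "concat_imag (map (\<lambda>x. {[x]}) bs) = {bs}"
  by (induction bs) (auto simp: concat_imag_def pair_imag_def)

text \<open>A real parameter has only one representative, so the set of imaginaries is the image of
  a definable set of tuples.\<close>

lemma eq_set_cl:
  assumes "is_sort M n e"
  shows "eq_set M n e p {bs} = cl M n e ` {u \<in> tuples M n. holds M p (u @ bs)}"
proof -
  have eq: "equiv (tuples M n) (sort_rel M n e)" using assms by (simp add: is_sort_def)
  show ?thesis
  proof (intro equalityI subsetI)
    fix y assume "y \<in> eq_set M n e p {bs}"
    then obtain u where y: "y \<in> tuples M n // sort_rel M n e" "u \<in> y" "holds M p (u @ bs)"
      by (auto simp: eq_set_def sort_elems_def holds_eq_def pair_imag_singleton)
    have "u \<in> tuples M n" using eq y(1,2) by (meson in_quotient_imp_subset subsetD)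
    moreover have "y = cl M n e u"
      using quotientI[OF calculation, of "sort_rel M n e"] quotient_eqI[OF eq y(1) _ y(2), of "cl M n e u" u] eq calculation
      by (simp add: cl_def equiv_class_self equiv_def refl_on_def)
    ultimately show "y \<in> cl M n e ` {u \<in> tuples M n. holds M p (u @ bs)}" using y(3) by blast
  next
    fix y assume "y \<in> cl M n e ` {u \<in> tuples M n. holds M p (u @ bs)}"
    then obtain u where u: "u \<in> tuples M n" "holds M p (u @ bs)" "y = cl M n e u" by blast
    then have "u \<in> y" using equiv_class_self[OF eq] by (simp add: cl_def)
    then show "y \<in> eq_set M n e p {bs}" using u
      by (auto simp: eq_set_def sort_elems_def holds_eq_def pair_imag_singleton cl_def intro: quotientI)
  qed
qed

lemma interpretable_cl:
  assumes "is_sort M n e" "tdef M n S"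
  shows "interpretable M (cl M n e ` S)"
proof -
  obtain p bs where p: "set bs \<subseteq> carrier M" "S = {u \<in> tuples M n. holds M p (u @ bs)}"
    using assms(2) by (auto simp: tdef_def)
  show ?thesis unfolding interpretable_def interpretable_over_def
    by (rule exI[of _ n], rule exI[of _ e], rule exI[of _ p], rule exI[of _ "map (\<lambda>x. {[x]}) bs"])
      (use p assms(1) in \<open>auto simp: concat_imag_singletons eq_set_cl intro!: imag_tuple\<close>)
qed

lemma interpretable_tuples:
  assumes "tdef M n S" shows "interpretable M ((\<lambda>u. {u}) ` S)"
proof -
  have "S \<subseteq> tuples M n" using assms by (auto simp: tdef_def)
  then have "(\<lambda>u. {u}) ` S = cl M n (eqf n n) ` S" by (intro image_cong) (auto simp: cl_eqf)
  then show ?thesis using interpretable_cl[OF is_sort_eqf assms] by simp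
qed

lemma home_eq: "home X = (\<lambda>u. {u}) ` ((\<lambda>x. [x]) ` X)"
  by (auto simp: home_def)

lemma tuples_1: "tuples M 1 = (\<lambda>x. [x]) ` carrier M"
  by (auto simp: tuples_def length_Suc_conv)

lemma singles_Collect: "(\<lambda>x. [x]) ` {x \<in> carrier M. P M (x ## b)} = {u \<in> tuples M 1. P M (app u b)}"
  by (auto simp: tuples_1 simp del: One_nat_def)

definition mdef :: "'a monoid \<Rightarrow> 'a set \<Rightarrow> bool" where
  "mdef M X \<longleftrightarrow> (\<exists>P b. fo P \<and> env M b \<and> X = {x \<in> carrier M. P M (x ## b)})"

lemma mdefI: "fo P \<Longrightarrow> env M b \<Longrightarrow> mdef M {x \<in> carrier M. P M (x ## b)}"
  by (auto simp: mdef_def)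

lemma tdef_singles:
  assumes "group M" "mdef M X" shows "tdef M 1 ((\<lambda>x. [x]) ` X)"
  using assms tdef_fo[OF _ assms(1)] by (auto simp: mdef_def singles_Collect simp del: One_nat_def)

lemma interpretable_home: "group M \<Longrightarrow> mdef M X \<Longrightarrow> interpretable M (home X)"
  unfolding home_eq by (rule interpretable_tuples[OF tdef_singles])

lemma mdef_definable:
  assumes "group M" "mdef M X" shows "definable M X"
proof -
  obtain P b where P: "fo P" "env M b" "X = {x \<in> carrier M. P M (x ## b)}" using assms(2)
      by (auto simp: mdef_def)
  obtain p K where p: "\<And>M u b. group M \<Longrightarrow> set u \<subseteq> carrier M \<Longrightarrow> env M b \<Longrightarrow>
    holds M p (u @ map b [0..<K]) = P M (app u b)" using fo_holds[OF P(1)] by blast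
  have "X = {x \<in> carrier M. holds M p (x # map b [0..<K])}"
    using p[OF assms(1) _ P(2), of "[_]"] by (auto simp: P(3))
  moreover have "set (map b [0..<K]) \<subseteq> carrier M" using P(2) by auto
  ultimately show ?thesis unfolding definable_def by blast
qed

text \<open>This makes the graph of a map from tuples to classes interpretable: its points
  \<open>(u, v/e)\<close> are elements of a sort that compares the first component by equality and
  the second by \<open>e\<close>.\<close>

lemma product_sort:
  assumes e: "is_sort M m e" and M: "group M"
  shows "\<exists>e'. is_sort M (n + m) e' \<and>
    (\<forall>u v. u \<in> tuples M n \<longrightarrow> v \<in> tuples M m \<longrightarrow> cl M (n + m) e' (u @ v) = pair_imag {u} (cl M m e v))"
proof -
  \<comment> \<open>In the concatenation of \<open>u\<close>, \<open>v\<close>, \<open>u'\<close>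
    and \<open>v'\<close>, the last two lists start at \<open>n + m\<close> and
    \<open>n + m + n\<close>. Variables beyond the two tuples compared by \<open>e\<close> denote
    the neutral element, as in \<open>holds\<close>.\<close>
  define P where "P = (\<lambda>(M::'a monoid) s. (\<forall>i<n. s i = s (n + m + i)) \<and>
    sat M (\<lambda>i. if i < m then s (n + i) else if i < m + m then s (n + m + n + (i - m)) else \<one>\<^bsub>M\<^esub>) e)"
  have "fo P" unfolding P_def
    by (intro fo_conj fo_all_less fo_eq ft_var
      fo_subst[OF fo_sat, of "\<lambda>M s i. if i < m then s (n + i) else
          if i < m + m then s (n + m + n + (i - m)) else \<one>\<^bsub>M\<^esub>"]
      ft_if ft_one)
  then obtain e' where e': "\<And>M s. group M \<Longrightarrow> env M s \<Longrightarrow> sat M s e' = P M s" using fo_gform by blast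
  have holds: "holds M e' ((u @ v) @ (u' @ v')) \<longleftrightarrow> u = u' \<and> holds M e (v @ v')"
    if "u \<in> tuples M n" "v \<in> tuples M m" "u' \<in> tuples M n" "v' \<in> tuples M m" for u v u' v'
  proof -
    let ?w = "(u @ v) @ (u' @ v')"
    have len: "length u = n" "length v = m" "length u' = n" "length v' = m"
      and sub: "set ?w \<subseteq> carrier M" using that by (auto simp: tuples_def)
    let ?b = "\<lambda>i. \<one>\<^bsub>M\<^esub>"
    have w: "app ?w ?b = app u (app v (app u' (app v' ?b)))" by (simp add: app_append)
    have 1: "holds M e' ?w \<longleftrightarrow> P M (app u (app v (app u' (app v' ?b))))"
      unfolding holds_app using e'[OF M env_app[OF sub]] group_one[OF M] by (simp add: env_def flip: w)
    have skip: "app u (app v b) (n + m + i) = b i" "app u b (n + i) = b i" "app v b (m + i) = b i"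
        "app u' b (n + i) = b i" for b i
      using len by (simp_all add: app_def)
    have 2: "(\<forall>i<n. app u (app v (app u' (app v' ?b))) i =
        app u (app v (app u' (app v' ?b))) (n + m + i)) \<longleftrightarrow> u = u'"
      unfolding skip using len by (simp add: app_def list_eq_iff_nth_eq)
    have 3: "(\<lambda>i. if i < m then app u (app v (app u' (app v' ?b))) (n + i)
        else if i < m + m then app u (app v (app u' (app v' ?b))) (n + m + n + (i - m)) else \<one>\<^bsub>M\<^esub>) =
        app (v @ v') ?b"
      unfolding skip add.assoc[of "n + m"] app_append using len by (auto simp: app_def fun_eq_iff)
    show ?thesis using 1[unfolded P_def 2 3] by (simp add: holds_app[of M e])
  qed
  have split: "w \<in> tuples M (n + m) \<longleftrightarrow> (\<exists>u v. w = u @ v \<and> u \<in> tuples M n \<and> v \<in> tuples M m)" for w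
  proof
    assume "w \<in> tuples M (n + m)"
    then show "\<exists>u v. w = u @ v \<and> u \<in> tuples M n \<and> v \<in> tuples M m"
      by (intro exI[of _ "take n w"] exI[of _ "drop n w"])
        (auto simp: tuples_def dest: in_set_takeD in_set_dropD)
  qed (auto simp: tuples_def)
  have eq: "equiv (tuples M m) (sort_rel M m e)" using e by (simp add: is_sort_def)
  have rel: "(u @ v, u' @ v') \<in> sort_rel M (n + m) e' \<longleftrightarrow> u = u' \<and> (v, v') \<in> sort_rel M m e"
    if "u \<in> tuples M n" "v \<in> tuples M m" "u' \<in> tuples M n" "v' \<in> tuples M m" for u v u' v'
    using holds[OF that] that split by (auto simp: sort_rel_def simp del: append_assoc)
  have rel': "(w, w') \<in> sort_rel M (n + m) e' \<longleftrightarrow> (\<exists>u v v'. w = u @ v \<and> w' = u @ v' \<and> u \<in> tuples M n \<and>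
      (v, v') \<in> sort_rel M m e)" for w w'
  proof
    assume r: "(w, w') \<in> sort_rel M (n + m) e'"
    then have "w \<in> tuples M (n + m)" "w' \<in> tuples M (n + m)" by (auto simp: sort_rel_def)
    then obtain u v u' v' where "w = u @ v" "w' = u' @ v'" "u \<in> tuples M n" "v \<in> tuples M m"
      "u' \<in> tuples M n" "v' \<in> tuples M m" unfolding split by blast
    then show "\<exists>u v v'. w = u @ v \<and> w' = u @ v' \<and> u \<in> tuples M n \<and> (v, v') \<in> sort_rel M m e"
      using r rel by blast
  next
    assume "\<exists>u v v'. w = u @ v \<and> w' = u @ v' \<and> u \<in> tuples M n \<and> (v, v') \<in> sort_rel M m e"
    then obtain u v v' where "w = u @ v" "w' = u @ v'" "u \<in> tuples M n" "(v, v') \<in> sort_rel M m e" by blast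
    moreover then have "v \<in> tuples M m" "v' \<in> tuples M m" by (auto simp: sort_rel_def)
    ultimately show "(w, w') \<in> sort_rel M (n + m) e'" using rel by blast
  qed
  have "is_sort M (n + m) e'" unfolding is_sort_def
  proof (rule equivI)
    show "sort_rel M (n + m) e' \<subseteq> tuples M (n + m) \<times> tuples M (n + m)" by (auto simp: sort_rel_def)
    have refl: "(v, v) \<in> sort_rel M m e" if "v \<in> tuples M m" for v
      using eq that by (meson equivE refl_onD)
    show "refl_on (tuples M (n + m)) (sort_rel M (n + m) e')"
    proof (rule refl_onI)
      fix w assume "w \<in> tuples M (n + m)"
      then obtain u v where "w = u @ v" "u \<in> tuples M n" "v \<in> tuples M m" unfolding split by blast
      then show "(w, w) \<in> sort_rel M (n + m) e'" using rel refl by blast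
    qed
    show "sym (sort_rel M (n + m) e')"
    proof (rule symI)
      fix w w' assume "(w, w') \<in> sort_rel M (n + m) e'"
      then obtain u v v' where "w = u @ v" "w' = u @ v'" "u \<in> tuples M n" "(v, v') \<in> sort_rel M m e"
        unfolding rel' by blast
      moreover then have "(v', v) \<in> sort_rel M m e" using eq by (meson equivE symD)
      ultimately show "(w', w) \<in> sort_rel M (n + m) e'" unfolding rel' by blast
    qed
    show "trans (sort_rel M (n + m) e')"
    proof (rule transI)
      fix x y z assume "(x, y) \<in> sort_rel M (n + m) e'" "(y, z) \<in> sort_rel M (n + m) e'"
      then obtain u v v' u2 v2 v2' where a: "x = u @ v" "y =
          u @ v'" "u \<in> tuples M n" "(v, v') \<in> sort_rel M m e"
        "y = u2 @ v2" "z = u2 @ v2'" "u2 \<in> tuples M n" "(v2, v2') \<in> sort_rel M m e" unfolding rel' by blast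
      then have "u2 = u" "v2 = v'" by (auto simp: tuples_def)
      then have "(v, v2') \<in> sort_rel M m e" using a eq by (meson equivE transE)
      then show "(x, z) \<in> sort_rel M (n + m) e'" unfolding rel' using a \<open>u2 = u\<close> by blast
    qed
  qed
  moreover have "cl M (n + m) e' (u @ v) = pair_imag {u} (cl M m e v)"
      if "u \<in> tuples M n" "v \<in> tuples M m" for u v
  proof (intro equalityI subsetI)
    fix w assume "w \<in> cl M (n + m) e' (u @ v)"
    then have "(u @ v, w) \<in> sort_rel M (n + m) e'" by (simp add: cl_def)
    then obtain u' v2 v' where *: "u @ v = u' @ v2" "w =
        u' @ v'" "u' \<in> tuples M n" "(v2, v') \<in> sort_rel M m e"
      unfolding rel' by blast
    then have "u' = u" "v2 = v" using that by (auto simp: tuples_def)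
    then show "w \<in> pair_imag {u} (cl M m e v)" using * by (auto simp: pair_imag_singleton cl_def)
  next
    fix w assume "w \<in> pair_imag {u} (cl M m e v)"
    then show "w \<in> cl M (n + m) e' (u @ v)" using that(1)
      by (auto simp: pair_imag_singleton cl_def rel')
  qed
  ultimately show ?thesis by blast
qed

lemma tuples_Suc: "tuples M (Suc n) = {x # u | x u. x \<in> carrier M \<and> u \<in> tuples M n}"
  by (auto simp: tuples_def length_Suc_conv)

lemma same_type_tuples:
  assumes "group M" "group M'" "set bs \<subseteq> carrier M" "set bs' \<subseteq> carrier M'" "length bs = length bs'"
    and "\<And>p. holds M p bs \<longleftrightarrow> holds M' p bs'"
  shows "same_type M {bs} M' {bs'}"
  unfolding same_type_def using assms
  by (auto simp: holds_eq_def is_sort_eqf sort_elems_eqf tuples_def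
      intro!: exI[of _ "length bs"] exI[of _ "eqf (length bs) (length bs)"])

lemma tuples_image: "S \<subseteq> tuples M n \<Longrightarrow> (\<lambda>u. {u}) ` S = cl M n (eqf n n) ` S"
  by (intro image_cong) (auto simp: cl_eqf)

lemma home_cl: "X \<subseteq> carrier M \<Longrightarrow> home X = cl M 1 (eqf 1 1) ` (\<lambda>x. [x]) ` X"
  unfolding home_eq by (rule tuples_image) (auto simp: tuples_def)

text \<open>The shape to which the simplifier unfolds \<open>eqf 1 1\<close>.\<close>

lemma home_cl_Suc: "X \<subseteq> carrier M \<Longrightarrow>
    home X = cl M (Suc 0) (Conj (Eq (Var 0) (Var (Suc 0))) (Eq One One)) ` (\<lambda>x. [x]) ` X"
  using home_cl[of X M] by simp

section \<open>Consequences of the axioms of dimension\<close>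

locale dim_theory =
  fixes G :: "'a monoid" and dm :: "'a monoid \<Rightarrow> 'a list set set \<Rightarrow> ereal"
  assumes dim: "dimension G dm" and fine: "fine_dim G dm" and add: "additive_dim G dm"
    and grp: "group G" and inf: "infinite (carrier G)"
begin

definition model :: "'a monoid \<Rightarrow> bool" where "model M \<longleftrightarrow> model_of_Th G M"

lemma model_G: "model G"
  using grp by (simp add: model_def model_of_Th_def)

lemma model_group: "model M \<Longrightarrow> group M"
  by (simp add: model_def model_of_Th_def)

lemma dim_values: "model M \<Longrightarrow> interpretable M X \<Longrightarrow> dm M X = -\<infinity> \<or> (\<exists>k::nat. dm M X = ereal (real k))"
  using dim by (simp add: dimension_def model_def)

lemma dim_type: "model M \<Longrightarrow> model M' \<Longrightarrow> is_sort M n e \<Longrightarrow> same_type M a M' a' \<Longrightarrow>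
    dm M (eq_set M n e p a) = dm M' (eq_set M' n e p a')"
  using dim unfolding dimension_def model_def by blast

lemma dim_empty: "model M \<Longrightarrow> dm M {} = -\<infinity>"
  using dim unfolding dimension_def model_def by blast

lemma dim_finite: "model M \<Longrightarrow> interpretable M X \<Longrightarrow> X \<noteq> {} \<Longrightarrow> finite X \<Longrightarrow> dm M X = 0"
  using dim unfolding dimension_def model_def by blast

lemma dim_Un: "model M \<Longrightarrow> interpretable M X \<Longrightarrow> interpretable M Y \<Longrightarrow> interpretable M (X \<union> Y) \<Longrightarrow>
    dm M (X \<union> Y) = max (dm M X) (dm M Y)"
  using dim unfolding dimension_def model_def by blast

lemma dim_map: "model M \<Longrightarrow> interpretable M X \<Longrightarrow> interpretable M Y \<Longrightarrow> interpretable_map M X Y f \<Longrightarrow>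
    (\<And>y. y \<in> Y \<Longrightarrow> dm M {x \<in> X. f x = y} \<ge> ereal (real d)) \<Longrightarrow> dm M X \<ge> dm M Y + ereal (real d)"
proof -
  assume *: "model M" "interpretable M X" "interpretable M Y" "interpretable_map M X Y f"
    "\<And>y. y \<in> Y \<Longrightarrow> dm M {x \<in> X. f x = y} \<ge> ereal (real d)"
  have "\<forall>M X Y f (d::nat). model_of_Th G M \<and> interpretable M X \<and> interpretable M Y \<and>
        interpretable_map M X Y f \<and> (\<forall>y\<in>Y. dm M {x \<in> X. f x = y} \<ge> ereal (real d)) \<longrightarrow>
        dm M X \<ge> dm M Y + ereal (real d)"
    using dim unfolding dimension_def by (elim conjE)
  then show ?thesis using * unfolding model_def by blast
qed

lemma dim_fine: "model M \<Longrightarrow> interpretable M X \<Longrightarrow> dm M X = 0 \<Longrightarrow> finite X"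
  using fine unfolding fine_dim_def model_def by blast

lemma dim_subset:
  assumes "model M" "interpretable M X" "interpretable M Y" "X \<subseteq> Y" shows "dm M X \<le> dm M Y"
  using dim_Un[OF assms(1-3)] assms(3,4) by (simp add: Un_absorb1) (metis max.cobounded1)

lemma dim_cl_nonneg:
  assumes M: "model M" and e: "is_sort M n e" and S: "tdef M n S" and u: "u \<in> S"
  shows "0 \<le> dm M (cl M n e ` S)"
proof -
  have u': "u \<in> tuples M n" using S u by (auto simp: tdef_def)
  have "{u} = {v \<in> tuples M n. holds M (eqf n n) (v @ u)}"
    using u' holds_eqf[of _ n u M] by (auto simp: tuples_def)
  then have "tdef M n {u}" unfolding tdef_def using u'
      by (auto simp: tuples_def intro!: exI[of _ u] exI[of _ "eqf n n"])
  then have int: "interpretable M (cl M n e ` {u})" by (rule interpretable_cl[OF e])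
  then have "dm M (cl M n e ` {u}) = 0" using M by (intro dim_finite) auto
  moreover have "dm M (cl M n e ` {u}) \<le> dm M (cl M n e ` S)"
    using u by (intro dim_subset M int interpretable_cl[OF e S]) auto
  ultimately show ?thesis by simp
qed

text \<open>A nonempty set has dimension at least 0, fineness excludes the value 0, and the next
  possible value is 1.\<close>

lemma dim_cl_infinite:
  assumes M: "model M" and e: "is_sort M n e" and S: "tdef M n S" and inf: "infinite (cl M n e ` S)"
  shows "1 \<le> dm M (cl M n e ` S)"
proof -
  obtain u where "u \<in> S" using inf by fastforce
  then have "0 \<le> dm M (cl M n e ` S)" by (rule dim_cl_nonneg[OF M e S])
  moreover have int: "interpretable M (cl M n e ` S)" by (rule interpretable_cl[OF e S])
  moreover have "dm M (cl M n e ` S) \<noteq> 0" using dim_fine[OF M int] inf by blast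
  ultimately obtain k where k: "dm M (cl M n e ` S) = ereal (real k)" "k \<noteq> 0"
    using dim_values[OF M int] by (auto simp: zero_ereal_def)
  then show ?thesis by (simp add: one_ereal_def)
qed

text \<open>Axiom (4) for the map that sends \<open>u\<close> to the class of \<open>g u\<close>.
  Source, target and graph are reduced to definable sets of tuples, so that later applications only
  have to exhibit formulas.\<close>

lemma dim_fibres:
  assumes M: "model M" and S: "tdef M n S" and e: "is_sort M m e"
    and g: "\<And>u. u \<in> S \<Longrightarrow> g u \<in> tuples M m"
    and gS: "tdef M m (g ` S)" and gr: "tdef M (n + m) ((\<lambda>u. u @ g u) ` S)"
    and fib: "\<And>u. u \<in> S \<Longrightarrow> ereal (real d) \<le> dm M ((\<lambda>v. {v}) ` {v \<in> S. cl M m e (g v) = cl M m e (g u)})"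
  shows "dm M (cl M m e ` g ` S) + ereal (real d) \<le> dm M ((\<lambda>v. {v}) ` S)"
proof -
  have sub: "S \<subseteq> tuples M n" using S by (auto simp: tdef_def)
  define f where "f x = cl M m e (g (the_elem x))" for x
  obtain e' where e': "is_sort M (n + m) e'"
    "\<And>u v. u \<in> tuples M n \<Longrightarrow> v \<in> tuples M m \<Longrightarrow> cl M (n + m) e' (u @ v) = pair_imag {u} (cl M m e v)"
    using product_sort[OF e model_group[OF M], of n] by blast
  have "{pair_imag x (f x) |x. x \<in> (\<lambda>v. {v}) ` S} = (\<lambda>u. pair_imag {u} (cl M m e (g u))) ` S"
    by (force simp: f_def)
  also have "\<dots> = cl M (n + m) e' ` (\<lambda>u. u @ g u) ` S"
    unfolding image_image using e'(2) sub g by (intro image_cong) auto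
  finally have graph: "interpretable M {pair_imag x (f x) |x. x \<in> (\<lambda>v. {v}) ` S}"
    using interpretable_cl[OF e'(1) gr] by simp
  show ?thesis
  proof (rule dim_map[OF M interpretable_tuples[OF S] interpretable_cl[OF e gS]])
    show "interpretable_map M ((\<lambda>v. {v}) ` S) (cl M m e ` g ` S) f"
      using graph by (auto simp: interpretable_map_def f_def)
    fix y assume "y \<in> cl M m e ` g ` S"
    then obtain u where u: "u \<in> S" "y = cl M m e (g u)" by auto
    have "{x \<in> (\<lambda>v. {v}) ` S. f x = y} = (\<lambda>v. {v}) ` {v \<in> S. cl M m e (g v) = cl M m e (g u)}"
    proof (intro equalityI subsetI)
      fix x assume "x \<in> {x \<in> (\<lambda>v. {v}) ` S. f x = y}"
      then obtain v where "v \<in> S" "x = {v}" "f {v} = y" by blast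
      then show "x \<in> (\<lambda>v. {v}) ` {v \<in> S. cl M m e (g v) = cl M m e (g u)}"
        unfolding f_def u(2) by simp
    next
      fix x assume "x \<in> (\<lambda>v. {v}) ` {v \<in> S. cl M m e (g v) = cl M m e (g u)}"
      then show "x \<in> {x \<in> (\<lambda>v. {v}) ` S. f x = y}" unfolding f_def u(2) by force
    qed
    then show "ereal (real d) \<le> dm M {x \<in> (\<lambda>v. {v}) ` S. f x = y}" using fib[OF u(1)] by simp
  qed
qed

text \<open>Lower bounds are what axiom (4) produces. An upper bound is expressed by the negation at
  the next number, which avoids arithmetic with the value of the empty set.\<close>

definition dge :: "'a monoid \<Rightarrow> 'a set \<Rightarrow> nat \<Rightarrow> bool" where
  "dge M X d \<longleftrightarrow> ereal (real d) \<le> dm M (home X)"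

lemma dge_mono:
  assumes "model M" "mdef M X" "mdef M Y" "X \<subseteq> Y" "dge M X d" shows "dge M Y d"
proof -
  have "dm M (home X) \<le> dm M (home Y)"
    using assms by (intro dim_subset interpretable_home model_group) (auto simp: home_def)
  then show ?thesis using assms(5) by (auto simp: dge_def)
qed

lemma mdef_Un:
  assumes M: "group M" and "mdef M X" "mdef M Y" shows "mdef M (X \<union> Y)"
proof -
  obtain P b Q c where P: "fo P" "env M b" "X = {x \<in> carrier M. P M (x ## b)}"
    and Q: "fo Q" "env M c" "Y = {x \<in> carrier M. Q M (x ## c)}" using assms(2,3) by (auto simp: mdef_def)
  \<comment> \<open>The two environments are interleaved at even and odd positions.\<close>
  define s where "s i = (if even i then b (i div 2) else c (i div 2))" for i
  have R: "fo (\<lambda>M s. P M (s 0 ## (\<lambda>i. s (Suc (2 * i)))) \<or> Q M (s 0 ## (\<lambda>i. s (Suc (2 * i + 1)))))"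
    by (intro fo_disj fo_subst[OF P(1), of "\<lambda>M s. s 0 ## (\<lambda>i. s (Suc (2 * i)))"]
        fo_subst[OF Q(1), of "\<lambda>M s. s 0 ## (\<lambda>i. s (Suc (2 * i + 1)))"] ft_push ft_var)
  have "env M s" using P(2) Q(2) by (auto simp: s_def env_def)
  moreover have "(\<lambda>i. s (2 * i)) = b" "(\<lambda>i. s (2 * i + 1)) = c" by (auto simp: s_def)
  then have "X \<union> Y = {x \<in> carrier M. P M ((x ## s) 0 ## (\<lambda>i. (x ## s) (Suc (2 * i)))) \<or>
      Q M ((x ## s) 0 ## (\<lambda>i. (x ## s) (Suc (2 * i + 1))))}"
    by (auto simp: P(3) Q(3))
  ultimately show ?thesis using mdefI[OF R] by simp
qed

lemma dge_Un:
  assumes M: "model M" and X: "mdef M X" and Y: "mdef M Y" and d: "dge M (X \<union> Y) d"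
  shows "dge M X d \<or> dge M Y d"
proof -
  note gr = model_group[OF M]
  have "home (X \<union> Y) = home X \<union> home Y" by (auto simp: home_def)
  moreover have "dm M (home X \<union> home Y) = max (dm M (home X)) (dm M (home Y))"
    using interpretable_home[OF gr X] interpretable_home[OF gr Y] interpretable_home[OF gr mdef_Un[OF gr X Y]]
    by (intro dim_Un M) (simp_all add: calculation)
  ultimately show ?thesis using d by (auto simp: dge_def max_def split: if_splits)
qed

lemma mdef_subset: "mdef M X \<Longrightarrow> X \<subseteq> carrier M"
  by (auto simp: mdef_def)

lemma dge_0:
  assumes "model M" "mdef M X" shows "dge M X 0 \<longleftrightarrow> X \<noteq> {}"
proof -
  have "dge M X 0" if "x \<in> X" for x
    using dim_cl_nonneg[OF assms(1) is_sort_eqf tdef_singles[OF model_group[OF assms(1)] assms(2)], of "[x]"] that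
    unfolding dge_def home_cl[OF mdef_subset[OF assms(2)]] by (simp add: zero_ereal_def)
  moreover have "\<not> dge M {} 0" using dim_empty[OF assms(1)] by (simp add: dge_def home_def)
  ultimately show ?thesis by auto
qed

text \<open>The form in which fineness is used. Infinite sets get dimension at least 1 from it; the
  converse is the axiom on finite sets.\<close>

lemma dge_1:
  assumes "model M" "mdef M X" shows "dge M X 1 \<longleftrightarrow> infinite X"
proof -
  have inj: "inj_on (\<lambda>x. {[x]}) X" by (auto simp: inj_on_def)
  have fin: "finite (home X) \<longleftrightarrow> finite X" unfolding home_def by (rule finite_image_iff[OF inj])
  have "dge M X 1" if "infinite X"
    using dim_cl_infinite[OF assms(1) is_sort_eqf tdef_singles[OF model_group[OF assms(1)] assms(2)]] that
    unfolding dge_def by (simp add: fin one_ereal_def flip: home_cl_Suc[OF mdef_subset[OF assms(2)]])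
  moreover have "\<not> dge M X 1" if "finite X"
  proof (cases "X = {}")
    case True then show ?thesis using dim_empty[OF assms(1)] by (simp add: dge_def home_def)
  next
    case False
    then have "dm M (home X) = 0" using that fin
      by (intro dim_finite assms(1) interpretable_home model_group assms(2)) (auto simp: home_def)
    then show ?thesis by (simp add: dge_def)
  qed
  ultimately show ?thesis by blast
qed

lemma dge_value:
  assumes M: "model M" "mdef M X" and "dge M X d" "\<not> dge M X (Suc d)"
  shows "dm M (home X) = ereal (real d)"
proof -
  have "dm M (home X) = -\<infinity> \<or> (\<exists>k::nat. dm M (home X) = ereal (real k))"
    by (intro dim_values M interpretable_home model_group)
  then show ?thesis using assms(3,4) by (auto simp: dge_def not_le)
qed

text \<open>Axiom (1) for parameters of equal type in two different models. Only the first
  \<open>K\<close> parameters occur in the formula, and their type is determined by the uniform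
  predicates true of them.\<close>

lemma dge_transfer:
  assumes M: "model M" "env M s" and M': "model M'" "env M' s'"
    and eq: "\<And>Q. fo Q \<Longrightarrow> Q M s \<longleftrightarrow> Q M' s'" and P: "fo P"
  shows "dge M {x \<in> carrier M. P M (x ## s)} d \<longleftrightarrow> dge M' {x \<in> carrier M'. P M' (x ## s')} d"
proof -
  note gr = model_group[OF M(1)] model_group[OF M'(1)]
  obtain p K where p: "\<And>M u b. group M \<Longrightarrow> set u \<subseteq> carrier M \<Longrightarrow> env M b \<Longrightarrow>
    holds M p (u @ map b [0..<K]) = P M (app u b)" using fo_holds[OF P] by blast
  have *: "home {x \<in> carrier M. P M (x ## s)} = eq_set M 1 (eqf 1 1) p {map s [0..<K]}"
    if "group M" "env M s" for M s
  proof -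
    have "{u \<in> tuples M 1. holds M p (u @ map s [0..<K])} = {u \<in> tuples M 1. P M (app u s)}"
      using p[OF that(1) _ that(2)] by (auto simp: tuples_def)
    then show ?thesis
      by (simp only: eq_set_cl[OF is_sort_eqf] flip: singles_Collect) (rule home_cl, auto)
  qed
  have "same_type M {map s [0..<K]} M' {map s' [0..<K]}"
  proof (rule same_type_tuples[OF gr])
    fix q
    define Q where "Q = (\<lambda>(M :: 'a monoid) s. sat M (\<lambda>i. if i < K then s i else \<one>\<^bsub>M\<^esub>) q)"
    have "fo Q" unfolding Q_def
      by (intro fo_subst[OF fo_sat, of "\<lambda>M s i. if i < K then s i else \<one>\<^bsub>M\<^esub>"] ft_if ft_var ft_one)
    moreover have "holds M q (map s [0..<K]) = Q M s" for M s
      by (simp add: holds_def Q_def cong: if_cong)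
    ultimately show "holds M q (map s [0..<K]) = holds M' q (map s' [0..<K])" using eq by simp
  qed (use M M' in auto)
  from dim_type[OF M(1) M'(1) is_sort_eqf this, of 1 p]
  show ?thesis unfolding dge_def *[OF gr(1) M(2)] *[OF gr(2) M'(2)] by simp
qed

text \<open>Axiom (4) with fibres of dimension at least 0, which just means nonempty fibres: a
  definable image has no larger dimension.\<close>

lemma dge_surj:
  assumes M: "model M" "env M b" and P: "fo P" "X = {x \<in> carrier M. P M (x ## b)}"
    and Q: "fo Q" "Y = {x \<in> carrier M. Q M (x ## b)}"
    and R: "fo R" "\<And>x y. x \<in> X \<Longrightarrow> y \<in> carrier M \<Longrightarrow> R M (x ## y ## b) \<longleftrightarrow> y = f x"
    and f: "f ` X = Y" and d: "dge M Y d"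
  shows "dge M X d"
proof -
  note gr = model_group[OF M(1)]
  let ?S = "(\<lambda>x. [x]) ` X" and ?g = "\<lambda>u. [f (hd u)]"
  have X: "mdef M X" and Y: "mdef M Y" using P Q mdefI M(2) by auto
  have fX: "f x \<in> carrier M" if "x \<in> X" for x using that f mdef_subset[OF Y] by auto
  have gS: "?g ` ?S = (\<lambda>x. [x]) ` Y" using f by (auto simp: image_image)
  have "(\<lambda>u. u @ ?g u) ` ?S = {u \<in> tuples M 2. (\<lambda>M s. P M (s 0 ## (\<lambda>i. s (i + 2))) \<and> R M s) M (app u b)}"
  proof (intro equalityI subsetI)
    fix w assume "w \<in> (\<lambda>u. u @ ?g u) ` ?S"
    then obtain x where "x \<in> X" "w = [x, f x]" by auto
    then show "w \<in> {u \<in> tuples M 2. (\<lambda>M s. P M (s 0 ## (\<lambda>i. s (i + 2))) \<and> R M s) M (app u b)}"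
      using fX[of x] R(2)[of x "f x"] P(2) by (simp add: tuples_def)
  next
    fix w assume w: "w \<in> {u \<in> tuples M 2. (\<lambda>M s. P M (s 0 ## (\<lambda>i. s (i + 2))) \<and> R M s) M (app u b)}"
    then obtain x y where xy: "w = [x, y]" "x \<in> carrier M" "y \<in> carrier M"
      by (auto simp: tuples_def numeral_2_eq_2 length_Suc_conv)
    with w have "x \<in> X" "R M (x ## y ## b)" by (simp_all add: P(2))
    then show "w \<in> (\<lambda>u. u @ ?g u) ` ?S" using R(2)[of x y] xy by (intro image_eqI[of _ _ "[x]"]) auto
  qed
  moreover have "fo (\<lambda>M s. P M (s 0 ## (\<lambda>i. s (i + 2))) \<and> R M s)"
    by (intro fo_conj fo_subst[OF P(1), of "\<lambda>M s. s 0 ## (\<lambda>i. s (i + 2))"] R(1) ft_push ft_var)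
  ultimately have gr: "tdef M (1 + 1) ((\<lambda>u. u @ ?g u) ` ?S)"
    using tdef_fo[OF _ gr M(2), of _ 2] by (simp only: one_add_one)
  have "dm M (cl M 1 (eqf 1 1) ` ?g ` ?S) + ereal (real 0) \<le> dm M ((\<lambda>v. {v}) ` ?S)"
  proof (rule dim_fibres[OF M(1) tdef_singles[OF model_group[OF M(1)] X] is_sort_eqf _ _ gr])
    show "\<And>u. u \<in> ?S \<Longrightarrow> ?g u \<in> tuples M 1" using f mdef_subset[OF Y] by (auto simp: tuples_def)
    show "tdef M 1 (?g ` ?S)" unfolding gS by (rule tdef_singles[OF model_group[OF M(1)] Y])
    fix u assume "u \<in> ?S"
    then obtain x0 where x0: "x0 \<in> X" "u = [x0]" by auto
    let ?F = "{x \<in> X. f x = f x0}"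
    have cl1: "cl M 1 (eqf 1 1) [f x] = {[f x]}" if "x \<in> X" for x
      using fX[OF that] by (intro cl_eqf) (simp add: tuples_def)
    have "?F = {x \<in> carrier M. (\<lambda>M s. P M (s 0 ## (\<lambda>i. s (Suc (Suc i)))) \<and>
        R M (s 0 ## s 1 ## (\<lambda>i. s (Suc (Suc i))))) M (x ## f x0 ## b)}"
      using R(2) x0(1) f mdef_subset[OF Y] by (auto simp: P(2))
    moreover have "fo (\<lambda>M s. P M (s 0 ## (\<lambda>i. s (Suc (Suc i)))) \<and>
        R M (s 0 ## s 1 ## (\<lambda>i. s (Suc (Suc i)))))"
      by (intro fo_conj fo_subst[OF P(1), of "\<lambda>M s. s 0 ## (\<lambda>i. s (Suc (Suc i)))"]
        fo_subst[OF R(1), of "\<lambda>M s. s 0 ## s 1 ## (\<lambda>i. s (Suc (Suc i)))"] ft_push ft_var)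
    moreover have "env M (f x0 ## b)" using M(2) x0(1) f mdef_subset[OF Y] by auto
    ultimately have F: "mdef M ?F" unfolding mdef_def by blast
    have "{v \<in> ?S. cl M 1 (eqf 1 1) (?g v) = cl M 1 (eqf 1 1) (?g u)} = (\<lambda>x. [x]) ` ?F"
      using x0 cl1 by (auto simp del: One_nat_def)
    then show "ereal (real 0) \<le> dm M ((\<lambda>v. {v}) ` {v \<in> ?S. cl M 1 (eqf 1 1) (?g v) =
        cl M 1 (eqf 1 1) (?g u)})"
      using dge_0[OF M(1) F] x0(1) by (auto simp: dge_def home_eq)
  qed
  then have "dm M (home Y) \<le> dm M (home X)"
    unfolding gS home_cl[OF mdef_subset[OF Y], symmetric] home_eq[of X, symmetric] by simp
  then show ?thesis using d by (auto simp: dge_def)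
qed

end

context dim_theory begin

text \<open>Axiom (4) for the quotient map. The classes are coded
  by the sort of pairs \<open>(x, b)\<close>, identified when the sets \<open>{z. E\<^sub>b x z}\<close> agree, which is an
  equivalence relation for every choice of parameters.\<close>

lemma dge_quotient:
  assumes M: "model M" "env M b" and P: "fo P" "X = {x \<in> carrier M. P M (x ## b)}"
    and Q: "fo Q" "\<And>x y. x \<in> X \<Longrightarrow> y \<in> X \<Longrightarrow> Q M (x ## y ## b) \<longleftrightarrow> E x y"
    and refl: "\<And>x. x \<in> X \<Longrightarrow> E x x"
    and sym: "\<And>x y. x \<in> X \<Longrightarrow> y \<in> X \<Longrightarrow> E x y \<Longrightarrow> E y x"
    and trans: "\<And>x y z. x \<in> X \<Longrightarrow> y \<in> X \<Longrightarrow> z \<in> X \<Longrightarrow> E x y \<Longrightarrow> E y z \<Longrightarrow> E x z"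
    and cls: "\<And>x. x \<in> X \<Longrightarrow> dge M {y \<in> X. E x y} d"
    and infn: "infinite ((\<lambda>x. {y \<in> X. E x y}) ` X)"
  shows "dge M X (Suc d)"
proof -
  note gr = model_group[OF M(1)]
  have X: "mdef M X" using P mdefI M(2) by auto
  \<comment> \<open>The relation is cut down to \<open>X\<close>, so that the set coded by
    \<open>x\<close> is its class inside \<open>X\<close>.\<close>
  define Q' where "Q' = (\<lambda>(M::'a monoid) s. P M (s 0 ## (\<lambda>i. s (Suc (Suc i)))) \<and>
    P M (s 1 ## (\<lambda>i. s (Suc (Suc i)))) \<and> Q M s)"
  have foQ': "fo Q'" unfolding Q'_def
    by (intro fo_conj fo_subst[OF P(1), of "\<lambda>M s. s 0 ## (\<lambda>i. s (Suc (Suc i)))"]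
        fo_subst[OF P(1), of "\<lambda>M s. s 1 ## (\<lambda>i. s (Suc (Suc i)))"] ft_push ft_var Q(1))
  have Q'E: "Q' M (x ## y ## b) \<longleftrightarrow> x \<in> X \<and> y \<in> X \<and> E x y" if "x \<in> carrier M" "y \<in> carrier M" for x y
    using Q(2) that by (auto simp: Q'_def P(2))
  obtain K where K: "\<And>M s s'. group M \<Longrightarrow> env M s \<Longrightarrow> env M s' \<Longrightarrow> \<forall>i<K. s i = s' i \<Longrightarrow> Q' M s = Q' M s'"
    using fo_finite_support[OF foQ'] by blast
  let ?one = "\<lambda>M i. \<one>\<^bsub>M\<^esub>"
  define T where "T = (\<lambda>(M::'a monoid) s. \<forall>z\<in>carrier M.
    Q' M (s 0 ## z ## (\<lambda>i. if i < K then s (Suc i) else \<one>\<^bsub>M\<^esub>)) \<longleftrightarrow>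
    Q' M (s (Suc K) ## z ## (\<lambda>i. if i < K then s (Suc K + Suc i) else \<one>\<^bsub>M\<^esub>)))"
  have "fo T" unfolding T_def
    by (intro fo_all fo_iff
        fo_subst[OF foQ', of "\<lambda>M s. s (Suc 0) ## s 0 ## (\<lambda>i. if i < K then s (Suc (Suc i)) else \<one>\<^bsub>M\<^esub>)"]
        fo_subst[OF foQ', of "\<lambda>M s. s (Suc (Suc K)) ## s 0 ## (\<lambda>i.
            if i < K then s (Suc (Suc K + Suc i)) else \<one>\<^bsub>M\<^esub>)"]
        ft_push ft_var ft_if ft_one)
  then obtain e where e: "\<And>M s. group M \<Longrightarrow> env M s \<Longrightarrow> sat M s e = T M s" using fo_gform by blast
  define h where "h u = {z \<in> carrier M. Q' M (hd u ## z ## app (tl u) (?one M))}" for u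
  have rel: "sort_rel M (Suc K) e = {(u, v). u \<in> tuples M (Suc K) \<and> v \<in> tuples M (Suc K) \<and> h u = h v}"
  proof -
    have "holds M e (u @ v) \<longleftrightarrow> h u = h v" if uv: "u \<in> tuples M (Suc K)" "v \<in> tuples M (Suc K)" for u v
    proof -
      obtain x a where u: "u = x # a" "x \<in> carrier M" "a \<in> tuples M K" using uv(1)
          by (auto simp: tuples_Suc)
      obtain y c where v: "v = y # c" "y \<in> carrier M" "c \<in> tuples M K" using uv(2)
          by (auto simp: tuples_Suc)
      have len: "length a = K" "length c = K" and sub: "set (u @ v) \<subseteq> carrier M"
        using u v by (auto simp: tuples_def)
      let ?s = "x ## app a (y ## app c (?one M))"
      have s: "app (u @ v) (?one M) = ?s" by (simp add: u v app_append)
      have *: "(\<lambda>i. if i < K then ?s (Suc i) else \<one>\<^bsub>M\<^esub>) = app a (?one M)"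
        using len by (auto simp: app_def fun_eq_iff)
      have skip: "app a f (K + i) = f i" for f i using len by (simp add: app_def)
      have 2: "?s (Suc K) = y" using skip[of _ 0] by simp
      have "?s (Suc K + Suc i) = app c (?one M) i" for i using skip[of _ "Suc i"] by simp
      then have 3: "(\<lambda>i. if i < K then ?s (Suc K + Suc i) else \<one>\<^bsub>M\<^esub>) = app c (?one M)"
        using len by (auto simp: app_def fun_eq_iff)
      have "holds M e (u @ v) = T M ?s" unfolding holds_app s
        using e[OF gr, of ?s] env_app[OF sub, of "?one M"] group_one[OF gr] s
            by (simp add: env_def[of M "\<lambda>i. \<one>\<^bsub>M\<^esub>"])
      also have "\<dots> \<longleftrightarrow> (\<forall>z\<in>carrier M. Q' M (x ## z ## app a (?one M)) \<longleftrightarrow> Q' M (y ## z ## app c (?one M)))"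
        unfolding T_def 2 3 * by simp
      also have "\<dots> \<longleftrightarrow> h u = h v" by (auto simp: h_def u v)
      finally show ?thesis .
    qed
    then show ?thesis by (auto simp: sort_rel_def)
  qed
  have sort: "is_sort M (Suc K) e" unfolding is_sort_def rel
    by (rule equivI) (auto simp: refl_on_def sym_def trans_def)
  have cl: "cl M (Suc K) e u = {v \<in> tuples M (Suc K). h v = h u}" if "u \<in> tuples M (Suc K)" for u
    using that by (auto simp: cl_def rel)
  have cl_eq: "cl M (Suc K) e u = cl M (Suc K) e v \<longleftrightarrow> h u = h v"
    if "u \<in> tuples M (Suc K)" "v \<in> tuples M (Suc K)" for u v
    using that cl by blast
  let ?S = "(\<lambda>x. [x]) ` X" and ?B = "map b [0..<K]"
  \<comment> \<open>A class is named by any of its elements together with the first \<open>K\<close>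
    of the fixed parameters.\<close>
  let ?g = "\<lambda>u. hd u # ?B"
  have tB: "x # ?B \<in> tuples M (Suc K)" if "x \<in> X" for x
    using that mdef_subset[OF X] M(2) by (auto simp: tuples_def)
  have hB: "h (x # ?B) = {y \<in> X. E x y}" if "x \<in> X" for x
  proof -
    have "Q' M (x ## z ## app ?B (?one M)) \<longleftrightarrow> Q' M (x ## z ## b)" if "z \<in> carrier M" for z
    proof (rule K[OF gr])
      show "env M (x ## z ## app ?B (?one M))" "env M (x ## z ## b)"
        using that \<open>x \<in> X\<close> mdef_subset[OF X] M(2) group_one[OF gr]
        by (auto simp: env_def[of M "\<lambda>i. \<one>\<^bsub>M\<^esub>"] intro!: env_app)
      show "\<forall>i<K. (x ## z ## app ?B (?one M)) i = (x ## z ## b) i"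
        by (auto simp: push_def app_def split: nat.split)
    qed
    then show ?thesis using Q'E[of x] that mdef_subset[OF X] by (auto simp: h_def)
  qed
  have hBeq: "h (x # ?B) = h (y # ?B) \<longleftrightarrow> E x y" if "x \<in> X" "y \<in> X" for x y
    unfolding hB[OF that(1)] hB[OF that(2)] using that refl sym trans by blast
  have "?g ` ?S = {u \<in> tuples M (Suc K). (\<lambda>M s. P M (s 0 ## (\<lambda>i. s (Suc K + i))) \<and>
      (\<forall>i<K. s (Suc i) = s (Suc K + i))) M (app u b)}"
  proof (intro equalityI subsetI)
    fix w assume "w \<in> ?g ` ?S"
    then obtain x where x: "x \<in> X" "w = x # ?B" by auto
    have "app ?B b (K + i) = b i" "i < K \<Longrightarrow> app ?B b i = b i" for i by (auto simp: app_def)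
    then show "w \<in> {u \<in> tuples M (Suc K). (\<lambda>M s. P M (s 0 ## (\<lambda>i. s (Suc K + i))) \<and>
      (\<forall>i<K. s (Suc i) = s (Suc K + i))) M (app u b)}"
      using x tB P(2) by simp
  next
    fix w assume w: "w \<in> {u \<in> tuples M (Suc K). (\<lambda>M s. P M (s 0 ## (\<lambda>i. s (Suc K + i))) \<and>
      (\<forall>i<K. s (Suc i) = s (Suc K + i))) M (app u b)}"
    then obtain x a where a: "w = x # a" "x \<in> carrier M" "length a = K"
      by (auto simp: tuples_def length_Suc_conv)
    have "app a b (K + i) = b i" "i < K \<Longrightarrow> app a b i = a ! i" for i using a(3) by (auto simp: app_def)
    then have "P M (x ## b)" "\<forall>i<K. a ! i = b i" using w unfolding a(1) by auto
    then have "x \<in> X" "a = ?B" using a by (auto simp: P(2) list_eq_iff_nth_eq)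
    then show "w \<in> ?g ` ?S" using a(1) by (intro image_eqI[of _ _ "[x]"]) auto
  qed
  moreover have "fo (\<lambda>M s. P M (s 0 ## (\<lambda>i. s (Suc K + i))) \<and> (\<forall>i<K. s (Suc i) = s (Suc K + i)))"
    by (intro fo_conj fo_subst[OF P(1), of "\<lambda>M s. s 0 ## (\<lambda>i. s (Suc K + i))"] ft_push ft_var fo_all_less fo_eq)
  ultimately have tgS: "tdef M (Suc K) (?g ` ?S)" using tdef_fo[OF _ gr M(2)] by simp
  have "(\<lambda>u. u @ ?g u) ` ?S = {u \<in> tuples M (1 + Suc K). (\<lambda>M s. s 0 = s 1 \<and>
      P M (s 0 ## (\<lambda>i. s (Suc (Suc K + i)))) \<and>
      (\<forall>i<K. s (Suc (Suc i)) = s (Suc (Suc K + i)))) M (app u b)}"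
  proof (intro equalityI subsetI)
    fix w assume "w \<in> (\<lambda>u. u @ ?g u) ` ?S"
    then obtain x where x: "x \<in> X" "w = x # x # ?B" by auto
    have "app ?B b (K + i) = b i" "i < K \<Longrightarrow> app ?B b i = b i" for i by (auto simp: app_def)
    then show "w \<in> {u \<in> tuples M (1 + Suc K). (\<lambda>M s. s 0 = s 1 \<and> P M (s 0 ## (\<lambda>i. s (Suc (Suc K + i)))) \<and>
      (\<forall>i<K. s (Suc (Suc i)) = s (Suc (Suc K + i)))) M (app u b)}"
      using x tB[OF x(1)] P(2) by (simp add: tuples_Suc)
  next
    fix w assume w: "w \<in> {u \<in> tuples M (1 + Suc K). (\<lambda>M s. s 0 = s 1 \<and>
        P M (s 0 ## (\<lambda>i. s (Suc (Suc K + i)))) \<and>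
      (\<forall>i<K. s (Suc (Suc i)) = s (Suc (Suc K + i)))) M (app u b)}"
    then obtain x y a where a: "w = x # y # a" "x \<in> carrier M" "length a = K"
      by (auto simp: tuples_def length_Suc_conv)
    have "app a b (K + i) = b i" "i < K \<Longrightarrow> app a b i = a ! i" for i using a(3) by (auto simp: app_def)
    then have "y = x" "P M (x ## b)" "\<forall>i<K. a ! i = b i" using w unfolding a(1) by auto
    then have "y = x" "x \<in> X" "a = ?B" using a by (auto simp: P(2) list_eq_iff_nth_eq)
    then show "w \<in> (\<lambda>u. u @ ?g u) ` ?S" using a(1) by (intro image_eqI[of _ _ "[x]"]) auto
  qed
  moreover have "fo (\<lambda>M s. s 0 = s 1 \<and> P M (s 0 ## (\<lambda>i. s (Suc (Suc K + i)))) \<and> (\<forall>i<K. s (Suc (Suc i)) =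
      s (Suc (Suc K + i))))"
    by (intro fo_conj fo_subst[OF P(1), of "\<lambda>M s. s 0 ## (\<lambda>i. s (Suc (Suc K + i)))"] ft_push ft_var fo_all_less fo_eq)
  ultimately have tgr: "tdef M (1 + Suc K) ((\<lambda>u. u @ ?g u) ` ?S)" using tdef_fo[OF _ gr M(2)] by simp
  have "dm M (cl M (Suc K) e ` ?g ` ?S) + ereal (real d) \<le> dm M ((\<lambda>v. {v}) ` ?S)"
  proof (rule dim_fibres[OF M(1) tdef_singles[OF gr X] sort _ tgS tgr])
    show "\<And>u. u \<in> ?S \<Longrightarrow> ?g u \<in> tuples M (Suc K)" using tB by auto
    fix u assume "u \<in> ?S"
    then obtain x where x: "x \<in> X" "u = [x]" by auto
    have "{v \<in> ?S. cl M (Suc K) e (?g v) = cl M (Suc K) e (?g u)} = (\<lambda>x. [x]) ` {y \<in> X. E x y}"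
    proof -
      have c: "y \<in> X \<and> cl M (Suc K) e (y # ?B) = cl M (Suc K) e (x # ?B) \<longleftrightarrow> y \<in> X \<and> E x y" for y
        using cl_eq[OF tB tB, of y x] hBeq[of y x] sym[of x y] sym[of y x] x(1) by metis
      have "{v \<in> ?S. cl M (Suc K) e (?g v) = cl M (Suc K) e (?g u)} =
          (\<lambda>x. [x]) ` {y \<in> X. cl M (Suc K) e (y # ?B) = cl M (Suc K) e (x # ?B)}"
      proof (intro equalityI subsetI)
        fix v assume "v \<in> {v \<in> ?S. cl M (Suc K) e (?g v) = cl M (Suc K) e (?g u)}"
        then obtain y where "y \<in> X" "v = [y]" "cl M (Suc K) e (?g [y]) = cl M (Suc K) e (?g [x])"
          unfolding x(2) by blast
        then show "v \<in> (\<lambda>x. [x]) ` {y \<in> X. cl M (Suc K) e (y # ?B) = cl M (Suc K) e (x # ?B)}"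
          unfolding list.sel by blast
      next
        fix v assume "v \<in> (\<lambda>x. [x]) ` {y \<in> X. cl M (Suc K) e (y # ?B) = cl M (Suc K) e (x # ?B)}"
        then obtain y where "y \<in> X" "v = [y]" "cl M (Suc K) e (y # ?B) = cl M (Suc K) e (x # ?B)" by blast
        then show "v \<in> {v \<in> ?S. cl M (Suc K) e (?g v) = cl M (Suc K) e (?g u)}"
          unfolding x(2) by simp
      qed
      then show ?thesis unfolding c .
    qed
    then show "ereal (real d) \<le> dm M ((\<lambda>v. {v}) ` {v \<in> ?S. cl M (Suc K) e (?g v) = cl M (Suc K) e (?g u)})"
      using cls[OF x(1)] by (simp add: dge_def home_eq)
  qed
  moreover have "1 \<le> dm M (cl M (Suc K) e ` ?g ` ?S)"
  proof (rule dim_cl_infinite[OF M(1) sort tgS])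
    have "cl M (Suc K) e ` ?g ` ?S = (\<lambda>x. cl M (Suc K) e (x # ?B)) ` X" by (simp add: image_image)
    moreover have "infinite ((\<lambda>x. cl M (Suc K) e (x # ?B)) ` X)"
    proof
      assume "finite ((\<lambda>x. cl M (Suc K) e (x # ?B)) ` X)"
      \<comment> \<open>Any representative of a class of the sort determines the value of
        \<open>h\<close>, so the sort has at least as many of these classes as
        \<open>E\<close>.\<close>
      then have "finite ((\<lambda>c. h (SOME v. v \<in> c)) ` (\<lambda>x. cl M (Suc K) e (x # ?B)) ` X)" by simp
      moreover have "h (SOME v. v \<in> cl M (Suc K) e (x # ?B)) = {y \<in> X. E x y}" if "x \<in> X" for x
      proof -
        have "(SOME v. v \<in> cl M (Suc K) e (x # ?B)) \<in> cl M (Suc K) e (x # ?B)"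
          by (rule someI[of _ "x # ?B"]) (use cl[OF tB[OF that]] tB[OF that] in auto)
        then show ?thesis using cl[OF tB[OF that]] hB[OF that] by auto
      qed
      ultimately have "finite ((\<lambda>x. {y \<in> X. E x y}) ` X)" by (simp add: image_image cong: image_cong)
      then show False using infn by simp
    qed
    ultimately show "infinite (cl M (Suc K) e ` ?g ` ?S)" by simp
  qed
  ultimately have "1 + ereal (real d) \<le> dm M (home X)"
    unfolding home_eq[of X] by (meson add_right_mono order_trans)
  then show ?thesis by (simp add: dge_def one_ereal_def add.commute)
qed

end

lemma fo_app1: "fo P \<Longrightarrow> ft t \<Longrightarrow> (\<And>i. ft (\<lambda>M s. u M s i)) \<Longrightarrow> fo (\<lambda>M s. P M (t M s ## u M s))"
  by (rule fo_subst[of P "\<lambda>M s. t M s ## u M s", OF _ ft_push])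

lemma fo_app2: "fo P \<Longrightarrow> ft t \<Longrightarrow> ft t' \<Longrightarrow> (\<And>i. ft (\<lambda>M s. u M s i)) \<Longrightarrow>
    fo (\<lambda>M s. P M (t M s ## t' M s ## u M s))"
  by (rule fo_subst[of P "\<lambda>M s. t M s ## t' M s ## u M s", OF _ ft_push[OF _ ft_push]])

definition cls :: "'b set \<Rightarrow> ('b \<Rightarrow> 'b \<Rightarrow> bool) \<Rightarrow> 'b set set" where
  "cls X E = (\<lambda>x. {y \<in> X. E x y}) ` X"

definition equ :: "'b set \<Rightarrow> ('b \<Rightarrow> 'b \<Rightarrow> bool) \<Rightarrow> bool" where
  "equ X E \<longleftrightarrow> (\<forall>x\<in>X. E x x) \<and> (\<forall>x\<in>X. \<forall>y\<in>X. E x y \<longrightarrow> E y x) \<and>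
     (\<forall>x\<in>X. \<forall>y\<in>X. \<forall>z\<in>X. E x y \<longrightarrow> E y z \<longrightarrow> E x z)"

section \<open>Equivalence relations with finitely many classes\<close>

text \<open>\<open>nge n X E\<close> says that \<open>E\<close> has at least \<open>n\<close> classes on \<open>X\<close>.\<close>

primrec nge :: "nat \<Rightarrow> 'b set \<Rightarrow> ('b \<Rightarrow> 'b \<Rightarrow> bool) \<Rightarrow> bool" where
  "nge 0 X E = True"
| "nge (Suc n) X E = (\<exists>x\<in>X. nge n {y \<in> X. \<not> E x y} E)"

lemma equ_subset: "equ X E \<Longrightarrow> Y \<subseteq> X \<Longrightarrow> equ Y E"
  unfolding equ_def by blast

lemma equ_eq: "equ X (=)" by (simp add: equ_def)

text \<open>Each chosen witness removes exactly its own class from the set, so the number of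
  possible choices is the number of classes.\<close>

lemma nge_iff: "equ X E \<Longrightarrow> nge n X E \<longleftrightarrow> (finite (cls X E) \<longrightarrow> n \<le> card (cls X E))"
proof (induction n arbitrary: X)
  case (Suc n)
  have eq: "equ X E" by fact
  have cls': "cls {y \<in> X. \<not> E x y} E = cls X E - {{y \<in> X. E x y}}" if x: "x \<in> X" for x
  proof -
    have 1: "{z \<in> {y \<in> X. \<not> E x y}. E y z} = {z \<in> X. E y z}" if "y \<in> X" "\<not> E x y" for y
      using eq x that unfolding equ_def by blast
    have 2: "E x y \<longleftrightarrow> {z \<in> X. E y z} = {z \<in> X. E x z}" if "y \<in> X" for y
      using eq x that unfolding equ_def by blast
    have "cls {y \<in> X. \<not> E x y} E = (\<lambda>y. {z \<in> X. E y z}) ` {y \<in> X. \<not> E x y}"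
      unfolding cls_def by (intro image_cong refl) (use 1 in simp)
    also have "\<dots> = cls X E - {{y \<in> X. E x y}}" unfolding cls_def using 2 by blast
    finally show ?thesis .
  qed
  have step: "nge n {y \<in> X. \<not> E x y} E \<longleftrightarrow> (finite (cls X E) \<longrightarrow> Suc n \<le> card (cls X E))" if x: "x \<in> X" for x
  proof -
    have in_cls: "{y \<in> X. E x y} \<in> cls X E" using x by (auto simp: cls_def)
    have "equ {y \<in> X. \<not> E x y} E" by (rule equ_subset[OF eq]) auto
    from Suc.IH[OF this] have "nge n {y \<in> X. \<not> E x y} E \<longleftrightarrow>
      (finite (cls X E) \<longrightarrow> n \<le> card (cls X E - {{y \<in> X. E x y}}))"
      unfolding cls'[OF x] by simp
    also have "\<dots> \<longleftrightarrow> (finite (cls X E) \<longrightarrow> Suc n \<le> card (cls X E))"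
    proof (cases "finite (cls X E)")
      case True
      then have "card (cls X E) > 0" using in_cls by (auto simp: card_gt_0_iff)
      then show ?thesis using card_Diff_singleton[OF in_cls] True by auto
    qed simp
    finally show ?thesis .
  qed
  show ?case
  proof (cases "X = {}")
    case True then show ?thesis by (simp add: cls_def)
  next
    case False then show ?thesis using step by auto
  qed
qed simp

lemma nge_all: "equ X E \<Longrightarrow> (\<forall>n. nge n X E) \<longleftrightarrow> infinite (cls X E)"
  using nge_iff[of X E] by (auto simp: not_less_eq_eq) (metis Suc_n_not_le_n)

lemma not_nge: "equ X E \<Longrightarrow> \<not> nge n X E \<longleftrightarrow> finite (cls X E) \<and> card (cls X E) < n"
  using nge_iff[of X E n] by auto

lemma cls_eq: "cls X (=) = (\<lambda>x. {x}) ` X"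
  by (auto simp: cls_def)

lemma nge_card: "nge n X (=) \<longleftrightarrow> (finite X \<longrightarrow> n \<le> card X)"
proof -
  have "inj_on (\<lambda>x. {x}) X" by (auto simp: inj_on_def)
  then show ?thesis by (simp add: nge_iff[OF equ_eq] cls_eq card_image finite_image_iff)
qed

lemma nge_mono: "nge n X E \<Longrightarrow> m \<le> n \<Longrightarrow> nge m X E"
proof (induction n arbitrary: m X)
  case (Suc n)
  show ?case
  proof (cases m)
    case (Suc k) then show ?thesis using Suc.prems Suc.IH[of _ k] by auto
  qed simp
qed simp

text \<open>Equal values under \<open>f\<close> force equivalence, so the classes form an image of a
  subset of \<open>F\<close>. All comparisons of indices below are instances of this.\<close>

lemma cls_bound:
  assumes E: "equ X E" and F: "finite F" "\<And>x. x \<in> X \<Longrightarrow> f x \<in> F"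
    and f: "\<And>x y. x \<in> X \<Longrightarrow> y \<in> X \<Longrightarrow> f x = f y \<Longrightarrow> E x y"
  shows "finite (cls X E) \<and> card (cls X E) \<le> card F"
proof -
  define g where "g v = {y \<in> X. E (SOME x. x \<in> X \<and> f x = v) y}" for v
  have "g (f x) = {y \<in> X. E x y}" if "x \<in> X" for x
  proof -
    define x' where "x' = (SOME x'. x' \<in> X \<and> f x' = f x)"
    have x': "x' \<in> X \<and> f x' = f x" unfolding x'_def by (rule someI[of _ x]) (use that in simp)
    then have "E x' x" "E x x'" using f that by metis+
    then have "{y \<in> X. E x' y} = {y \<in> X. E x y}" using E x' that unfolding equ_def by blast
    then show ?thesis by (simp add: g_def x'_def)
  qed
  then have "cls X E = g ` f ` X" unfolding cls_def image_image by (intro image_cong) auto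
  moreover have "f ` X \<subseteq> F" using F(2) by auto
  ultimately show ?thesis
    by (metis F(1) card_image_le card_mono finite_imageI finite_subset order_trans)
qed

text \<open>The reason for defining \<open>nge\<close> by recursion: every step is one existential
  quantifier and shrinks the set by a first-order condition.\<close>

lemma fo_nge:
  assumes "fo (\<lambda>M s. P M (\<lambda>i. s (Suc i)) (s 0))" "fo (\<lambda>M s. E M (\<lambda>i. s (Suc (Suc i))) (s (Suc 0)) (s 0))"
  shows "fo (\<lambda>M s. nge n {x \<in> carrier M. P M s x} (E M s))"
  using assms
proof (induction n arbitrary: P E)
  case 0 show ?case using fo_const[of True] by simp
next
  case (Suc n)
  have "fo (\<lambda>M s. P M (\<lambda>i. s (Suc (Suc i))) (s 0) \<and> \<not> E M (\<lambda>i. s (Suc (Suc i))) (s (Suc 0)) (s 0))"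
    using fo_shift[OF Suc.prems(1), of "\<lambda>i. case i of 0 \<Rightarrow> 0 | Suc j \<Rightarrow> Suc (Suc j)"] Suc.prems(2)
    by (intro fo_conj fo_neg) simp_all
  moreover have "fo (\<lambda>M s. E M (\<lambda>i. s (Suc (Suc (Suc i)))) (s (Suc 0)) (s 0))"
    using fo_shift[OF Suc.prems(2), of "\<lambda>i. if i \<le> 1 then i else Suc i"] by simp
  ultimately have "fo (\<lambda>M s. nge n {y \<in> carrier M. P M (\<lambda>i. s (Suc i)) y \<and>
      \<not> E M (\<lambda>i. s (Suc i)) (s 0) y} (E M (\<lambda>i. s (Suc i))))"
    using Suc.IH[of "\<lambda>M s y. P M (\<lambda>i. s (Suc i)) y \<and>
        \<not> E M (\<lambda>i. s (Suc i)) (s 0) y" "\<lambda>M s. E M (\<lambda>i. s (Suc i))"] by simp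
  with Suc.prems(1) have "fo (\<lambda>M s. P M (\<lambda>i. s (Suc i)) (s 0) \<and>
      nge n {y \<in> carrier M. P M (\<lambda>i. s (Suc i)) y \<and> \<not> E M (\<lambda>i. s (Suc i)) (s 0) y} (E M (\<lambda>i. s (Suc i))))"
    by (rule fo_conj)
  then have *: "fo (\<lambda>M s. \<exists>x\<in>carrier M. P M s x \<and> nge n {y \<in> carrier M. P M s y \<and> \<not> E M s x y} (E M s))"
    by (rule fo_ex)
  have "nge (Suc n) {x \<in> carrier M. P M s x} (E M s) \<longleftrightarrow>
      (\<exists>x\<in>carrier M. P M s x \<and> nge n {y \<in> carrier M. P M s y \<and> \<not> E M s x y} (E M s))" for M s
  proof -
    have "{y \<in> {x \<in> carrier M. P M s x}. \<not> E M s x y} = {y \<in> carrier M. P M s y \<and> \<not> E M s x y}" for x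
        by auto
    then show ?thesis by auto
  qed
  then show ?case using * by simp
qed

section \<open>Dimension of a union of infinitely many cosets\<close>

context group begin

lemma mult_inv_cancel: "x \<in> carrier G \<Longrightarrow> w \<in> carrier G \<Longrightarrow> x \<otimes> (inv x \<otimes> w) = w"
  and inv_mult_cancel: "x \<in> carrier G \<Longrightarrow> w \<in> carrier G \<Longrightarrow> inv x \<otimes> (x \<otimes> w) = w"
  by (simp_all flip: m_assoc)

lemmas gsimps = m_assoc inv_mult_group mult_inv_cancel inv_mult_cancel

lemma equ_lco:
  assumes "subgroup H G" "X \<subseteq> carrier G" shows "equ X (\<lambda>x y. inv x \<otimes> y \<in> H)"
proof -
  interpret H: subgroup H G by fact
  have c: "x \<in> X \<Longrightarrow> x \<in> carrier G" for x using assms(2) by auto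
  have s: "inv y \<otimes> x \<in> H" if "x \<in> X" "y \<in> X" "inv x \<otimes> y \<in> H" for x y
  proof -
    have "inv (inv x \<otimes> y) \<in> H" using that(3) by simp
    then show ?thesis using c that by (simp add: inv_mult_group)
  qed
  have t: "inv x \<otimes> z \<in> H" if "x \<in> X" "y \<in> X" "z \<in> X" "inv x \<otimes> y \<in> H" "inv y \<otimes> z \<in> H" for x y z
  proof -
    have "(inv x \<otimes> y) \<otimes> (inv y \<otimes> z) \<in> H" using that by simp
    moreover have "(inv x \<otimes> y) \<otimes> (inv y \<otimes> z) = inv x \<otimes> z"
      using c that by (simp add: gsimps)
    ultimately show ?thesis by simp
  qed
  have r: "inv x \<otimes> x \<in> H" if "x \<in> X" for x using c[OF that] by simp
  show ?thesis unfolding equ_def using r s t by blast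
qed

end

context dim_theory begin

text \<open>Translation maps each coset onto \<open>H\<close>, so every class has dimension at least
  \<open>d\<close>; having infinitely many classes adds one.\<close>

lemma dge_cosets:
  assumes M: "model M" "env M b" and P: "fo P" "X = {x \<in> carrier M. P M (x ## b)}"
    and Q: "fo Q" "H = {x \<in> carrier M. Q M (x ## b)}" and H: "subgroup H M"
    and XH: "\<And>x h. x \<in> X \<Longrightarrow> h \<in> H \<Longrightarrow> x \<otimes>\<^bsub>M\<^esub> h \<in> X"
    and d: "dge M H d" and infn: "infinite (cls X (\<lambda>x y. inv\<^bsub>M\<^esub> x \<otimes>\<^bsub>M\<^esub> y \<in> H))"
  shows "dge M X (Suc d)"
proof -
  interpret M: group M using M model_group by simp
  have Xc: "X \<subseteq> carrier M" using P(2) by auto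
  have eq: "equ X (\<lambda>x y. inv\<^bsub>M\<^esub> x \<otimes>\<^bsub>M\<^esub> y \<in> H)" by (rule M.equ_lco[OF H Xc])
  have R: "fo (\<lambda>M s. Q M ((inv\<^bsub>M\<^esub> (s 0) \<otimes>\<^bsub>M\<^esub> s 1) ## (\<lambda>i. s (Suc (Suc i)))))"
    by (intro fo_app1[OF Q(1)] ft.intros)
  show ?thesis
  proof (rule dge_quotient[OF M P R, where E = "\<lambda>x y. inv\<^bsub>M\<^esub> x \<otimes>\<^bsub>M\<^esub> y \<in> H"])
    fix x assume x: "x \<in> X"
    then have xc: "x \<in> carrier M" using Xc by auto
    let ?C = "{y \<in> X. inv\<^bsub>M\<^esub> x \<otimes>\<^bsub>M\<^esub> y \<in> H}"
    have foC: "fo (\<lambda>M s. P M (s 0 ## (\<lambda>i. s (Suc (Suc i)))) \<and>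
        Q M ((inv\<^bsub>M\<^esub> (s 1) \<otimes>\<^bsub>M\<^esub> s 0) ## (\<lambda>i. s (Suc (Suc i)))))"
      by (intro fo_conj fo_app1[OF Q(1)] fo_app1[OF P(1)] ft.intros)
    have C: "?C = {y \<in> carrier M. P M ((y ## x ## b) 0 ## (\<lambda>i. (y ## x ## b) (Suc (Suc i)))) \<and>
       Q M ((inv\<^bsub>M\<^esub> ((y ## x ## b) 1) \<otimes>\<^bsub>M\<^esub> (y ## x ## b) 0) ## (\<lambda>i. (y ## x ## b) (Suc (Suc i))))}"
      using xc by (auto simp: P(2) Q(2))
    have foH: "fo (\<lambda>M s. Q M (s 0 ## (\<lambda>i. s (Suc (Suc i)))))" by (intro fo_app1[OF Q(1)] ft.intros)
    have foR: "fo (\<lambda>M s. s 1 = inv\<^bsub>M\<^esub> (s 2) \<otimes>\<^bsub>M\<^esub> s 0)" by (intro fo_eq ft.intros)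
    show "dge M ?C d"
    proof (rule dge_surj[OF M(1) _ foC C foH _ foR])
      show "env M (x ## b)" using M(2) xc by simp
      show "H = {y \<in> carrier M. Q M ((y ## x ## b) 0 ## (\<lambda>i. (y ## x ## b) (Suc (Suc i))))}"
          by (simp add: Q(2))
      show "(\<lambda>y. inv\<^bsub>M\<^esub> x \<otimes>\<^bsub>M\<^esub> y) ` ?C = H"
      proof (intro equalityI subsetI)
        fix h assume h: "h \<in> H"
        then have "h = inv\<^bsub>M\<^esub> x \<otimes>\<^bsub>M\<^esub> (x \<otimes>\<^bsub>M\<^esub> h)" using xc Q(2) by (simp add: M.m_assoc[symmetric])
        then show "h \<in> (\<lambda>y. inv\<^bsub>M\<^esub> x \<otimes>\<^bsub>M\<^esub> y) ` ?C" using XH[OF x h] h by auto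
      qed auto
    qed (use d in auto)
  next
    show "infinite ((\<lambda>x. {y \<in> X. inv\<^bsub>M\<^esub> x \<otimes>\<^bsub>M\<^esub> y \<in> H}) ` X)" using infn by (simp add: cls_def)
    show "\<And>x y. x \<in> X \<Longrightarrow> y \<in> X \<Longrightarrow>
      Q M ((inv\<^bsub>M\<^esub> ((x ## y ## b) 0) \<otimes>\<^bsub>M\<^esub> (x ## y ## b) 1) ## (\<lambda>i. (x ## y ## b) (Suc (Suc i)))) =
          (inv\<^bsub>M\<^esub> x \<otimes>\<^bsub>M\<^esub> y \<in> H)"
      using Xc by (auto simp: Q(2))
  qed (use eq in \<open>unfold equ_def, blast+\<close>)
qed

end

section \<open>The dimension of conjugacy classes\<close>

lemma tuples_2: "w \<in> tuples M 2 \<longleftrightarrow> (\<exists>a b. w = [a, b] \<and> a \<in> carrier M \<and> b \<in> carrier M)"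
  by (auto simp: tuples_def numeral_2_eq_2 length_Suc_conv)

lemma tuples_3: "w \<in> tuples M 3 \<longleftrightarrow>
    (\<exists>a b c. w = [a, b, c] \<and> a \<in> carrier M \<and> b \<in> carrier M \<and> c \<in> carrier M)"
  by (auto simp: tuples_def numeral_3_eq_3 length_Suc_conv)

lemma fo_holds_sat: "fo (\<lambda>M s. holds M p [])"
proof -
  have "fo (\<lambda>M s. sat M (\<lambda>i. \<one>\<^bsub>M\<^esub>) p)"
    by (rule fo_subst[OF fo_sat, of "\<lambda>M s i. \<one>\<^bsub>M\<^esub>"]) (rule ft_one)
  then show ?thesis by (simp add: holds_def)
qed

lemma interpretable_over_home:
  assumes R: "fo R" and M: "group M" "env M b" and B: "range b \<subseteq> B"
  shows "interpretable_over M ((\<lambda>y. {[y]}) ` B) (home {v \<in> carrier M. R M (v ## b)})"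
proof -
  obtain p K where p: "\<And>M u b. group M \<Longrightarrow> set u \<subseteq> carrier M \<Longrightarrow> env M b \<Longrightarrow>
    holds M p (u @ map b [0..<K]) = R M (app u b)" using fo_holds[OF R] by blast
  have "{u \<in> tuples M 1. holds M p (u @ map b [0..<K])} = {u \<in> tuples M 1. R M (app u b)}"
    using p[OF M(1) _ M(2)] by (auto simp: tuples_def)
  then have "home {v \<in> carrier M. R M (v ## b)} = eq_set M 1 (eqf 1 1) p {map b [0..<K]}"
    by (simp only: eq_set_cl[OF is_sort_eqf] flip: singles_Collect)
      (simp only: home_eq, rule tuples_image, auto simp: tuples_def)
  moreover have "{map b [0..<K]} = concat_imag (map (\<lambda>y. {[y]}) (map b [0..<K]))"
    by (simp only: concat_imag_singletons)
  moreover have "set (map (\<lambda>y. {[y]}) (map b [0..<K])) \<subseteq> (\<lambda>y. {[y]}) ` B"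
    using B by (auto intro!: imageI)
  ultimately show ?thesis unfolding interpretable_over_def using is_sort_eqf[of M 1] by metis
qed

context dim_theory begin

lemma elementary_extension_G:
  assumes S: "\<And>k. env G (S k)"
  obtains M s where "model M" "env M s"
    "\<And>P. fo P \<Longrightarrow> eventually (\<lambda>k. P G (S k)) sequentially \<Longrightarrow> P M s"
proof -
  obtain M s where *: "group M \<and> env M s \<and>
    (\<forall>P. fo P \<longrightarrow> eventually (\<lambda>k. P G (S k)) sequentially \<longrightarrow> P M s)"
    using elementary_extension[of G S, OF grp inf S] by (elim exE)
  then have M: "group M" "env M s" by simp_all
  note M3 = conjunct2[OF conjunct2[OF *], rule_format]
  have "holds M p []" if "holds G p []" for p
    using M3[of "\<lambda>M s. holds M p []", OF fo_holds_sat] that by simp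
  then have "model M" using M(1) by (simp add: model_def model_of_Th_def)
  then show ?thesis by (rule that[OF _ M(2)]) (rule M3)
qed

lemma dge_empty: "model M \<Longrightarrow> \<not> dge M {} d"
  by (simp add: dge_def home_def dim_empty)

lemma additivity:
  assumes "model M" "set u \<subseteq> carrier M" "set v \<subseteq> carrier M" "C \<subseteq> imaginaries M"
  shows "dim_type dm M {u @ v} C = dim_type dm M {u} (insert {v} C) + dim_type dm M {v} C"
proof -
  have "pair_imag {u} {v} = {u @ v}" by (auto simp: pair_imag_def)
  then show ?thesis
    using add assms imag_tuple[OF assms(2)] imag_tuple[OF assms(3)] unfolding additive_dim_def model_def
        by metis
qed

text \<open>A finite union of sets of dimension below \<open>d\<close> has dimension below
  \<open>d\<close>, hence misses a point of \<open>G\<close>. The points \<open>y k\<close> avoid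
  more and more of the small sets definable over \<open>x\<close>, and an elementary extension along
  this sequence contains a \<open>g\<close> that avoids all of them, over an \<open>x'\<close> of
  the same type as \<open>x\<close>.\<close>

lemma generic_element:
  assumes x: "x \<in> carrier G" and d: "dge G (carrier G) d"
  obtains M g x' where "model M" "g \<in> carrier M" "x' \<in> carrier M"
    "\<And>Q. fo Q \<Longrightarrow> Q M (\<lambda>_. x') \<longleftrightarrow> Q G (\<lambda>_. x)"
    "\<And>R. fo R \<Longrightarrow> R M (g ## (\<lambda>_. x')) \<Longrightarrow> dge M {v \<in> carrier M. R M (v ## (\<lambda>_. x'))} d"
proof -
  have envx: "env G (\<lambda>_. x)" using x by (simp add: env_def)
  define D where "D n = {v \<in> carrier G. sat G (v ## (\<lambda>_. x)) (from_nat n)}" for n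
  have D: "mdef G (D n)" for n unfolding D_def by (rule mdefI[OF fo_sat envx])
  define B where "B k = (\<Union>n\<in>{n. n < k \<and> \<not> dge G (D n) d}. D n)" for k
  have B: "mdef G (B k) \<and> \<not> dge G (B k) d" for k
  proof (induction k)
    case 0
    have "mdef G {}" unfolding mdef_def using fo_const[of False] envx
      by (intro exI[of _ "\<lambda>M s. False"] exI[of _ "\<lambda>_. x"]) auto
    then show ?case using dge_empty[OF model_G] by (simp add: B_def)
  next
    case (Suc k)
    have "B (Suc k) = (if dge G (D k) d then B k else B k \<union> D k)" unfolding B_def
      by (auto simp: less_Suc_eq)
    moreover have "\<not> dge G (B k \<union> D k) d" if "\<not> dge G (D k) d"
      using dge_Un[OF model_G _ D, of "B k" k d] Suc that by blast
    moreover have "mdef G (B k \<union> D k)" using mdef_Un[OF grp _ D, of "B k" k] Suc by blast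
    ultimately show ?case using Suc by simp
  qed
  have "B k \<noteq> carrier G" for k using B d by metis
  moreover have "B k \<subseteq> carrier G" for k using B mdef_subset by blast
  ultimately have "\<exists>y\<in>carrier G. y \<notin> B k" for k by blast
  then obtain y where y: "\<And>k. y k \<in> carrier G" "\<And>k. y k \<notin> B k" by metis
  obtain M s where M: "model M" "env M s"
    "\<And>P. fo P \<Longrightarrow> eventually (\<lambda>k. P G (y k ## (\<lambda>_. x))) sequentially \<Longrightarrow> P M s"
    by (rule elementary_extension_G[of "\<lambda>k. y k ## (\<lambda>_. x)"]) (use y envx in auto)
  note gr = model_group[OF M(1)]
  define x' where "x' = s 1"
  have sSuc: "s (Suc i) = x'" for i
    unfolding x'_def by (rule M(3)) (auto intro: fo_eq ft.intros)
  from sSuc have s: "s = s 0 ## (\<lambda>_. x')" by (auto simp: push_def fun_eq_iff split: nat.split)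
  have c: "s 0 \<in> carrier M" "x' \<in> carrier M" using M(2) by (auto simp: x'_def)
  have tr: "Q M (\<lambda>_. x') \<longleftrightarrow> Q G (\<lambda>_. x)" if Q: "fo Q" for Q
  proof -
    have "fo (\<lambda>M s. Q M (\<lambda>i. s (Suc i)))" by (rule fo_shift[OF Q])
    from M(3)[OF this] M(3)[OF fo_neg[OF this]] show ?thesis
      by (cases "Q G (\<lambda>_. x)") (simp_all add: sSuc)
  qed
  have "dge M {v \<in> carrier M. R M (v ## (\<lambda>_. x'))} d" if R: "fo R" "R M (s 0 ## (\<lambda>_. x'))" for R
  proof (rule ccontr)
    assume n: "\<not> ?thesis"
    obtain p where p: "\<And>M s. group M \<Longrightarrow> env M s \<Longrightarrow> sat M s p = R M s" using fo_gform[OF R(1)] by blast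
    have "D (to_nat p) = {v \<in> carrier G. R G (v ## (\<lambda>_. x))}"
      using p[OF grp] envx by (auto simp: D_def)
    moreover have "\<not> dge G {v \<in> carrier G. R G (v ## (\<lambda>_. x))} d"
      using n dge_transfer[OF model_G envx M(1), of "\<lambda>_. x'" R d] tr R(1) c by (auto simp: env_def)
    ultimately have "\<not> R G (y k ## (\<lambda>_. x))" if "k > to_nat p" for k
      using y[of k] that by (auto simp: B_def)
    then have "eventually (\<lambda>k. \<not> R G (y k ## (\<lambda>_. x))) sequentially"
      by (auto simp: eventually_sequentially intro!: exI[of _ "Suc (to_nat p)"])
    from M(3)[OF fo_neg[OF R(1)] this] show False using R(2) s by simp
  qed
  note gen = this
  show ?thesis by (rule that[of M "s 0" x']) (fact M(1) c tr gen)+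
qed

text \<open>For generic \<open>g\<close>, additivity computes the dimension of \<open>(g, gxg\<inverse>)\<close>: the first
  entry is algebraic over the second one and \<open>x\<close>.\<close>

lemma dge_conj_class:
  assumes x: "x \<in> carrier G" and fin: "finite {y \<in> carrier G. x \<otimes>\<^bsub>G\<^esub> y = y \<otimes>\<^bsub>G\<^esub> x}"
    and d: "dge G (carrier G) d"
  shows "dge G {y \<in> carrier G. \<exists>g\<in>carrier G. y = g \<otimes>\<^bsub>G\<^esub> x \<otimes>\<^bsub>G\<^esub> inv\<^bsub>G\<^esub> g} d"
proof (rule ccontr)
  assume small: "\<not> ?thesis"
  have envx: "env G (\<lambda>_. x)" using x by (simp add: env_def)
  obtain M g x' where M: "model M" and c: "g \<in> carrier M" "x' \<in> carrier M"
    and tr: "\<And>Q. fo Q \<Longrightarrow> Q M (\<lambda>_. x') \<longleftrightarrow> Q G (\<lambda>_. x)"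
    and gen: "\<And>R. fo R \<Longrightarrow> R M (g ## (\<lambda>_. x')) \<Longrightarrow> dge M {v \<in> carrier M. R M (v ## (\<lambda>_. x'))} d"
    using generic_element[OF x d] by blast
  note gr = model_group[OF M]
  interpret M: group M by (rule gr)
  have envx': "env M (\<lambda>_. x')" using c by (simp add: env_def)
  define cj where "cj v = v \<otimes>\<^bsub>M\<^esub> x' \<otimes>\<^bsub>M\<^esub> inv\<^bsub>M\<^esub> v" for v
  define h where "h = cj g"
  have cjc: "v \<in> carrier M \<Longrightarrow> cj v \<in> carrier M" for v using c by (simp add: cj_def)
  have h: "h \<in> carrier M" using c cjc by (simp add: h_def)
  have finM: "finite {y \<in> carrier M. x' \<otimes>\<^bsub>M\<^esub> y = y \<otimes>\<^bsub>M\<^esub> x'}"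
  proof -
    \<comment> \<open>Finiteness itself is not first-order, but the bound given by the size in
      \<open>G\<close> is, and it passes to \<open>M\<close>.\<close>
    let ?n = "Suc (card {y \<in> carrier G. x \<otimes>\<^bsub>G\<^esub> y = y \<otimes>\<^bsub>G\<^esub> x})"
    have "fo (\<lambda>M s. nge ?n {y \<in> carrier M. s 0 \<otimes>\<^bsub>M\<^esub> y = y \<otimes>\<^bsub>M\<^esub> s 0} (=))"
      by (rule fo_nge) (intro fo_eq ft.intros)+
    from tr[OF this] fin show ?thesis by (auto simp: nge_card)
  qed
  have finF: "finite {v \<in> carrier M. cj v = h}"
  proof (rule finite_surj[OF finM])
    show "{v \<in> carrier M. cj v = h} \<subseteq> (\<lambda>y. g \<otimes>\<^bsub>M\<^esub> y) ` {y \<in> carrier M. x' \<otimes>\<^bsub>M\<^esub> y = y \<otimes>\<^bsub>M\<^esub> x'}"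
    proof
      fix v assume "v \<in> {v \<in> carrier M. cj v = h}"
      then have v: "v \<in> carrier M" "cj v = h" by auto
      have e: "v \<otimes>\<^bsub>M\<^esub> x' \<otimes>\<^bsub>M\<^esub> inv\<^bsub>M\<^esub> v = g \<otimes>\<^bsub>M\<^esub> x' \<otimes>\<^bsub>M\<^esub> inv\<^bsub>M\<^esub> g" using v(2) by (simp add: h_def cj_def)
      have "inv\<^bsub>M\<^esub> g \<otimes>\<^bsub>M\<^esub> (v \<otimes>\<^bsub>M\<^esub> x' \<otimes>\<^bsub>M\<^esub> inv\<^bsub>M\<^esub> v) \<otimes>\<^bsub>M\<^esub> v = x' \<otimes>\<^bsub>M\<^esub> (inv\<^bsub>M\<^esub> g \<otimes>\<^bsub>M\<^esub> v)"
        unfolding e using c v(1) by (simp add: M.gsimps)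
      then have "x' \<otimes>\<^bsub>M\<^esub> (inv\<^bsub>M\<^esub> g \<otimes>\<^bsub>M\<^esub> v) = inv\<^bsub>M\<^esub> g \<otimes>\<^bsub>M\<^esub> v \<otimes>\<^bsub>M\<^esub> x'"
        using c v(1) by (simp add: M.gsimps)
      moreover have "v = g \<otimes>\<^bsub>M\<^esub> (inv\<^bsub>M\<^esub> g \<otimes>\<^bsub>M\<^esub> v)" using c v(1) by (simp add: M.gsimps)
      ultimately show "v \<in> (\<lambda>y. g \<otimes>\<^bsub>M\<^esub> y) ` {y \<in> carrier M. x' \<otimes>\<^bsub>M\<^esub> y = y \<otimes>\<^bsub>M\<^esub> x'}"
        using c v(1) by blast
    qed
  qed
  let ?C = "{{[x']}}"
  have C: "?C \<subseteq> imaginaries M" using imag_tuple[of "[x']" M] c by simp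
  have add: "dim_type dm M {[g, h]} ?C = dim_type dm M {[g]} {{[h]}, {[x']}} + dim_type dm M {[h]} ?C"
    using additivity[OF M, of "[g]" "[h]" ?C] c h C by simp
  \<comment> \<open>The element \<open>g\<close> lies in a finite set definable from
    \<open>h\<close> and \<open>x'\<close>.\<close>
  have t1: "dim_type dm M {[g]} {{[h]}, {[x']}} \<le> 0"
  proof -
    let ?R = "\<lambda>M s. s 0 \<otimes>\<^bsub>M\<^esub> s 2 \<otimes>\<^bsub>M\<^esub> inv\<^bsub>M\<^esub> (s 0) = s 1"
    let ?X = "{v \<in> carrier M. ?R M (v ## h ## (\<lambda>_. x'))}"
    have R: "fo ?R" by (intro fo_eq ft.intros)
    have e: "env M (h ## (\<lambda>_. x'))" using h envx' by simp
    have X: "?X = {v \<in> carrier M. cj v = h}" by (simp add: cj_def numeral_2_eq_2)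
    have "interpretable_over M ((\<lambda>y. {[y]}) ` {h, x'}) (home ?X)"
      by (rule interpretable_over_home[OF R gr e]) (auto simp: push_def split: nat.splits)
    then have "interpretable_over M {{[h]}, {[x']}} (home ?X)" by simp
    moreover have "{[g]} \<in> home ?X" unfolding X using c by (simp add: home_def h_def)
    moreover have "dm M (home ?X) = 0"
    proof (rule dim_finite[OF M interpretable_home[OF gr mdefI[OF R e]]])
      show "home ?X \<noteq> {}" unfolding X using c(1) by (auto simp: home_def h_def)
      show "finite (home ?X)" unfolding X home_def using finF by simp
    qed
    ultimately show ?thesis unfolding dim_type_def by (intro Inf_lower2[of "dm M (home ?X)"]) auto
  qed
  \<comment> \<open>The element \<open>h\<close> lies in the conjugacy class of \<open>x'\<close>,
    whose dimension is below \<open>d\<close> by the assumption to be refuted.\<close>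
  have t2: "dim_type dm M {[h]} ?C < ereal (real d)"
  proof -
    let ?R = "\<lambda>M s. \<exists>g\<in>carrier M. s 0 = g \<otimes>\<^bsub>M\<^esub> s 1 \<otimes>\<^bsub>M\<^esub> inv\<^bsub>M\<^esub> g"
    let ?X = "{v \<in> carrier M. ?R M (v ## (\<lambda>_. x'))}"
    have R: "fo ?R" by (intro fo_ex fo_eq ft.intros)
    have "\<not> dge G {v \<in> carrier G. ?R G (v ## (\<lambda>_. x))} d" using small by simp
    then have "\<not> dge M ?X d"
      using dge_transfer[OF model_G envx M envx' _ R, of d] tr by blast
    then have "dm M (home ?X) < ereal (real d)" by (simp add: dge_def)
    moreover have "interpretable_over M ((\<lambda>y. {[y]}) ` {x'}) (home ?X)"
      by (rule interpretable_over_home[OF R gr envx']) auto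
    then have "interpretable_over M ?C (home ?X)" by simp
    moreover have "{[h]} \<in> home ?X" using c h by (auto simp: home_def h_def cj_def)
    ultimately show ?thesis unfolding dim_type_def by (intro le_less_trans[OF Inf_lower]) auto
  qed
  \<comment> \<open>Every set over \<open>x'\<close> that contains the pair contains all pairs
    \<open>[v, cj v]\<close> with \<open>v\<close> in a definable set through the generic
    \<open>g\<close>; such a set has dimension at least \<open>d\<close>.\<close>
  have t3: "ereal (real d) \<le> dim_type dm M {[g, h]} ?C"
    unfolding dim_type_def
  proof (rule Inf_greatest)
    fix z assume "z \<in> {dm M X |X. interpretable_over M ?C X \<and> {[g, h]} \<in> X}"
    then obtain X where z: "z = dm M X" and X: "interpretable_over M ?C X" "{[g, h]} \<in> X" by blast
    then obtain n e p cs where cs: "is_sort M n e" "set cs \<subseteq> ?C" "X = eq_set M n e p (concat_imag cs)"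
      by (auto simp: interpretable_over_def)
    define k where "k = length cs"
    have "cs = map (\<lambda>y. {[y]}) (replicate k x')" using cs(2) unfolding k_def by (induction cs) auto
    then have conc: "concat_imag cs = {replicate k x'}" by (simp only: concat_imag_singletons)
    have X': "X = cl M n e ` {u \<in> tuples M n. holds M p (u @ replicate k x')}"
      unfolding cs(3) conc by (rule eq_set_cl[OF cs(1)])
    then obtain u where u: "u \<in> tuples M n" "{[g, h]} = cl M n e u" "holds M p (u @ replicate k x')"
      using X(2) by blast
    have "u \<in> cl M n e u" using cs(1) u(1) equiv_class_self[of "tuples M n" "sort_rel M n e" u]
      by (simp add: cl_def is_sort_def)
    then have u': "u = [g, h]" using u(2) by auto
    have n: "n = 2" using u(1) u' by (simp add: tuples_def)
    have single: "cl M n e [v, w] = {[v, w]} \<longleftrightarrow>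
      (\<forall>a\<in>carrier M. \<forall>b\<in>carrier M. holds M e ([v, w] @ [a, b]) \<longrightarrow> a = v \<and> b = w)"
      if "v \<in> carrier M" "w \<in> carrier M" for v w
    proof -
      have 1: "[v, w] \<in> cl M n e [v, w]"
        using cs(1) that equiv_class_self[of "tuples M n" "sort_rel M n e" "[v, w]"]
        by (simp add: cl_def is_sort_def tuples_def n)
      have 2: "[a, b] \<in> cl M n e [v, w] \<longleftrightarrow> a \<in> carrier M \<and> b \<in> carrier M \<and> holds M e ([v, w] @ [a, b])"
          for a b
        using that by (simp add: cl_def sort_rel_def tuples_def n)
      have 3: "\<exists>a b. y = [a, b]" if "y \<in> cl M n e [v, w]" for y
        using that by (auto simp: cl_def sort_rel_def tuples_def n numeral_2_eq_2 length_Suc_conv)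
      show ?thesis
      proof (intro iffI ballI impI)
        fix a b assume "cl M n e [v, w] =
            {[v, w]}" "a \<in> carrier M" "b \<in> carrier M" "holds M e ([v, w] @ [a, b])"
        then show "a = v \<and> b = w" using 2[of a b] by simp
      next
        assume *: "\<forall>a\<in>carrier M. \<forall>b\<in>carrier M. holds M e ([v, w] @ [a, b]) \<longrightarrow> a = v \<and> b = w"
        have "y = [v, w]" if y: "y \<in> cl M n e [v, w]" for y
        proof -
          obtain a b where ab: "y = [a, b]" using 3[OF y] by (elim exE)
          have "a \<in> carrier M" "b \<in> carrier M" "holds M e ([v, w] @ [a, b])"
            using y unfolding ab 2 by simp_all
          then have "a = v \<and> b = w" using *[THEN bspec, of a, THEN bspec, of b] by simp
          then show ?thesis by (simp add: ab)
        qed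
        with 1 show "cl M n e [v, w] = {[v, w]}" by (intro equalityI subsetI) simp_all
      qed
    qed
    \<comment> \<open>The sort of \<open>X\<close> may differ from the sort of pairs and still have
      \<open>{[g, h]}\<close> among its elements. So \<open>R\<close> retains only those
      \<open>v\<close> for which the pair is alone in its class, a condition that \<open>g\<close>
      satisfies.\<close>
    define R where "R = (\<lambda>(M::'a monoid) (s::nat \<Rightarrow> 'a).
      (\<forall>a\<in>carrier M. \<forall>b\<in>carrier M. sat M (s 0 ## (s 0 \<otimes>\<^bsub>M\<^esub> s 1 \<otimes>\<^bsub>M\<^esub> inv\<^bsub>M\<^esub> (s 0)) ## a ## b ## (\<lambda>i. \<one>\<^bsub>M\<^esub>)) e \<longrightarrow>
         a = s 0 \<and> b = s 0 \<otimes>\<^bsub>M\<^esub> s 1 \<otimes>\<^bsub>M\<^esub> inv\<^bsub>M\<^esub> (s 0)) \<and>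
      sat M (s 0 ## (s 0 \<otimes>\<^bsub>M\<^esub> s 1 \<otimes>\<^bsub>M\<^esub> inv\<^bsub>M\<^esub> (s 0)) ## (\<lambda>i. if i < k then s 1 else \<one>\<^bsub>M\<^esub>)) p)"
    have f1: "fo (\<lambda>M s. \<forall>a\<in>carrier M. \<forall>b\<in>carrier M. sat M (s 0 ## (s 0 \<otimes>\<^bsub>M\<^esub> s 1 \<otimes>\<^bsub>M\<^esub> inv\<^bsub>M\<^esub> (s 0)) ## a ## b ## (\<lambda>i. \<one>\<^bsub>M\<^esub>)) e \<longrightarrow>
         a = s 0 \<and> b = s 0 \<otimes>\<^bsub>M\<^esub> s 1 \<otimes>\<^bsub>M\<^esub> inv\<^bsub>M\<^esub> (s 0))"
      by (intro fo_all fo_imp fo_conj fo_app2[OF fo_sat] fo_eq ft.intros ft_push ft_if)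
    have f2: "fo (\<lambda>M s. sat M (s 0 ## (s 0 \<otimes>\<^bsub>M\<^esub> s 1 \<otimes>\<^bsub>M\<^esub> inv\<^bsub>M\<^esub> (s 0)) ## (\<lambda>i.
        if i < k then s 1 else \<one>\<^bsub>M\<^esub>)) p)"
      by (intro fo_app2[OF fo_sat] fo_eq ft.intros ft_push ft_if)
    have foR: "fo R" unfolding R_def by (rule fo_conj[OF f1 f2])
    have app_rep: "app (replicate k x') (\<lambda>i. \<one>\<^bsub>M\<^esub>) = (\<lambda>i. if i < k then x' else \<one>\<^bsub>M\<^esub>)"
      by (auto simp: app_def)
    have R: "R M (v ## (\<lambda>_. x')) \<longleftrightarrow> cl M n e [v, cj v] = {[v, cj v]} \<and>
        holds M p ([v, cj v] @ replicate k x')"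
      if "v \<in> carrier M" for v
      unfolding single[OF that cjc[OF that]] using that
          by (simp add: R_def holds_app app_rep cj_def cong: if_cong)
    define S where "S = {v \<in> carrier M. R M (v ## (\<lambda>_. x'))}"
    have S: "dge M S d" unfolding S_def
      by (rule gen[OF foR]) (use R[OF c(1)] u u' in \<open>simp add: h_def\<close>)
    let ?S2 = "(\<lambda>v. [v, cj v]) ` S"
    have Sc: "S \<subseteq> carrier M" and mS: "mdef M S" unfolding S_def using mdefI[OF foR envx'] by auto
    have S2X: "(\<lambda>u. {u}) ` ?S2 \<subseteq> X"
    proof
      fix y assume "y \<in> (\<lambda>u. {u}) ` ?S2"
      then obtain v where "v \<in> S" and y: "y = {[v, cj v]}" by blast
      then have v: "v \<in> carrier M" and "cl M n e [v, cj v] =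
          {[v, cj v]}" "holds M p ([v, cj v] @ replicate k x')"
        using R by (auto simp: S_def)
      then show "y \<in> X" unfolding X' y using cjc[OF v]
        by (intro image_eqI[of _ _ "[v, cj v]"]) (auto simp: tuples_def n)
    qed
    have fo2: "fo (\<lambda>M s. R M (s 0 ## (\<lambda>i. s (Suc (Suc i)))) \<and> s 1 = s 0 \<otimes>\<^bsub>M\<^esub> s 2 \<otimes>\<^bsub>M\<^esub> inv\<^bsub>M\<^esub> (s 0))"
      by (intro fo_conj fo_app1[OF foR] fo_eq ft.intros)
    have fo3: "fo (\<lambda>M s. R M (s 0 ## (\<lambda>i. s (Suc (Suc (Suc i))))) \<and> s 1 =
        s 0 \<otimes>\<^bsub>M\<^esub> s 3 \<otimes>\<^bsub>M\<^esub> inv\<^bsub>M\<^esub> (s 0) \<and> s 2 = s 0)"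
      by (intro fo_conj fo_app1[OF foR] fo_eq ft.intros)
    have "?S2 = {u \<in> tuples M 2. (\<lambda>M s. R M (s 0 ## (\<lambda>i. s (Suc (Suc i)))) \<and> s 1 =
        s 0 \<otimes>\<^bsub>M\<^esub> s 2 \<otimes>\<^bsub>M\<^esub> inv\<^bsub>M\<^esub> (s 0)) M (app u (\<lambda>_. x'))}"
    proof (intro equalityI subsetI)
      fix w assume "w \<in> ?S2"
      then obtain v where v: "w = [v, cj v]" "v \<in> carrier M" "R M (v ## (\<lambda>_. x'))" unfolding S_def by blast
      then show "w \<in> {u \<in> tuples M 2. (\<lambda>M s. R M (s 0 ## (\<lambda>i. s (Suc (Suc i)))) \<and> s 1 =
          s 0 \<otimes>\<^bsub>M\<^esub> s 2 \<otimes>\<^bsub>M\<^esub> inv\<^bsub>M\<^esub> (s 0)) M (app u (\<lambda>_. x'))}"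
        using cjc[OF v(2)] by (simp add: tuples_2 cj_def)
    next
      fix w assume w: "w \<in> {u \<in> tuples M 2. (\<lambda>M s. R M (s 0 ## (\<lambda>i. s (Suc (Suc i)))) \<and> s 1 =
          s 0 \<otimes>\<^bsub>M\<^esub> s 2 \<otimes>\<^bsub>M\<^esub> inv\<^bsub>M\<^esub> (s 0)) M (app u (\<lambda>_. x'))}"
      then obtain a b where ab: "w = [a, b]" "a \<in> carrier M" unfolding tuples_2 by blast
      with w have "R M (a ## (\<lambda>_. x'))" "b = cj a" by (simp_all add: cj_def)
      then show "w \<in> ?S2" using ab by (simp add: S_def)
    qed
    then have tS2: "tdef M 2 ?S2" using tdef_fo[OF fo2 gr envx', of 2] by simp
    have "(\<lambda>u. u @ [hd u]) ` ?S2 = {u \<in> tuples M 3. (\<lambda>M s. R M (s 0 ## (\<lambda>i. s (Suc (Suc (Suc i))))) \<and>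
        s 1 = s 0 \<otimes>\<^bsub>M\<^esub> s 3 \<otimes>\<^bsub>M\<^esub> inv\<^bsub>M\<^esub> (s 0) \<and> s 2 = s 0) M (app u (\<lambda>_. x'))}"
    proof (intro equalityI subsetI)
      fix w assume "w \<in> (\<lambda>u. u @ [hd u]) ` ?S2"
      then obtain v where v: "w = [v, cj v, v]" "v \<in> carrier M" "R M (v ## (\<lambda>_. x'))" unfolding S_def
          by force
      then show "w \<in> {u \<in> tuples M 3. (\<lambda>M s. R M (s 0 ## (\<lambda>i. s (Suc (Suc (Suc i))))) \<and> s 1 =
          s 0 \<otimes>\<^bsub>M\<^esub> s 3 \<otimes>\<^bsub>M\<^esub> inv\<^bsub>M\<^esub> (s 0) \<and> s 2 = s 0) M (app u (\<lambda>_. x'))}"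
        using cjc[OF v(2)] by (simp add: tuples_3 cj_def)
    next
      fix w assume w: "w \<in> {u \<in> tuples M 3. (\<lambda>M s. R M (s 0 ## (\<lambda>i. s (Suc (Suc (Suc i))))) \<and> s 1 =
          s 0 \<otimes>\<^bsub>M\<^esub> s 3 \<otimes>\<^bsub>M\<^esub> inv\<^bsub>M\<^esub> (s 0) \<and> s 2 = s 0) M (app u (\<lambda>_. x'))}"
      then obtain a b c where ab: "w = [a, b, c]" "a \<in> carrier M" unfolding tuples_3 by blast
      with w have "R M (a ## (\<lambda>_. x'))" "b = cj a" "c = a" by (simp_all add: cj_def)
      then have "a \<in> S" "w = [a, cj a] @ [hd [a, cj a]]" using ab by (simp_all add: S_def)
      then show "w \<in> (\<lambda>u. u @ [hd u]) ` ?S2" by blast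
    qed
    then have tgr: "tdef M (2 + 1) ((\<lambda>u. u @ [hd u]) ` ?S2)" using tdef_fo[OF fo3 gr envx', of 3] by simp
    have gS: "(\<lambda>u. [hd u]) ` ?S2 = (\<lambda>v. [v]) ` S" by (auto simp: image_image)
    \<comment> \<open>Projection to the first entry maps the pairs onto \<open>S\<close>, so they
      inherit its lower bound.\<close>
    have "dm M (cl M 1 (eqf 1 1) ` (\<lambda>u. [hd u]) ` ?S2) + ereal (real 0) \<le> dm M ((\<lambda>v. {v}) ` ?S2)"
    proof (rule dim_fibres[OF M tS2 is_sort_eqf _ _ tgr])
      show "\<And>u. u \<in> ?S2 \<Longrightarrow> [hd u] \<in> tuples M 1" using Sc by (auto simp: tuples_def)
      show "tdef M 1 ((\<lambda>u. [hd u]) ` ?S2)" unfolding gS by (rule tdef_singles[OF gr mS])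
      fix u assume "u \<in> ?S2"
      then obtain v where v: "v \<in> S" "u = [v, cj v]" by auto
      have cl1: "cl M 1 (eqf 1 1) [w] = {[w]}" if "w \<in> S" for w
        using that Sc by (intro cl_eqf) (auto simp: tuples_def)
      have "{w \<in> ?S2. cl M 1 (eqf 1 1) [hd w] = cl M 1 (eqf 1 1) [hd u]} = {u}"
      proof (intro equalityI subsetI)
        fix w assume "w \<in> {w \<in> ?S2. cl M 1 (eqf 1 1) [hd w] = cl M 1 (eqf 1 1) [hd u]}"
        then obtain v' where "v' \<in> S" "w = [v', cj v']" "cl M 1 (eqf 1 1) [v'] = cl M 1 (eqf 1 1) [v]"
          unfolding v(2) by force
        then show "w \<in> {u}" using cl1 v by simp
      next
        fix w assume "w \<in> {u}"
        then show "w \<in> {w \<in> ?S2. cl M 1 (eqf 1 1) [hd w] = cl M 1 (eqf 1 1) [hd u]}"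
          using v by simp
      qed
      moreover have "0 \<le> dm M (cl M 2 (eqf 2 2) ` {u})"
      proof (rule dim_cl_nonneg[OF M is_sort_eqf, of _ _ u])
        have e1: "{u} = {w \<in> tuples M 2. (\<lambda>M s. s 0 = s 2 \<and> s 1 = s 3) M (app w (v ## cj v ## (\<lambda>_. x')))}"
        proof (intro equalityI subsetI)
          fix w assume "w \<in> {u}"
          then show "w \<in> {w \<in> tuples M 2. (\<lambda>M s. s 0 = s 2 \<and> s 1 = s 3) M (app w (v ## cj v ## (\<lambda>_. x')))}"
            using v Sc cjc[of v] by (auto simp: tuples_2)
        next
          fix w assume w: "w \<in> {w \<in> tuples M 2. (\<lambda>M s. s 0 = s 2 \<and> s 1 =
              s 3) M (app w (v ## cj v ## (\<lambda>_. x')))}"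
          then obtain a b where ab: "w = [a, b]" unfolding tuples_2 by blast
          with w show "w \<in> {u}" by (simp add: v)
        qed
        have e2: "fo (\<lambda>M s. s 0 = s 2 \<and> s 1 = s 3)" by (intro fo_conj fo_eq ft.intros)
        have e3: "env M (v ## cj v ## (\<lambda>_. x'))" using v Sc cjc envx' by auto
        show "tdef M 2 {u}" unfolding e1 by (rule tdef_fo[OF e2 gr e3])
      qed simp
      moreover have "cl M 2 (eqf 2 2) u = {u}" using v Sc cjc by (intro cl_eqf) (auto simp: tuples_def)
      ultimately show "ereal (real 0) \<le> dm M ((\<lambda>v. {v}) ` {w \<in> ?S2. cl M 1 (eqf 1 1) [hd w] =
          cl M 1 (eqf 1 1) [hd u]})"
        by (simp add: zero_ereal_def)
    qed
    then have "dm M (home S) \<le> dm M ((\<lambda>u. {u}) ` ?S2)"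
      unfolding gS home_cl[OF Sc, symmetric] by simp
    also have "\<dots> \<le> dm M X"
    proof (rule dim_subset[OF M interpretable_tuples[OF tS2] _ S2X])
      show "interpretable M X" unfolding interpretable_def using X(1) C
        unfolding interpretable_over_def by blast
    qed
    finally show "ereal (real d) \<le> z" using S by (simp add: dge_def z)
  qed
  have "ereal (real d) \<le> 0 + dim_type dm M {[h]} ?C"
    using t3 unfolding add using add_right_mono[OF t1] by (rule order_trans)
  then show False using t2 by simp
qed

end

section \<open>Sections of groups\<close>

text \<open>Uniformly definable families of sets. The inclusion is demanded for all \<open>M\<close>
  and \<open>s\<close>, groups or not, so that \<open>fof_eq\<close> can rewrite a family as a
  comprehension without side conditions.\<close>

definition fof :: "('a monoid \<Rightarrow> (nat \<Rightarrow> 'a) \<Rightarrow> 'a set) \<Rightarrow> bool" where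
  "fof F \<longleftrightarrow> fo (\<lambda>M s. s 0 \<in> F M (\<lambda>i. s (Suc i))) \<and> (\<forall>M s. F M s \<subseteq> carrier M)"

lemma fof_subset: "fof F \<Longrightarrow> F M s \<subseteq> carrier M"
  by (simp add: fof_def)

lemma fof_eq: "fof F \<Longrightarrow> F M s = {x \<in> carrier M. (\<lambda>M s. s 0 \<in> F M (\<lambda>i. s (Suc i))) M (x ## s)}"
  by (auto simp: fof_def)

lemma fo_mem: "fof F \<Longrightarrow> ft t \<Longrightarrow> (\<And>i. ft (\<lambda>M s. u M s i)) \<Longrightarrow> fo (\<lambda>M s. t M s \<in> F M (u M s))"
  using fo_app1[of "\<lambda>M s. s 0 \<in> F M (\<lambda>i. s (Suc i))" t u] by (simp add: fof_def)

lemma fof_Collect: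
  assumes "fo (\<lambda>M s. R M (\<lambda>i. s (Suc i)) (s 0))" shows "fof (\<lambda>M s. {x \<in> carrier M. R M s x})"
  using fo_conj[OF fo_carrier[OF ft_var[of 0]] assms] by (simp add: fof_def)

lemma fof_shift:
  assumes "fof F" shows "fof (\<lambda>M s. F M (\<lambda>i. s (f i)))"
proof -
  have "fo (\<lambda>M s. s 0 \<in> F M (\<lambda>i. s (Suc (f i))))" by (rule fo_mem[OF assms ft_var ft_var])
  then show ?thesis using assms by (simp add: fof_def)
qed

lemma fof_mdef: "fof F \<Longrightarrow> env M s \<Longrightarrow> mdef M (F M s)"
  unfolding fof_eq[of F M s] by (rule mdefI) (simp_all add: fof_def)

lemma mdef_fof:
  assumes "mdef M X" obtains F s where "fof F" "env M s" "X = F M s"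
proof -
  obtain P b where P: "fo P" "env M b" "X = {x \<in> carrier M. P M (x ## b)}" using assms
      by (auto simp: mdef_def)
  have "fo (\<lambda>M s. P M (s 0 ## (\<lambda>i. s (Suc i))))" by (intro fo_app1[OF P(1)] ft_var)
  then have "fof (\<lambda>M s. {x \<in> carrier M. P M (x ## s)})" by (rule fof_Collect)
  from that[OF this P(2)] P(3) show ?thesis by simp
qed

lemma fo_nge_fof:
  assumes F: "fof F" and E: "fo (\<lambda>M s. E M (\<lambda>i. s (Suc (Suc i))) (s (Suc 0)) (s 0))"
  shows "fo (\<lambda>M s. nge n (F M s) (E M s))"
proof -
  have "fo (\<lambda>M s. nge n {x \<in> carrier M. x \<in> F M s} (E M s))"
    by (rule fo_nge[OF fo_mem[OF F] E]) (rule ft_var)+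
  moreover have "{x \<in> carrier M. x \<in> F M s} = F M s" for M s using fof_subset[OF F] by auto
  ultimately show ?thesis by simp
qed

text \<open>Equality of the left cosets \<open>xH\<close> and \<open>yH\<close>. Thus
  \<open>cls X (lco M H)\<close> counts the cosets of \<open>H\<close> that meet \<open>X\<close>,
  and for \<open>H \<subseteq> X\<close> subgroups it is the set behind the index.\<close>

definition lco :: "('a, 'b) monoid_scheme \<Rightarrow> 'a set \<Rightarrow> 'a \<Rightarrow> 'a \<Rightarrow> bool" where
  "lco M H x y \<longleftrightarrow> inv\<^bsub>M\<^esub> x \<otimes>\<^bsub>M\<^esub> y \<in> H"

lemma fo_index:
  assumes "fof F" "fof H" shows "fo (\<lambda>M s. nge n (F M s) (lco M (H M s)))"
  unfolding lco_def by (intro fo_nge_fof[OF assms(1)] fo_mem[OF assms(2)] ft.intros)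

lemma fo_subset:
  assumes "fof F" "fof H" shows "fo (\<lambda>M s. F M s \<subseteq> H M s)"
proof (rule fo_cong)
  show "fo (\<lambda>M s. \<forall>x\<in>carrier M. x \<in> F M s \<longrightarrow> x \<in> H M s)"
    by (intro fo_all fo_imp fo_mem[OF assms(1)] fo_mem[OF assms(2)] ft.intros)
qed (use fof_subset[OF assms(1)] in blast)

lemma fo_subgroup:
  assumes F: "fof F" shows "fo (\<lambda>M s. subgroup (F M s) M)"
proof (rule fo_cong)
  show "fo (\<lambda>M s. \<one>\<^bsub>M\<^esub> \<in> F M s \<and> (\<forall>x\<in>carrier M. x \<in> F M s \<longrightarrow> inv\<^bsub>M\<^esub> x \<in> F M s) \<and>
     (\<forall>x\<in>carrier M. \<forall>y\<in>carrier M. x \<in> F M s \<longrightarrow> y \<in> F M s \<longrightarrow> x \<otimes>\<^bsub>M\<^esub> y \<in> F M s))"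
    by (intro fo_conj fo_all fo_imp fo_mem[OF F] ft.intros)
  show "(\<one>\<^bsub>M\<^esub> \<in> F M s \<and> (\<forall>x\<in>carrier M. x \<in> F M s \<longrightarrow> inv\<^bsub>M\<^esub> x \<in> F M s) \<and>
     (\<forall>x\<in>carrier M. \<forall>y\<in>carrier M. x \<in> F M s \<longrightarrow> y \<in> F M s \<longrightarrow> x \<otimes>\<^bsub>M\<^esub> y \<in> F M s)) = subgroup (F M s) M" for M s
    unfolding subgroup_def using fof_subset[OF F, of M s] by blast
qed

lemma cls_eqD:
  assumes "equ X E" "Y \<subseteq> X" "x \<in> Y" "y \<in> Y" "{z \<in> X. E x z} = {z \<in> X. E y z}" shows "E x y"
proof -
  have "y \<in> {z \<in> X. E y z}" using assms(1,2,4) by (auto simp: equ_def)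
  then show ?thesis unfolding assms(5)[symmetric] by simp
qed

section \<open>Index arithmetic\<close>

context group begin

lemma equ_lco': "subgroup H G \<Longrightarrow> X \<subseteq> carrier G \<Longrightarrow> equ X (lco G H)"
  unfolding lco_def by (rule equ_lco)

lemma lco_finite_mono:
  assumes "subgroup H G" "subgroup H' G" "H \<subseteq> H'" "X \<subseteq> carrier G" "finite (cls X (lco G H))"
  shows "finite (cls X (lco G H')) \<and> card (cls X (lco G H')) \<le> card (cls X (lco G H))"
proof (rule cls_bound[OF equ_lco'[OF assms(2,4)] assms(5)])
  show "x \<in> X \<Longrightarrow> {y \<in> X. lco G H x y} \<in> cls X (lco G H)" for x by (auto simp: cls_def)
  fix x y assume xy: "x \<in> X" "y \<in> X" "{z \<in> X. lco G H x z} = {z \<in> X. lco G H y z}"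
  have "lco G H x y" by (rule cls_eqD[OF equ_lco'[OF assms(1,4)] subset_refl xy])
  then show "lco G H' x y" using assms(3) by (auto simp: lco_def)
qed

lemma lco_finite_subset:
  assumes "subgroup H G" "Y \<subseteq> X" "X \<subseteq> carrier G" "finite (cls X (lco G H))"
  shows "finite (cls Y (lco G H)) \<and> card (cls Y (lco G H)) \<le> card (cls X (lco G H))"
proof (rule cls_bound[OF equ_lco'[OF assms(1)] assms(4)])
  show "Y \<subseteq> carrier G" using assms by auto
  show "x \<in> Y \<Longrightarrow> {y \<in> X. lco G H x y} \<in> cls X (lco G H)" for x using assms(2) by (auto simp: cls_def)
  fix x y assume xy: "x \<in> Y" "y \<in> Y" "{z \<in> X. lco G H x z} = {z \<in> X. lco G H y z}"
  show "lco G H x y" by (rule cls_eqD[OF equ_lco'[OF assms(1,3)] assms(2) xy])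
qed

lemma lco_finite_Int:
  assumes "subgroup H G" "subgroup H' G" "X \<subseteq> carrier G"
    "finite (cls X (lco G H))" "finite (cls X (lco G H'))"
  shows "finite (cls X (lco G (H \<inter> H')))"
proof -
  have "finite (cls X (lco G (H \<inter> H'))) \<and>
      card (cls X (lco G (H \<inter> H'))) \<le> card (cls X (lco G H) \<times> cls X (lco G H'))"
  proof (rule cls_bound[OF equ_lco'[OF subgroups_Inter_pair[OF assms(1,2)] assms(3)],
      where f = "\<lambda>x. ({y \<in> X. lco G H x y}, {y \<in> X. lco G H' x y})"])
    show "finite (cls X (lco G H) \<times> cls X (lco G H'))" using assms by simp
    show "x \<in> X \<Longrightarrow> ({y \<in> X. lco G H x y}, {y \<in> X. lco G H' x y}) \<in> cls X (lco G H) \<times> cls X (lco G H')" for x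
      by (auto simp: cls_def)
    fix x y assume xy: "x \<in> X" "y \<in> X" "({z \<in> X. lco G H x z}, {z \<in> X. lco G H' x z}) =
        ({z \<in> X. lco G H y z}, {z \<in> X. lco G H' y z})"
    have "lco G H x y" by (rule cls_eqD[OF equ_lco'[OF assms(1,3)] subset_refl xy(1,2)]) (use xy(3) in simp)
    moreover have "lco G H' x y" by (rule cls_eqD[OF equ_lco'[OF assms(2,3)] subset_refl xy(1,2)])
        (use xy(3) in simp)
    ultimately show "lco G (H \<inter> H') x y" by (simp add: lco_def)
  qed
  then show ?thesis by simp
qed

text \<open>With a representative \<open>r x\<close> chosen in each class of \<open>H\<close>, the
  coset \<open>xL\<close> is determined by the class of \<open>x\<close> and the coset of
  \<open>inv (r x) \<otimes> x\<close> in \<open>H\<close>.\<close>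

lemma lco_finite_mult:
  assumes H: "subgroup H G" and L: "subgroup L G" "L \<subseteq> H" and X: "X \<subseteq> carrier G"
    and f1: "finite (cls X (lco G H))" and f2: "finite (cls H (lco G L))"
  shows "finite (cls X (lco G L)) \<and>
      card (cls X (lco G L)) \<le> card (cls X (lco G H)) * card (cls H (lco G L))"
proof -
  interpret H: subgroup H G by fact
  let ?c = "\<lambda>x. {y \<in> X. lco G H x y}"
  define r where "r x = (SOME y. y \<in> ?c x)" for x
  have eq: "equ X (lco G H)" by (rule equ_lco'[OF H X])
  have r: "r x \<in> ?c x" if "x \<in> X" for x unfolding r_def
    by (rule someI[of _ x]) (use eq that in \<open>simp add: equ_def\<close>)
  have rX: "r x \<in> X" "r x \<in> carrier G" "x \<in> carrier G" "inv (r x) \<otimes> x \<in> H" if "x \<in> X" for x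
  proof -
    show "r x \<in> X" using r that by auto
    then show "r x \<in> carrier G" "x \<in> carrier G" using X that by auto
    have "lco G H (r x) x" using r[OF that] eq that unfolding equ_def by blast
    then show "inv (r x) \<otimes> x \<in> H" by (simp add: lco_def)
  qed
  have "finite (cls X (lco G L)) \<and> card (cls X (lco G L)) \<le> card (cls X (lco G H) \<times> cls H (lco G L))"
  proof (rule cls_bound[OF equ_lco'[OF L(1) X],
      where f = "\<lambda>x. (?c x, {h \<in> H. lco G L (inv (r x) \<otimes> x) h})"])
    show "finite (cls X (lco G H) \<times> cls H (lco G L))" using f1 f2 by simp
    show "x \<in> X \<Longrightarrow> (?c x, {h \<in> H. lco G L (inv (r x) \<otimes> x) h}) \<in> cls X (lco G H) \<times> cls H (lco G L)" for x
      using rX(4) by (auto simp: cls_def)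
    fix x y assume xy: "x \<in> X" "y \<in> X"
      "(?c x, {h \<in> H. lco G L (inv (r x) \<otimes> x) h}) = (?c y, {h \<in> H. lco G L (inv (r y) \<otimes> y) h})"
    then have rr: "r x = r y" by (simp add: r_def)
    have "inv (r y) \<otimes> y \<in> {h \<in> H. lco G L (inv (r y) \<otimes> y) h}"
      using rX[OF xy(2)] L(1) by (auto simp: lco_def subgroup.one_closed)
    then have "lco G L (inv (r x) \<otimes> x) (inv (r x) \<otimes> y)" using xy(3) rr by auto
    then show "lco G L x y" using rX[OF xy(1)] rX[OF xy(2)] by (simp add: lco_def gsimps rr)
  qed
  then show ?thesis by (simp add: card_cartesian_product)
qed

text \<open>Lagrange for a union \<open>X\<close> of left cosets of \<open>H\<close>.\<close>

lemma card_lco: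
  assumes H: "subgroup H G" and X: "finite X" "X \<subseteq> carrier G" "\<And>x h. x \<in> X \<Longrightarrow> h \<in> H \<Longrightarrow> x \<otimes> h \<in> X"
  shows "card X = card (cls X (lco G H)) * card H"
proof -
  have eq: "equ X (lco G H)" by (rule equ_lco'[OF H X(2)])
  have c: "card C = card H" if C: "C \<in> cls X (lco G H)" for C
  proof -
    obtain x where x: "x \<in> X" "C = {y \<in> X. lco G H x y}" using C by (auto simp: cls_def)
    have xc: "x \<in> carrier G" using x X by auto
    have Hc: "h \<in> carrier G" if "h \<in> H" for h using H that by (rule subgroup.mem_carrier)
    have "C = (\<lambda>h. x \<otimes> h) ` H"
    proof (intro equalityI subsetI)
      fix y assume "y \<in> C"
      then have y: "y \<in> carrier G" "inv x \<otimes> y \<in> H" using x X(2) by (auto simp: lco_def)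
      have "y = x \<otimes> (inv x \<otimes> y)" using xc y(1) by (simp add: gsimps)
      then show "y \<in> (\<lambda>h. x \<otimes> h) ` H" using y(2) by blast
    next
      fix y assume "y \<in> (\<lambda>h. x \<otimes> h) ` H"
      then show "y \<in> C" using x xc X(3) Hc by (auto simp: lco_def gsimps)
    qed
    moreover have "inj_on (\<lambda>h. x \<otimes> h) H" using xc Hc by (auto simp: inj_on_def)
    ultimately show ?thesis by (simp add: card_image)
  qed
  have fin: "finite (cls X (lco G H))" using X(1) by (simp add: cls_def)
  have U: "\<Union> (cls X (lco G H)) = X" using eq by (auto simp: cls_def equ_def)
  have disj: "C \<inter> D = {}" if CD: "C \<in> cls X (lco G H)" "D \<in> cls X (lco G H)" "C \<noteq> D" for C D
  proof (rule ccontr)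
    assume "C \<inter> D \<noteq> {}"
    then obtain z x y where z: "z \<in> X" "x \<in> X" "y \<in> X" "lco G H x z" "lco G H y z"
      "C = {w \<in> X. lco G H x w}" "D = {w \<in> X. lco G H y w}" using CD(1,2) by (auto simp: cls_def)
    then have "lco G H x y" using eq unfolding equ_def by meson
    then have "lco G H x w \<longleftrightarrow> lco G H y w" if "w \<in> X" for w
      using eq z(2,3) that unfolding equ_def by meson
    then have "C = D" unfolding z(6,7) by blast
    then show False using CD(3) by simp
  qed
  have "card (\<Union> (cls X (lco G H))) = (\<Sum>C\<in>cls X (lco G H). card C)"
  proof (rule card_Union_disjoint)
    show "pairwise disjnt (cls X (lco G H))" using disj by (simp add: pairwise_def disjnt_def)
    show "\<And>C. C \<in> cls X (lco G H) \<Longrightarrow> finite C" using X(1) by (auto simp: cls_def)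
  qed
  then have "card X = (\<Sum>C\<in>cls X (lco G H). card C)" unfolding U .
  also have "\<dots> = card (cls X (lco G H)) * card H" using c by simp
  finally show ?thesis .
qed

end

section \<open>Conjugation, centralisers and classes in a section\<close>

definition cj :: "('a, 'b) monoid_scheme \<Rightarrow> 'a \<Rightarrow> 'a \<Rightarrow> 'a" where
  "cj M y x = y \<otimes>\<^bsub>M\<^esub> x \<otimes>\<^bsub>M\<^esub> inv\<^bsub>M\<^esub> y"

text \<open>For a section \<open>A/N\<close>, the preimages in \<open>A\<close> of the centraliser and of the
  conjugacy class of the coset of \<open>x\<close>.\<close>

definition CN :: "('a, 'b) monoid_scheme \<Rightarrow> 'a set \<Rightarrow> 'a set \<Rightarrow> 'a \<Rightarrow> 'a set" where
  "CN M A N x = {y \<in> A. lco M N x (cj M y x)}"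

definition Kl :: "('a, 'b) monoid_scheme \<Rightarrow> 'a set \<Rightarrow> 'a set \<Rightarrow> 'a \<Rightarrow> 'a set" where
  "Kl M A N x = {z \<in> A. \<exists>y\<in>A. lco M N (cj M y x) z}"

definition secn :: "('a, 'b) monoid_scheme \<Rightarrow> 'a set \<Rightarrow> 'a set \<Rightarrow> bool" where
  "secn M A N \<longleftrightarrow> subgroup A M \<and> subgroup N M \<and> N \<subseteq> A \<and> (\<forall>a\<in>A. \<forall>n\<in>N. cj M a n \<in> N)"

locale section_group = group +
  fixes A N assumes sec: "secn G A N"
begin

abbreviation cjg where "cjg y x \<equiv> cj G y x"
abbreviation eq where "eq x y \<equiv> lco G N x y"
abbreviation C where "C x \<equiv> CN G A N x"
abbreviation K where "K x \<equiv> Kl G A N x"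

lemma A: "subgroup A G" and N: "subgroup N G" and NA: "N \<subseteq> A" and nrm: "a \<in> A \<Longrightarrow> n \<in> N \<Longrightarrow> cj G a n \<in> N"
  using sec by (auto simp: secn_def)

lemma Ac [simp]: "x \<in> A \<Longrightarrow> x \<in> carrier G" using A by (rule subgroup.mem_carrier)
lemma Am [simp]: "x \<in> A \<Longrightarrow> y \<in> A \<Longrightarrow> x \<otimes> y \<in> A" using A by (rule subgroup.m_closed)
lemma Ai [simp]: "x \<in> A \<Longrightarrow> inv x \<in> A" using A by (rule subgroup.m_inv_closed)
lemma Nm [simp]: "x \<in> N \<Longrightarrow> y \<in> N \<Longrightarrow> x \<otimes> y \<in> N" using N by (rule subgroup.m_closed)
lemma Ni [simp]: "x \<in> N \<Longrightarrow> inv x \<in> N" using N by (rule subgroup.m_inv_closed)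
lemma N1 [simp]: "\<one> \<in> N" using N by (rule subgroup.one_closed)
lemma A1 [simp]: "\<one> \<in> A" using A by (rule subgroup.one_closed)
lemma NA' [simp]: "x \<in> N \<Longrightarrow> x \<in> A" using NA by auto

lemma cj_A [simp]: "y \<in> A \<Longrightarrow> x \<in> A \<Longrightarrow> cjg y x \<in> A" by (simp add: cj_def)

lemma cj_mult: "y \<in> A \<Longrightarrow> z \<in> A \<Longrightarrow> x \<in> A \<Longrightarrow> cjg (y \<otimes> z) x = cjg y (cjg z x)"
  by (simp add: cj_def gsimps)

lemma cj_hom: "y \<in> A \<Longrightarrow> z \<in> A \<Longrightarrow> x \<in> A \<Longrightarrow> cjg y (x \<otimes> z) = cjg y x \<otimes> cjg y z"
  by (simp add: cj_def gsimps)

lemma cj_inv: "y \<in> A \<Longrightarrow> x \<in> A \<Longrightarrow> cjg y (inv x) = inv (cjg y x)"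
  by (simp add: cj_def gsimps)

lemma cj_one [simp]: "x \<in> A \<Longrightarrow> cjg \<one> x = x" by (simp add: cj_def)

lemma cj_cancel [simp]: "y \<in> A \<Longrightarrow> x \<in> A \<Longrightarrow> cjg (inv y) (cjg y x) = x" 
  "y \<in> A \<Longrightarrow> x \<in> A \<Longrightarrow> cjg y (cjg (inv y) x) = x" 
  by (simp_all add: cj_def gsimps)

lemma eq_refl [simp]: "x \<in> A \<Longrightarrow> eq x x" by (simp add: lco_def)

lemma equA: "X \<subseteq> A \<Longrightarrow> equ X eq"
  by (rule equ_lco'[OF N]) auto

lemma eq_sym: "x \<in> A \<Longrightarrow> y \<in> A \<Longrightarrow> eq x y \<Longrightarrow> eq y x"
  using equA[OF subset_refl] unfolding equ_def by blast

lemma eq_trans: "x \<in> A \<Longrightarrow> y \<in> A \<Longrightarrow> z \<in> A \<Longrightarrow> eq x y \<Longrightarrow> eq y z \<Longrightarrow> eq x z"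
  using equA[OF subset_refl] unfolding equ_def by meson

lemma eq_cj: "x \<in> A \<Longrightarrow> z \<in> A \<Longrightarrow> y \<in> A \<Longrightarrow> eq x z \<Longrightarrow> eq (cjg y x) (cjg y z)"
  using nrm[of y "inv x \<otimes> z"] unfolding lco_def by (simp add: cj_hom cj_inv)

lemma eq_mult:
  assumes "x \<in> A" "x' \<in> A" "y \<in> A" "y' \<in> A" "eq x x'" "eq y y'" shows "eq (x \<otimes> y) (x' \<otimes> y')"
proof -
  have "cjg (inv y) (inv x \<otimes> x') \<otimes> (inv y \<otimes> y') \<in> N"
    using assms nrm[of "inv y" "inv x \<otimes> x'"] by (simp add: lco_def)
  moreover have "cjg (inv y) (inv x \<otimes> x') \<otimes> (inv y \<otimes> y') = inv (x \<otimes> y) \<otimes> (x' \<otimes> y')"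
    using assms(1-4) by (simp add: cj_def gsimps)
  ultimately show ?thesis by (simp add: lco_def)
qed

lemma CA: "C x \<subseteq> A" by (auto simp: CN_def)
lemma KA: "K x \<subseteq> A" by (auto simp: Kl_def)

lemma C_subgroup:
  assumes x: "x \<in> A" shows "subgroup (C x) G"
proof (rule subgroup.intro)
  show "C x \<subseteq> carrier G" using CA Ac by blast
  show "\<one> \<in> C x" using x by (simp add: CN_def)
  fix y assume y: "y \<in> C x"
  then have y': "y \<in> A" "eq x (cjg y x)" by (auto simp: CN_def)
  then have "eq (cjg (inv y) x) (cjg (inv y) (cjg y x))" using x by (intro eq_cj) auto
  then have "eq x (cjg (inv y) x)" using x y' eq_sym[of "cjg (inv y) x" x] by simp
  then show "inv y \<in> C x" using y' by (simp add: CN_def)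
  fix z assume z: "z \<in> C x"
  then have z': "z \<in> A" "eq x (cjg z x)" by (auto simp: CN_def)
  have "eq (cjg y x) (cjg y (cjg z x))" using x y' z' by (intro eq_cj) auto
  then have "eq x (cjg y (cjg z x))" using eq_trans[of x "cjg y x" "cjg y (cjg z x)"] x y' z' by simp
  then show "y \<otimes> z \<in> C x" using x y' z' by (simp add: CN_def cj_mult)
qed

lemma N_C: "x \<in> A \<Longrightarrow> N \<subseteq> C x"
proof
  fix n assume x: "x \<in> A" and n: "n \<in> N"
  have "cjg (inv x) n \<otimes> inv n \<in> N" using nrm[of "inv x" n] x n by simp
  moreover have "cjg (inv x) n \<otimes> inv n = inv x \<otimes> cjg n x" using x n by (simp add: cj_def gsimps)
  ultimately show "n \<in> C x" using n by (simp add: CN_def lco_def)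
qed

lemma C_mult: "x \<in> A \<Longrightarrow> z \<in> A \<Longrightarrow> C x \<inter> C z \<subseteq> C (x \<otimes> z)"
  using eq_mult[of x "cjg _ x" z "cjg _ z"] by (auto simp: CN_def cj_hom)

lemma C_inv: 
  assumes x: "x \<in> A" shows "C x \<subseteq> C (inv x)"
proof
  fix y assume "y \<in> C x"
  then have y: "y \<in> A" "eq x (cjg y x)" by (auto simp: CN_def)
  have "cjg x (inv (inv x \<otimes> cjg y x)) \<in> N" using y x nrm[of x] by (simp add: lco_def del: inv_mult_group)
  moreover have "cjg x (inv (inv x \<otimes> cjg y x)) = x \<otimes> cjg y (inv x)"
    using x y(1) by (simp add: cj_inv) (simp add: cj_def gsimps)
  ultimately show "y \<in> C (inv x)" using x y(1) by (simp add: CN_def lco_def)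
qed

lemma lco_C: "lco G (C x) y y' \<longleftrightarrow> inv y \<otimes> y' \<in> C x"
  by (simp add: lco_def)

lemma C_same: "y \<in> A \<Longrightarrow> y' \<in> A \<Longrightarrow> x \<in> A \<Longrightarrow> eq (cjg y x) (cjg y' x) \<Longrightarrow> lco G (C x) y y'"
  using eq_cj[of "cjg y x" "cjg y' x" "inv y"] unfolding lco_C by (simp add: CN_def cj_mult)

lemma C_same': 
  assumes "y \<in> A" "y' \<in> A" "x \<in> A" "lco G (C x) y y'" shows "eq (cjg y x) (cjg y' x)"
proof -
  have "eq x (cjg (inv y) (cjg y' x))" using assms unfolding lco_C by (simp add: CN_def cj_mult)
  then have "eq (cjg y x) (cjg y (cjg (inv y) (cjg y' x)))" using assms by (intro eq_cj) auto
  then show ?thesis using assms by simp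
qed

lemma K_refl: "x \<in> A \<Longrightarrow> x \<in> K x"
  unfolding Kl_def by (rule CollectI, rule conjI, simp, rule bexI[of _ \<one>]) simp_all

lemma K_sym: 
  assumes "x \<in> A" "z \<in> K x" shows "x \<in> K z"
proof -
  obtain y where y: "y \<in> A" "z \<in> A" "eq (cjg y x) z" using assms(2) by (auto simp: Kl_def)
  then have "eq (cjg (inv y) (cjg y x)) (cjg (inv y) z)" using assms by (intro eq_cj) auto
  then have "eq (cjg (inv y) z) x" using y assms eq_sym[of x "cjg (inv y) z"] by simp
  then show ?thesis using y assms by (auto simp: Kl_def intro!: bexI[of _ "inv y"])
qed

lemma K_trans: 
  assumes "x \<in> A" "z \<in> K x" "w \<in> K z" shows "w \<in> K x"
proof -
  obtain y where y: "y \<in> A" "z \<in> A" "eq (cjg y x) z" using assms(2) by (auto simp: Kl_def)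
  obtain v where v: "v \<in> A" "w \<in> A" "eq (cjg v z) w" using assms(3) by (auto simp: Kl_def)
  have "eq (cjg v (cjg y x)) (cjg v z)" using y v assms by (intro eq_cj) auto
  then have "eq (cjg (v \<otimes> y) x) w" using eq_trans[of "cjg v (cjg y x)" "cjg v z" w] y v assms
      by (simp add: cj_mult)
  then show ?thesis using y v by (auto simp: Kl_def intro!: bexI[of _ "v \<otimes> y"])
qed

lemma K_eq: "x \<in> A \<Longrightarrow> z \<in> K x \<Longrightarrow> K z = K x"
  using K_sym K_trans KA by blast

lemma K_mult: 
  assumes "x \<in> A" "z \<in> K x" "n \<in> N" shows "z \<otimes> n \<in> K x"
proof -
  obtain y where y: "y \<in> A" "z \<in> A" "inv (cjg y x) \<otimes> z \<in> N" using assms(2) by (auto simp: Kl_def lco_def)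
  then have "inv (cjg y x) \<otimes> z \<otimes> n \<in> N" using assms by simp
  then have "eq (cjg y x) (z \<otimes> n)" using y assms by (simp add: lco_def m_assoc)
  then show ?thesis using y assms by (auto simp: Kl_def)
qed

lemma K_cj: "x \<in> A \<Longrightarrow> y \<in> A \<Longrightarrow> cjg y x \<in> K x"
  unfolding Kl_def by (rule CollectI, rule conjI, simp, rule bexI[of _ y]) simp_all

text \<open>Together with \<open>finite_K\<close>, the orbit-stabiliser correspondence modulo
  \<open>N\<close>: \<open>y\<close> and \<open>y'\<close> lie in the same coset of
  \<open>C x\<close> iff they conjugate \<open>x\<close> to the same coset of
  \<open>N\<close>.\<close>

lemma finite_C:
  assumes x: "x \<in> A" and f: "finite (cls (K x) eq)"
  shows "finite (cls A (lco G (C x))) \<and> card (cls A (lco G (C x))) \<le> card (cls (K x) eq)"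
proof -
  show "finite (cls A (lco G (C x))) \<and> card (cls A (lco G (C x))) \<le> card (cls (K x) eq)"
  proof (rule cls_bound[OF equ_lco'[OF C_subgroup[OF x]] f, where f = "\<lambda>y. {z \<in> K x. eq (cjg y x) z}"])
    show "A \<subseteq> carrier G" by auto
    show "y \<in> A \<Longrightarrow> {z \<in> K x. eq (cjg y x) z} \<in> cls (K x) eq" for y using K_cj[OF x] by (auto simp: cls_def)
    fix y y' assume y: "y \<in> A" "y' \<in> A" "{z \<in> K x. eq (cjg y x) z} = {z \<in> K x. eq (cjg y' x) z}"
    have "eq (cjg y x) (cjg y' x)"
      by (rule cls_eqD[OF equA[OF KA] subset_refl _ _ y(3)]) (use K_cj x y in auto)
    then show "lco G (C x) y y'" using C_same x y by simp
  qed
qed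

lemma finite_K:
  assumes x: "x \<in> A" and f: "finite (cls A (lco G (C x)))"
  shows "finite (cls (K x) eq) \<and> card (cls (K x) eq) \<le> card (cls A (lco G (C x)))"
proof -
  define h where "h z = (SOME y. y \<in> A \<and> eq (cjg y x) z)" for z
  have h: "h z \<in> A \<and> eq (cjg (h z) x) z" if "z \<in> K x" for z
    unfolding h_def by (rule someI_ex) (use that in \<open>auto simp: Kl_def\<close>)
  show "finite (cls (K x) eq) \<and> card (cls (K x) eq) \<le> card (cls A (lco G (C x)))"
  proof (rule cls_bound[OF equA[OF KA] f, where f = "\<lambda>z. {y \<in> A. lco G (C x) (h z) y}"])
    show "z \<in> K x \<Longrightarrow> {y \<in> A. lco G (C x) (h z) y} \<in> cls A (lco G (C x))" for z using h
        by (auto simp: cls_def)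
    fix z z' assume z: "z \<in> K x" "z' \<in> K x" "{y \<in> A. lco G (C x) (h z) y} = {y \<in> A. lco G (C x) (h z') y}"
    have "lco G (C x) (h z) (h z')"
      by (rule cls_eqD[OF equ_lco'[OF C_subgroup[OF x]] subset_refl _ _ z(3)]) (use h z in auto)
    then have "eq (cjg (h z) x) (cjg (h z') x)" using h z x by (intro C_same') auto
    moreover have "z \<in> A" "z' \<in> A" using z KA by auto
    ultimately show "eq z z'" using h[OF z(1)] h[OF z(2)] x
        eq_trans[of "cjg (h z) x" "cjg (h z') x" z'] eq_sym[of "cjg (h z) x" z] eq_trans[of z "cjg (h z) x" z'] by simp
  qed
qed

lemma finite_K_iff: "x \<in> A \<Longrightarrow> finite (cls (K x) eq) \<longleftrightarrow> finite (cls A (lco G (C x)))"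
  using finite_C finite_K by blast

text \<open>The map \<open>(y, n) \<mapsto> cjg y x \<otimes> n\<close> sends
  \<open>A \<times> N\<close> onto \<open>K x\<close>, and each fibre is parametrised by
  \<open>C x\<close>.\<close>

lemma card_K:
  assumes x: "x \<in> A" and fin: "finite A"
  shows "card (K x) * card (C x) = card A * card N"
proof -
  let ?f = "\<lambda>(y, n). cjg y x \<otimes> n"
  have finN: "finite N" using fin NA by (rule rev_finite_subset)
  have img: "?f ` (A \<times> N) = K x"
  proof (intro equalityI subsetI)
    fix z assume "z \<in> ?f ` (A \<times> N)"
    then show "z \<in> K x" using x K_cj K_mult by auto
  next
    fix z assume "z \<in> K x"
    then obtain y where y: "z \<in> A" "y \<in> A" "inv (cjg y x) \<otimes> z \<in> N" by (auto simp: Kl_def lco_def)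
    have "z = cjg y x \<otimes> (inv (cjg y x) \<otimes> z)" using y x by (simp add: gsimps)
    then show "z \<in> ?f ` (A \<times> N)" using y by (intro image_eqI[of _ _ "(y, inv (cjg y x) \<otimes> z)"]) auto
  qed
  have fib: "card {p \<in> A \<times> N. ?f p = z} = card (C x)" if z: "z \<in> K x" for z
  proof -
    obtain y0 where y0: "z \<in> A" "y0 \<in> A" "eq (cjg y0 x) z" using z by (auto simp: Kl_def)
    let ?g = "\<lambda>c. (y0 \<otimes> c, inv (cjg (y0 \<otimes> c) x) \<otimes> z)"
    have Cc: "c \<in> A" if "c \<in> C x" for c using that CA by auto
    have "{p \<in> A \<times> N. ?f p = z} = ?g ` C x"
    proof (intro equalityI subsetI)
      fix p assume "p \<in> {p \<in> A \<times> N. ?f p = z}"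
      then obtain y n where p: "p = (y, n)" "y \<in> A" "n \<in> N" "cjg y x \<otimes> n = z" by auto
      have n: "n = inv (cjg y x) \<otimes> z" using p x by (simp add: inv_mult_cancel flip: p(4))
      have "eq (cjg y x) z" using n p(3) by (simp add: lco_def)
      then have "eq (cjg y0 x) (cjg y x)"
          using y0 p x eq_sym[of "cjg y x" z] eq_trans[of "cjg y0 x" z "cjg y x"] by simp
      then have "inv y0 \<otimes> y \<in> C x" using C_same[of y0 y x] y0 p x by (simp add: lco_def)
      moreover have "y = y0 \<otimes> (inv y0 \<otimes> y)" using y0 p by (simp add: gsimps)
      ultimately show "p \<in> ?g ` C x" unfolding p(1) n
          by (intro image_eqI[of _ _ "inv y0 \<otimes> y"]) (simp_all add: p(2) y0 mult_inv_cancel)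
    next
      fix p assume "p \<in> ?g ` C x"
      then obtain c where c: "c \<in> C x" "p = ?g c" by auto
      have cA: "c \<in> A" using c Cc by simp
      have "lco G (C x) y0 (y0 \<otimes> c)" using y0 c cA by (simp add: lco_def gsimps)
      then have "eq (cjg y0 x) (cjg (y0 \<otimes> c) x)" using y0 x cA by (intro C_same') auto
      then have "eq (cjg (y0 \<otimes> c) x) z" using y0 x cA eq_sym[of "cjg y0 x" "cjg (y0 \<otimes> c) x"]
        eq_trans[of "cjg (y0 \<otimes> c) x" "cjg y0 x" z] by simp
      then show "p \<in> {p \<in> A \<times> N. ?f p = z}" using c y0 x cA by (simp add: lco_def mult_inv_cancel)
    qed
    moreover have "inj_on ?g (C x)" using y0 Cc by (auto simp: inj_on_def)
    ultimately show ?thesis by (simp add: card_image)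
  qed
  have "card (A \<times> N) = (\<Sum>p\<in>A \<times> N. 1)" by simp
  also have "\<dots> = (\<Sum>z\<in>?f ` (A \<times> N). \<Sum>p\<in>{p \<in> A \<times> N. ?f p = z}. 1)"
    by (rule sum.image_gen) (use fin finN in simp)
  also have "\<dots> = (\<Sum>z\<in>K x. card (C x))" unfolding img using fib by (intro sum.cong) auto
  finally show ?thesis by (simp add: card_cartesian_product)
qed

end

declare nge.simps(2) [simp del]

lemma fof_CN:
  assumes A: "fof A" and N: "fof N" and t: "ft t"
  shows "fof (\<lambda>M s. CN M (A M s) (N M s) (t M s))"
proof -
  have "fof (\<lambda>M s. {y \<in> carrier M. y \<in> A M s \<and> inv\<^bsub>M\<^esub> (t M s) \<otimes>\<^bsub>M\<^esub> (y \<otimes>\<^bsub>M\<^esub> t M s \<otimes>\<^bsub>M\<^esub> inv\<^bsub>M\<^esub> y) \<in> N M s})"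
    by (rule fof_Collect) (intro fo_conj fo_mem[OF A] fo_mem[OF N] ft.intros ft_shift[OF t])
  moreover have "CN M (A M s) (N M s) (t M s) = {y \<in> carrier M. y \<in> A M s \<and>
      inv\<^bsub>M\<^esub> (t M s) \<otimes>\<^bsub>M\<^esub> (y \<otimes>\<^bsub>M\<^esub> t M s \<otimes>\<^bsub>M\<^esub> inv\<^bsub>M\<^esub> y) \<in> N M s}" for M s
    using fof_subset[OF A, of M s] by (auto simp: CN_def lco_def cj_def)
  ultimately show ?thesis by simp
qed

lemma fof_Kl:
  assumes A: "fof A" and N: "fof N" and t: "ft t"
  shows "fof (\<lambda>M s. Kl M (A M s) (N M s) (t M s))"
proof -
  have t2: "ft (\<lambda>M s. t M (\<lambda>i. s (Suc (Suc i))))" using ft_shift[OF t, of "\<lambda>i. Suc (Suc i)"] by simp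
  have "fof (\<lambda>M s. {z \<in> carrier M. z \<in> A M s \<and>
      (\<exists>y\<in>carrier M. y \<in> A M s \<and> inv\<^bsub>M\<^esub> (y \<otimes>\<^bsub>M\<^esub> t M s \<otimes>\<^bsub>M\<^esub> inv\<^bsub>M\<^esub> y) \<otimes>\<^bsub>M\<^esub> z \<in> N M s)})"
    by (rule fof_Collect) (intro fo_conj fo_ex fo_mem[OF A] fo_mem[OF N] ft.intros t2)
  moreover have "Kl M (A M s) (N M s) (t M s) = {z \<in> carrier M. z \<in> A M s \<and>
      (\<exists>y\<in>carrier M. y \<in> A M s \<and> inv\<^bsub>M\<^esub> (y \<otimes>\<^bsub>M\<^esub> t M s \<otimes>\<^bsub>M\<^esub> inv\<^bsub>M\<^esub> y) \<otimes>\<^bsub>M\<^esub> z \<in> N M s)}" for M s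
    using fof_subset[OF A, of M s] by (auto simp: Kl_def lco_def cj_def)
  ultimately show ?thesis by simp
qed

lemma fo_secn:
  assumes A: "fof A" and N: "fof N" shows "fo (\<lambda>M s. secn M (A M s) (N M s))"
proof (rule fo_cong)
  show "fo (\<lambda>M s. subgroup (A M s) M \<and> subgroup (N M s) M \<and> N M s \<subseteq> A M s \<and>
     (\<forall>a\<in>carrier M. \<forall>n\<in>carrier M. a \<in> A M s \<longrightarrow> n \<in> N M s \<longrightarrow> a \<otimes>\<^bsub>M\<^esub> n \<otimes>\<^bsub>M\<^esub> inv\<^bsub>M\<^esub> a \<in> N M s))"
    by (intro fo_conj fo_subgroup[OF A] fo_subgroup[OF N] fo_subset[OF N A] fo_all fo_imp fo_mem[OF A] fo_mem[OF N] ft.intros)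
  show "(subgroup (A M s) M \<and> subgroup (N M s) M \<and> N M s \<subseteq> A M s \<and>
     (\<forall>a\<in>carrier M. \<forall>n\<in>carrier M. a \<in> A M s \<longrightarrow> n \<in> N M s \<longrightarrow> a \<otimes>\<^bsub>M\<^esub> n \<otimes>\<^bsub>M\<^esub> inv\<^bsub>M\<^esub> a \<in> N M s)) =
         secn M (A M s) (N M s)" for M s
    using fof_subset[OF A, of M s] fof_subset[OF N, of M s] unfolding secn_def cj_def by blast
qed

text \<open>The preimage of the elements of \<open>A/N\<close> with fewer than \<open>D\<close> conjugates.\<close>

definition Zd :: "nat \<Rightarrow> ('a, 'b) monoid_scheme \<Rightarrow> 'a set \<Rightarrow> 'a set \<Rightarrow> 'a set" where
  "Zd D M A N = {x \<in> A. \<not> nge D (Kl M A N x) (lco M N)}"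

lemma fof_Zd:
  assumes A: "fof A" and N: "fof N" shows "fof (\<lambda>M s. Zd D M (A M s) (N M s))"
proof -
  have "fo (\<lambda>M s. \<not> nge D (Kl M (A M (\<lambda>i. s (Suc i))) (N M (\<lambda>i. s (Suc i))) (s 0)) (lco M (N M (\<lambda>i. s (Suc i)))))"
    by (intro fo_neg fo_index fof_Kl fof_shift[OF A] fof_shift[OF N] ft_var)
  then have "fof (\<lambda>M s. {x \<in> carrier M. x \<in> A M s \<and> \<not> nge D (Kl M (A M s) (N M s) x) (lco M (N M s))})"
    by (intro fof_Collect fo_conj fo_mem[OF A] ft_var)
  moreover have "Zd D M (A M s) (N M s) = {x \<in> carrier M. x \<in> A M s \<and>
      \<not> nge D (Kl M (A M s) (N M s) x) (lco M (N M s))}" for M s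
    using fof_subset[OF A, of M s] by (auto simp: Zd_def)
  ultimately show ?thesis by simp
qed

section \<open>The class equation of a section\<close>

context section_group begin

lemma Zd_K: "x \<in> Zd D G A N \<Longrightarrow> z \<in> K x \<Longrightarrow> z \<in> Zd D G A N"
  using K_eq[of x z] KA[of x] by (auto simp: Zd_def)

text \<open>The origin of the condition \<open>D \<ge> 2\<close> in later statements: the class of
  the identity is the single coset \<open>N\<close>, and \<open>Zd\<close> asks for strictly fewer
  than \<open>D\<close>.\<close>

lemma one_Zd: "D \<ge> 2 \<Longrightarrow> \<one> \<in> Zd D G A N"
proof -
  assume D: "D \<ge> 2"
  have sub: "cls (K \<one>) eq \<subseteq> {K \<one>}"
  proof
    fix c assume "c \<in> cls (K \<one>) eq"
    then obtain x where x: "x \<in> K \<one>" "c = {z \<in> K \<one>. eq x z}" by (auto simp: cls_def)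
    have *: "z \<in> K \<one> \<longleftrightarrow> z \<in> N" for z by (auto simp: Kl_def lco_def cj_def intro: A1)
    have "eq x z" if "z \<in> K \<one>" for z using that x * by (simp add: lco_def)
    then show "c \<in> {K \<one>}" using x by auto
  qed
  have "finite (cls (K \<one>) eq)" "card (cls (K \<one>) eq) \<le> 1"
    using finite_subset[OF sub] card_mono[OF _ sub] by simp_all
  then show ?thesis using D by (simp add: Zd_def not_nge[OF equA[OF KA]])
qed

text \<open>The class equation divided by \<open>card A\<close>, since a class then contributes the
  reciprocal of the order of a centraliser in the section. This separates the numbers that are fixed
  by \<open>G\<close> from the order of the section.\<close>

lemma class_equation:
  fixes r :: nat
  assumes fin: "finite A" and u: "\<And>i. i < r \<Longrightarrow> u i \<in> A - Zd D G A N"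
    and disj: "\<And>i j. i < r \<Longrightarrow> j < r \<Longrightarrow> i \<noteq> j \<Longrightarrow> u i \<notin> K (u j)"
    and cov: "\<And>x. x \<in> A \<Longrightarrow> x \<in> Zd D G A N \<or> (\<exists>i<r. x \<in> K (u i))"
  shows "1 = real (card (cls (Zd D G A N) eq)) / real (card (cls A eq)) +
    (\<Sum>i<r. 1 / real (card (cls (C (u i)) eq)))"
proof -
  let ?Z = "Zd D G A N"
  have ZA: "?Z \<subseteq> A" by (auto simp: Zd_def)
  have finN: "finite N" using fin NA by (rule rev_finite_subset)
  have N0: "card N > 0" using finN N1 by (metis card_gt_0_iff empty_iff)
  have A0: "card A > 0" using fin A1 by (metis card_gt_0_iff empty_iff)
  have cA: "card A = card (cls A eq) * card N" by (rule card_lco[OF N fin]) auto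
  have cZ: "card ?Z = card (cls ?Z eq) * card N"
  proof (rule card_lco[OF N])
    show "finite ?Z" using fin ZA by (rule rev_finite_subset)
    show "?Z \<subseteq> carrier G" using ZA by auto
    show "x \<otimes> h \<in> ?Z" if "x \<in> ?Z" "h \<in> N" for x h
      using Zd_K[OF that(1) K_mult[OF _ K_refl that(2)]] that(1) ZA by auto
  qed
  have cK: "real (card (K (u i))) = real (card A) * (1 / real (card (cls (C (u i)) eq)))" if i: "i < r"
      for i
  proof -
    have ui: "u i \<in> A" using u[OF i] by simp
    have finC: "finite (C (u i))" using fin CA by (rule rev_finite_subset)
    have "card (C (u i)) = card (cls (C (u i)) eq) * card N"
    proof (rule card_lco[OF N finC])
      show "C (u i) \<subseteq> carrier G" using CA Ac by blast
      show "x \<otimes> h \<in> C (u i)" if "x \<in> C (u i)" "h \<in> N" for x h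
        using subgroup.m_closed[OF C_subgroup[OF ui] that(1)] N_C[OF ui] that(2) by blast
    qed
    moreover have "card (C (u i)) > 0"
      using finC subgroup.one_closed[OF C_subgroup[OF ui]] by (auto simp: card_gt_0_iff)
    moreover have "card (K (u i)) * card (C (u i)) = card A * card N" by (rule card_K[OF ui fin])
    ultimately have "card (K (u i)) * card (cls (C (u i)) eq) = card A" "card (cls (C (u i)) eq) > 0"
      using N0 by (simp_all add: mult.assoc[symmetric])
    then have "real (card (K (u i))) * real (card (cls (C (u i)) eq)) = real (card A)"
      by (metis of_nat_mult)
    then show ?thesis using \<open>card (cls (C (u i)) eq) > 0\<close> by (simp add: field_simps)
  qed
  have "A = ?Z \<union> (\<Union>i<r. K (u i))" using cov ZA KA by blast
  moreover have "card (?Z \<union> (\<Union>i<r. K (u i))) = card ?Z + card (\<Union>i<r. K (u i))"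
  proof (rule card_Un_disjoint)
    show "finite ?Z" using fin ZA by (rule rev_finite_subset)
    show "finite (\<Union>i<r. K (u i))" using fin KA by (metis (no_types, lifting) UN_least rev_finite_subset)
    have "x \<notin> ?Z" if "i < r" "x \<in> K (u i)" for x i
      using Zd_K[of x D "u i"] K_sym[OF _ that(2)] u[OF that(1)] by blast
    then show "?Z \<inter> (\<Union>i<r. K (u i)) = {}" by blast
  qed
  moreover have "card (\<Union>i<r. K (u i)) = (\<Sum>i<r. card (K (u i)))"
  proof (rule card_UN_disjoint)
    show "\<forall>i\<in>{..<r}. finite (K (u i))" using fin KA rev_finite_subset by blast
    show "\<forall>i\<in>{..<r}. \<forall>j\<in>{..<r}. i \<noteq> j \<longrightarrow> K (u i) \<inter> K (u j) = {}"
    proof (intro ballI impI, rule ccontr)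
      fix i j assume ij: "i \<in> {..<r}" "j \<in> {..<r}" "i \<noteq> j" "K (u i) \<inter> K (u j) \<noteq> {}"
      then obtain z where z: "z \<in> K (u i)" "z \<in> K (u j)" by blast
      have "K z = K (u i)" "K z = K (u j)" using K_eq z u ij by auto
      then have "u i \<in> K (u j)" using K_refl[of "u i"] u ij by auto
      then show False using disj ij by auto
    qed
  qed simp
  ultimately have "real (card A) = real (card ?Z) + (\<Sum>i<r. real (card (K (u i))))"
    by (metis of_nat_add of_nat_sum)
  also have "(\<Sum>i<r. real (card (K (u i)))) = real (card A) * (\<Sum>i<r. 1 / real (card (cls (C (u i)) eq)))"
    unfolding sum_distrib_left using cK by (intro sum.cong) auto
  finally have "1 = real (card ?Z) / real (card A) + (\<Sum>i<r. 1 / real (card (cls (C (u i)) eq)))"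
    using A0 by (simp add: field_simps)
  also have "real (card ?Z) / real (card A) = real (card (cls ?Z eq)) / real (card (cls A eq))"
    unfolding cA cZ using N0 by simp
  finally show ?thesis .
qed

end

lemma cls_card_iff: "equ X E \<Longrightarrow> finite (cls X E) \<Longrightarrow> card (cls X E) = n \<longleftrightarrow> nge n X E \<and> \<not> nge (Suc n) X E"
  using nge_iff[of X E n] nge_iff[of X E "Suc n"] by linarith

context dim_theory begin

text \<open>All numbers in the class equation other than the order of \<open>A/N\<close> are finite
  in \<open>G\<close> and thus the same in almost all approximating groups. Hence the constant
  \<open>q\<close> equals \<open>z / a\<close> for arbitrarily large orders
  \<open>a\<close>.\<close>

lemma section_class_equation:
  fixes r :: nat
  assumes pf: "pseudofinite G" and b: "env G b" and A: "fof A" and N: "fof N"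
    and sec: "secn G (A G b) (N G b)"
    and D: "D \<ge> 2"
    and finZ: "finite (cls (Zd D G (A G b) (N G b)) (lco G (N G b)))"
    and u: "\<And>i. i < r \<Longrightarrow> u i \<in> A G b - Zd D G (A G b) (N G b)"
    and finC: "\<And>i. i < r \<Longrightarrow> finite (cls (CN G (A G b) (N G b) (u i)) (lco G (N G b)))"
    and disj: "\<And>i j. i < r \<Longrightarrow> j < r \<Longrightarrow> i \<noteq> j \<Longrightarrow> u i \<notin> Kl G (A G b) (N G b) (u j)"
    and cov: "\<And>x. x \<in> A G b \<Longrightarrow> x \<in> Zd D G (A G b) (N G b) \<or> (\<exists>i<r. x \<in> Kl G (A G b) (N G b) (u i))"
    and infA: "infinite (cls (A G b) (lco G (N G b)))"
  shows False
proof -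
  interpret S: section_group G "A G b" "N G b" using grp sec
      by (simp add: section_group_def section_group_axioms_def)
  \<comment> \<open>One environment carries the representatives and the parameters, so that a single
    sequence of finite groups satisfies all conditions.\<close>
  define t where "t i = (if i < r then u i else b (i - r))" for i
  have t: "env G t" using u b S.Ac by (auto simp: t_def env_def)
  have tb: "(\<lambda>i. t (r + i)) = b" and tu: "i < r \<Longrightarrow> t i = u i" for i by (auto simp: t_def)
  define A' where "A' = (\<lambda>(M::'a monoid) s. A M (\<lambda>i. s (r + i)))"
  define N' where "N' = (\<lambda>(M::'a monoid) s. N M (\<lambda>i. s (r + i)))"
  have A': "fof A'" and N': "fof N'" unfolding A'_def N'_def by (rule fof_shift[OF A], rule fof_shift[OF N])
  have Gt: "A' G t = A G b" "N' G t = N G b" by (simp_all add: A'_def N'_def tb)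
  obtain H :: "nat \<Rightarrow> 'a monoid" and s where Hs: "(\<forall>k. group (H k) \<and> finite (carrier (H k)) \<and>
      env (H k) (s k)) \<and>
    (\<forall>P. fo P \<longrightarrow> P G t \<longrightarrow> eventually (\<lambda>k. P (H k) (s k)) sequentially)"
    using finite_approximation[OF pf t] by (elim exE)
  then have H: "group (H k)" "finite (carrier (H k))" "env (H k) (s k)" for k by simp_all
  note ev = conjunct2[OF Hs, rule_format]
  define Z where "Z = (\<lambda>(M::'a monoid) s. Zd D M (A' M s) (N' M s))"
  have Z: "fof Z" unfolding Z_def by (rule fof_Zd[OF A' N'])
  have C: "fof (\<lambda>M s. CN M (A' M s) (N' M s) (s i))" for i by (rule fof_CN[OF A' N' ft_var])
  have K: "fof (\<lambda>M s. Kl M (A' M s) (N' M s) (s i))" for i by (rule fof_Kl[OF A' N' ft_var])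
  define z where "z = card (cls (Z G t) (lco G (N' G t)))"
  define c where "c i = card (cls (CN G (A' G t) (N' G t) (t i)) (lco G (N' G t)))" for i
  define q where "q = 1 - (\<Sum>i<r. 1 / real (c i))"
  have zpos: "z > 0"
  proof -
    have "\<one>\<^bsub>G\<^esub> \<in> Z G t" using S.one_Zd[OF D] by (simp add: Z_def Gt)
    then have "cls (Z G t) (lco G (N' G t)) \<noteq> {}" by (auto simp: cls_def)
    then show ?thesis using finZ by (simp add: z_def card_gt_0_iff Z_def Gt)
  qed
  have eqZ: "equ (Z G t) (lco G (N' G t))" unfolding Gt Z_def by (rule S.equA) (auto simp: Zd_def)
  have eqC: "equ (CN G (A' G t) (N' G t) x) (lco G (N' G t))" for x unfolding Gt by (rule S.equA[OF S.CA])
  have e1: "eventually (\<lambda>k. secn (H k) (A' (H k) (s k)) (N' (H k) (s k))) sequentially"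
    by (rule ev[OF fo_secn[OF A' N']]) (simp add: Gt sec)
  have e2: "eventually (\<lambda>k. nge z (Z (H k) (s k)) (lco (H k) (N' (H k) (s k))) \<and>
      \<not> nge (Suc z) (Z (H k) (s k)) (lco (H k) (N' (H k) (s k)))) sequentially"
  proof (rule ev)
    show "fo (\<lambda>M s. nge z (Z M s) (lco M (N' M s)) \<and> \<not> nge (Suc z) (Z M s) (lco M (N' M s)))"
      by (intro fo_conj fo_neg fo_index Z N')
    show "nge z (Z G t) (lco G (N' G t)) \<and> \<not> nge (Suc z) (Z G t) (lco G (N' G t))"
      by (rule iffD1[OF cls_card_iff[OF eqZ]]) (use finZ in \<open>simp_all add: z_def Z_def Gt\<close>)
  qed
  have e3: "eventually (\<lambda>k. \<forall>i<r. nge (c i) (CN (H k) (A' (H k) (s k)) (N' (H k) (s k)) (s k i)) (lco (H k) (N' (H k) (s k))) \<and>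
      \<not> nge (Suc (c i)) (CN (H k) (A' (H k) (s k)) (N' (H k) (s k)) (s k i)) (lco (H k) (N' (H k) (s k)))) sequentially"
  proof (rule ev)
    show "fo (\<lambda>M s. \<forall>i<r. nge (c i) (CN M (A' M s) (N' M s) (s i)) (lco M (N' M s)) \<and>
      \<not> nge (Suc (c i)) (CN M (A' M s) (N' M s) (s i)) (lco M (N' M s)))"
      by (intro fo_all_less fo_conj fo_neg fo_index C N')
    show "\<forall>i<r. nge (c i) (CN G (A' G t) (N' G t) (t i)) (lco G (N' G t)) \<and>
      \<not> nge (Suc (c i)) (CN G (A' G t) (N' G t) (t i)) (lco G (N' G t))"
    proof (intro allI impI)
      fix i assume i: "i < r"
      have f: "finite (cls (CN G (A' G t) (N' G t) (t i)) (lco G (N' G t)))" using finC[OF i]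
          by (simp add: Gt tu i)
      show "nge (c i) (CN G (A' G t) (N' G t) (t i)) (lco G (N' G t)) \<and>
        \<not> nge (Suc (c i)) (CN G (A' G t) (N' G t) (t i)) (lco G (N' G t))"
        by (rule iffD1[OF cls_card_iff[OF eqC f]]) (simp add: c_def)
    qed
  qed
  have e4: "eventually (\<lambda>k. \<forall>i<r. s k i \<in> A' (H k) (s k) \<and> s k i \<notin> Z (H k) (s k)) sequentially"
    by (rule ev[of "\<lambda>M s. \<forall>i<r. s i \<in> A' M s \<and> s i \<notin> Z M s"])
      (intro fo_all_less fo_conj fo_neg fo_mem[OF A'] fo_mem[OF Z] ft_var, use u in \<open>simp add: Gt Z_def tu\<close>)
  have e5: "eventually (\<lambda>k. \<forall>i<r. \<forall>j<r. i \<noteq> j \<longrightarrow>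
      s k i \<notin> Kl (H k) (A' (H k) (s k)) (N' (H k) (s k)) (s k j)) sequentially"
    by (rule ev[of "\<lambda>M s. \<forall>i<r. \<forall>j<r. i \<noteq> j \<longrightarrow> s i \<notin> Kl M (A' M s) (N' M s) (s j)"])
      (intro fo_all_less fo_imp fo_const fo_neg fo_mem[OF K] ft_var, use disj in \<open>simp add: Gt tu\<close>)
  have e6: "eventually (\<lambda>k. \<forall>x\<in>carrier (H k). x \<in> A' (H k) (s k) \<longrightarrow> x \<in> Z (H k) (s k) \<or>
      (\<exists>i<r. x \<in> Kl (H k) (A' (H k) (s k)) (N' (H k) (s k)) (s k i))) sequentially"
    by (rule ev[of "\<lambda>M s. \<forall>x\<in>carrier M. x \<in> A' M s \<longrightarrow> x \<in> Z M s \<or> (\<exists>i<r. x \<in> Kl M (A' M s) (N' M s) (s i))"])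
      (intro fo_all fo_imp fo_disj fo_ex_less fo_mem[OF A'] fo_mem[OF Z] fo_mem[OF K] ft_var, use cov tu in \<open>simp add: Gt Z_def, metis\<close>)
  have e7: "eventually (\<lambda>k. nge n (A' (H k) (s k)) (lco (H k) (N' (H k) (s k)))) sequentially" for n
    by (rule ev[OF fo_index[OF A' N']]) (use nge_all[OF S.equA[OF subset_refl]] infA in \<open>simp add: Gt\<close>)
  have main: "\<exists>a>n. q = real z / real a" for n :: nat
  proof -
    have "eventually (\<lambda>k. secn (H k) (A' (H k) (s k)) (N' (H k) (s k)) \<and>
      (nge z (Z (H k) (s k)) (lco (H k) (N' (H k) (s k))) \<and>
          \<not> nge (Suc z) (Z (H k) (s k)) (lco (H k) (N' (H k) (s k)))) \<and>
      (\<forall>i<r. nge (c i) (CN (H k) (A' (H k) (s k)) (N' (H k) (s k)) (s k i)) (lco (H k) (N' (H k) (s k))) \<and>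
      \<not> nge (Suc (c i)) (CN (H k) (A' (H k) (s k)) (N' (H k) (s k)) (s k i)) (lco (H k) (N' (H k) (s k)))) \<and>
      (\<forall>i<r. s k i \<in> A' (H k) (s k) \<and> s k i \<notin> Z (H k) (s k)) \<and>
      (\<forall>i<r. \<forall>j<r. i \<noteq> j \<longrightarrow> s k i \<notin> Kl (H k) (A' (H k) (s k)) (N' (H k) (s k)) (s k j)) \<and>
      (\<forall>x\<in>carrier (H k). x \<in> A' (H k) (s k) \<longrightarrow> x \<in> Z (H k) (s k) \<or>
      (\<exists>i<r. x \<in> Kl (H k) (A' (H k) (s k)) (N' (H k) (s k)) (s k i))) \<and>
      nge (Suc n) (A' (H k) (s k)) (lco (H k) (N' (H k) (s k)))) sequentially"
      by (intro eventually_conj e1 e2 e3 e4 e5 e6 e7)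
    note happens = eventually_happens'[OF sequentially_bot this]
    obtain k where k: "secn (H k) (A' (H k) (s k)) (N' (H k) (s k))"
      "nge z (Z (H k) (s k)) (lco (H k) (N' (H k) (s k))) \<and>
          \<not> nge (Suc z) (Z (H k) (s k)) (lco (H k) (N' (H k) (s k)))"
      "\<forall>i<r. nge (c i) (CN (H k) (A' (H k) (s k)) (N' (H k) (s k)) (s k i)) (lco (H k) (N' (H k) (s k))) \<and>
      \<not> nge (Suc (c i)) (CN (H k) (A' (H k) (s k)) (N' (H k) (s k)) (s k i)) (lco (H k) (N' (H k) (s k)))"
      "\<forall>i<r. s k i \<in> A' (H k) (s k) \<and> s k i \<notin> Z (H k) (s k)"
      "\<forall>i<r. \<forall>j<r. i \<noteq> j \<longrightarrow> s k i \<notin> Kl (H k) (A' (H k) (s k)) (N' (H k) (s k)) (s k j)"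
      "\<forall>x\<in>carrier (H k). x \<in> A' (H k) (s k) \<longrightarrow> x \<in> Z (H k) (s k) \<or>
      (\<exists>i<r. x \<in> Kl (H k) (A' (H k) (s k)) (N' (H k) (s k)) (s k i))"
      "nge (Suc n) (A' (H k) (s k)) (lco (H k) (N' (H k) (s k)))"
      using happens by (elim exE conjE) (rule that; (rule conjI)?; assumption)
    interpret T: section_group "H k" "A' (H k) (s k)" "N' (H k) (s k)"
      using H(1) k(1) by (simp add: section_group_def section_group_axioms_def)
    have fin: "finite (A' (H k) (s k))" using fof_subset[OF A'] H(2) by (rule finite_subset)
    have finc: "X \<subseteq> A' (H k) (s k) \<Longrightarrow> finite (cls X E)" for X E
      using fin by (auto simp: cls_def intro: finite_subset)
    have ZA: "Z (H k) (s k) \<subseteq> A' (H k) (s k)" by (auto simp: Z_def Zd_def)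
    have "card (cls (Z (H k) (s k)) T.eq) = z"
      using cls_card_iff[OF T.equA[OF ZA] finc[OF ZA]] k(2) by simp
    moreover have "card (cls (T.C (s k i)) T.eq) = c i" if "i < r" for i
      using cls_card_iff[OF T.equA[OF T.CA] finc[OF T.CA]] k(3)[rule_format, OF that] by simp
    moreover have "card (cls (A' (H k) (s k)) T.eq) > n"
      using k(7) nge_iff[OF T.equA[OF subset_refl], of "Suc n"] finc[OF subset_refl] by simp
    moreover have "1 = real (card (cls (Z (H k) (s k)) T.eq)) / real (card (cls (A' (H k) (s k)) T.eq)) +
       (\<Sum>i<r. 1 / real (card (cls (T.C (s k i)) T.eq)))"
      unfolding Z_def
    proof (rule T.class_equation[OF fin])
      show "i < r \<Longrightarrow> s k i \<in> A' (H k) (s k) - Zd D (H k) (A' (H k) (s k)) (N' (H k) (s k))" for i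
        using k(4) by (simp add: Z_def)
      show "i < r \<Longrightarrow> j < r \<Longrightarrow> i \<noteq> j \<Longrightarrow> s k i \<notin> T.K (s k j)" for i j using k(5) by simp
      show "x \<in> A' (H k) (s k) \<Longrightarrow> x \<in> Zd D (H k) (A' (H k) (s k)) (N' (H k) (s k)) \<or>
          (\<exists>i<r. x \<in> T.K (s k i))" for x
        using k(6) T.Ac[of x] by (simp add: Z_def)
    qed
    ultimately have "q = real z / real (card (cls (A' (H k) (s k)) T.eq))" by (simp add: q_def)
    then show ?thesis using \<open>card (cls (A' (H k) (s k)) T.eq) > n\<close> by blast
  qed
  \<comment> \<open>Positivity comes from the identity element, which makes \<open>z\<close>
    nonzero; it is incompatible with \<open>q\<close> being \<open>z / a\<close> for arbitrarily
    large \<open>a\<close>.\<close>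
  have "q > 0" using main[of 0] zpos by auto
  obtain n :: nat where n: "real n > real z / q" using reals_Archimedean2 by blast
  obtain a where a: "a > n" "q = real z / real a" using main by blast
  have "real a > real z / q" using a(1) n by linarith
  then have "q * real a > real z" using \<open>q > 0\<close> by (simp add: field_simps)
  moreover have "q * real a = real z" using a by simp
  ultimately show False by simp
qed

end

lemma fof_Diff:
  assumes "fof F" "fof H" shows "fof (\<lambda>M s. F M s - H M s)"
proof -
  have "fof (\<lambda>M s. {x \<in> carrier M. x \<in> F M s \<and> x \<notin> H M s})"
    by (intro fof_Collect fo_conj fo_neg fo_mem[OF assms(1)] fo_mem[OF assms(2)] ft_var)
  moreover have "F M s - H M s = {x \<in> carrier M. x \<in> F M s \<and> x \<notin> H M s}" for M s
    using fof_subset[OF assms(1), of M s] by auto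
  ultimately show ?thesis by simp
qed

lemma finite_representatives:
  assumes E: "equ X E" and fin: "finite (cls X E)"
  obtains r :: nat and u where "\<And>i. i < r \<Longrightarrow> u i \<in> X" "\<And>i j. i < r \<Longrightarrow> j < r \<Longrightarrow> i \<noteq> j \<Longrightarrow> \<not> E (u i) (u j)"
    "\<And>x. x \<in> X \<Longrightarrow> \<exists>i<r. E (u i) x"
proof -
  define r where "r = card (cls X E)"
  obtain f where f: "bij_betw f {..<r} (cls X E)"
    using ex_bij_betw_nat_finite[OF fin] by (auto simp: r_def atLeast0LessThan)
  have "\<exists>x\<in>X. f i = {y \<in> X. E x y}" if "i < r" for i
    using bij_betwE[OF f] that by (auto simp: cls_def)
  then obtain u where u: "\<And>i. i < r \<Longrightarrow> u i \<in> X \<and> f i = {y \<in> X. E (u i) y}" by metis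
  have "\<not> E (u i) (u j)" if "i < r" "j < r" "i \<noteq> j" for i j
  proof
    assume e: "E (u i) (u j)"
    have "E (u i) y \<longleftrightarrow> E (u j) y" if "y \<in> X" for y
      using E e u[OF \<open>i < r\<close>] u[OF \<open>j < r\<close>] that unfolding equ_def by meson
    then have "f i = f j" using u[OF that(1)] u[OF that(2)] by auto
    then show False using f that by (auto simp: bij_betw_def inj_on_def)
  qed
  moreover have "\<exists>i<r. E (u i) x" if x: "x \<in> X" for x
  proof -
    have "{y \<in> X. E x y} \<in> f ` {..<r}" using f x by (auto simp: bij_betw_def cls_def)
    then obtain i where i: "i < r" "f i = {y \<in> X. E x y}" by auto
    have "x \<in> {y \<in> X. E x y}" using E x by (auto simp: equ_def)
    then have "E (u i) x" using i u[OF i(1)] by auto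
    then show ?thesis using i(1) by blast
  qed
  ultimately show ?thesis using that[of r u] u by blast
qed

section \<open>Elements with few conjugates in sections of dimension one\<close>

context dim_theory begin

lemma fof_dge_mono: "model M \<Longrightarrow> env M s \<Longrightarrow> env M t \<Longrightarrow> fof F \<Longrightarrow> fof H \<Longrightarrow> F M s \<subseteq> H M t \<Longrightarrow> dge M (F M s) d \<Longrightarrow>
    dge M (H M t) d"
  by (rule dge_mono[of M "F M s" "H M t"]) (simp_all add: fof_mdef)

lemma fof_dge_transfer:
  assumes "model M" "env M s" "model M'" "env M' s'" "\<And>Q. fo Q \<Longrightarrow> Q M s \<longleftrightarrow> Q M' s'" "fof F"
  shows "dge M (F M s) d \<longleftrightarrow> dge M' (F M' s') d"
proof -
  have "F M s = {x \<in> carrier M. (x ## s) 0 \<in> F M (\<lambda>i. (x ## s) (Suc i))}" for M s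
    using fof_subset[OF assms(6), of M s] by auto
  moreover have "fo (\<lambda>M s. s 0 \<in> F M (\<lambda>i. s (Suc i)))" using assms(6) by (simp add: fof_def)
  note dge_transfer[OF assms(1-5) this, of d]
  ultimately show ?thesis by metis
qed

lemma fof_dge_cosets:
  assumes "model M" "env M s" "fof F" "fof H" "subgroup (H M s) M"
    "\<And>x h. x \<in> F M s \<Longrightarrow> h \<in> H M s \<Longrightarrow> x \<otimes>\<^bsub>M\<^esub> h \<in> F M s"
    "dge M (H M s) d" "infinite (cls (F M s) (lco M (H M s)))"
  shows "dge M (F M s) (Suc d)"
proof (rule dge_cosets[where P = "\<lambda>M s. s 0 \<in> F M (\<lambda>i. s (Suc i))" and Q = "\<lambda>M s. s 0 \<in> H M (\<lambda>i. s (Suc i))"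
      and X = "F M s" and H = "H M s" and b = s, OF assms(1,2) _ _ _ _ assms(5)])
  show "F M s = {x \<in> carrier M. (x ## s) 0 \<in> F M (\<lambda>i. (x ## s) (Suc i))}"
    "H M s = {x \<in> carrier M. (x ## s) 0 \<in> H M (\<lambda>i. (x ## s) (Suc i))}"
    using fof_subset[OF assms(3), of M s] fof_subset[OF assms(4), of M s] by auto
  show "fo (\<lambda>M s. s 0 \<in> F M (\<lambda>i. s (Suc i)))" "fo (\<lambda>M s. s 0 \<in> H M (\<lambda>i. s (Suc i)))"
    using assms(3,4) by (simp_all add: fof_def)
  show "infinite (cls (F M s) (\<lambda>x y. inv\<^bsub>M\<^esub> x \<otimes>\<^bsub>M\<^esub> y \<in> H M s))" using assms(8)
      by (simp add: lco_def[abs_def])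
qed (fact assms(6,7))+

lemma fof_dge_quotient:
  assumes "model M" "env M s" "fof F" "fo (\<lambda>M s. E M (\<lambda>i. s (Suc (Suc i))) (s 0) (s (Suc 0)))"
    "equ (F M s) (E M s)" "\<And>x. x \<in> F M s \<Longrightarrow> dge M {y \<in> F M s. E M s x y} d"
    "infinite (cls (F M s) (E M s))"
  shows "dge M (F M s) (Suc d)"
proof (rule dge_quotient[where P = "\<lambda>M s. s 0 \<in> F M (\<lambda>i. s (Suc i))" and Q =
    "\<lambda>M s. E M (\<lambda>i. s (Suc (Suc i))) (s 0) (s (Suc 0))"
      and X = "F M s" and b = s and E = "E M s", OF assms(1,2) _ _ assms(4)])
  show "F M s = {x \<in> carrier M. (x ## s) 0 \<in> F M (\<lambda>i. (x ## s) (Suc i))}"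
    using fof_subset[OF assms(3), of M s] by auto
  show "fo (\<lambda>M s. s 0 \<in> F M (\<lambda>i. s (Suc i)))" using assms(3) by (simp add: fof_def)
  show "infinite ((\<lambda>x. {y \<in> F M s. E M s x y}) ` F M s)" using assms(7) by (simp add: cls_def)
  show "\<And>x. x \<in> F M s \<Longrightarrow> E M s x x" "\<And>x y. x \<in> F M s \<Longrightarrow> y \<in> F M s \<Longrightarrow> E M s x y \<Longrightarrow> E M s y x"
    "\<And>x y z. x \<in> F M s \<Longrightarrow> y \<in> F M s \<Longrightarrow> z \<in> F M s \<Longrightarrow> E M s x y \<Longrightarrow> E M s y z \<Longrightarrow> E M s x z"
    using assms(5) unfolding equ_def by meson+
qed (use assms(6) in simp_all)

text \<open>Otherwise some elementary extension contains an element whose class and whose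
  centraliser are both infinite modulo \<open>N\<close>. The chain from \<open>N\<close> through the
  centraliser to \<open>A\<close> then has two infinite indices and raises the dimension from
  \<open>d\<close> to \<open>d + 2\<close>.\<close>

lemma section_bound:
  assumes b: "env G b" and A: "fof A" and N: "fof N" and sec: "secn G (A G b) (N G b)"
    and d: "dge G (N G b) d" and nd: "\<not> dge G (A G b) (Suc (Suc d))"
  shows "\<exists>D. \<forall>x\<in>A G b. \<not> nge D (Kl G (A G b) (N G b) x) (lco G (N G b)) \<or>
     \<not> nge D (CN G (A G b) (N G b) x) (lco G (N G b))"
proof (rule ccontr)
  assume "\<not> ?thesis"
  then have "\<forall>D. \<exists>x\<in>A G b. nge D (Kl G (A G b) (N G b) x) (lco G (N G b)) \<and>
     nge D (CN G (A G b) (N G b) x) (lco G (N G b))" by blast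
  then obtain x where x: "\<And>D. x D \<in> A G b" "\<And>D. nge D (Kl G (A G b) (N G b) (x D)) (lco G (N G b))"
     "\<And>D. nge D (CN G (A G b) (N G b) (x D)) (lco G (N G b))" by metis
  have ex: "env G (x k ## b)" for k using b x(1) fof_subset[OF A, of G b] by auto
  obtain M s where M: "model M" "env M s"
    and ev: "\<And>P. fo P \<Longrightarrow> eventually (\<lambda>k. P G (x k ## b)) sequentially \<Longrightarrow> P M s"
    by (rule elementary_extension_G[of "\<lambda>k. x k ## b", OF ex]) (rule that)
  define b' where "b' = (\<lambda>i. s (Suc i))"
  have b': "env M b'" using M(2) by (simp add: b'_def)
  have tr: "Q G b \<longleftrightarrow> Q M b'" if Q: "fo Q" for Q
  proof -
    have f: "fo (\<lambda>M s. Q M (\<lambda>i. s (Suc i)))" by (rule fo_shift[OF Q])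
    from ev[OF f] ev[OF fo_neg[OF f]] show ?thesis by (cases "Q G b") (simp_all add: b'_def)
  qed
  have sec': "secn M (A M b') (N M b')" using tr[OF fo_secn[OF A N]] sec by simp
  interpret S: section_group M "A M b'" "N M b'"
    using model_group[OF M(1)] sec' by (simp add: section_group_def section_group_axioms_def)
  define A' where "A' = (\<lambda>(M::'a monoid) s. A M (\<lambda>i. s (Suc i)))"
  define N' where "N' = (\<lambda>(M::'a monoid) s. N M (\<lambda>i. s (Suc i)))"
  have A': "fof A'" and N': "fof N'" unfolding A'_def N'_def by (rule fof_shift[OF A], rule fof_shift[OF N])
  have Ms: "A' M s = A M b'" "N' M s = N M b'" "A' G (y ## b) = A G b" "N' G (y ## b) = N G b" for y
    by (simp_all add: A'_def N'_def b'_def)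
  have "fo (\<lambda>M s. s 0 \<in> A' M s)" by (rule fo_mem[OF A' ft_var ft_var])
  from ev[OF this] have s0: "s 0 \<in> A M b'" using x(1) by (simp add: Ms)
  have K: "fof (\<lambda>M s. Kl M (A' M s) (N' M s) (s 0))" by (rule fof_Kl[OF A' N' ft_var])
  have C: "fof (\<lambda>M s. CN M (A' M s) (N' M s) (s 0))" by (rule fof_CN[OF A' N' ft_var])
  have "nge n (S.K (s 0)) S.eq" for n
    using ev[OF fo_index[OF K N'], of n] nge_mono[OF x(2), of n]
        by (simp add: Ms eventually_sequentially) blast
  then have infK: "infinite (cls (S.K (s 0)) S.eq)" using nge_all[OF S.equA[OF S.KA]] by blast
  have "nge n (S.C (s 0)) S.eq" for n
    using ev[OF fo_index[OF C N'], of n] nge_mono[OF x(3), of n]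
        by (simp add: Ms eventually_sequentially) blast
  then have infC: "infinite (cls (S.C (s 0)) S.eq)" using nge_all[OF S.equA[OF S.CA]] by blast
  have "dge M (N M b') d" using fof_dge_transfer[OF model_G b M(1) b' tr N] d by simp
  then have "dge M (S.C (s 0)) (Suc d)"
    using fof_dge_cosets[OF M C N', of d] S.N infC S.N_C[OF s0] subgroup.m_closed[OF S.C_subgroup[OF s0]]
    by (simp add: Ms subset_iff)
  then have "dge M (A M b') (Suc (Suc d))"
    using fof_dge_cosets[OF M A' C, of "Suc d"] S.C_subgroup[OF s0] infK[unfolded S.finite_K_iff[OF s0]] S.CA
    by (simp add: Ms subset_iff)
  then show False using fof_dge_transfer[OF model_G b M(1) b' tr A] nd by simp
qed

text \<open>The hypotheses make \<open>A/N\<close> behave like a section of dimension one. By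
  \<open>section_bound\<close>, having finitely many conjugates modulo \<open>N\<close> is the same
  as having fewer than \<open>D\<close>, so these elements form a definable subgroup
  \<open>Z\<close>. Were \<open>Z/N\<close> finite, every element outside \<open>Z\<close> would
  have a finite centraliser in the section and a class of dimension at least \<open>d + 1\<close>;
  there would be finitely many such classes, against \<open>section_class_equation\<close>. So
  \<open>Z/N\<close> is infinite, and an infinite index of \<open>Z\<close> in \<open>A\<close>
  would raise the dimension a second time.\<close>

lemma section_centre:
  assumes pf: "pseudofinite G" and b: "env G b" and A: "fof A" and N: "fof N"
    and sec: "secn G (A G b) (N G b)"
    and d: "dge G (N G b) d" and nd: "\<not> dge G (A G b) (Suc (Suc d))"
    and infA: "infinite (cls (A G b) (lco G (N G b)))"
  obtains D where "subgroup (Zd D G (A G b) (N G b)) G" "N G b \<subseteq> Zd D G (A G b) (N G b)"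
    "infinite (cls (Zd D G (A G b) (N G b)) (lco G (N G b)))"
    "finite (cls (A G b) (lco G (Zd D G (A G b) (N G b))))"
    "\<And>x. x \<in> A G b \<Longrightarrow> x \<in> Zd D G (A G b) (N G b) \<longleftrightarrow> finite (cls (A G b) (lco G (CN G (A G b) (N G b) x)))"
proof -
  interpret S: section_group G "A G b" "N G b" using grp sec
      by (simp add: section_group_def section_group_axioms_def)
  let ?A = "A G b" and ?N = "N G b"
  obtain D0 where "\<forall>x\<in>?A. \<not> nge D0 (S.K x) S.eq \<or> \<not> nge D0 (S.C x) S.eq"
    using section_bound[OF b A N sec d nd] by (elim exE)
  \<comment> \<open>At least 2, to keep the identity inside.\<close>
  moreover define D where "D = max D0 2"
  ultimately have D: "\<not> nge D (S.K x) S.eq \<or> \<not> nge D (S.C x) S.eq" if "x \<in> ?A" for x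
    using that nge_mono[of D "S.K x" S.eq D0] nge_mono[of D "S.C x" S.eq D0] by auto
  have D2: "D \<ge> 2" by (simp add: D_def)
  let ?Z = "Zd D G ?A ?N"
  have ZA: "?Z \<subseteq> ?A" by (auto simp: Zd_def)
  have Ac: "?A \<subseteq> carrier G" by auto
  \<comment> \<open>Both together would make \<open>A/N\<close> finite.\<close>
  have notboth: "\<not> (finite (cls ?A (lco G (S.C x))) \<and> finite (cls (S.C x) S.eq))" if "x \<in> ?A" for x
    using S.lco_finite_mult[OF S.C_subgroup[OF that] S.N S.N_C[OF that] Ac] infA by blast
  have Zfin: "x \<in> ?Z \<longleftrightarrow> finite (cls ?A (lco G (S.C x)))" if x: "x \<in> ?A" for x
  proof
    assume "x \<in> ?Z"
    then have "finite (cls (S.K x) S.eq)" using not_nge[OF S.equA[OF S.KA]] by (simp add: Zd_def)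
    then show "finite (cls ?A (lco G (S.C x)))" by (simp add: S.finite_K_iff[OF x])
  next
    assume "finite (cls ?A (lco G (S.C x)))"
    then have "infinite (cls (S.C x) S.eq)" using notboth[OF x] by blast
    then have "nge D (S.C x) S.eq" using nge_all[OF S.equA[OF S.CA]] by blast
    then show "x \<in> ?Z" using D[OF x] x by (simp add: Zd_def)
  qed
  have NZ: "?N \<subseteq> ?Z"
  proof
    fix n assume n: "n \<in> ?N"
    have "S.eq \<one>\<^bsub>G\<^esub> n" using n by (simp add: lco_def)
    then have "n \<in> S.K \<one>\<^bsub>G\<^esub>" using n S.K_mult[OF S.A1 S.K_refl[OF S.A1] n] by simp
    then show "n \<in> ?Z" using S.Zd_K[OF S.one_Zd[OF D2]] by blast
  qed
  have Zsub: "subgroup ?Z G"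
  proof (rule subgroup.intro)
    show "?Z \<subseteq> carrier G" using ZA Ac by blast
    show "\<one>\<^bsub>G\<^esub> \<in> ?Z" by (rule S.one_Zd[OF D2])
    fix x assume x: "x \<in> ?Z"
    then have xA: "x \<in> ?A" using ZA by auto
    have fx: "finite (cls ?A (lco G (S.C x)))" using x Zfin[OF xA] by simp
    then have "finite (cls ?A (lco G (S.C (inv\<^bsub>G\<^esub> x))))"
      using S.lco_finite_mono[OF S.C_subgroup[OF xA] S.C_subgroup[OF S.Ai[OF xA]] S.C_inv[OF xA] Ac] by simp
    then show "inv\<^bsub>G\<^esub> x \<in> ?Z" using Zfin[OF S.Ai[OF xA]] by simp
    fix y assume y: "y \<in> ?Z"
    then have yA: "y \<in> ?A" using ZA by auto
    have fy: "finite (cls ?A (lco G (S.C y)))" using y Zfin[OF yA] by simp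
    have "finite (cls ?A (lco G (S.C x \<inter> S.C y)))"
      by (rule S.lco_finite_Int[OF S.C_subgroup[OF xA] S.C_subgroup[OF yA] Ac fx fy])
    then have "finite (cls ?A (lco G (S.C (x \<otimes>\<^bsub>G\<^esub> y))))"
      using S.lco_finite_mono[OF S.subgroups_Inter_pair[OF S.C_subgroup[OF xA] S.C_subgroup[OF yA]]
        S.C_subgroup[OF S.Am[OF xA yA]] S.C_mult[OF xA yA] Ac] by simp
    then show "x \<otimes>\<^bsub>G\<^esub> y \<in> ?Z" using Zfin[OF S.Am[OF xA yA]] by simp
  qed
  have fZ: "fof (\<lambda>M s. Zd D M (A M s) (N M s))" by (rule fof_Zd[OF A N])
  have infZ: "infinite (cls ?Z S.eq)"
  proof
    assume finZ: "finite (cls ?Z S.eq)"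
    let ?X = "?A - ?Z"
    let ?F = "\<lambda>M s. A M s - Zd D M (A M s) (N M s)"
    let ?E = "\<lambda>M s x z. z \<in> Kl M (A M s) (N M s) x"
    have X: "fof ?F" by (rule fof_Diff[OF A fZ])
    have equX: "equ ?X (?E G b)" unfolding equ_def
    proof (intro conjI ballI impI)
      fix x y z assume x: "x \<in> ?X"
      show "x \<in> S.K x" using x S.K_refl by simp
      assume y: "y \<in> ?X" "y \<in> S.K x"
      show "x \<in> S.K y" using S.K_sym x y by simp
      assume z: "z \<in> ?X" "z \<in> S.K y"
      show "z \<in> S.K x" using S.K_trans[of x y z] x y z by simp
    qed
    have KX: "S.K x \<subseteq> ?X" if x: "x \<in> ?X" for x
    proof
      fix z assume z: "z \<in> S.K x"
      then have "z \<in> ?A" using S.KA by blast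
      moreover have "z \<notin> ?Z" using S.Zd_K[of z D x] S.K_sym[OF _ z] x by auto
      ultimately show "z \<in> ?X" by simp
    qed
    define A' where "A' = (\<lambda>(M::'a monoid) s. A M (\<lambda>i. s (Suc i)))"
    define N' where "N' = (\<lambda>(M::'a monoid) s. N M (\<lambda>i. s (Suc i)))"
    have A': "fof A'" and N': "fof N'" unfolding A'_def N'_def
        by (rule fof_shift[OF A], rule fof_shift[OF N])
    have Ks: "A' G (y ## b) = ?A" "N' G (y ## b) = ?N" for y by (simp_all add: A'_def N'_def)
    have K: "fof (\<lambda>M s. Kl M (A' M s) (N' M s) (s 0))" by (rule fof_Kl[OF A' N' ft_var])
    have finC: "finite (cls (S.C x) S.eq)" if x: "x \<in> ?X" for x
    proof -
      have "nge D (S.K x) S.eq" using x by (simp add: Zd_def)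
      then show ?thesis using D[of x] x not_nge[OF S.equA[OF S.CA]] by blast
    qed
    have big: "dge G (S.K x) (Suc d)" if x: "x \<in> ?X" for x
    proof -
      have xA: "x \<in> ?A" using x by simp
      have "infinite (cls (S.K x) S.eq)"
        using notboth[OF xA] finC[OF x] by (simp add: S.finite_K_iff[OF xA])
      then show ?thesis
        using fof_dge_cosets[OF model_G _ K N', of "x ## b" d] S.N S.K_mult[OF xA] b xA d by (simp add: Ks)
    qed
    have "finite (cls ?X (?E G b))"
    proof (rule ccontr)
      assume i: "infinite (cls ?X (?E G b))"
      have "dge G ?X (Suc (Suc d))"
      proof (rule fof_dge_quotient[OF model_G b X, where E = ?E])
        have "fof (\<lambda>M s. Kl M (A M (\<lambda>i. s (Suc (Suc i)))) (N M (\<lambda>i. s (Suc (Suc i)))) (s 0))"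
          by (intro fof_Kl fof_shift[OF A] fof_shift[OF N] ft_var)
        then show "fo (\<lambda>M s. s (Suc 0) \<in> Kl M (A M (\<lambda>i. s (Suc (Suc i)))) (N M (\<lambda>i. s (Suc (Suc i)))) (s 0))"
          by (rule fo_mem) (rule ft_var)+
        show "equ ?X (?E G b)" by (rule equX)
        show "infinite (cls ?X (?E G b))" by (rule i)
        fix x assume x: "x \<in> ?X"
        have "{y \<in> ?X. y \<in> S.K x} = S.K x" using KX[OF x] by auto
        then show "dge G {y \<in> ?X. y \<in> S.K x} (Suc d)" using big[OF x] by simp
      qed
      then have "dge G ?A (Suc (Suc d))"
        using fof_dge_mono[OF model_G b b X A, of "Suc (Suc d)"] by simp
      then show False using nd by simp
    qed
    then obtain r :: nat and u where u: "\<And>i. i < r \<Longrightarrow> u i \<in> ?X"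
      "\<And>i j. i < r \<Longrightarrow> j < r \<Longrightarrow> i \<noteq> j \<Longrightarrow> u j \<notin> S.K (u i)" "\<And>x. x \<in> ?X \<Longrightarrow> \<exists>i<r. x \<in> S.K (u i)"
      using finite_representatives[OF equX] by metis
    show False
    proof (rule section_class_equation[OF pf b A N sec D2 finZ, of r u])
      show "i < r \<Longrightarrow> u i \<in> ?X" for i by (rule u(1))
      show "i < r \<Longrightarrow> finite (cls (S.C (u i)) S.eq)" for i using finC[OF u(1)] .
      show "i < r \<Longrightarrow> j < r \<Longrightarrow> i \<noteq> j \<Longrightarrow> u i \<notin> S.K (u j)" for i j using u(2)[of j i] by simp
      show "x \<in> ?A \<Longrightarrow> x \<in> ?Z \<or> (\<exists>i<r. x \<in> S.K (u i))" for x using u(3)[of x] by blast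
    qed (rule infA)
  qed
  have finAZ: "finite (cls ?A (lco G ?Z))"
  proof (rule ccontr)
    assume i: "infinite (cls ?A (lco G ?Z))"
    have "dge G ?Z (Suc d)"
      using fof_dge_cosets[OF model_G b fZ N S.N _ d infZ] subgroup.m_closed[OF Zsub] NZ by blast
    then have "dge G ?A (Suc (Suc d))"
      using fof_dge_cosets[OF model_G b A fZ Zsub _ _ i] ZA by (meson S.Am subsetD)
    then show False using nd by simp
  qed
  show ?thesis by (rule that[of D]) (fact Zsub NZ infZ finAZ | rule Zfin)+
qed

end

section \<open>Lines\<close>

definition cen :: "('a, 'b) monoid_scheme \<Rightarrow> 'a \<Rightarrow> 'a set" where
  "cen M x = {y \<in> carrier M. x \<otimes>\<^bsub>M\<^esub> y = y \<otimes>\<^bsub>M\<^esub> x}"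

text \<open>The lines: for suitable \<open>D\<close>, the elements centralising a subgroup of finite
  index in the centraliser of \<open>x\<close>.\<close>

definition Ax :: "nat \<Rightarrow> ('a, 'b) monoid_scheme \<Rightarrow> 'a \<Rightarrow> 'a set" where
  "Ax D M x = {y \<in> carrier M. nge D (cen M x \<inter> cen M y) (=)}"

text \<open>The normaliser of the set \<open>Ax D M x\<close>. The equivalence makes it a subgroup
  of every group \<open>M\<close>, also of approximating groups in which \<open>Ax D M x\<close> is
  just a set.\<close>

definition Nx :: "nat \<Rightarrow> ('a, 'b) monoid_scheme \<Rightarrow> 'a \<Rightarrow> 'a set" where
  "Nx D M x = {g \<in> carrier M. \<forall>w\<in>carrier M. w \<in> Ax D M x \<longleftrightarrow> cj M g w \<in> Ax D M x}"

lemma fof_carrier: "fof (\<lambda>M s. carrier M)"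
  by (simp add: fof_def fo_carrier ft_var)

text \<open>The empty set outside groups is forced by \<open>fof\<close>, as the neutral element of
  a junk structure may lie outside its carrier.\<close>

lemma fof_one: "fof (\<lambda>M s. if group M then {\<one>\<^bsub>M\<^esub>} else {})"
proof -
  have "fo (\<lambda>M s. s 0 = \<one>\<^bsub>M\<^esub>)" by (intro fo_eq ft.intros)
  then have "fo (\<lambda>M s. s 0 \<in> (if group M then {\<one>\<^bsub>M\<^esub>} else {}))" by (rule fo_cong) auto
  then show ?thesis by (auto simp: fof_def group_one)
qed

lemma fof_Int:
  assumes "fof F" "fof H" shows "fof (\<lambda>M s. F M s \<inter> H M s)"
proof -
  have "fof (\<lambda>M s. {x \<in> carrier M. x \<in> F M s \<and> x \<in> H M s})"
    by (intro fof_Collect fo_conj fo_mem[OF assms(1)] fo_mem[OF assms(2)] ft_var)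
  moreover have "F M s \<inter> H M s = {x \<in> carrier M. x \<in> F M s \<and> x \<in> H M s}" for M s
    using fof_subset[OF assms(1), of M s] by auto
  ultimately show ?thesis by simp
qed

lemma fof_cen: 
  assumes t: "ft t" shows "fof (\<lambda>M s. cen M (t M s))"
  unfolding cen_def by (rule fof_Collect) (intro fo_eq ft.intros ft_shift[OF t])

lemma fo_card: "fof F \<Longrightarrow> fo (\<lambda>M s. nge n (F M s) (=))"
  by (rule fo_nge_fof[where E = "\<lambda>M s. (=)", OF _ fo_eq[OF ft_var ft_var]])

lemma fof_Ax:
  assumes t: "ft t" shows "fof (\<lambda>M s. Ax D M (t M s))"
  unfolding Ax_def by (rule fof_Collect) (intro fo_card fof_Int fof_cen ft_shift[OF t] ft_var)

lemma fof_Nx: "ft t \<Longrightarrow> fof (\<lambda>M s. Nx D M (t M s))"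
proof -
  assume t: "ft t"
  have t2: "ft (\<lambda>M s. t M (\<lambda>i. s (Suc (Suc i))))" by (rule ft_shift[OF t])
  have A: "fof (\<lambda>M s. Ax D M (t M (\<lambda>i. s (Suc (Suc i)))))" by (rule fof_Ax[OF t2])
  have "fo (\<lambda>M s. \<forall>w\<in>carrier M. w \<in> Ax D M (t M (\<lambda>i. s (Suc i))) \<longleftrightarrow>
      s 0 \<otimes>\<^bsub>M\<^esub> w \<otimes>\<^bsub>M\<^esub> inv\<^bsub>M\<^esub> (s 0) \<in> Ax D M (t M (\<lambda>i. s (Suc i))))"
    by (rule fo_all) (intro fo_iff fo_mem[OF A] ft.intros)
  then show ?thesis unfolding Nx_def cj_def by (rule fof_Collect)
qed

lemma nge_inj_image: "inj_on f X \<Longrightarrow> nge n (f ` X) (=) \<longleftrightarrow> nge n X (=)"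
  by (simp add: nge_card card_image finite_image_iff)

context group begin

lemma secn_one: "subgroup A G \<Longrightarrow> secn G A {\<one>}"
  using triv_subgroup subgroup.one_closed[of A G] subgroup.mem_carrier[of A G]
      by (auto simp: secn_def cj_def)

lemma secn_triv: "secn G (carrier G) {\<one>}"
  by (rule secn_one[OF subgroup_self])

lemma CN_triv:
  assumes *: "A \<subseteq> carrier G" "x \<in> carrier G" shows "CN G A {\<one>} x = A \<inter> cen G x"
proof (intro equalityI subsetI)
  fix y assume "y \<in> CN G A {\<one>} x"
  with * have y: "y \<in> A" "y \<in> carrier G" "inv x \<otimes> (y \<otimes> x \<otimes> inv y) = \<one>" by (auto simp: CN_def lco_def cj_def)
  then have "x \<otimes> (inv x \<otimes> (y \<otimes> x \<otimes> inv y)) \<otimes> y = x \<otimes> y" using *(2) by simp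
  then have "y \<otimes> x = x \<otimes> y" using y *(2) by (simp add: gsimps)
  then show "y \<in> A \<inter> cen G x" using y by (simp add: cen_def)
next
  fix y assume "y \<in> A \<inter> cen G x"
  then have y: "y \<in> A" "y \<in> carrier G" "y \<otimes> x = x \<otimes> y" by (auto simp: cen_def)
  then show "y \<in> CN G A {\<one>} x" using *(2) by (simp add: CN_def lco_def cj_def m_assoc)
qed

lemma cen_subgroup: "x \<in> carrier G \<Longrightarrow> subgroup (cen G x) G"
proof -
  assume x: "x \<in> carrier G"
  interpret S: section_group G "carrier G" "{\<one>}" by unfold_locales (rule secn_triv)
  have "CN G (carrier G) {\<one>} x = cen G x" using CN_triv[OF subset_refl x] by (auto simp: cen_def)
  then show ?thesis using S.C_subgroup[OF x] by simp
qed

lemma cen_sym: "x \<in> carrier G \<Longrightarrow> y \<in> carrier G \<Longrightarrow> y \<in> cen G x \<longleftrightarrow> x \<in> cen G y"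
  by (auto simp: cen_def)

lemma cj_closed [simp]: "g \<in> carrier G \<Longrightarrow> x \<in> carrier G \<Longrightarrow> cj G g x \<in> carrier G"
  by (simp add: cj_def)

lemma cj_inj: "g \<in> carrier G \<Longrightarrow> inj_on (cj G g) (carrier G)"
  by (auto simp: inj_on_def cj_def)

lemma cj_cj: "g \<in> carrier G \<Longrightarrow> h \<in> carrier G \<Longrightarrow> x \<in> carrier G \<Longrightarrow> cj G g (cj G h x) = cj G (g \<otimes> h) x"
  by (simp add: cj_def gsimps)

lemma cj_inv_cancel [simp]: "g \<in> carrier G \<Longrightarrow> x \<in> carrier G \<Longrightarrow> cj G (inv g) (cj G g x) = x"
  "g \<in> carrier G \<Longrightarrow> x \<in> carrier G \<Longrightarrow> cj G g (cj G (inv g) x) = x"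
  by (simp_all add: cj_def gsimps)

lemma cen_cj:
  assumes g: "g \<in> carrier G" and x: "x \<in> carrier G" shows "cen G (cj G g x) = cj G g ` cen G x"
proof -
  have *: "y \<in> cen G x \<Longrightarrow> g \<in> carrier G \<Longrightarrow> x \<in> carrier G \<Longrightarrow> cj G g y \<in> cen G (cj G g x)" for x y g
  proof -
    assume y: "y \<in> cen G x" and g: "g \<in> carrier G" and x: "x \<in> carrier G"
    have yc: "y \<in> carrier G" and xy: "x \<otimes> y = y \<otimes> x" using y by (simp_all add: cen_def)
    have "cj G g x \<otimes> cj G g y = cj G g (x \<otimes> y)" "cj G g y \<otimes> cj G g x = cj G g (y \<otimes> x)"
      using g x yc by (simp_all add: cj_def gsimps)
    then show ?thesis using yc xy g x by (simp add: cen_def)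
  qed
  show ?thesis
  proof (intro equalityI subsetI)
    fix y assume y: "y \<in> cen G (cj G g x)"
    then have yc: "y \<in> carrier G" by (simp add: cen_def)
    have "cj G (inv g) y \<in> cen G x" using *[OF y, of "inv g"] g x by simp
    moreover have "y = cj G g (cj G (inv g) y)" using g yc by simp
    ultimately show "y \<in> cj G g ` cen G x" by blast
  qed (use * g x in auto)
qed

lemma Ax_cj:
  assumes g: "g \<in> carrier G" and x: "x \<in> carrier G" and y: "y \<in> carrier G"
  shows "cj G g y \<in> Ax D G (cj G g x) \<longleftrightarrow> y \<in> Ax D G x"
proof -
  have sub: "cen G x \<inter> cen G y \<subseteq> carrier G" "cen G x \<subseteq> carrier G" "cen G y \<subseteq> carrier G"
      by (auto simp: cen_def)
  have "cen G (cj G g x) \<inter> cen G (cj G g y) = cj G g ` (cen G x \<inter> cen G y)"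
    unfolding cen_cj[OF g x] cen_cj[OF g y] using inj_on_image_Int[OF cj_inj[OF g] sub(2,3)] by simp
  moreover have "nge D (cj G g ` (cen G x \<inter> cen G y)) (=) \<longleftrightarrow> nge D (cen G x \<inter> cen G y) (=)"
    by (rule nge_inj_image) (rule inj_on_subset[OF cj_inj[OF g] sub(1)])
  ultimately show ?thesis using g y x by (simp add: Ax_def)
qed

lemma NxD: "g \<in> Nx D G x \<Longrightarrow> w \<in> carrier G \<Longrightarrow> w \<in> Ax D G x \<longleftrightarrow> cj G g w \<in> Ax D G x"
  unfolding Nx_def by blast

lemma NxI: "g \<in> carrier G \<Longrightarrow> (\<And>w. w \<in> carrier G \<Longrightarrow> w \<in> Ax D G x \<longleftrightarrow> cj G g w \<in> Ax D G x) \<Longrightarrow> g \<in> Nx D G x"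
  unfolding Nx_def by blast

lemma Nx_subgroup: "subgroup (Nx D G x) G"
proof (rule subgroup.intro)
  show "Nx D G x \<subseteq> carrier G" by (auto simp: Nx_def)
  show "\<one> \<in> Nx D G x" by (simp add: Nx_def cj_def)
  fix g assume g: "g \<in> Nx D G x"
  then have gc: "g \<in> carrier G" unfolding Nx_def by blast
  have "w \<in> Ax D G x \<longleftrightarrow> cj G (inv g) w \<in> Ax D G x" if "w \<in> carrier G" for w
  proof -
    have "cj G (inv g) w \<in> Ax D G x \<longleftrightarrow> cj G g (cj G (inv g) w) \<in> Ax D G x"
      by (rule NxD[OF g]) (use that gc in simp)
    then show ?thesis using that gc by simp
  qed
  then show "inv g \<in> Nx D G x" by (rule NxI[OF inv_closed[OF gc]])
  fix h assume h: "h \<in> Nx D G x"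
  then have hc: "h \<in> carrier G" unfolding Nx_def by blast
  have "w \<in> Ax D G x \<longleftrightarrow> cj G (g \<otimes> h) w \<in> Ax D G x" if "w \<in> carrier G" for w
  proof -
    have "w \<in> Ax D G x \<longleftrightarrow> cj G h w \<in> Ax D G x" by (rule NxD[OF h that])
    also have "\<dots> \<longleftrightarrow> cj G g (cj G h w) \<in> Ax D G x" by (rule NxD[OF g]) (use that hc in simp)
    finally show ?thesis unfolding cj_cj[OF gc hc that] .
  qed
  then show "g \<otimes> h \<in> Nx D G x" by (rule NxI[OF m_closed[OF gc hc]])
qed

text \<open>Conjugation maps the pairs \<open>(g, a)\<close> with \<open>a \<in> A - Z\<close> onto
  the set to be counted. The trivial intersection property says that in a fibre \<open>g\<close>
  ranges over a single left coset of \<open>N\<close>, with \<open>a\<close> determined by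
  \<open>g\<close>.\<close>

lemma card_TI_conjugates:
  assumes fin: "finite (carrier G)" and A: "A \<subseteq> carrier G" and Z: "Z \<subseteq> A"
    and Zn: "\<And>g z. g \<in> carrier G \<Longrightarrow> z \<in> carrier G \<Longrightarrow> cj G g z \<in> Z \<longleftrightarrow> z \<in> Z"
    and N: "subgroup N G" "\<And>g w. g \<in> N \<Longrightarrow> w \<in> A \<Longrightarrow> cj G g w \<in> A"
    and TI: "\<And>g w. g \<in> carrier G \<Longrightarrow> w \<in> A \<Longrightarrow> w \<notin> Z \<Longrightarrow> cj G g w \<in> A \<Longrightarrow> g \<in> N"
  shows "card {y \<in> carrier G - Z. \<exists>g\<in>carrier G. cj G g y \<in> A} * card N =
      (card A - card Z) * card (carrier G)"
proof -
  let ?U = "{y \<in> carrier G - Z. \<exists>g\<in>carrier G. cj G g y \<in> A}"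
  let ?f = "\<lambda>(g, a). cj G g a"
  let ?P = "carrier G \<times> (A - Z)"
  have finA: "finite A" "finite Z" using fin A Z by (auto intro: finite_subset)
  have Nc: "g \<in> carrier G" if "g \<in> N" for g using N(1) that by (rule subgroup.mem_carrier)
  have img: "?f ` ?P = ?U"
  proof (intro equalityI subsetI)
    fix y assume "y \<in> ?f ` ?P"
    then obtain g a where ga: "g \<in> carrier G" "a \<in> A" "a \<notin> Z" "y = cj G g a" by auto
    then have ac: "a \<in> carrier G" using A by auto
    have "cj G (inv g) y = a" using ga ac by simp
    then have "\<exists>g\<in>carrier G. cj G g y \<in> A" using ga by (intro bexI[of _ "inv g"]) auto
    then show "y \<in> ?U" using ga ac Zn by auto
  next
    fix y assume "y \<in> ?U"
    then obtain g where g: "y \<in> carrier G" "y \<notin> Z" "g \<in> carrier G" "cj G g y \<in> A" by auto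
    then have "y = ?f (inv g, cj G g y)" "cj G g y \<notin> Z" using Zn by auto
    then show "y \<in> ?f ` ?P" using g by (intro image_eqI[of _ _ "(inv g, cj G g y)"]) auto
  qed
  have fib: "card {p \<in> ?P. ?f p = y} = card N" if y: "y \<in> ?U" for y
  proof -
    from y obtain g0 a0 where g0: "g0 \<in> carrier G" "a0 \<in> A" "a0 \<notin> Z" "y = cj G g0 a0"
      unfolding img[symmetric] by auto
    have a0c: "a0 \<in> carrier G" using g0 A by auto
    let ?g = "\<lambda>h. (g0 \<otimes> inv h, cj G h a0)"
    have "{p \<in> ?P. ?f p = y} = ?g ` N"
    proof (intro equalityI subsetI)
      fix p assume "p \<in> {p \<in> ?P. ?f p = y}"
      then obtain g a where p: "p = (g, a)" "g \<in> carrier G" "a \<in> A" "a \<notin> Z" "cj G g a = y" by auto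
      have ac: "a \<in> carrier G" using p A by auto
      let ?h = "inv g \<otimes> g0"
      have "cj G (inv g) y = a" using cj_inv_cancel(1)[OF p(2) ac] p(5) by simp
      then have a: "a = cj G ?h a0" using p(2) g0 a0c by (simp add: cj_cj)
      have "?h \<in> N" by (rule TI[of _ a0]) (use p g0 a in auto)
      moreover have "g = g0 \<otimes> inv ?h" using p g0 by (simp add: gsimps)
      ultimately show "p \<in> ?g ` N" using p(1) a by blast
    next
      fix p assume "p \<in> ?g ` N"
      then obtain h where h: "h \<in> N" "p = ?g h" by auto
      have "cj G (g0 \<otimes> inv h) (cj G h a0) = y" using h g0 a0c Nc by (simp add: cj_cj gsimps)
      moreover have "cj G h a0 \<in> A" "cj G h a0 \<notin> Z"
          using N(2)[OF h(1) g0(2)] Zn[of h a0] g0 a0c Nc[OF h(1)] by auto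
      ultimately show "p \<in> {p \<in> ?P. ?f p = y}" using h g0 Nc by auto
    qed
    moreover have "inj_on ?g N" using g0 Nc by (auto simp: inj_on_def) (metis inv_inv)
    ultimately show ?thesis by (simp add: card_image)
  qed
  have "card ?P = (\<Sum>p\<in>?P. 1)" by simp
  also have "\<dots> = (\<Sum>y\<in>?f ` ?P. \<Sum>p\<in>{p \<in> ?P. ?f p = y}. 1)"
    by (rule sum.image_gen) (use fin finA in simp)
  also have "\<dots> = (\<Sum>y\<in>?U. card N)" unfolding img using fib by (intro sum.cong) auto
  finally show ?thesis using finA Z by (simp add: card_cartesian_product card_Diff_subset mult.commute)
qed

end

section \<open>The class equation for lines\<close>

context group begin

lemma card_conj_class:
  assumes fin: "finite (carrier G)" and u: "u \<in> carrier G"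
  shows "card {y \<in> carrier G. \<exists>g\<in>carrier G. cj G g y = u} * card (cen G u) = card (carrier G)"
proof -
  interpret S: section_group G "carrier G" "{\<one>}" by unfold_locales (rule secn_triv)
  have "S.K u = {y \<in> carrier G. \<exists>g\<in>carrier G. cj G g y = u}"
  proof (intro equalityI subsetI)
    fix y assume "y \<in> S.K u"
    then obtain g where g: "y \<in> carrier G" "g \<in> carrier G" "inv (cj G g u) \<otimes> y = \<one>"
        by (auto simp: Kl_def lco_def)
    then have "cj G g u \<otimes> (inv (cj G g u) \<otimes> y) = cj G g u" using u by simp
    then have "y = cj G g u" using mult_inv_cancel[of "cj G g u" y] g u by simp
    then have "cj G (inv g) y = u" using g u by simp
    then show "y \<in> {y \<in> carrier G. \<exists>g\<in>carrier G. cj G g y = u}" using g by blast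
  next
    fix y assume "y \<in> {y \<in> carrier G. \<exists>g\<in>carrier G. cj G g y = u}"
    then obtain g where g: "y \<in> carrier G" "g \<in> carrier G" "cj G g y = u" by auto
    then have "cj G (inv g) u = y" by auto
    then have "lco G {\<one>} (cj G (inv g) u) y" using g by (simp add: lco_def)
    then show "y \<in> S.K u" using g by (auto simp: Kl_def)
  qed
  moreover have "S.C u = cen G u" using CN_triv[OF subset_refl u] by (auto simp: cen_def)
  ultimately show ?thesis using S.card_K[OF u fin] by simp
qed

text \<open>The group is partitioned into \<open>Z\<close>, the conjugates of the \<open>A i\<close>
  outside \<open>Z\<close>, and the classes of the \<open>u j\<close>. By the preceding count the
  conjugates of \<open>A i\<close> make up the proportion \<open>(|A i| - |Z|) / |N i|\<close>,
  written here as the reciprocal of the index of \<open>A i\<close> in \<open>N i\<close> minus an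
  error term.\<close>

lemma line_class_equation:
  fixes m r :: nat
  assumes fin: "finite (carrier G)" and Zc: "Z \<subseteq> carrier G"
    and Zn: "\<And>g z. g \<in> carrier G \<Longrightarrow> z \<in> carrier G \<Longrightarrow> cj G g z \<in> Z \<longleftrightarrow> z \<in> Z"
    and u: "\<And>j. j < r \<Longrightarrow> u j \<in> carrier G"
    and A: "\<And>i. i < m \<Longrightarrow> subgroup (A i) G" "\<And>i. i < m \<Longrightarrow> Z \<subseteq> A i" "\<And>i. i < m \<Longrightarrow> A i \<subseteq> N i"
    and N: "\<And>i. i < m \<Longrightarrow> subgroup (N i) G" "\<And>i g w. i < m \<Longrightarrow> g \<in> N i \<Longrightarrow> w \<in> A i \<Longrightarrow> cj G g w \<in> A i"
    and TI: "\<And>i g w. i < m \<Longrightarrow> g \<in> carrier G \<Longrightarrow> w \<in> A i \<Longrightarrow> w \<notin> Z \<Longrightarrow> cj G g w \<in> A i \<Longrightarrow> g \<in> N i"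
    and cov: "\<And>y. y \<in> carrier G \<Longrightarrow> y \<in> Z \<or> (\<exists>i<m. \<exists>g\<in>carrier G. cj G g y \<in> A i) \<or>
        (\<exists>j<r. \<exists>g\<in>carrier G. cj G g y = u j)"
    and d1: "\<And>i i' g w. i < m \<Longrightarrow> i' < m \<Longrightarrow> i \<noteq> i' \<Longrightarrow> g \<in> carrier G \<Longrightarrow> w \<in> A i \<Longrightarrow> w \<notin> Z \<Longrightarrow> cj G g w \<notin> A i'"
    and d2: "\<And>i j g. i < m \<Longrightarrow> j < r \<Longrightarrow> g \<in> carrier G \<Longrightarrow> cj G g (u j) \<notin> A i"
    and d3: "\<And>j. j < r \<Longrightarrow> u j \<notin> Z"
    and d4: "\<And>j j' g. j < r \<Longrightarrow> j' < r \<Longrightarrow> j \<noteq> j' \<Longrightarrow> g \<in> carrier G \<Longrightarrow> cj G g (u j) \<noteq> u j'"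
  shows "1 = real (card Z) / real (card (carrier G)) +
    (\<Sum>i<m. 1 / real (card (cls (N i) (lco G (A i)))) - real (card Z) / real (card (N i))) +
    (\<Sum>j<r. 1 / real (card (cen G (u j))))"
proof -
  let ?n = "real (card (carrier G))"
  have n0: "?n > 0" using fin one_closed by (metis card_gt_0_iff empty_iff of_nat_0_less_iff)
  define U where "U i = {y \<in> carrier G - Z. \<exists>g\<in>carrier G. cj G g y \<in> A i}" for i
  define K where "K j = {y \<in> carrier G. \<exists>g\<in>carrier G. cj G g y = u j}" for j
  have finU: "finite (U i)" "finite (K j)" for i j using fin by (auto simp: U_def K_def)
  have Ac: "A i \<subseteq> carrier G" "N i \<subseteq> carrier G" if "i < m" for i
    using subgroup.subset[OF A(1)[OF that]] subgroup.subset[OF N(1)[OF that]] by simp_all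
  have cU: "real (card (U i)) = ?n * (1 / real (card (cls (N i) (lco G (A i)))) - real (card Z) / real (card (N i)))"
    if i: "i < m" for i
  proof -
    have finN: "finite (N i)" "finite (A i)" "finite Z" using Ac[OF i] Zc fin finite_subset by blast+
    have N0: "card (N i) > 0" using finN subgroup.one_closed[OF N(1)[OF i]]
        by (metis card_gt_0_iff empty_iff)
    have 1: "card (U i) * card (N i) = (card (A i) - card Z) * card (carrier G)"
      unfolding U_def
      by (rule card_TI_conjugates[OF fin Ac(1)[OF i] A(2)[OF i] Zn N(1)[OF i] N(2)[OF i] TI[OF i]])
    have 2: "card (N i) = card (cls (N i) (lco G (A i))) * card (A i)"
      by (rule card_lco[OF A(1)[OF i] finN(1) Ac(2)[OF i]])
        (use subgroup.m_closed[OF N(1)[OF i]] A(3)[OF i] in blast)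
    have 3: "card Z \<le> card (A i)" using A(2)[OF i] finN by (intro card_mono)
    let ?a = "real (card (A i))" and ?N = "real (card (N i))" and ?z = "real (card Z)"
      and ?c = "real (card (cls (N i) (lco G (A i))))"
    have "real (card (U i)) * ?N = (?a - ?z) * ?n" using 1 3 by (metis of_nat_diff of_nat_mult)
    moreover have Nc: "?N = ?c * ?a" using 2 by (metis of_nat_mult)
    moreover have "?N > 0" using N0 by simp
    moreover have "?c \<noteq> 0" "?a \<noteq> 0" using Nc \<open>?N > 0\<close> by (metis mult_zero_left mult_zero_right less_irrefl)+
    ultimately have "real (card (U i)) = (?a / ?N - ?z / ?N) * ?n" by (simp add: field_simps)
    also have "?a / ?N = 1 / ?c" unfolding Nc using \<open>?a \<noteq> 0\<close> by simp
    finally show ?thesis by simp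
  qed
  have cK: "real (card (K j)) = ?n * (1 / real (card (cen G (u j))))" if j: "j < r" for j
  proof -
    have "card (K j) * card (cen G (u j)) = card (carrier G)"
      unfolding K_def by (rule card_conj_class[OF fin u[OF j]])
    then have *: "real (card (K j)) * real (card (cen G (u j))) = ?n" by (metis of_nat_mult)
    then have "real (card (cen G (u j))) \<noteq> 0" using n0 by (metis mult_zero_right less_irrefl)
    then show ?thesis using *[symmetric] by simp
  qed
  have part: "carrier G = Z \<union> ((\<Union>i<m. U i) \<union> (\<Union>j<r. K j))"
  proof (intro equalityI subsetI)
    fix y assume y: "y \<in> carrier G"
    show "y \<in> Z \<union> ((\<Union>i<m. U i) \<union> (\<Union>j<r. K j))"
    proof (cases "y \<in> Z")
      case False
      then show ?thesis using cov[OF y] y by (auto simp: U_def K_def)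
    qed simp
  qed (use Zc in \<open>auto simp: U_def K_def\<close>)
  have disjU: "U i \<inter> U i' = {}" if "i < m" "i' < m" "i \<noteq> i'" for i i'
  proof (rule ccontr)
    assume "U i \<inter> U i' \<noteq> {}"
    then obtain y g h where y: "y \<in> carrier G" "y \<notin> Z" "g \<in> carrier G" "h \<in> carrier G" "cj G g y \<in> A i" "cj G h y \<in> A i'"
      by (auto simp: U_def)
    have "cj G (h \<otimes> inv g) (cj G g y) = cj G h y" using y by (simp add: cj_cj m_assoc)
    moreover have "cj G g y \<notin> Z" using Zn y by simp
    ultimately show False using d1[OF that, of "h \<otimes> inv g" "cj G g y"] y by simp
  qed
  have disjK: "K j \<inter> K j' = {}" if "j < r" "j' < r" "j \<noteq> j'" for j j'
  proof (rule ccontr)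
    assume "K j \<inter> K j' \<noteq> {}"
    then obtain y g h where y: "y \<in> carrier G" "g \<in> carrier G" "h \<in> carrier G" "cj G g y =
        u j" "cj G h y = u j'"
      by (auto simp: K_def)
    have "cj G (h \<otimes> inv g) (cj G g y) = cj G h y" using y(1-3) by (simp add: cj_cj m_assoc)
    then show False using d4[OF that, of "h \<otimes> inv g"] y by simp
  qed
  have disjUK: "U i \<inter> K j = {}" if "i < m" "j < r" for i j
  proof (rule ccontr)
    assume "U i \<inter> K j \<noteq> {}"
    then obtain y g h where y: "y \<in> carrier G" "g \<in> carrier G" "h \<in> carrier G" "cj G g y \<in> A i" "cj G h y = u j"
      by (auto simp: K_def U_def)
    have "cj G (g \<otimes> inv h) (cj G h y) = cj G g y" using y(1-3) by (simp add: cj_cj m_assoc)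
    then show False using d2[OF that, of "g \<otimes> inv h"] y by simp
  qed
  have disjZ: "Z \<inter> ((\<Union>i<m. U i) \<union> (\<Union>j<r. K j)) = {}"
  proof -
    have "y \<notin> Z" if "j < r" "y \<in> K j" for y j
    proof -
      obtain g where "y \<in> carrier G" "g \<in> carrier G" "cj G g y = u j" using \<open>y \<in> K j\<close> by (auto simp: K_def)
      then show ?thesis using d3[OF \<open>j < r\<close>] Zn[of g y] by simp
    qed
    moreover have "y \<notin> Z" if "y \<in> U i" for y i using that by (simp add: U_def)
    ultimately show ?thesis by blast
  qed
  have "card (carrier G) = card Z + card ((\<Union>i<m. U i) \<union> (\<Union>j<r. K j))"
    by (subst (1) part, rule card_Un_disjoint) (use disjZ finU Zc fin finite_subset in auto)
  also have "card ((\<Union>i<m. U i) \<union> (\<Union>j<r. K j)) = card (\<Union>i<m. U i) + card (\<Union>j<r. K j)"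
    by (rule card_Un_disjoint) (use disjUK finU in auto)
  also have "card (\<Union>i<m. U i) = (\<Sum>i<m. card (U i))"
    by (rule card_UN_disjoint) (use disjU finU in auto)
  also have "card (\<Union>j<r. K j) = (\<Sum>j<r. card (K j))"
    by (rule card_UN_disjoint) (use disjK finU in auto)
  finally have "?n = real (card Z) + ((\<Sum>i<m. real (card (U i))) + (\<Sum>j<r. real (card (K j))))"
    by simp
  also have "(\<Sum>i<m. real (card (U i))) =
      ?n * (\<Sum>i<m. 1 / real (card (cls (N i) (lco G (A i)))) - real (card Z) / real (card (N i)))"
    unfolding sum_distrib_left using cU by (intro sum.cong) auto
  also have "(\<Sum>j<r. real (card (K j))) = ?n * (\<Sum>j<r. 1 / real (card (cen G (u j))))"
    unfolding sum_distrib_left using cK by (intro sum.cong) auto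
  finally show ?thesis using n0 by (simp add: field_simps)
qed

lemma Zd_cj: "g \<in> carrier G \<Longrightarrow> z \<in> carrier G \<Longrightarrow> cj G g z \<in> Zd D G (carrier G) {\<one>} \<longleftrightarrow>
    z \<in> Zd D G (carrier G) {\<one>}"
proof -
  interpret S: section_group G "carrier G" "{\<one>}" by unfold_locales (rule secn_triv)
  assume g: "g \<in> carrier G" "z \<in> carrier G"
  show ?thesis using S.Zd_K[OF _ S.K_cj[OF _ g(1)], of "z" D] S.Zd_K[OF _ S.K_cj[of "cj G g z" "inv g"], of D] g by auto
qed

end

text \<open>As \<open>n\<close> and the \<open>a i\<close> tend to infinity, the equation forces \<open>q = 0\<close>, and then
  \<open>1 / n\<close> is the sum of the \<open>1 / a i\<close>, contradicting \<open>a i < n\<close>.\<close>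

lemma no_infinitesimal_class_equation:
  fixes m :: nat and z q :: real
  assumes "z > 0" and "\<And>k::nat. \<exists>n a. n > real k \<and> (\<forall>i<m. a i > real k \<and> a i < n) \<and> q =
      z * (1 / n - (\<Sum>i<m. 1 / a i))"
  shows False
proof -
  have bound: "\<bar>q\<bar> \<le> z * (1 + real m) / real k" if "k > 0" for k
  proof -
    obtain n a where na: "n > real k" "\<forall>i<m. a i > real k \<and> a i < n" "q = z * (1 / n - (\<Sum>i<m. 1 / a i))"
      using assms(2)[of k] by blast
    have "\<bar>1 / n\<bar> \<le> 1 / real k" using na(1) that by (simp add: frac_le)
    moreover have "\<bar>\<Sum>i<m. 1 / a i\<bar> \<le> (\<Sum>i<m. 1 / real k)"
    proof (rule order_trans[OF sum_abs], rule sum_mono)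
      fix i assume "i \<in> {..<m}"
      then have "a i > real k" using na(2) by auto
      then show "\<bar>1 / a i\<bar> \<le> 1 / real k" using that by (simp add: frac_le)
    qed
    ultimately have "\<bar>1 / n - (\<Sum>i<m. 1 / a i)\<bar> \<le> 1 / real k + (\<Sum>i<m. 1 / real k)" by linarith
    then have "\<bar>1 / n - (\<Sum>i<m. 1 / a i)\<bar> \<le> (1 + real m) / real k" by (simp add: add_divide_distrib)
    from mult_left_mono[OF this, of z] show ?thesis unfolding na(3) abs_mult using assms(1) by simp
  qed
  have "q = 0"
  proof (rule ccontr)
    assume "q \<noteq> 0"
    obtain k :: nat where k: "real k > z * (1 + real m) / \<bar>q\<bar>" using reals_Archimedean2 by blast
    have "z * (1 + real m) / \<bar>q\<bar> \<ge> 0" using assms(1) by simp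
    then have k0: "real k > 0" using k by linarith
    have "\<bar>q\<bar> * real k > z * (1 + real m)" using k \<open>q \<noteq> 0\<close> by (simp add: field_simps)
    moreover have "\<bar>q\<bar> * real k \<le> z * (1 + real m)" using bound[of k] k0 by (simp add: field_simps)
    ultimately show False by linarith
  qed
  obtain n a where na: "n > real 1" "\<forall>i<m. a i > real 1 \<and> a i < n" "q = z * (1 / n - (\<Sum>i<m. 1 / a i))"
    using assms(2)[of 1] by blast
  have e: "1 / n = (\<Sum>i<m. 1 / a i)" using na(3) \<open>q = 0\<close> assms(1) by simp
  show False
  proof (cases m)
    case 0 then show False using e na(1) by simp
  next
    case (Suc m')
    have a0: "a 0 > 1" "a 0 < n" using na(2) Suc by auto
    have "1 / a 0 \<le> (\<Sum>i<m. 1 / a i)"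
      by (rule member_le_sum[of 0 "{..<m}" "\<lambda>i. 1 / a i"])
          (use na(2) Suc in \<open>auto intro: less_imp_le less_trans[of 0 1]\<close>)
    moreover have "1 / n < 1 / a 0" using a0 by (simp add: frac_less2)
    ultimately show False using e by linarith
  qed
qed

context dim_theory begin

text \<open>In the approximating groups \<open>H\<close> the class equation becomes
  \<open>q = z * (1 / |H| - (\<Sum>i<m. 1 / |N i|))\<close> with \<open>q\<close> and
  \<open>z\<close> computed in \<open>G\<close>. The normalisers grow because they contain the
  infinite lines, and they stay smaller than \<open>H\<close> because no line is normal in
  \<open>G\<close>.\<close>

lemma line_class_contradiction:
  fixes m r :: nat
  assumes pf: "pseudofinite G" and D1: "D1 \<ge> 2"
    and Z: "Z = Zd D1 G (carrier G) {\<one>\<^bsub>G\<^esub>}" "finite Z"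
    and x: "\<And>i. i < m \<Longrightarrow> x i \<in> carrier G" and u: "\<And>j. j < r \<Longrightarrow> u j \<in> carrier G"
    and A: "\<And>i. i < m \<Longrightarrow> subgroup (Ax D G (x i)) G" "\<And>i. i < m \<Longrightarrow> Z \<subseteq> Ax D G (x i)"
      "\<And>i. i < m \<Longrightarrow> Ax D G (x i) \<subseteq> Nx D G (x i)" "\<And>i. i < m \<Longrightarrow> infinite (Ax D G (x i))"
    and N: "\<And>i. i < m \<Longrightarrow> finite (cls (Nx D G (x i)) (lco G (Ax D G (x i))))" "\<And>i. i < m \<Longrightarrow>
        Nx D G (x i) \<noteq> carrier G"
    and TI: "\<And>i g w. i < m \<Longrightarrow> g \<in> carrier G \<Longrightarrow> w \<in> Ax D G (x i) \<Longrightarrow> w \<notin> Z \<Longrightarrow> cj G g w \<in> Ax D G (x i) \<Longrightarrow>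
        g \<in> Nx D G (x i)"
    and cov: "\<And>y. y \<in> carrier G \<Longrightarrow> y \<in> Z \<or> (\<exists>i<m. \<exists>g\<in>carrier G. cj G g y \<in> Ax D G (x i)) \<or>
        (\<exists>j<r. \<exists>g\<in>carrier G. cj G g y = u j)"
    and d1: "\<And>i i' g w. i < m \<Longrightarrow> i' < m \<Longrightarrow> i \<noteq> i' \<Longrightarrow> g \<in> carrier G \<Longrightarrow> w \<in> Ax D G (x i) \<Longrightarrow> w \<notin> Z \<Longrightarrow>
        cj G g w \<notin> Ax D G (x i')"
    and d2: "\<And>i j g. i < m \<Longrightarrow> j < r \<Longrightarrow> g \<in> carrier G \<Longrightarrow> cj G g (u j) \<notin> Ax D G (x i)"
    and d3: "\<And>j. j < r \<Longrightarrow> u j \<notin> Z"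
    and d4: "\<And>j j' g. j < r \<Longrightarrow> j' < r \<Longrightarrow> j \<noteq> j' \<Longrightarrow> g \<in> carrier G \<Longrightarrow> cj G g (u j) \<noteq> u j'"
    and finC: "\<And>j. j < r \<Longrightarrow> finite (cen G (u j))"
  shows False
proof -
  interpret group G by (rule grp)
  interpret S: section_group G "carrier G" "{\<one>\<^bsub>G\<^esub>}" by unfold_locales (rule secn_triv)
  define t where "t i = (if i < m then x i else if i < m + r then u (i - m) else \<one>\<^bsub>G\<^esub>)" for i
  have t: "env G t"
    unfolding env_def t_def using x u[of "i - m" for i] one_closed by (simp split: if_split)
  have tx: "i < m \<Longrightarrow> t i = x i" and tu: "j < r \<Longrightarrow> t (m + j) = u j" for i j by (auto simp: t_def)
  define one where "one = (\<lambda>(M::'a monoid) (s::nat\<Rightarrow>'a). if group M then {\<one>\<^bsub>M\<^esub>} else {})"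
  have one: "fof one" unfolding one_def by (rule fof_one)
  define Zf where "Zf = (\<lambda>(M::'a monoid) s. Zd D1 M (carrier M) (one M s))"
  have Zf: "fof Zf" unfolding Zf_def by (rule fof_Zd[OF fof_carrier one])
  have ZG: "Zf G t = Z" unfolding Zf_def one_def Z(1) by (simp only: grp if_True)
  have fA: "fof (\<lambda>M s. Ax D M (s i))" for i by (rule fof_Ax[OF ft_var])
  have fN: "fof (\<lambda>M s. Nx D M (s i))" for i by (rule fof_Nx[OF ft_var])
  have fC: "fof (\<lambda>M s. cen M (s i))" for i by (rule fof_cen[OF ft_var])
  obtain H :: "nat \<Rightarrow> 'a monoid" and s where Hs: "(\<forall>k. group (H k) \<and> finite (carrier (H k)) \<and>
      env (H k) (s k)) \<and>
    (\<forall>P. fo P \<longrightarrow> P G t \<longrightarrow> eventually (\<lambda>k. P (H k) (s k)) sequentially)"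
    using finite_approximation[OF pf t] by (elim exE)
  have H: "group (H k)" "finite (carrier (H k))" "env (H k) (s k)" for k using conjunct1[OF Hs] by simp_all
  note ev = conjunct2[OF Hs, rule_format]
  define z where "z = card Z"
  have "\<one>\<^bsub>G\<^esub> \<in> Z" using S.one_Zd[OF D1] by (simp add: Z)
  then have z0: "z > 0" using Z(2) by (auto simp: z_def card_gt_0_iff)
  define c where "c i = card (cls (Nx D G (x i)) (lco G (Ax D G (x i))))" for i
  define e where "e j = card (cen G (u j))" for j
  define q where "q = 1 - (\<Sum>i<m. 1 / real (c i)) - (\<Sum>j<r. 1 / real (e j))"
  define P1 where "P1 = (\<lambda>(M::'a monoid) (s::nat \<Rightarrow> 'a). nge z (Zf M s) (=) \<and> \<not> nge (Suc z) (Zf M s) (=))"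
  have f1: "fo P1" unfolding P1_def
    by (intro fo_conj fo_neg fo_card Zf)
  have g1: "P1 G t" using Z(2) by (simp add: P1_def ZG z_def nge_card)
  define P2 where "P2 = (\<lambda>(M::'a monoid) (s::nat \<Rightarrow> 'a). \<forall>i<m. subgroup (Ax D M (s i)) M \<and>
      Zf M s \<subseteq> Ax D M (s i) \<and> Ax D M (s i) \<subseteq> Nx D M (s i))"
  have f2: "fo P2" unfolding P2_def
    by (intro fo_all_less fo_conj fo_subgroup fo_subset fA fN Zf)
  have g2: "P2 G t" using A(1-3) by (simp add: P2_def ZG tx)
  define P3 where "P3 = (\<lambda>(M::'a monoid) (s::nat \<Rightarrow> 'a). \<forall>i<m. \<forall>g\<in>carrier M. \<forall>w\<in>carrier M. w \<in> Ax D M (s i) \<longrightarrow> w \<notin> Zf M s \<longrightarrow>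
      g \<otimes>\<^bsub>M\<^esub> w \<otimes>\<^bsub>M\<^esub> inv\<^bsub>M\<^esub> g \<in> Ax D M (s i) \<longrightarrow> g \<in> Nx D M (s i))"
  have f3: "fo P3" unfolding P3_def
    by (intro fo_all_less fo_all fo_imp fo_neg fo_mem[OF fA, where u =
        "\<lambda>M s i. s (Suc (Suc i))"] fo_mem[OF fN, where u = "\<lambda>M s i. s (Suc (Suc i))"]
    fo_mem[OF Zf] ft.intros)
  have g3: "P3 G t" unfolding P3_def ZG using TI tx by (simp add: cj_def)
  define P4 where "P4 = (\<lambda>(M::'a monoid) (s::nat \<Rightarrow> 'a). \<forall>i<m. nge (c i) (Nx D M (s i)) (lco M (Ax D M (s i))) \<and>
      \<not> nge (Suc (c i)) (Nx D M (s i)) (lco M (Ax D M (s i))))"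
  have f4: "fo P4" unfolding P4_def
    by (intro fo_all_less fo_conj fo_neg fo_index fA fN)
  have g4: "P4 G t" unfolding P4_def
  proof (intro allI impI)
    fix i assume i: "i < m"
    have "equ (Nx D G (x i)) (lco G (Ax D G (x i)))"
      by (rule equ_lco'[OF A(1)[OF i] subgroup.subset[OF Nx_subgroup]])
    from iffD1[OF cls_card_iff[OF this N(1)[OF i], of "c i"]]
    show "nge (c i) (Nx D G (t i)) (lco G (Ax D G (t i))) \<and>
        \<not> nge (Suc (c i)) (Nx D G (t i)) (lco G (Ax D G (t i)))"
      by (simp add: tx[OF i] c_def)
  qed
  define P5 where "P5 = (\<lambda>(M::'a monoid) (s::nat \<Rightarrow> 'a). \<forall>i<m. \<exists>g\<in>carrier M. g \<notin> Nx D M (s i))"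
  have f5: "fo P5" unfolding P5_def
    by (intro fo_all_less fo_ex fo_neg fo_mem[OF fN, where u = "\<lambda>M s i. s (Suc i)"] ft_var)
  have g5: "P5 G t" unfolding P5_def using N(2) subgroup.subset[OF Nx_subgroup] tx
      by (metis subsetI subset_antisym)
  define P7 where "P7 = (\<lambda>(M::'a monoid) (s::nat \<Rightarrow> 'a). \<forall>y\<in>carrier M. y \<in> Zf M s \<or>
      (\<exists>i<m. \<exists>g\<in>carrier M. g \<otimes>\<^bsub>M\<^esub> y \<otimes>\<^bsub>M\<^esub> inv\<^bsub>M\<^esub> g \<in> Ax D M (s i)) \<or>
      (\<exists>j<r. \<exists>g\<in>carrier M. g \<otimes>\<^bsub>M\<^esub> y \<otimes>\<^bsub>M\<^esub> inv\<^bsub>M\<^esub> g = s (m + j)))"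
  have f7: "fo P7" unfolding P7_def
    by (intro fo_all fo_disj fo_ex_less fo_ex fo_eq fo_mem[OF Zf] fo_mem[OF fA, where u =
        "\<lambda>M s i. s (Suc (Suc i))"] ft.intros)
  have g7: "P7 G t" unfolding P7_def
  proof
    fix y assume "y \<in> carrier G"
    from cov[OF this, unfolded cj_def] show "y \<in> Zf G t \<or>
      (\<exists>i<m. \<exists>g\<in>carrier G. g \<otimes>\<^bsub>G\<^esub> y \<otimes>\<^bsub>G\<^esub> inv\<^bsub>G\<^esub> g \<in> Ax D G (t i)) \<or>
      (\<exists>j<r. \<exists>g\<in>carrier G. g \<otimes>\<^bsub>G\<^esub> y \<otimes>\<^bsub>G\<^esub> inv\<^bsub>G\<^esub> g = t (m + j))"
      unfolding ZG using tx tu by metis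
  qed
  define P8 where "P8 = (\<lambda>(M::'a monoid) (s::nat \<Rightarrow> 'a). \<forall>i<m. \<forall>i'<m. i \<noteq> i' \<longrightarrow>
      (\<forall>g\<in>carrier M. \<forall>w\<in>carrier M. w \<in> Ax D M (s i) \<longrightarrow> w \<notin> Zf M s \<longrightarrow>
      g \<otimes>\<^bsub>M\<^esub> w \<otimes>\<^bsub>M\<^esub> inv\<^bsub>M\<^esub> g \<notin> Ax D M (s i')))"
  have f8: "fo P8" unfolding P8_def
    by (intro fo_all_less fo_all fo_imp fo_const fo_neg fo_mem[OF fA, where u =
        "\<lambda>M s i. s (Suc (Suc i))"] fo_mem[OF Zf] ft.intros)
  have g8: "P8 G t" unfolding P8_def ZG using d1 tx by (simp add: cj_def)
  define P9 where "P9 = (\<lambda>(M::'a monoid) (s::nat \<Rightarrow> 'a). \<forall>j<r. s (m + j) \<notin> Zf M s \<and>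
      nge (e j) (cen M (s (m + j))) (=) \<and> \<not> nge (Suc (e j)) (cen M (s (m + j))) (=) \<and>
      (\<forall>i<m. \<forall>g\<in>carrier M. g \<otimes>\<^bsub>M\<^esub> s (m + j) \<otimes>\<^bsub>M\<^esub> inv\<^bsub>M\<^esub> g \<notin> Ax D M (s i)) \<and>
      (\<forall>j'<r. j \<noteq> j' \<longrightarrow> (\<forall>g\<in>carrier M. g \<otimes>\<^bsub>M\<^esub> s (m + j) \<otimes>\<^bsub>M\<^esub> inv\<^bsub>M\<^esub> g \<noteq> s (m + j'))))"
  have f9: "fo P9" unfolding P9_def
    by (intro fo_all_less fo_conj fo_all fo_imp fo_const fo_neg fo_card fC fo_mem[OF fA, where u =
        "\<lambda>M s i. s (Suc i)"]
    fo_mem[OF Zf] fo_eq ft.intros)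
  have g9: "P9 G t" unfolding P9_def ZG using d2 d3 d4 finC by (simp add: cj_def tx tu e_def nge_card)
  have e6: "eventually (\<lambda>k. (\<forall>i<m. nge n (Ax D (H k) (s k i)) (=)) \<and>
      nge n (carrier (H k)) (=)) sequentially" for n
    by (rule ev[of "\<lambda>M s. (\<forall>i<m. nge n (Ax D M (s i)) (=)) \<and> nge n (carrier M) (=)"])
      (intro fo_all_less fo_conj fo_card fA fof_carrier, use A(4) inf in \<open>simp add: tx nge_card\<close>)
  have main: "\<exists>n a. n > real l \<and> (\<forall>i<m. a i > real l \<and> a i < n) \<and> q =
      real z * (1 / n - (\<Sum>i<m. 1 / a i))" for l :: nat
  proof -
    obtain k where hk: "((\<forall>i<m. nge (Suc l) (Ax D (H k) (s k i)) (=)) \<and> nge (Suc l) (carrier (H k)) (=)) \<and>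
      P1 (H k) (s k) \<and> P2 (H k) (s k) \<and> P3 (H k) (s k) \<and> P4 (H k) (s k) \<and> P5 (H k) (s k) \<and> P7 (H k) (s k) \<and>
      P8 (H k) (s k) \<and> P9 (H k) (s k)"
      using eventually_happens'[OF sequentially_bot
      eventually_conj[OF e6[of "Suc l"] eventually_conj[OF ev[OF f1 g1] eventually_conj[OF ev[OF f2 g2]
      eventually_conj[OF ev[OF f3 g3] eventually_conj[OF ev[OF f4 g4] eventually_conj[OF ev[OF f5 g5]
      eventually_conj[OF ev[OF f7 g7] eventually_conj[OF ev[OF f8 g8] ev[OF f9 g9]]]]]]]]]]
      by (elim exE)
    note k6 = conjunct1[OF hk] and h1 = conjunct2[OF hk]
    note k1 = conjunct1[OF h1, unfolded P1_def, rule_format] and h2 = conjunct2[OF h1]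
    note k2 = conjunct1[OF h2, unfolded P2_def, rule_format] and h3 = conjunct2[OF h2]
    note k3 = conjunct1[OF h3, unfolded P3_def, rule_format] and h4 = conjunct2[OF h3]
    note k4 = conjunct1[OF h4, unfolded P4_def, rule_format] and h5 = conjunct2[OF h4]
    note k5 = conjunct1[OF h5, unfolded P5_def, rule_format] and h6 = conjunct2[OF h5]
    note k7 = conjunct1[OF h6, unfolded P7_def, rule_format] and h8 = conjunct2[OF h6]
    note k8 = conjunct1[OF h8, unfolded P8_def, rule_format] 
    note k9 = conjunct2[OF h8, unfolded P9_def, rule_format]
    interpret T: group "H k" by (rule H(1))
    note fin = H(2)[of k]
    let ?Z = "Zf (H k) (s k)"
    let ?A = "\<lambda>i. Ax D (H k) (s k i)" and ?N = "\<lambda>i. Nx D (H k) (s k i)"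
    have sc: "s k i \<in> carrier (H k)" for i using H(3)[of k] by simp
    have ZT: "?Z = Zd D1 (H k) (carrier (H k)) {\<one>\<^bsub>H k\<^esub>}" by (simp add: Zf_def one_def H(1))
    have Zc: "?Z \<subseteq> carrier (H k)" by (auto simp: ZT Zd_def)
    have Nc: "?N i \<subseteq> carrier (H k)" for i by (rule subgroup.subset[OF T.Nx_subgroup])
    have Ac: "?A i \<subseteq> carrier (H k)" for i by (auto simp: Ax_def)
    have cZ: "card ?Z = z" using k1 finite_subset[OF Zc fin] by (simp add: nge_card)
    have cN: "card (cls (?N i) (lco (H k) (?A i))) = c i" if "i < m" for i
    proof -
      have "equ (?N i) (lco (H k) (?A i))" using T.equ_lco'[OF _ Nc] k2[OF that] by blast
      moreover have "finite (cls (?N i) (lco (H k) (?A i)))" using finite_subset[OF Nc fin]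
          by (simp add: cls_def)
      ultimately show ?thesis using cls_card_iff k4[OF that] by blast
    qed
    have cC: "card (cen (H k) (s k (m + j))) = e j" if "j < r" for j
    proof -
      have "finite (cen (H k) (s k (m + j)))" using fin by (simp add: cen_def)
      then show ?thesis using k9[OF that] by (simp add: nge_card)
    qed
    have eqn: "1 = real (card ?Z) / real (card (carrier (H k))) +
      (\<Sum>i<m. 1 / real (card (cls (?N i) (lco (H k) (?A i)))) - real (card ?Z) / real (card (?N i))) +
      (\<Sum>j<r. 1 / real (card (cen (H k) (s k (m + j)))))"
    proof (rule T.line_class_equation[OF fin Zc, where A = ?A and N = ?N and u = "\<lambda>j. s k (m + j)"])
      show "cj (H k) g w \<in> ?Z \<longleftrightarrow> w \<in> ?Z" if "g \<in> carrier (H k)" "w \<in> carrier (H k)" for g w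
        unfolding ZT by (rule T.Zd_cj[OF that])
      show "subgroup (?N i) (H k)" for i by (rule T.Nx_subgroup)
      show "cj (H k) g w \<in> ?A i" if "g \<in> ?N i" "w \<in> ?A i" for i g w
        using T.NxD[OF that(1)] that(2) Ac by blast
      show "g \<in> ?N i" if "i < m" "g \<in> carrier (H k)" "w \<in> ?A i" "w \<notin> ?Z" "cj (H k) g w \<in> ?A i" for i g w
        using k3[OF that(1,2) _ that(3,4)] that(3,5) Ac unfolding cj_def by blast
      show "y \<in> ?Z \<or> (\<exists>i<m. \<exists>g\<in>carrier (H k). cj (H k) g y \<in> ?A i) \<or>
          (\<exists>j<r. \<exists>g\<in>carrier (H k). cj (H k) g y = s k (m + j))"
        if "y \<in> carrier (H k)" for y using k7[OF that] unfolding cj_def .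
      show "cj (H k) g w \<notin> ?A i'" if "i < m" "i' < m" "i \<noteq> i'" "g \<in> carrier (H k)" "w \<in> ?A i" "w \<notin> ?Z"
          for i i' g w
        using k8[OF that(1,2,3,4) _ that(5,6)] that(5) Ac unfolding cj_def by blast
      show "cj (H k) g (s k (m + j)) \<notin> ?A i" if "i < m" "j < r" "g \<in> carrier (H k)" for i j g
        using k9[OF that(2)] that unfolding cj_def by blast
      show "cj (H k) g (s k (m + j)) \<noteq> s k (m + j')" if "j < r" "j' < r" "j \<noteq> j'" "g \<in> carrier (H k)"
          for j j' g
        using k9[OF that(1)] that unfolding cj_def by blast
    qed (use k2 k9 sc in simp_all)
    let ?n = "real (card (carrier (H k)))" and ?a = "\<lambda>i. real (card (?N i))"
    have q1: "q = real z * (1 / ?n - (\<Sum>i<m. 1 / ?a i))"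
    proof -
      have "(\<Sum>i<m. 1 / real (card (cls (?N i) (lco (H k) (?A i)))) - real (card ?Z) / ?a i) =
        (\<Sum>i<m. 1 / real (c i) - real z * (1 / ?a i))"
        by (intro sum.cong) (simp_all add: cN cZ)
      also have "\<dots> = (\<Sum>i<m. 1 / real (c i)) - real z * (\<Sum>i<m. 1 / ?a i)"
        by (simp add: sum_subtractf sum_distrib_left)
      finally have "1 = real z / ?n + ((\<Sum>i<m. 1 / real (c i)) - real z * (\<Sum>i<m. 1 / ?a i)) + (\<Sum>j<r. 1 / real (e j))"
        using eqn cC cZ by simp
      then show ?thesis by (simp add: q_def right_diff_distrib)
    qed
    have n1: "?n > real l" using k6 fin by (simp add: nge_card)
    have a1: "?a i > real l \<and> ?a i < ?n" if i: "i < m" for i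
    proof
      have "card (?A i) \<ge> Suc l" using k6 i finite_subset[OF Ac fin] by (simp add: nge_card)
      moreover have "card (?A i) \<le> card (?N i)" using k2[OF i]
          by (intro card_mono finite_subset[OF Nc fin]) simp
      ultimately show "?a i > real l" by simp
      obtain g where "g \<in> carrier (H k)" "g \<notin> ?N i" using k5[OF i] by blast
      then have "?N i \<subset> carrier (H k)" using Nc by blast
      then show "?a i < ?n" using psubset_card_mono[OF fin] by simp
    qed
    show ?thesis by (rule exI[of _ ?n], rule exI[of _ ?a], intro conjI[OF n1 conjI[OF _ q1]] allI impI a1)
  qed
  show False
    by (rule no_infinitesimal_class_equation[of "real z" m q, OF _ main]) (use z0 in simp)
qed

end

lemma finite_cls_subset:
  assumes "equ X E" "Y \<subseteq> X" "finite (cls X E)" shows "finite (cls Y E)"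
proof -
  have "finite (cls Y E) \<and> card (cls Y E) \<le> card (cls X E)"
  proof (rule cls_bound[OF equ_subset[OF assms(1,2)] assms(3), of "\<lambda>x. {z \<in> X. E x z}"])
    show "x \<in> Y \<Longrightarrow> {z \<in> X. E x z} \<in> cls X E" for x using assms(2) by (auto simp: cls_def)
    show "x \<in> Y \<Longrightarrow> y \<in> Y \<Longrightarrow> {z \<in> X. E x z} = {z \<in> X. E y z} \<Longrightarrow> E x y" for x y
      by (rule cls_eqD[OF assms(1,2)])
  qed
  then show ?thesis ..
qed

section \<open>Commensurability and the FC-centre\<close>

context group begin

lemma cls_lco_Int:
  assumes "subgroup K G" "X \<subseteq> K" shows "cls X (lco G (K \<inter> H)) = cls X (lco G H)"
proof -
  have "lco G (K \<inter> H) x y \<longleftrightarrow> lco G H x y" if "x \<in> X" "y \<in> X" for x y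
    using subgroup.m_closed[OF assms(1) subgroup.m_inv_closed[OF assms(1), of x], of y] that assms(2)
        by (auto simp: lco_def)
  then have "{y \<in> X. lco G (K \<inter> H) x y} = {y \<in> X. lco G H x y}" if "x \<in> X" for x using that by blast
  then show ?thesis by (simp add: cls_def)
qed

lemma lco_one: "x \<in> carrier G \<Longrightarrow> y \<in> carrier G \<Longrightarrow> lco G {\<one>} x y \<longleftrightarrow> x = y"
  using mult_inv_cancel[of x y] by (auto simp: lco_def)

lemma cls_lco_one:
  assumes "X \<subseteq> carrier G" shows "cls X (lco G {\<one>}) = cls X (=)"
proof -
  have "{y \<in> X. lco G {\<one>} x y} = {y \<in> X. x = y}" if "x \<in> X" for x using that assms lco_one[of x] by blast
  then show ?thesis by (simp add: cls_def)
qed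

lemma finite_cls_lco_one: "X \<subseteq> carrier G \<Longrightarrow> finite (cls X (lco G {\<one>})) \<longleftrightarrow> finite X"
  by (simp add: cls_lco_one cls_eq finite_image_iff)

text \<open>Otherwise the trivial subgroup would have finite index in \<open>K\<close>.\<close>

lemma infinite_lco_Int:
  assumes K: "subgroup K G" and H: "subgroup H G" and "infinite K" "finite (cls K (lco G H))"
  shows "infinite (K \<inter> H)"
proof
  assume f: "finite (K \<inter> H)"
  have KH: "subgroup (K \<inter> H) G" by (rule subgroups_Inter_pair[OF K H])
  have "finite (cls K (lco G (K \<inter> H)))" using assms(4) cls_lco_Int[OF K subset_refl] by simp
  moreover have "finite (cls (K \<inter> H) (lco G {\<one>}))" using f by (simp add: cls_def)
  ultimately have "finite (cls K (lco G {\<one>}))"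
    using lco_finite_mult[OF KH triv_subgroup _ subgroup.subset[OF K]] subgroup.one_closed[OF KH] by blast
  then show False using assms(3) finite_cls_lco_one[OF subgroup.subset[OF K]] by simp
qed

text \<open>Transitivity of containment up to finite index. The groups need not be nested, so
  indices are multiplied along \<open>X\<close>, \<open>X \<inter> Y\<close> and
  \<open>X \<inter> Y \<inter> H\<close>.\<close>

lemma lco_finite_trans:
  assumes H: "subgroup H G" and H': "subgroup H' G" and X: "subgroup X G" and Y: "subgroup Y G"
    and f: "finite (cls X (lco G Y))" "finite (cls Y (lco G H))"
  shows "finite (cls X (lco G H))"
proof -
  have XY: "subgroup (X \<inter> Y) G" and XYH: "subgroup (X \<inter> Y \<inter> H) G" by (intro subgroups_Inter_pair X Y H)+
  have "finite (cls X (lco G (X \<inter> Y)))" using f(1) cls_lco_Int[OF X subset_refl] by simp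
  moreover have "finite (cls (X \<inter> Y) (lco G H))"
      using lco_finite_subset[OF H _ subgroup.subset[OF Y] f(2)] by blast
  then have "finite (cls (X \<inter> Y) (lco G (X \<inter> Y \<inter> H)))" using cls_lco_Int[OF XY subset_refl] by simp
  ultimately have "finite (cls X (lco G (X \<inter> Y \<inter> H)))"
    using lco_finite_mult[OF XY XYH _ subgroup.subset[OF X]] by blast
  then show ?thesis using lco_finite_mono[OF XYH H _ subgroup.subset[OF X]] by blast
qed

lemma cen_mult: "x \<in> carrier G \<Longrightarrow> y \<in> carrier G \<Longrightarrow> cen G x \<inter> cen G y \<subseteq> cen G (x \<otimes> y)"
proof
  fix z assume a: "x \<in> carrier G" "y \<in> carrier G" "z \<in> cen G x \<inter> cen G y"
  then have z: "z \<in> carrier G" "x \<in> cen G z" "y \<in> cen G z" using cen_sym by (auto simp: cen_def)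
  then have "x \<otimes> y \<in> cen G z" using subgroup.m_closed[OF cen_subgroup] by blast
  then show "z \<in> cen G (x \<otimes> y)" using a z by (auto simp: cen_def)
qed

lemma cen_inv: "x \<in> carrier G \<Longrightarrow> cen G x \<subseteq> cen G (inv x)"
proof
  fix z assume a: "x \<in> carrier G" "z \<in> cen G x"
  then have z: "z \<in> carrier G" "x \<in> cen G z" by (auto simp: cen_def)
  then have "inv x \<in> cen G z" using subgroup.m_inv_closed[OF cen_subgroup] by blast
  then show "z \<in> cen G (inv x)" using a z by (auto simp: cen_def)
qed

text \<open>The FC-centre: by orbit-stabiliser, the elements with finitely many conjugates.\<close>

definition FC :: "'a set" where "FC = {x \<in> carrier G. finite (cls (carrier G) (lco G (cen G x)))}"

lemma FC_subgroup: "subgroup FC G"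
proof (rule subgroup.intro)
  show "FC \<subseteq> carrier G" by (auto simp: FC_def)
  have "cen G \<one> = carrier G" by (auto simp: cen_def)
  moreover have "{y \<in> carrier G. lco G (carrier G) x y} = carrier G" if "x \<in> carrier G" for x
    using that by (auto simp: lco_def)
  ultimately show "\<one> \<in> FC" by (simp add: FC_def cls_def image_constant_conv)
  fix x assume x: "x \<in> FC"
  then have xc: "x \<in> carrier G" and fx: "finite (cls (carrier G) (lco G (cen G x)))" by (auto simp: FC_def)
  show "inv x \<in> FC"
    using xc fx lco_finite_mono[OF cen_subgroup[OF xc] cen_subgroup[OF inv_closed[OF xc]] cen_inv[OF xc] subset_refl]
    by (simp add: FC_def)
  fix y assume y: "y \<in> FC"
  then have yc: "y \<in> carrier G" and fy: "finite (cls (carrier G) (lco G (cen G y)))" by (auto simp: FC_def)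
  have "finite (cls (carrier G) (lco G (cen G x \<inter> cen G y)))"
    by (rule lco_finite_Int[OF cen_subgroup[OF xc] cen_subgroup[OF yc] subset_refl fx fy])
  then show "x \<otimes> y \<in> FC"
    using xc yc lco_finite_mono[OF subgroups_Inter_pair[OF cen_subgroup[OF xc] cen_subgroup[OF yc]]
      cen_subgroup[OF m_closed[OF xc yc]] cen_mult[OF xc yc] subset_refl] by (simp add: FC_def)
qed

end

context dim_theory begin

lemma mdef_empty: "group M \<Longrightarrow> mdef M {}"
  using mdefI[OF fo_const[of False], of M "\<lambda>_. \<one>\<^bsub>M\<^esub>"] by (simp add: env_def group_one)

lemma dge_UN:
  fixes n :: nat
  assumes "\<And>i. i < n \<Longrightarrow> mdef G (X i)"
  shows "mdef G (\<Union>i<n. X i) \<and> (dge G (\<Union>i<n. X i) d \<longrightarrow> (\<exists>i<n. dge G (X i) d))"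
  using assms
proof (induction n)
  case 0 then show ?case using dge_empty[OF model_G] mdef_empty[OF grp] by simp
next
  case (Suc n)
  have IH: "mdef G (\<Union>i<n. X i)" "dge G (\<Union>i<n. X i) d \<Longrightarrow> \<exists>i<n. dge G (X i) d" using Suc by auto
  have X: "mdef G (X n)" using Suc by simp
  have e: "(\<Union>i<Suc n. X i) = (\<Union>i<n. X i) \<union> X n" by (auto simp: lessThan_Suc)
  show ?case unfolding e using mdef_Un[OF grp IH(1) X] dge_Un[OF model_G IH(1) X, of d] IH(2) less_Suc_eq by blast
qed

end

section \<open>Pseudofinite groups of dimension 2\<close>

locale dim2 = dim_theory +
  assumes pf: "pseudofinite G" and dge2: "dge G (carrier G) 2"
      and not3: "\<not> dge G (carrier G) (Suc (Suc (Suc 0)))"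

sublocale dim2 \<subseteq> group G by (rule grp)

context dim2 begin

text \<open>Otherwise an elementary extension contains an infinite
  \<open>cen M x \<inter> cen M y\<close> of infinite index in \<open>cen M x\<close>, itself of
  infinite index in \<open>M\<close>. Infinity gives dimension 1 and each infinite index adds one,
  against dimension 2.\<close>

lemma centraliser_bound:
  "\<exists>D. \<forall>x\<in>carrier G. \<forall>y\<in>carrier G. \<not> nge D (carrier G) (lco G (cen G x)) \<or>
     \<not> nge D (cen G x) (lco G (cen G x \<inter> cen G y)) \<or> \<not> nge D (cen G x \<inter> cen G y) (=)"
proof (rule ccontr)
  assume "\<not> ?thesis"
  then have "\<forall>D. \<exists>x y. x \<in> carrier G \<and> y \<in> carrier G \<and> nge D (carrier G) (lco G (cen G x)) \<and>
     nge D (cen G x) (lco G (cen G x \<inter> cen G y)) \<and> nge D (cen G x \<inter> cen G y) (=)" by blast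
  then obtain x y where xc: "\<And>D. x D \<in> carrier G" and yc: "\<And>D. y D \<in> carrier G"
    and n1: "\<And>D. nge D (carrier G) (lco G (cen G (x D)))"
    and n2: "\<And>D. nge D (cen G (x D)) (lco G (cen G (x D) \<inter> cen G (y D)))"
    and n3: "\<And>D. nge D (cen G (x D) \<inter> cen G (y D)) (=)" by metis
  \<comment> \<open>A parameter-free environment, by which the dimension of the whole group is
    compared between \<open>G\<close> and the extension.\<close>
  define b where "b = (\<lambda>i::nat. \<one>\<^bsub>G\<^esub>)"
  have b: "env G b" by (simp add: b_def env_def)
  have ex: "env G (x k ## y k ## b)" for k using b xc yc by simp
  obtain M s where M: "model M" "env M s"
    and ev: "\<And>P. fo P \<Longrightarrow> eventually (\<lambda>k. P G (x k ## y k ## b)) sequentially \<Longrightarrow> P M s"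
    by (rule elementary_extension_G[of "\<lambda>k. x k ## y k ## b", OF ex]) (rule that)
  interpret T: group M by (rule model_group[OF M(1)])
  define b' where "b' = (\<lambda>i. s (Suc (Suc i)))"
  have b': "env M b'" unfolding b'_def by (rule env_comp[OF M(2)])
  have tr: "Q G b \<longleftrightarrow> Q M b'" if Q: "fo Q" for Q
  proof -
    have f: "fo (\<lambda>M s. Q M (\<lambda>i. s (Suc (Suc i))))" by (rule fo_shift[OF Q])
    from ev[OF f] ev[OF fo_neg[OF f]] show ?thesis by (cases "Q G b") (simp_all add: b'_def)
  qed
  have C: "fof (\<lambda>M s. cen M (s 0))" and J: "fof (\<lambda>M s. cen M (s 0) \<inter> cen M (s (Suc 0)))"
    by (intro fof_Int fof_cen ft_var)+
  have sc: "s i \<in> carrier M" for i using M(2) by simp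
  let ?C = "cen M (s 0)" and ?J = "cen M (s 0) \<inter> cen M (s (Suc 0))"
  have sC: "subgroup ?C M" and sJ: "subgroup ?J M"
    by (intro T.subgroups_Inter_pair T.cen_subgroup sc)+
  have "nge n (carrier M) (lco M ?C)" for n
    using ev[OF fo_index[OF fof_carrier C], of n] nge_mono[OF n1, of n]
        by (simp add: eventually_sequentially) blast
  then have i1: "infinite (cls (carrier M) (lco M ?C))" using nge_all[OF T.equ_lco'[OF sC subset_refl]]
      by blast
  have "nge n ?C (lco M ?J)" for n
    using ev[OF fo_index[OF C J], of n] nge_mono[OF n2, of n] by (simp add: eventually_sequentially) blast
  then have i2: "infinite (cls ?C (lco M ?J))"
      using nge_all[OF T.equ_lco'[OF sJ subgroup.subset[OF sC]]] by blast
  have "nge n ?J (=)" for n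
    using ev[OF fo_card[OF J], of n] nge_mono[OF n3, of n] by (simp add: eventually_sequentially) blast
  then have "infinite ?J" using nge_card[of "Suc (card ?J)" ?J] by auto
  then have "dge M ?J (Suc 0)" using dge_1[OF M(1) fof_mdef[OF J M(2)]] by simp
  then have "dge M ?C (Suc (Suc 0))"
    using fof_dge_cosets[OF M C J sJ _ _ i2] subgroup.m_closed[OF sC] by blast
  then have "dge M (carrier M) (Suc (Suc (Suc 0)))"
    using fof_dge_cosets[OF M fof_carrier C sC _ _ i1] subgroup.subset[OF sC] by blast
  then show False using fof_dge_transfer[OF model_G b M(1) b' tr fof_carrier] not3 by simp
qed

text \<open>Definability of the FC-centre amounts to a common bound on the indices of its
  centralisers. If some \<open>x\<close> in it has index at least \<open>D\<close>, the first
  alternative of \<open>centraliser_bound\<close> fails for \<open>x\<close>. The third fails too,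
  as the intersection of two centralisers of finite index is infinite. So the second holds and
  bounds the index of every \<open>cen G y\<close> by \<open>D\<close> times that of
  \<open>cen G x\<close>.\<close>

lemma FC_Zd: "\<exists>D\<ge>2. Zd D G (carrier G) {\<one>\<^bsub>G\<^esub>} = FC"
proof -
  interpret S: section_group G "carrier G" "{\<one>\<^bsub>G\<^esub>}" by unfold_locales (rule secn_triv)
  have SC: "S.C x = cen G x" if "x \<in> carrier G" for x using CN_triv[OF subset_refl that]
      by (auto simp: cen_def)
  let ?i = "\<lambda>x. cls (carrier G) (lco G (cen G x))"
  obtain D where D: "\<And>x y. x \<in> carrier G \<Longrightarrow> y \<in> carrier G \<Longrightarrow> \<not> nge D (carrier G) (lco G (cen G x)) \<or>
     \<not> nge D (cen G x) (lco G (cen G x \<inter> cen G y)) \<or> \<not> nge D (cen G x \<inter> cen G y) (=)"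
    using centraliser_bound by blast
  have ex: "\<exists>B. \<forall>x\<in>FC. card (?i x) \<le> B"
  proof (cases "\<exists>x\<in>FC. nge D (carrier G) (lco G (cen G x))")
    case False
    then show ?thesis using not_nge[OF equ_lco'[OF cen_subgroup subset_refl]]
        by (intro exI[of _ D]) (auto simp: FC_def less_imp_le)
  next
    case True
    then obtain x where x: "x \<in> FC" "x \<in> carrier G" "nge D (carrier G) (lco G (cen G x))"
        by (auto simp: FC_def)
    have "card (?i y) \<le> card (?i x) * D" if y: "y \<in> FC" for y
    proof -
      have yc: "y \<in> carrier G" using y by (simp add: FC_def)
      have J: "subgroup (cen G x \<inter> cen G y) G" by (intro subgroups_Inter_pair cen_subgroup x(2) yc)
      have f: "finite (?i x)" "finite (?i y)" using x y by (auto simp: FC_def)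
      then have "finite (cls (carrier G) (lco G (cen G x \<inter> cen G y)))"
        by (rule lco_finite_Int[OF cen_subgroup[OF x(2)] cen_subgroup[OF yc] subset_refl])
      then have "infinite (cen G x \<inter> cen G y)"
        using infinite_lco_Int[OF subgroup_self J inf] by auto
      then have "\<not> nge D (cen G x) (lco G (cen G x \<inter> cen G y))" using D[OF x(2) yc] x(3)
          by (simp add: nge_card)
      then have c: "finite (cls (cen G x) (lco G (cen G x \<inter> cen G y)))" "card (cls (cen G x) (lco G (cen G x \<inter> cen G y))) < D"
        using not_nge[OF equ_lco'[OF J subgroup.subset[OF cen_subgroup[OF x(2)]]]] by auto
      have m: "finite (cls (carrier G) (lco G (cen G x \<inter> cen G y))) \<and>
        card (cls (carrier G) (lco G (cen G x \<inter> cen G y))) \<le> card (?i x) * card (cls (cen G x) (lco G (cen G x \<inter> cen G y)))"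
        by (rule lco_finite_mult[OF cen_subgroup[OF x(2)] J _ subset_refl f(1) c(1)]) blast
      have "card (?i y) \<le> card (cls (carrier G) (lco G (cen G x \<inter> cen G y)))"
        using lco_finite_mono[OF J cen_subgroup[OF yc] _ subset_refl] m by blast
      also have "\<dots> \<le> card (?i x) * card (cls (cen G x) (lco G (cen G x \<inter> cen G y)))" using m by blast
      also have "\<dots> \<le> card (?i x) * D" using c(2) by simp
      finally show ?thesis .
    qed
    then show ?thesis by blast
  qed
  obtain B where B: "\<And>x. x \<in> FC \<Longrightarrow> card (?i x) \<le> B" using ex by blast
  have "x \<in> Zd (max 2 (Suc B)) G (carrier G) {\<one>\<^bsub>G\<^esub>} \<longleftrightarrow> x \<in> FC" if x: "x \<in> carrier G" for x
  proof
    assume "x \<in> Zd (max 2 (Suc B)) G (carrier G) {\<one>\<^bsub>G\<^esub>}"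
    then have "finite (cls (S.K x) S.eq)" using not_nge[OF S.equA[OF S.KA]] by (simp add: Zd_def)
    then show "x \<in> FC" using S.finite_K_iff[OF x] SC[OF x] x by (simp add: FC_def)
  next
    assume f: "x \<in> FC"
    then have "finite (cls (S.K x) S.eq) \<and> card (cls (S.K x) S.eq) \<le> card (?i x)"
      using S.finite_K[OF x] SC[OF x] by (simp add: FC_def)
    then have "finite (cls (S.K x) S.eq) \<and> card (cls (S.K x) S.eq) < max 2 (Suc B)" using B[OF f]
        by linarith
    then show "x \<in> Zd (max 2 (Suc B)) G (carrier G) {\<one>\<^bsub>G\<^esub>}" using not_nge[OF S.equA[OF S.KA]] x
        by (simp add: Zd_def)
  qed
  moreover have "Zd (max 2 (Suc B)) G (carrier G) {\<one>\<^bsub>G\<^esub>} \<subseteq> carrier G" "FC \<subseteq> carrier G"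
      by (auto simp: Zd_def FC_def)
  ultimately have "Zd (max 2 (Suc B)) G (carrier G) {\<one>\<^bsub>G\<^esub>} = FC" by blast
  then show ?thesis by (intro exI[of _ "max 2 (Suc B)"]) simp
qed

end

lemma (in group) pairwise_inequivalent:
  assumes "subgroup H G" "X \<subseteq> carrier G" "infinite (cls X (lco G H))"
  obtains h where "\<And>i::nat. h i \<in> X" "\<And>i j. i \<noteq> j \<Longrightarrow> inv (h i) \<otimes> h j \<notin> H"
proof -
  have E: "equ X (lco G H)" by (rule equ_lco'[OF assms(1,2)])
  obtain f :: "nat \<Rightarrow> 'a set" where f: "inj f" "range f \<subseteq> cls X (lco G H)"
    using infinite_countable_subset[OF assms(3)] by blast
  then have "\<forall>i. \<exists>x\<in>X. f i = {y \<in> X. lco G H x y}" by (auto simp: cls_def)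
  then obtain h where h: "\<And>i. h i \<in> X" "\<And>i. f i = {y \<in> X. lco G H (h i) y}" by metis
  have "inv (h i) \<otimes> h j \<notin> H" if "i \<noteq> j" for i j
  proof
    assume "inv (h i) \<otimes> h j \<in> H"
    then have a: "lco G H (h i) (h j)" "lco G H (h j) (h i)" using E h(1) by (auto simp: lco_def equ_def)
    have "f i = f j" unfolding h(2) using a E h(1) unfolding equ_def by blast
    then show False using f(1) that by (simp add: inj_eq)
  qed
  then show ?thesis using that h(1) by blast
qed

section \<open>Lines when the FC-centre is finite\<close>

locale lines = dim2 +
  fixes D D1 :: nat
  assumes bound: "\<And>x y. x \<in> carrier G \<Longrightarrow> y \<in> carrier G \<Longrightarrow> \<not> nge D (carrier G) (lco G (cen G x)) \<or>
     \<not> nge D (cen G x) (lco G (cen G x \<inter> cen G y)) \<or> \<not> nge D (cen G x \<inter> cen G y) (=)"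
    and D1: "D1 \<ge> 2" and ZF: "Zd D1 G (carrier G) {\<one>\<^bsub>G\<^esub>} = group.FC G" and finZ: "finite (group.FC G)"
begin

abbreviation A where "A x \<equiv> Ax D G x"
abbreviation N where "N x \<equiv> Nx D G x"
abbreviation Z where "Z \<equiv> FC"

definition L where "L = {x \<in> carrier G - Z. infinite (cen G x)}"

lemma L_carrier: "x \<in> L \<Longrightarrow> x \<in> carrier G" and L_Z: "x \<in> L \<Longrightarrow> x \<notin> Z" and L_inf: "x \<in> L \<Longrightarrow> infinite (cen G x)"
  by (auto simp: L_def)

lemma Ac: "y \<in> A x \<Longrightarrow> y \<in> carrier G" by (simp add: Ax_def)

lemma cens: "x \<in> carrier G \<Longrightarrow> subgroup (cen G x) G" by (rule cen_subgroup)

lemma cenc: "cen G x \<subseteq> carrier G" by (auto simp: cen_def)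

lemma Z_cj: "g \<in> carrier G \<Longrightarrow> z \<in> carrier G \<Longrightarrow> cj G g z \<in> Z \<longleftrightarrow> z \<in> Z"
  using Zd_cj[of g z D1] by (simp add: ZF)

lemma cls_cen: "x \<in> carrier G \<Longrightarrow> cls (cen G x) (lco G (cen G x \<inter> H)) = cls (cen G x) (lco G H)"
  by (rule cls_lco_Int[OF cens subset_refl])

text \<open>Of the three alternatives in \<open>bound\<close>, the first fails because
  \<open>x\<close> is outside \<open>Z\<close> and the third because
  \<open>y \<in> A x\<close>.\<close>

lemma index_A:
  assumes x: "x \<in> carrier G" "x \<notin> Z" and y: "y \<in> A x"
  shows "\<not> nge D (cen G x) (lco G (cen G x \<inter> cen G y))" "finite (cls (cen G x) (lco G (cen G y)))"
proof -
  have "infinite (cls (carrier G) (lco G (cen G x)))" using x by (simp add: FC_def)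
  then have "nge D (carrier G) (lco G (cen G x))"
      using nge_all[OF equ_lco'[OF cens[OF x(1)] subset_refl]] by blast
  then show n: "\<not> nge D (cen G x) (lco G (cen G x \<inter> cen G y))" using bound[OF x(1) Ac[OF y]] y
      by (simp add: Ax_def)
  have "subgroup (cen G x \<inter> cen G y) G" by (intro subgroups_Inter_pair cens x Ac[OF y])
  from not_nge[OF equ_lco'[OF this cenc]] n show "finite (cls (cen G x) (lco G (cen G y)))"
    using cls_cen[OF x(1)] by auto
qed

text \<open>The first-order condition with threshold \<open>D\<close> is traded for finite index,
  from which the subgroup property and the comparison of lines follow. Conversely, finite index in
  the infinite group \<open>cen G x\<close> makes the intersection infinite.\<close>

lemma A_iff:
  assumes x: "x \<in> L" and y: "y \<in> carrier G"
  shows "y \<in> A x \<longleftrightarrow> finite (cls (cen G x) (lco G (cen G y)))"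
proof
  assume "finite (cls (cen G x) (lco G (cen G y)))"
  then have "infinite (cen G x \<inter> cen G y)"
      using infinite_lco_Int[OF cens cens L_inf[OF x]] x y L_carrier by blast
  then show "y \<in> A x" using y by (simp add: Ax_def nge_card)
qed (use index_A(2) L_carrier[OF x] L_Z[OF x] in blast)

lemma not_dge_cen:
  assumes x: "x \<in> carrier G" "x \<notin> Z" shows "\<not> dge G (cen G x) (Suc (Suc 0))"
proof
  assume d: "dge G (cen G x) (Suc (Suc 0))"
  have i: "infinite (cls (carrier G) (lco G (cen G x)))" using x by (simp add: FC_def)
  have e: "env G (\<lambda>_. x)" using x by (simp add: env_def)
  have "dge G (carrier G) (Suc (Suc (Suc 0)))"
    using fof_dge_cosets[OF model_G e fof_carrier fof_cen[OF ft_var[of 0]] cens[OF x(1)] _ d i] cenc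
        by blast
  then show False using not3 by simp
qed

lemma A_subgroup:
  assumes x: "x \<in> L" shows "subgroup (A x) G"
proof (rule subgroup.intro)
  have xc: "x \<in> carrier G" by (rule L_carrier[OF x])
  show "A x \<subseteq> carrier G" using Ac by blast
  have "cen G \<one>\<^bsub>G\<^esub> = carrier G" by (auto simp: cen_def)
  then have "cen G x \<inter> cen G \<one>\<^bsub>G\<^esub> = cen G x" using cenc by blast
  then show "\<one>\<^bsub>G\<^esub> \<in> A x" using L_inf[OF x] by (simp add: Ax_def nge_card)
  fix y assume y: "y \<in> A x"
  have fy: "finite (cls (cen G x) (lco G (cen G y)))" and yc: "y \<in> carrier G"
      using A_iff[OF x Ac[OF y]] y Ac by auto
  show "inv\<^bsub>G\<^esub> y \<in> A x" unfolding A_iff[OF x inv_closed[OF yc]]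
    using lco_finite_mono[OF cens[OF yc] cens[OF inv_closed[OF yc]] cen_inv[OF yc] cenc fy] by blast
  fix z assume z: "z \<in> A x"
  have fz: "finite (cls (cen G x) (lco G (cen G z)))" and zc: "z \<in> carrier G"
      using A_iff[OF x Ac[OF z]] z Ac by auto
  have "finite (cls (cen G x) (lco G (cen G y \<inter> cen G z)))"
      by (rule lco_finite_Int[OF cens[OF yc] cens[OF zc] cenc fy fz])
  then show "y \<otimes>\<^bsub>G\<^esub> z \<in> A x" unfolding A_iff[OF x m_closed[OF yc zc]]
    using lco_finite_mono[OF subgroups_Inter_pair[OF cens[OF yc] cens[OF zc]] cens[OF m_closed[OF yc zc]] cen_mult[OF yc zc] cenc]
    by blast
qed

lemma Z_A: "x \<in> L \<Longrightarrow> Z \<subseteq> A x"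
proof
  fix z assume x: "x \<in> L" and z: "z \<in> Z"
  then have zc: "z \<in> carrier G" and f: "finite (cls (carrier G) (lco G (cen G z)))" by (auto simp: FC_def)
  show "z \<in> A x" unfolding A_iff[OF x zc] using lco_finite_subset[OF cens[OF zc] cenc subset_refl f]
      by blast
qed

lemma self_A: "x \<in> L \<Longrightarrow> x \<in> A x"
  using L_carrier L_inf by (simp add: Ax_def nge_card)

text \<open>The centraliser of \<open>x\<close> is infinite of dimension below 2, so
  \<open>section_centre\<close> applies to it modulo the trivial group. The infinitely many elements
  that it yields centralise subgroups of finite index in \<open>cen G x\<close>, hence lie on the
  line.\<close>

lemma infinite_A:
  assumes x: "x \<in> L" shows "infinite (cen G x \<inter> A x)"
proof -
  have xc: "x \<in> carrier G" by (rule L_carrier[OF x])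
  define b where "b = (\<lambda>_::nat. x)"
  have b: "env G b" using xc by (simp add: b_def env_def)
  define one where "one = (\<lambda>(M::'a monoid) (s::nat\<Rightarrow>'a). if group M then {\<one>\<^bsub>M\<^esub>} else {})"
  have one: "fof one" unfolding one_def by (rule fof_one)
  have C: "fof (\<lambda>M s. cen M (s 0))" by (rule fof_cen[OF ft_var])
  have o: "one G b = {\<one>\<^bsub>G\<^esub>}" "one G (\<lambda>_. x) = {\<one>\<^bsub>G\<^esub>}" unfolding one_def by (simp_all only: grp if_True)
  have "secn G (cen G x) {\<one>\<^bsub>G\<^esub>}" by (rule secn_one[OF cens[OF xc]])
  then have sec: "secn G (cen G (b 0)) (one G b)" by (simp add: o b_def)
  have d: "dge G (one G b) 0" using dge_0[OF model_G fof_mdef[OF one b]] by (simp add: o)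
  have nd: "\<not> dge G (cen G (b 0)) (Suc (Suc 0))" using not_dge_cen[OF xc L_Z[OF x]] by (simp add: b_def)
  have i: "infinite (cls (cen G (b 0)) (lco G (one G b)))"
    using finite_cls_lco_one[OF cenc] L_inf[OF x] by (simp add: o b_def)
  obtain D2 where D2: "infinite (cls (Zd D2 G (cen G (b 0)) (one G b)) (lco G (one G b)))"
     "\<And>y. y \<in> cen G (b 0) \<Longrightarrow> y \<in> Zd D2 G (cen G (b 0)) (one G b) \<longleftrightarrow>
        finite (cls (cen G (b 0)) (lco G (CN G (cen G (b 0)) (one G b) y)))"
    by (rule section_centre[OF pf b C one sec d nd i]) (rule that)
  let ?S = "Zd D2 G (cen G x) {\<one>\<^bsub>G\<^esub>}"
  have S: "?S \<subseteq> cen G x" by (auto simp: Zd_def)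
  have "infinite ?S" using D2(1) finite_cls_lco_one[OF subset_trans[OF S cenc]] by (simp add: o b_def)
  moreover have "y \<in> A x" if y: "y \<in> ?S" for y
  proof -
    have y': "y \<in> cen G x" "y \<in> carrier G" using y S cenc by auto
    then have "finite (cls (cen G x) (lco G (cen G x \<inter> cen G y)))"
      using D2(2)[of y] y CN_triv[OF cenc y'(2)] by (simp add: o b_def)
    then show ?thesis using A_iff[OF x y'(2)] cls_cen[OF xc] by simp
  qed
  ultimately show ?thesis using S by (meson finite_subset le_inf_iff subsetI)
qed

text \<open>Membership in \<open>Ax\<close> is symmetric, so the centralisers of \<open>x\<close>
  and \<open>y\<close> are commensurable, and the line depends only on the centraliser up to
  commensurability.\<close>

lemma A_eq:
  assumes x: "x \<in> L" and y: "y \<in> A x" "y \<notin> Z" shows "y \<in> L" "A y = A x"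
proof -
  have xc: "x \<in> carrier G" and yc: "y \<in> carrier G" using L_carrier[OF x] Ac[OF y(1)] by auto
  have f1: "finite (cls (cen G x) (lco G (cen G y)))" using y(1) by (simp add: A_iff[OF x yc])
  have "infinite (cen G x \<inter> cen G y)" by (rule infinite_lco_Int[OF cens[OF xc] cens[OF yc] L_inf[OF x] f1])
  then show yL: "y \<in> L" using y yc by (auto simp: L_def)
  have "x \<in> A y" using y(1) xc by (simp add: Ax_def Int_commute)
  then have f2: "finite (cls (cen G y) (lco G (cen G x)))" by (simp add: A_iff[OF yL xc])
  have "w \<in> A y \<longleftrightarrow> w \<in> A x" if w: "w \<in> carrier G" for w
    unfolding A_iff[OF x w] A_iff[OF yL w]
    using lco_finite_trans[OF cens[OF w] cens[OF xc] cens[OF yc] cens[OF xc] f2]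
      lco_finite_trans[OF cens[OF w] cens[OF xc] cens[OF xc] cens[OF yc] f1] by blast
  then show "A y = A x" using Ac by blast
qed

text \<open>Take \<open>D\<close> elements \<open>h i\<close> of \<open>cen G x\<close> that are
  pairwise inequivalent modulo the finite group \<open>Z\<close>. For \<open>y\<close> on the line,
  \<open>cen G y\<close> has fewer than \<open>D\<close> cosets in \<open>cen G x\<close>, so
  \<open>y\<close> commutes with some \<open>inv (h i) \<otimes> h j\<close>. Thus the line is
  covered by finitely many centralisers of elements outside \<open>Z\<close>, each of dimension
  below 2.\<close>

lemma not_dge_A:
  assumes x: "x \<in> L" shows "\<not> dge G (A x) (Suc (Suc 0))"
proof
  assume d: "dge G (A x) (Suc (Suc 0))"
  have xc: "x \<in> carrier G" by (rule L_carrier[OF x])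
  have Zs: "subgroup Z G" by (rule FC_subgroup)
  have "infinite (cls (cen G x) (lco G Z))"
  proof
    assume f: "finite (cls (cen G x) (lco G Z))"
    have "infinite (cen G x \<inter> Z)" by (rule infinite_lco_Int[OF cens[OF xc] Zs L_inf[OF x] f])
    then show False using finZ by simp
  qed
  then obtain h where h: "\<And>i::nat. h i \<in> cen G x" "\<And>i j. i \<noteq> j \<Longrightarrow> inv\<^bsub>G\<^esub> (h i) \<otimes>\<^bsub>G\<^esub> h j \<notin> Z"
    using pairwise_inequivalent[OF Zs cenc] by metis
  have hc: "h i \<in> carrier G" for i using h(1) cenc by blast
  define P where "P = {(i, j). i < D \<and> j < D \<and> i \<noteq> j}"
  have "finite P" unfolding P_def by (rule finite_subset[of _ "{..<D} \<times> {..<D}"]) auto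
  then obtain n :: nat and p where p: "P = p ` {..<n}" using finite_imp_nat_seg_image_inj_on
      by (metis lessThan_def)
  define X where "X k = cen G (inv\<^bsub>G\<^esub> (h (fst (p k))) \<otimes>\<^bsub>G\<^esub> h (snd (p k)))" for k
  have env: "env G (\<lambda>_. y)" if "y \<in> carrier G" for y using that by (simp add: env_def)
  have mX: "mdef G (X k)" for k unfolding X_def
    using fof_mdef[OF fof_cen[OF ft_var[of 0]] env[of "inv\<^bsub>G\<^esub> (h (fst (p k))) \<otimes>\<^bsub>G\<^esub> h (snd (p k))"]] hc
        by simp
  have "A x \<subseteq> (\<Union>k<n. X k)"
  proof
    fix y assume y: "y \<in> A x"
    have yc: "y \<in> carrier G" by (rule Ac[OF y])
    let ?E = "lco G (cen G x \<inter> cen G y)"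
    have J: "subgroup (cen G x \<inter> cen G y) G" by (intro subgroups_Inter_pair cens xc yc)
    have E: "equ (cen G x) ?E" by (rule equ_lco'[OF J cenc])
    have c: "finite (cls (cen G x) ?E)" "card (cls (cen G x) ?E) < D"
      using index_A(1)[OF xc L_Z[OF x] y] not_nge[OF E] by auto
    let ?f = "\<lambda>i. {z \<in> cen G x. ?E (h i) z}"
    have "?f ` {..<D} \<subseteq> cls (cen G x) ?E" using h(1) by (auto simp: cls_def)
    then have "card (?f ` {..<D}) < card {..<D}" using le_less_trans[OF card_mono[OF c(1)] c(2)] by simp
    then have "\<not> inj_on ?f {..<D}" by (rule pigeonhole)
    then obtain i j where ij: "i < D" "j < D" "i \<noteq> j" "?f i = ?f j" by (auto simp: inj_on_def)
    have "?E (h i) (h j)" by (rule cls_eqD[OF E subset_refl h(1) h(1) ij(4)])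
    then have "inv\<^bsub>G\<^esub> (h i) \<otimes>\<^bsub>G\<^esub> h j \<in> cen G y" by (simp add: lco_def)
    then have "y \<in> cen G (inv\<^bsub>G\<^esub> (h i) \<otimes>\<^bsub>G\<^esub> h j)" using cen_sym[OF yc, of "inv\<^bsub>G\<^esub> (h i) \<otimes>\<^bsub>G\<^esub> h j"] hc
        by simp
    moreover have "(i, j) \<in> p ` {..<n}" unfolding p[symmetric] P_def using ij(1-3) by simp
    then obtain k where "k < n" "p k = (i, j)" by auto
    ultimately have "y \<in> X k" "k < n" by (auto simp: X_def)
    then show "y \<in> (\<Union>k<n. X k)" by blast
  qed
  then have "dge G (\<Union>k<n. X k) (Suc (Suc 0))"
    using dge_mono[OF model_G _ _ _ d] fof_mdef[OF fof_Ax[OF ft_var[of 0]] env[OF xc]] dge_UN[of n X, OF mX] by auto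
  then obtain k where k: "k < n" "dge G (X k) (Suc (Suc 0))" using dge_UN[of n X, OF mX] by blast
  have "p k \<in> P" using k(1) p by blast
  then have "inv\<^bsub>G\<^esub> (h (fst (p k))) \<otimes>\<^bsub>G\<^esub> h (snd (p k)) \<notin> Z" using h(2) by (auto simp: P_def)
  then show False using not_dge_cen k(2) hc unfolding X_def by simp
qed

lemma L_cj:
  assumes "g \<in> carrier G" "x \<in> L" shows "cj G g x \<in> L"
proof -
  have xc: "x \<in> carrier G" by (rule L_carrier[OF assms(2)])
  have "finite (cj G g ` cen G x) \<longleftrightarrow> finite (cen G x)"
    by (rule finite_image_iff) (rule inj_on_subset[OF cj_inj[OF assms(1)] cenc])
  then show ?thesis using assms xc Z_cj by (simp add: L_def cen_cj)
qed

text \<open>Both \<open>w\<close> and its conjugate determine the line of \<open>x\<close>, and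
  conjugation by \<open>g\<close> carries the line of \<open>w\<close> to that of the
  conjugate.\<close>

lemma line_TI:
  assumes x: "x \<in> L" and g: "g \<in> carrier G" and w: "w \<in> A x" "w \<notin> Z" "cj G g w \<in> A x"
  shows "g \<in> N x"
proof (rule NxI[OF g])
  have wc: "w \<in> carrier G" by (rule Ac[OF w(1)])
  have e: "A w = A x" "A (cj G g w) = A x" using A_eq(2)[OF x] w Z_cj[OF g wc] by auto
  show "v \<in> A x \<longleftrightarrow> cj G g v \<in> A x" if "v \<in> carrier G" for v
    using Ax_cj[OF g wc that, of D] unfolding e by simp
qed

lemma A_N: "x \<in> L \<Longrightarrow> A x \<subseteq> N x"
proof
  fix g assume x: "x \<in> L" and g: "g \<in> A x"
  have gc: "g \<in> carrier G" by (rule Ac[OF g])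
  have s: "subgroup (A x) G" by (rule A_subgroup[OF x])
  show "g \<in> N x"
  proof (rule NxI[OF gc])
    fix v assume v: "v \<in> carrier G"
    show "v \<in> A x \<longleftrightarrow> cj G g v \<in> A x"
    proof
      assume "v \<in> A x" then show "cj G g v \<in> A x" unfolding cj_def
        by (intro subgroup.m_closed[OF s] subgroup.m_inv_closed[OF s] g)
    next
      assume "cj G g v \<in> A x"
      then have "cj G (inv\<^bsub>G\<^esub> g) (cj G g v) \<in> A x" unfolding cj_def[of G "inv\<^bsub>G\<^esub> g"]
        by (intro subgroup.m_closed[OF s] subgroup.m_inv_closed[OF s] g)
      then show "v \<in> A x" using gc v by simp
    qed
  qed
qed

lemma N_cj:
  assumes x: "x \<in> carrier G" and g: "g \<in> carrier G" and n: "n \<in> N x"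
  shows "cj G g n \<in> N (cj G g x)"
proof (rule NxI)
  have nc: "n \<in> carrier G" using n unfolding Nx_def by blast
  show "cj G g n \<in> carrier G" using g nc by simp
  fix v assume v: "v \<in> carrier G"
  let ?v = "cj G (inv\<^bsub>G\<^esub> g) v"
  have vc: "?v \<in> carrier G" using v g by simp
  have "v \<in> A (cj G g x) \<longleftrightarrow> ?v \<in> A x" using Ax_cj[OF g x vc, of D] g v by simp
  also have "\<dots> \<longleftrightarrow> cj G n ?v \<in> A x" by (rule NxD[OF n vc])
  also have "\<dots> \<longleftrightarrow> cj G g (cj G n ?v) \<in> A (cj G g x)" using Ax_cj[OF g x, of "cj G n ?v" D] nc vc by simp
  also have "cj G g (cj G n ?v) = cj G (cj G g n) v" using g nc v by (simp add: cj_def gsimps)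
  finally show "v \<in> A (cj G g x) \<longleftrightarrow> cj G (cj G g n) v \<in> A (cj G g x)" .
qed

text \<open>Suppose \<open>g\<close> moves the line to that of \<open>?x\<close>, so that the two
  meet in \<open>Z\<close> only. Both normalisers have finite index. So there is \<open>b\<close>
  outside \<open>Z\<close> on the second line normalising the first, and an infinite subgroup of
  \<open>cen G x\<close> on the first line normalising the second. Its commutators with
  \<open>b\<close> fall into the finite \<open>Z\<close>, so infinitely many of its elements commute
  with \<open>b\<close>, which puts \<open>b\<close> on the first line.\<close>

lemma line_normal:
  assumes x: "x \<in> L" and f: "finite (cls (carrier G) (lco G (N x)))"
  shows "N x = carrier G"
proof (rule ccontr)
  assume "N x \<noteq> carrier G"
  then obtain g where g: "g \<in> carrier G" "g \<notin> N x" using subgroup.subset[OF Nx_subgroup] by blast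
  have xc: "x \<in> carrier G" by (rule L_carrier[OF x])
  let ?x = "cj G g x"
  have y: "?x \<in> L" by (rule L_cj[OF g(1) x])
  have sN: "subgroup (N x) G" "subgroup (N ?x) G" by (rule Nx_subgroup)+
  have AB: "A x \<inter> A ?x \<subseteq> Z"
  proof
    fix w assume w: "w \<in> A x \<inter> A ?x"
    show "w \<in> Z"
    proof (rule ccontr)
      assume "w \<notin> Z"
      then have e: "A x = A ?x" using A_eq(2)[OF x, of w] A_eq(2)[OF y, of w] w by simp
      have "g \<in> N x" by (rule NxI[OF g(1)]) (use Ax_cj[OF g(1) xc, of _ D] e in simp)
      then show False using g(2) by simp
    qed
  qed
  have fB: "finite (cls (carrier G) (lco G (N ?x)))"
  proof -
    let ?f = "\<lambda>a. {z \<in> carrier G. lco G (N x) (cj G (inv\<^bsub>G\<^esub> g) a) z}"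
    have "finite (cls (carrier G) (lco G (N ?x))) \<and>
        card (cls (carrier G) (lco G (N ?x))) \<le> card (cls (carrier G) (lco G (N x)))"
    proof (rule cls_bound[OF equ_lco'[OF sN(2) subset_refl] f, of ?f])
      show "a \<in> carrier G \<Longrightarrow> ?f a \<in> cls (carrier G) (lco G (N x))" for a using g(1) by (auto simp: cls_def)
      fix a b assume ab: "a \<in> carrier G" "b \<in> carrier G" "?f a = ?f b"
      have "lco G (N x) (cj G (inv\<^bsub>G\<^esub> g) a) (cj G (inv\<^bsub>G\<^esub> g) b)"
        by (rule cls_eqD[OF equ_lco'[OF sN(1) subset_refl] subset_refl _ _ ab(3)]) (use ab g in simp_all)
      then have "cj G g (inv\<^bsub>G\<^esub> (cj G (inv\<^bsub>G\<^esub> g) a) \<otimes>\<^bsub>G\<^esub> cj G (inv\<^bsub>G\<^esub> g) b) \<in> N ?x"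
        unfolding lco_def by (rule N_cj[OF xc g(1)])
      moreover have "cj G g (inv\<^bsub>G\<^esub> (cj G (inv\<^bsub>G\<^esub> g) a) \<otimes>\<^bsub>G\<^esub> cj G (inv\<^bsub>G\<^esub> g) b) = inv\<^bsub>G\<^esub> a \<otimes>\<^bsub>G\<^esub> b"
        using ab g(1) by (simp add: cj_def gsimps)
      ultimately show "lco G (N ?x) a b" by (simp add: lco_def)
    qed
    then show ?thesis ..
  qed
  have sub: "subgroup (cen G x \<inter> A x) G" "subgroup (A ?x) G"
    by (intro subgroups_Inter_pair cens xc A_subgroup x y)+
  have "infinite (A ?x)" using infinite_A[OF y] by auto
  moreover have "finite (cls (A ?x) (lco G (N x)))"
    using lco_finite_subset[OF sN(1) subgroup.subset[OF sub(2)] subset_refl f] by simp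
  ultimately have "infinite (A ?x \<inter> N x)" by (rule infinite_lco_Int[OF sub(2) sN(1)])
  then obtain b where b: "b \<in> A ?x" "b \<in> N x" "b \<notin> Z" using finZ by (meson Int_iff finite_subset subsetI)
  have bc: "b \<in> carrier G" by (rule Ac[OF b(1)])
  let ?Y = "cen G x \<inter> A x \<inter> N ?x"
  have "finite (cls (cen G x \<inter> A x) (lco G (N ?x)))"
    using lco_finite_subset[OF sN(2) subgroup.subset[OF sub(1)] subset_refl fB] by simp
  then have iY: "infinite ?Y" by (rule infinite_lco_Int[OF sub(1) sN(2) infinite_A[OF x]])
  have sY: "subgroup ?Y G" by (rule subgroups_Inter_pair[OF sub(1) sN(2)])
  have Yc: "a \<in> carrier G" if "a \<in> ?Y" for a using that Ac by blast
  have sA: "subgroup (A x) G" by (rule A_subgroup[OF x])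
  \<comment> \<open>The commutator of \<open>a\<close> and \<open>b\<close>, read in two ways: as a
    product of elements of the second line, and as a product of elements of the first.\<close>
  have com: "cj G a b \<otimes>\<^bsub>G\<^esub> inv\<^bsub>G\<^esub> b \<in> Z" if a: "a \<in> ?Y" for a
  proof -
    have ac: "a \<in> carrier G" by (rule Yc[OF a])
    have aA: "a \<in> A x" "a \<in> N ?x" using a by auto
    have "cj G a b \<in> A ?x" using NxD[OF aA(2) bc] b(1) by simp
    then have 1: "cj G a b \<otimes>\<^bsub>G\<^esub> inv\<^bsub>G\<^esub> b \<in> A ?x"
      by (intro subgroup.m_closed[OF sub(2)] subgroup.m_inv_closed[OF sub(2)] b(1))
    have "inv\<^bsub>G\<^esub> a \<in> A x" by (rule subgroup.m_inv_closed[OF sA aA(1)])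
    then have "cj G b (inv\<^bsub>G\<^esub> a) \<in> A x" using NxD[OF b(2), of "inv\<^bsub>G\<^esub> a"] ac by simp
    then have "a \<otimes>\<^bsub>G\<^esub> cj G b (inv\<^bsub>G\<^esub> a) \<in> A x" by (rule subgroup.m_closed[OF sA aA(1)])
    moreover have "a \<otimes>\<^bsub>G\<^esub> cj G b (inv\<^bsub>G\<^esub> a) = cj G a b \<otimes>\<^bsub>G\<^esub> inv\<^bsub>G\<^esub> b" using ac bc
        by (simp add: cj_def m_assoc)
    ultimately show ?thesis using 1 AB by auto
  qed
  have "finite (cls ?Y (lco G (cen G b))) \<and> card (cls ?Y (lco G (cen G b))) \<le> card Z"
  proof (rule cls_bound[OF equ_lco'[OF cens[OF bc] subgroup.subset[OF sY]] finZ, of "\<lambda>a. cj G a b \<otimes>\<^bsub>G\<^esub> inv\<^bsub>G\<^esub> b"])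
    fix a a' assume a: "a \<in> ?Y" "a' \<in> ?Y" "cj G a b \<otimes>\<^bsub>G\<^esub> inv\<^bsub>G\<^esub> b = cj G a' b \<otimes>\<^bsub>G\<^esub> inv\<^bsub>G\<^esub> b"
    have ac: "a \<in> carrier G" "a' \<in> carrier G" using Yc a by auto
    have "cj G a b = cj G a' b" using a(3) right_cancel[OF inv_closed[OF bc] cj_closed[OF ac(1) bc] cj_closed[OF ac(2) bc]] by blast
    then have "cj G (inv\<^bsub>G\<^esub> a) (cj G a' b) = b" using ac bc by (metis cj_inv_cancel(1))
    then have e: "cj G (inv\<^bsub>G\<^esub> a \<otimes>\<^bsub>G\<^esub> a') b = b" using ac bc by (simp add: cj_cj)
    have "inv\<^bsub>G\<^esub> a \<otimes>\<^bsub>G\<^esub> a' \<in> cen G b"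
    proof -
      let ?c = "inv\<^bsub>G\<^esub> a \<otimes>\<^bsub>G\<^esub> a'"
      have cc: "?c \<in> carrier G" using ac by simp
      have "?c \<otimes>\<^bsub>G\<^esub> b = cj G ?c b \<otimes>\<^bsub>G\<^esub> ?c" using cc bc by (simp add: cj_def m_assoc del: inv_mult_group)
      then show ?thesis using e cc by (simp add: cen_def)
    qed
    then show "lco G (cen G b) a a'" by (simp add: lco_def)
  qed (rule com)
  then have "infinite (?Y \<inter> cen G b)" using infinite_lco_Int[OF sY cens[OF bc] iY] by blast
  then have "infinite (cen G x \<inter> cen G b)" by (rule contrapos_nn) (erule finite_subset[rotated], blast)
  then have "b \<in> A x" using bc by (simp add: Ax_def nge_card)
  then show False using AB b by blast
qed

text \<open>The line is infinite, so a second infinite index would lead to dimension 3.\<close>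

lemma finite_N_A:
  assumes x: "x \<in> L" and i: "infinite (cls (carrier G) (lco G (N x)))"
  shows "finite (cls (N x) (lco G (A x)))"
proof (rule ccontr)
  assume j: "infinite (cls (N x) (lco G (A x)))"
  have e: "env G (\<lambda>_. x)" using L_carrier[OF x] by (simp add: env_def)
  note fA = fof_Ax[OF ft_var[of 0], of D] and fN = fof_Nx[OF ft_var[of 0], of D]
  have "infinite (A x)" using infinite_A[OF x] by auto
  then have "dge G (A x) (Suc 0)" using dge_1[OF model_G fof_mdef[OF fA e]] by simp
  then have "dge G (N x) (Suc (Suc 0))"
    using fof_dge_cosets[OF model_G e fN fA A_subgroup[OF x] _ _ j] subgroup.m_closed[OF Nx_subgroup[of D x]] A_N[OF x]
    by blast
  then have "dge G (carrier G) (Suc (Suc (Suc 0)))"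
    using fof_dge_cosets[OF model_G e fof_carrier fN Nx_subgroup _ _ i] subgroup.subset[OF Nx_subgroup[of D x]] by blast
  then show False using not3 by simp
qed

end

section \<open>Conjugacy of lines, and a normal line\<close>

context lines begin

text \<open>Conjugacy of the sets \<open>Ax D M y\<close> and \<open>Ax D M y'\<close>. It is an
  equivalence also on elements with finite centraliser, so a single definable relation covers
  everything outside \<open>Z\<close>.\<close>

definition same_line :: "'a monoid \<Rightarrow> 'a \<Rightarrow> 'a \<Rightarrow> bool" where
  "same_line M y y' \<longleftrightarrow> (\<exists>g\<in>carrier M. \<forall>w\<in>carrier M. w \<in> Ax D M y \<longleftrightarrow> g \<otimes>\<^bsub>M\<^esub> w \<otimes>\<^bsub>M\<^esub> inv\<^bsub>M\<^esub> g \<in> Ax D M y')"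

lemma same_lineI: "g \<in> carrier G \<Longrightarrow> (\<And>w. w \<in> carrier G \<Longrightarrow> w \<in> A y \<longleftrightarrow> cj G g w \<in> A y') \<Longrightarrow> same_line G y y'"
  unfolding same_line_def cj_def by blast

lemma same_lineE:
  assumes "same_line G y y'"
  obtains g where "g \<in> carrier G" "\<And>w. w \<in> carrier G \<Longrightarrow> w \<in> A y \<longleftrightarrow> cj G g w \<in> A y'"
  using assms unfolding same_line_def cj_def by blast

lemma same_line_cj: "x \<in> carrier G \<Longrightarrow> g \<in> carrier G \<Longrightarrow> same_line G x (cj G g x)"
  by (rule same_lineI[of g]) (simp_all add: Ax_cj)

lemma equ_same_line: "equ X (same_line G)" 
  unfolding equ_def
proof (intro conjI ballI impI)
  show "same_line G x x" for x by (rule same_lineI[of "\<one>\<^bsub>G\<^esub>"]) (simp_all add: cj_def)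
  fix x y assume "same_line G x y"
  then obtain g where g: "g \<in> carrier G" "\<And>w. w \<in> carrier G \<Longrightarrow> w \<in> A x \<longleftrightarrow> cj G g w \<in> A y"
      by (rule same_lineE) (rule that)
  show "same_line G y x"
    by (rule same_lineI[of "inv\<^bsub>G\<^esub> g"]) (use g(1) g(2)[of "cj G (inv\<^bsub>G\<^esub> g) w" for w] in simp_all)
  fix z assume "same_line G y z"
  then obtain h where h: "h \<in> carrier G" "\<And>w. w \<in> carrier G \<Longrightarrow> w \<in> A y \<longleftrightarrow> cj G h w \<in> A z"
      by (rule same_lineE) (rule that)
  show "same_line G x z"
    by (rule same_lineI[of "h \<otimes>\<^bsub>G\<^esub> g"]) (use g(1) h(1) g(2) h(2)[of "cj G g w"
        for w] in \<open>simp_all add: cj_cj[symmetric]\<close>)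
qed

lemma fo_same_line:
  assumes "ft t" "ft t'" shows "fo (\<lambda>M s. same_line M (t M s) (t' M s))"
proof -
  note F = fo_mem[OF fof_Ax[OF ft_var[of 0], of D]]
  have "fo (\<lambda>M s. \<exists>g\<in>carrier M. \<forall>w\<in>carrier M. w \<in> Ax D M (s 0) \<longleftrightarrow>
      g \<otimes>\<^bsub>M\<^esub> w \<otimes>\<^bsub>M\<^esub> inv\<^bsub>M\<^esub> g \<in> Ax D M (s (Suc 0)))"
    by (intro fo_ex fo_all fo_iff F[where u = "\<lambda>M s i. s (Suc (Suc 0))"] F[where u =
        "\<lambda>M s i. s (Suc (Suc (Suc 0)))"] ft.intros)
  then have "fo (\<lambda>M s. same_line M (s 0) (s (Suc 0)))" unfolding same_line_def .
  from fo_app2[OF this assms ft_var] show ?thesis by simp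
qed

lemma dge_class:
  assumes x: "x \<in> carrier G" "finite (cen G x)" and e: "env G s" and F: "fof F"
    and sub: "\<And>g. g \<in> carrier G \<Longrightarrow> cj G g x \<in> F G s"
  shows "dge G (F G s) (Suc (Suc 0))"
proof -
  have "fof (\<lambda>M s. {y \<in> carrier M. \<exists>g\<in>carrier M. y = g \<otimes>\<^bsub>M\<^esub> s 0 \<otimes>\<^bsub>M\<^esub> inv\<^bsub>M\<^esub> g})"
    by (rule fof_Collect) (intro fo_ex fo_eq ft.intros)
  then have K: "mdef G {y \<in> carrier G. \<exists>g\<in>carrier G. y = g \<otimes>\<^bsub>G\<^esub> x \<otimes>\<^bsub>G\<^esub> inv\<^bsub>G\<^esub> g}"
    using fof_mdef[of _ G "\<lambda>_. x"] x(1) by (fastforce simp: env_def)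
  have "dge G {y \<in> carrier G. \<exists>g\<in>carrier G. y = g \<otimes>\<^bsub>G\<^esub> x \<otimes>\<^bsub>G\<^esub> inv\<^bsub>G\<^esub> g} (Suc (Suc 0))"
    using dge_conj_class[OF x(1) _ dge2] x(2) by (simp add: cen_def numeral_2_eq_2)
  then show ?thesis
    by (rule dge_mono[OF model_G K fof_mdef[OF F e], rotated]) (use sub in \<open>auto simp: cj_def\<close>)
qed

text \<open>Infinitely many classes of dimension 2 would give dimension 3.\<close>

lemma finite_classes:
  assumes F: "fof F" and e: "env G s" and E: "fo (\<lambda>M s. E M (\<lambda>i. s (Suc (Suc i))) (s 0) (s (Suc 0)))"
    "equ (F G s) (E G s)" "\<And>x. x \<in> F G s \<Longrightarrow> dge G {y \<in> F G s. E G s x y} (Suc (Suc 0))"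
  shows "finite (cls (F G s) (E G s))"
proof (rule ccontr)
  assume i: "infinite (cls (F G s) (E G s))"
  have "dge G (F G s) (Suc (Suc (Suc 0)))"
    by (rule fof_dge_quotient[where E = E, OF model_G e F E(1,2) _ i]) (erule E(3))
  then have "dge G (carrier G) (Suc (Suc (Suc 0)))"
    using fof_dge_mono[OF model_G e e F fof_carrier] fof_subset[OF F] by blast
  then show False using not3 by simp
qed

lemma normal_line: "\<exists>x\<in>L. N x = carrier G"
proof (rule ccontr)
  assume "\<not> ?thesis"
  then have nn: "N x \<noteq> carrier G" if "x \<in> L" for x using that by blast
  then have iN: "infinite (cls (carrier G) (lco G (N x)))" if "x \<in> L" for x using that line_normal by blast
  define one where "one = (\<lambda>(M::'a monoid) (s::nat\<Rightarrow>'a). if group M then {\<one>\<^bsub>M\<^esub>} else {})"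
  have one: "fof one" unfolding one_def by (rule fof_one)
  define W where "W = (\<lambda>(M::'a monoid) s. carrier M - Zd D1 M (carrier M) (one M s))"
  have W: "fof W" unfolding W_def by (rule fof_Diff[OF fof_carrier fof_Zd[OF fof_carrier one]])
  have WG: "W G s = carrier G - Z" for s unfolding W_def one_def by (simp only: grp if_True ZF)
  have env: "env G (\<lambda>_. y)" if "y \<in> carrier G" for y using that by (simp add: env_def)
  have WL: "finite (cen G x)" if "x \<in> carrier G - Z" "x \<notin> L" for x using that by (simp add: L_def)
  \<comment> \<open>If the centraliser of \<open>x\<close> is finite, the conjugacy class of
    \<open>x\<close> already has dimension 2. If \<open>x \<in> L\<close>, the set is divided
    according to lines: there are infinitely many, since the normaliser has infinite index, and each
    is infinite outside \<open>Z\<close>.\<close>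
  have big: "dge G {y \<in> carrier G - Z. same_line G x y} (Suc (Suc 0))" if x: "x \<in> carrier G - Z" for x
  proof -
    have xc: "x \<in> carrier G" using x by simp
    define U where "U = (\<lambda>(M::'a monoid) s. {y \<in> carrier M. y \<in> W M s \<and> same_line M (s 0) y})"
    have U: "fof U" unfolding U_def
      by (rule fof_Collect) (intro fo_conj fo_mem[OF W] fo_same_line ft_var)
    have UG: "U G (\<lambda>_. x) = {y \<in> carrier G - Z. same_line G x y}" by (auto simp: U_def WG)
    show ?thesis
    proof (cases "x \<in> L")
      case False
      have "dge G (U G (\<lambda>_. x)) (Suc (Suc 0))"
        by (rule dge_class[OF xc WL[OF x False] env[OF xc] U]) (use x Z_cj same_line_cj in \<open>simp add: UG\<close>)
      then show ?thesis by (simp add: UG)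
    next
      case True
      define E where "E = (\<lambda>(M::'a monoid) (s::nat\<Rightarrow>'a) y y'. \<forall>w\<in>carrier M. w \<in> Ax D M y \<longleftrightarrow> w \<in> Ax D M y')"
      note F = fo_mem[OF fof_Ax[OF ft_var[of 0], of D]]
      have fE: "fo (\<lambda>M s. E M (\<lambda>i. s (Suc (Suc i))) (s 0) (s (Suc 0)))" unfolding E_def
        by (intro fo_all fo_iff F[where u = "\<lambda>M s i. s (Suc 0)"] F[where u =
            "\<lambda>M s i. s (Suc (Suc 0))"] ft_var)
      have EG: "E G s y y' \<longleftrightarrow> A y = A y'" for s y y' unfolding E_def using Ac by blast
      have equE: "equ X (E G s)" for X s unfolding equ_def EG by blast
      let ?U = "U G (\<lambda>_. x)"
      have Us: "?U \<subseteq> carrier G" by (auto simp: UG)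
      have c: "cj G g x \<in> ?U" if "g \<in> carrier G" for g using that x Z_cj same_line_cj by (simp add: UG)
      have "dge G {y' \<in> ?U. E G (\<lambda>_. x) y y'} (Suc 0)" if y: "y \<in> ?U" for y
      proof -
        obtain g where g: "g \<in> carrier G" "\<And>w. w \<in> carrier G \<Longrightarrow> w \<in> A x \<longleftrightarrow> cj G g w \<in> A y"
          using y unfolding UG by (auto elim: same_lineE)
        have gx: "cj G g x \<in> L" by (rule L_cj[OF g(1) True])
        \<comment> \<open>The element \<open>y\<close> is not known to lie in \<open>L\<close>, but
          its set \<open>A y\<close> is the line of a conjugate of \<open>x\<close>.\<close>
        have Ay: "A y = A (cj G g x)"
        proof -
          have "w \<in> A y \<longleftrightarrow> w \<in> A (cj G g x)" if w: "w \<in> carrier G" for w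
            using g(2)[of "cj G (inv\<^bsub>G\<^esub> g) w"] Ax_cj[OF g(1) xc, of "cj G (inv\<^bsub>G\<^esub> g) w" D] w g(1) by simp
          then show ?thesis using Ac by blast
        qed
        have "A y - Z \<subseteq> {y' \<in> ?U. E G (\<lambda>_. x) y y'}"
        proof
          fix v assume v: "v \<in> A y - Z"
          have e: "A v = A y" using A_eq(2)[OF gx, of v] v Ay by simp
          have "same_line G x v" by (rule same_lineI[OF g(1)]) (simp add: e g(2))
          then show "v \<in> {y' \<in> ?U. E G (\<lambda>_. x) y y'}" using v Ac[of v y] e by (simp add: UG EG)
        qed
        moreover have "infinite (A y - Z)" using infinite_A[OF gx] finZ unfolding Ay
            by (meson Diff_infinite_finite finite_Int)
        ultimately have i: "infinite {y' \<in> ?U. E G (\<lambda>_. x) y y'}" using finite_subset by blast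
        have "fof (\<lambda>M s. {y' \<in> carrier M. y' \<in> U M (\<lambda>i. s (Suc i)) \<and> E M s (s 0) y'})"
          unfolding E_def
          by (rule fof_Collect) (intro fo_conj fo_mem[OF U] fo_all fo_iff F[where u =
              "\<lambda>M s i. s (Suc 0)"] F[where u = "\<lambda>M s i. s (Suc (Suc 0))"] ft_var)
        moreover have "env G (y ## (\<lambda>_. x))" using env[OF xc] y Us by auto
        ultimately have "mdef G {y' \<in> carrier G. y' \<in> ?U \<and> E G (\<lambda>_. x) y y'}"
          using fof_mdef[of _ G "y ## (\<lambda>_. x)"] by (fastforce simp: EG)
        then have "mdef G {y' \<in> ?U. E G (\<lambda>_. x) y y'}"
          using Us by (simp add: Collect_conj_eq Int_absorb1 Int_assoc[symmetric])
        then show ?thesis using dge_1[OF model_G] i by simp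
      qed
      moreover have "infinite (cls ?U (E G (\<lambda>_. x)))"
      proof
        assume f: "finite (cls ?U (E G (\<lambda>_. x)))"
        have "finite (cls (carrier G) (lco G (N x))) \<and>
            card (cls (carrier G) (lco G (N x))) \<le> card (cls ?U (E G (\<lambda>_. x)))"
        proof (rule cls_bound[OF equ_lco'[OF Nx_subgroup subset_refl] f, of "\<lambda>g. {y \<in> ?U. E G (\<lambda>_. x) (cj G g x) y}"])
          show "g \<in> carrier G \<Longrightarrow> {y \<in> ?U. E G (\<lambda>_. x) (cj G g x) y} \<in> cls ?U (E G (\<lambda>_. x))" for g using c
              by (auto simp: cls_def)
          fix g h assume gh: "g \<in> carrier G" "h \<in> carrier G"
            "{y \<in> ?U. E G (\<lambda>_. x) (cj G g x) y} = {y \<in> ?U. E G (\<lambda>_. x) (cj G h x) y}"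
          have "E G (\<lambda>_. x) (cj G g x) (cj G h x)"
              by (rule cls_eqD[OF equE subset_refl c[OF gh(1)] c[OF gh(2)] gh(3)])
          then have e: "A (cj G g x) = A (cj G h x)" by (simp add: EG)
          have "inv\<^bsub>G\<^esub> g \<otimes>\<^bsub>G\<^esub> h \<in> N x"
          proof (rule NxI)
            fix w assume w: "w \<in> carrier G"
            have "w \<in> A x \<longleftrightarrow> cj G h w \<in> A (cj G g x)" unfolding e using Ax_cj[OF gh(2) xc w] by simp
            also have "cj G h w = cj G g (cj G (inv\<^bsub>G\<^esub> g) (cj G h w))" using gh w by simp
            also have "\<dots> \<in> A (cj G g x) \<longleftrightarrow> cj G (inv\<^bsub>G\<^esub> g) (cj G h w) \<in> A x" by (rule Ax_cj)
                (use gh w xc in simp_all)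
            also have "cj G (inv\<^bsub>G\<^esub> g) (cj G h w) = cj G (inv\<^bsub>G\<^esub> g \<otimes>\<^bsub>G\<^esub> h) w" using gh w
                by (simp add: cj_cj)
            finally show "w \<in> A x \<longleftrightarrow> cj G (inv\<^bsub>G\<^esub> g \<otimes>\<^bsub>G\<^esub> h) w \<in> A x" .
          qed (use gh in simp)
          then show "lco G (N x) g h" by (simp add: lco_def)
        qed
        then show False using iN[OF True] by simp
      qed
      ultimately have "dge G ?U (Suc (Suc 0))" by (rule fof_dge_quotient[OF model_G env[OF xc] U fE equE])
      then show ?thesis by (simp add: UG)
    qed
  qed
  have o: "env G (\<lambda>_. \<one>\<^bsub>G\<^esub>)" by (rule env) simp
  have "finite (cls (W G (\<lambda>_. \<one>\<^bsub>G\<^esub>)) (same_line G))"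
    by (rule finite_classes[OF W o, where E = "\<lambda>M s. same_line M"])
      (use big in \<open>auto simp: WG intro: fo_same_line ft_var equ_same_line\<close>)
  then have "finite (cls (carrier G - Z) (same_line G))" by (simp add: WG)
  then have "finite (cls L (same_line G))"
    by (rule finite_cls_subset[OF equ_same_line, rotated]) (auto simp: L_def)
  then obtain m :: nat and x where x: "\<And>i. i < m \<Longrightarrow> x i \<in> L" "\<And>i j. i < m \<Longrightarrow> j < m \<Longrightarrow> i \<noteq> j \<Longrightarrow>
      \<not> same_line G (x i) (x j)"
    "\<And>y. y \<in> L \<Longrightarrow> \<exists>i<m. same_line G (x i) y"
    using finite_representatives[OF equ_same_line] by metis
  define t where "t i = (if i < m then x i else \<one>\<^bsub>G\<^esub>)" for i
  have t: "env G t" using x(1) L_carrier by (auto simp: t_def env_def)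
  \<comment> \<open>What is left outside \<open>Z\<close> and outside all conjugates of the chosen
    lines. These elements are not in \<open>L\<close>, so their centralisers are finite.\<close>
  define R where "R = (\<lambda>(M::'a monoid) s. {y \<in> carrier M. y \<in> W M s \<and>
    \<not> (\<exists>i<m. \<exists>g\<in>carrier M. g \<otimes>\<^bsub>M\<^esub> y \<otimes>\<^bsub>M\<^esub> inv\<^bsub>M\<^esub> g \<in> Ax D M (s i))})"
  have fA: "fof (\<lambda>M s. Ax D M (s i))" for i by (rule fof_Ax[OF ft_var])
  have R: "fof R" unfolding R_def
    by (rule fof_Collect) (intro fo_conj fo_neg fo_ex_less fo_ex fo_mem[OF W] fo_mem[OF fA, where u =
        "\<lambda>M s i. s (Suc (Suc i))"] ft.intros)
  have RG: "y \<in> R G t \<longleftrightarrow> y \<in> carrier G \<and> y \<notin> Z \<and> \<not> (\<exists>i<m. \<exists>g\<in>carrier G. cj G g y \<in> A (x i))" for y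
    unfolding R_def WG cj_def by (auto simp: t_def)
  have Rc: "R G t \<subseteq> carrier G" by (auto simp: RG)
  have RL: "y \<notin> L" if y: "y \<in> R G t" for y
  proof
    assume yL: "y \<in> L"
    obtain i where i: "i < m" "same_line G (x i) y" using x(3)[OF yL] by blast
    obtain g where g: "g \<in> carrier G" "\<And>w. w \<in> carrier G \<Longrightarrow> w \<in> A (x i) \<longleftrightarrow> cj G g w \<in> A y"
      using i(2) by (rule same_lineE) (rule that)
    have "cj G (inv\<^bsub>G\<^esub> g) y \<in> A (x i)"
        using g(2)[of "cj G (inv\<^bsub>G\<^esub> g) y"] self_A[OF yL] g(1) L_carrier[OF yL] by simp
    then show False using y i(1) g(1) unfolding RG by (meson inv_closed)
  qed
  have Rcj: "cj G g y \<in> R G t" if y: "y \<in> R G t" and g: "g \<in> carrier G" for y g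
  proof -
    have yc: "y \<in> carrier G" "y \<notin> Z" using y by (auto simp: RG)
    have "False" if "i < m" "h \<in> carrier G" "cj G h (cj G g y) \<in> A (x i)" for i h
      using that y g yc cj_cj[OF that(2) g yc(1)] unfolding RG by (metis m_closed)
    then show ?thesis unfolding RG using g yc Z_cj by auto
  qed
  define E where "E = (\<lambda>(M::'a monoid) (s::nat\<Rightarrow>'a) y y'. \<exists>g\<in>carrier M. g \<otimes>\<^bsub>M\<^esub> y \<otimes>\<^bsub>M\<^esub> inv\<^bsub>M\<^esub> g = y')"
  have fE: "fo (\<lambda>M s. E M (\<lambda>i. s (Suc (Suc i))) (s 0) (s (Suc 0)))" unfolding E_def
    by (intro fo_ex fo_eq ft.intros)
  have EG: "E G s y y' \<longleftrightarrow> (\<exists>g\<in>carrier G. cj G g y = y')" for s y y' by (simp add: E_def cj_def)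
  have equE: "equ (R G t) (E G t)" unfolding equ_def EG
  proof (intro conjI ballI impI)
    fix x y z assume xyz: "x \<in> R G t" "y \<in> R G t" "z \<in> R G t"
    then have c: "x \<in> carrier G" "y \<in> carrier G" "z \<in> carrier G" using Rc by auto
    assume xy: "\<exists>g\<in>carrier G. cj G g x = y" and yz: "\<exists>g\<in>carrier G. cj G g y = z"
    then obtain g h where "g \<in> carrier G" "h \<in> carrier G" "cj G g x = y" "cj G h y = z" by blast
    then have "cj G (h \<otimes>\<^bsub>G\<^esub> g) x = z" "h \<otimes>\<^bsub>G\<^esub> g \<in> carrier G" using c by (auto simp: cj_cj[symmetric])
    then show "\<exists>g\<in>carrier G. cj G g x = z" by blast
  next
    fix x y assume xyz: "x \<in> R G t" "y \<in> R G t"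
    assume "\<exists>g\<in>carrier G. cj G g x = y"
    then obtain g where "g \<in> carrier G" "cj G g x = y" by blast
    then have "cj G (inv\<^bsub>G\<^esub> g) y = x" "inv\<^bsub>G\<^esub> g \<in> carrier G" using xyz Rc by auto
    then show "\<exists>g\<in>carrier G. cj G g y = x" by blast
  next
    fix x assume "x \<in> R G t"
    then have "cj G \<one>\<^bsub>G\<^esub> x = x" using Rc by (auto simp: cj_def)
    then show "\<exists>g\<in>carrier G. cj G g x = x" by blast
  qed
  have "finite (cls (R G t) (E G t))"
  proof (rule finite_classes[OF R t fE equE])
    fix y assume y: "y \<in> R G t"
    then have yc: "y \<in> carrier G" "y \<in> carrier G - Z" by (auto simp: RG)
    define V where "V = (\<lambda>(M::'a monoid) s. {v \<in> carrier M. v \<in> R M (\<lambda>i. s (Suc i)) \<and>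
        (\<exists>g\<in>carrier M. g \<otimes>\<^bsub>M\<^esub> s 0 \<otimes>\<^bsub>M\<^esub> inv\<^bsub>M\<^esub> g = v)})"
    have V: "fof V" unfolding V_def
      by (rule fof_Collect) (intro fo_conj fo_mem[OF R, where u =
          "\<lambda>M s i. s (Suc (Suc i))"] fo_ex fo_eq ft.intros)
    have VG: "V G (y ## t) = {v \<in> R G t. E G t y v}" unfolding V_def E_def using Rc by auto
    have "dge G (V G (y ## t)) (Suc (Suc 0))"
      by (rule dge_class[OF yc(1) WL[OF yc(2) RL[OF y]] _ V]) (use t yc(1) Rcj[OF y] in \<open>auto simp: VG EG\<close>)
    then show "dge G {v \<in> R G t. E G t y v} (Suc (Suc 0))" by (simp add: VG)
  qed
  then obtain r :: nat and u where u: "\<And>j. j < r \<Longrightarrow> u j \<in> R G t" "\<And>i j. i < r \<Longrightarrow> j < r \<Longrightarrow> i \<noteq> j \<Longrightarrow>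
      \<not> E G t (u i) (u j)"
    "\<And>y. y \<in> R G t \<Longrightarrow> \<exists>j<r. E G t (u j) y"
    using finite_representatives[OF equE] by metis
  show False
  proof (rule line_class_contradiction[OF pf D1 ZF[symmetric] finZ, of m x r u D])
    show "i < m \<Longrightarrow> x i \<in> carrier G" for i by (rule L_carrier[OF x(1)])
    show "j < r \<Longrightarrow> u j \<in> carrier G" for j using u(1) Rc by blast
    show "i < m \<Longrightarrow> subgroup (A (x i)) G" for i by (rule A_subgroup[OF x(1)])
    show "i < m \<Longrightarrow> Z \<subseteq> A (x i)" for i by (rule Z_A[OF x(1)])
    show "i < m \<Longrightarrow> A (x i) \<subseteq> N (x i)" for i by (rule A_N[OF x(1)])
    show "i < m \<Longrightarrow> infinite (A (x i))" for i using infinite_A[OF x(1)] by blast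
    show "i < m \<Longrightarrow> finite (cls (N (x i)) (lco G (A (x i))))" for i by (rule finite_N_A[OF x(1) iN[OF x(1)]])
    show "i < m \<Longrightarrow> N (x i) \<noteq> carrier G" for i by (rule nn[OF x(1)])
    show "i < m \<Longrightarrow> g \<in> carrier G \<Longrightarrow> w \<in> A (x i) \<Longrightarrow> w \<notin> Z \<Longrightarrow> cj G g w \<in> A (x i) \<Longrightarrow> g \<in> N (x i)" for i g w
      by (rule line_TI[OF x(1)])
    show "y \<in> Z \<or> (\<exists>i<m. \<exists>g\<in>carrier G. cj G g y \<in> A (x i)) \<or> (\<exists>j<r. \<exists>g\<in>carrier G. cj G g y = u j)"
      if y: "y \<in> carrier G" for y
    proof (cases "y \<in> R G t")
      case True
      then obtain j where j: "j < r" "E G t (u j) y" using u(3) by blast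
      then have "E G t y (u j)" using equE u(1) True unfolding equ_def by blast
      then show ?thesis using j(1) unfolding EG by blast
    qed (use y in \<open>auto simp: RG\<close>)
    show "cj G g w \<notin> A (x i')" if h: "i < m" "i' < m" "i \<noteq> i'" "g \<in> carrier G" "w \<in> A (x i)" "w \<notin> Z"
        for i i' g w
    proof
      assume c: "cj G g w \<in> A (x i')"
      have wc: "w \<in> carrier G" using h(5) by (rule Ac)
      have e: "A w = A (x i)" "A (cj G g w) = A (x i')"
        using A_eq(2)[OF x(1)[OF h(1)] h(5,6)] A_eq(2)[OF x(1)[OF h(2)] c] Z_cj[OF h(4) wc] h(6) by auto
      have "same_line G (x i) (x i')"
        by (rule same_lineI[OF h(4)]) (use Ax_cj[OF h(4) wc, of _ D] e in simp)
      then show False using x(2)[OF h(1-3)] by simp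
    qed
    show "j < r \<Longrightarrow> u j \<notin> Z" for j using u(1) by (simp add: RG)
    show "i < m \<Longrightarrow> j < r \<Longrightarrow> g \<in> carrier G \<Longrightarrow> cj G g (u j) \<notin> A (x i)" for i j g using u(1)[of j]
        unfolding RG by blast
    show "j < r \<Longrightarrow> j' < r \<Longrightarrow> j \<noteq> j' \<Longrightarrow> g \<in> carrier G \<Longrightarrow> cj G g (u j) \<noteq> u j'" for j j' g
      using u(2)[of j j'] unfolding EG by blast
    show "finite (cen G (u j))" if "j < r" for j
      by (rule WL[OF _ RL[OF u(1)[OF that]]]) (use u(1)[OF that] in \<open>simp add: RG\<close>)
  qed
qed

end

section \<open>Groups with bounded conjugacy classes\<close>

context group begin

definition cc :: "'a \<Rightarrow> 'a set" where "cc x = (\<lambda>g. cj G g x) ` carrier G"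

abbreviation lprod :: "'a list \<Rightarrow> 'a" where "lprod xs \<equiv> foldr (\<otimes>) xs \<one>"

lemma cc_carrier: "x \<in> carrier G \<Longrightarrow> cc x \<subseteq> carrier G" by (auto simp: cc_def)

lemma cc_cj: "x \<in> carrier G \<Longrightarrow> y \<in> cc x \<Longrightarrow> g \<in> carrier G \<Longrightarrow> cj G g y \<in> cc x"
  by (auto simp: cc_def cj_cj)

lemma cj_mult_hom: "g \<in> carrier G \<Longrightarrow> x \<in> carrier G \<Longrightarrow> y \<in> carrier G \<Longrightarrow> cj G g (x \<otimes> y) = cj G g x \<otimes> cj G g y"
  by (simp add: cj_def gsimps)

lemma cj_inv_hom: "g \<in> carrier G \<Longrightarrow> x \<in> carrier G \<Longrightarrow> cj G g (inv x) = inv (cj G g x)"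
  by (simp add: cj_def gsimps)

text \<open>Neumann: if the conjugacy class of \<open>a\<close> is largest possible and \<open>u\<close> centralises
  finitely many elements that conjugate \<open>a\<close> to all its conjugates, then the class of
  \<open>u \<otimes> a\<close> is \<open>u\<close> times that of \<open>a\<close>.\<close>

lemma finite_commutators:
  fixes B :: nat
  assumes fin: "\<And>x. x \<in> carrier G \<Longrightarrow> finite (cc x)" and B: "\<And>x. x \<in> carrier G \<Longrightarrow> card (cc x) \<le> B"
  shows "finite (derived_set G (carrier G))"
proof -
  obtain a where a: "a \<in> carrier G" and amax: "\<And>x. x \<in> carrier G \<Longrightarrow> card (cc x) \<le> card (cc a)"
    using ex_has_greatest_nat[of "\<lambda>x. x \<in> carrier G" \<one> "\<lambda>x. card (cc x)" "Suc B"] B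
    by (metis less_Suc_eq_le one_closed)
  have "\<forall>y\<in>cc a. \<exists>s. s \<in> carrier G \<and> cj G s a = y" by (auto simp: cc_def)
  then obtain t where t: "\<And>y. y \<in> cc a \<Longrightarrow> t y \<in> carrier G" "\<And>y. y \<in> cc a \<Longrightarrow> cj G (t y) a = y" by metis
  define T where "T = t ` cc a"
  have T: "finite T" "T \<subseteq> carrier G" using fin[OF a] t(1) by (auto simp: T_def)
  define S where "S = (\<lambda>(y, z). y \<otimes> inv z) ` (cc a \<times> cc a)"
  have finS: "finite S" using fin[OF a] by (simp add: S_def)
  have Sc: "S \<subseteq> carrier G" using cc_carrier[OF a] by (auto simp: S_def)
  have S_cj: "cj G u s \<in> S" if "u \<in> carrier G" "s \<in> S" for u s
  proof -
    obtain y z where yz: "y \<in> cc a" "z \<in> cc a" "s = y \<otimes> inv z" using \<open>s \<in> S\<close> by (auto simp: S_def)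
    then have c: "y \<in> carrier G" "z \<in> carrier G" using cc_carrier[OF a] by auto
    have "cj G u s = cj G u y \<otimes> inv (cj G u z)" using c that(1) yz(3) by (simp add: cj_mult_hom cj_inv_hom)
    then show ?thesis using cc_cj[OF a yz(1) that(1)] cc_cj[OF a yz(2) that(1)] unfolding S_def
      by (intro image_eqI[of _ _ "(cj G u y, cj G u z)"]) auto
  qed
  have key: "inv u \<otimes> cj G g u \<in> S" if u: "u \<in> carrier G" "\<forall>s\<in>T. cj G s u = u" and g: "g \<in> carrier G" for u g
  proof -
    have ua: "u \<otimes> a \<in> carrier G" using u a by simp
    have "(\<lambda>y. u \<otimes> y) ` cc a \<subseteq> cc (u \<otimes> a)"
    proof
      fix w assume "w \<in> (\<lambda>y. u \<otimes> y) ` cc a"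
      then obtain y where y: "y \<in> cc a" "w = u \<otimes> y" by auto
      have "cj G (t y) (u \<otimes> a) = u \<otimes> y" using u y(1) t[OF y(1)] a by (simp add: cj_mult_hom T_def)
      then show "w \<in> cc (u \<otimes> a)" unfolding cc_def y(2) using t(1)[OF y(1)]
          by (intro image_eqI[of _ _ "t y"]) simp_all
    qed
    moreover have "card ((\<lambda>y. u \<otimes> y) ` cc a) = card (cc a)"
      using cc_carrier[OF a] u by (intro card_image inj_onI) (metis inv_mult_cancel subsetD)
    ultimately have "(\<lambda>y. u \<otimes> y) ` cc a = cc (u \<otimes> a)" using amax[OF ua]
        by (intro card_seteq fin ua) simp_all
    moreover have "cj G g (u \<otimes> a) \<in> cc (u \<otimes> a)" using g by (simp add: cc_def)
    ultimately obtain y where y: "y \<in> cc a" "cj G g (u \<otimes> a) = u \<otimes> y" by auto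
    have yc: "y \<in> carrier G" using cc_carrier[OF a] y(1) by auto
    have za: "cj G g a \<in> cc a" using g by (simp add: cc_def)
    have "cj G g u \<otimes> cj G g a \<otimes> inv (cj G g a) = u \<otimes> y \<otimes> inv (cj G g a)" using y(2) u a g
        by (simp add: cj_mult_hom)
    then have "cj G g u = u \<otimes> (y \<otimes> inv (cj G g a))" using u a g yc by (simp add: m_assoc)
    then have "inv u \<otimes> cj G g u = y \<otimes> inv (cj G g a)" using u a g yc by (simp add: inv_mult_cancel)
    then show ?thesis using y(1) za unfolding S_def by (intro image_eqI[of _ _ "(y, cj G g a)"]) auto
  qed
  \<comment> \<open>The action of \<open>h\<close> on the finite set \<open>T\<close> takes finitely
    many values. Choosing one element for each gives a finite \<open>V\<close> such that every
    \<open>h\<close> is some \<open>v \<in> V\<close> times an element commuting with all of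
    \<open>T\<close>.\<close>
  define f where "f h = (\<lambda>s\<in>T. cj G h s)" for h
  have "f ` carrier G \<subseteq> (\<Pi>\<^sub>E s\<in>T. cc s)" by (auto simp: f_def cc_def)
  moreover have "finite (\<Pi>\<^sub>E s\<in>T. cc s)" using T fin by (intro finite_PiE) auto
  ultimately have "finite (f ` carrier G)" using finite_subset by blast
  then obtain V where V: "V \<subseteq> carrier G" "finite V" "f ` carrier G = f ` V"
    using finite_subset_image[of "f ` carrier G" f "carrier G"] by blast
  have dec: "\<exists>v\<in>V. \<forall>s\<in>T. cj G s (inv v \<otimes> h) = inv v \<otimes> h" if h: "h \<in> carrier G" for h
  proof -
    have "f h \<in> f ` V" using h V(3) by blast
    then obtain v where v: "v \<in> V" "f h = f v" by blast
    have vc: "v \<in> carrier G" using v V by auto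
    have "cj G s (inv v \<otimes> h) = inv v \<otimes> h" if s: "s \<in> T" for s
    proof -
      have sc: "s \<in> carrier G" using s T by auto
      have "cj G h s = cj G v s" using fun_cong[OF v(2), of s] s by (simp add: f_def)
      then have "cj G (inv v) (cj G h s) = s" using vc sc by simp
      then have e: "cj G (inv v \<otimes> h) s = s" using vc sc h by (simp add: cj_cj)
      let ?u = "inv v \<otimes> h"
      have uc: "?u \<in> carrier G" using vc h by simp
      have "?u \<otimes> s = cj G ?u s \<otimes> ?u" using uc sc by (simp add: cj_def m_assoc del: inv_mult_group)
      then have "s \<otimes> ?u \<otimes> inv s = ?u \<otimes> s \<otimes> inv s" using e by simp
      then show ?thesis using uc sc by (simp add: cj_def m_assoc)
    qed
    then show ?thesis using v(1) by blast
  qed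
  have "derived_set G (carrier G) \<subseteq> (\<Union>v\<in>V. (\<lambda>(p, s). p \<otimes> s \<otimes> inv v) ` (cc v \<times> S))"
  proof
    fix x assume "x \<in> derived_set G (carrier G)"
    then obtain g h where gh: "g \<in> carrier G" "h \<in> carrier G" "x = g \<otimes> h \<otimes> inv g \<otimes> inv h" by auto
    obtain v where v: "v \<in> V" "\<forall>s\<in>T. cj G s (inv v \<otimes> h) = inv v \<otimes> h" using dec[OF gh(2)] by blast
    have vc: "v \<in> carrier G" using v V by auto
    let ?u = "inv v \<otimes> h"
    have uc: "?u \<in> carrier G" using vc gh by simp
    have s: "cj G ?u (inv ?u \<otimes> cj G g ?u) \<in> S" by (rule S_cj[OF uc key[OF uc v(2) gh(1)]])
    have "cj G g v \<in> cc v" using gh(1) by (simp add: cc_def)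
    \<comment> \<open>The commutator of \<open>g\<close> with \<open>h = v \<otimes> ?u\<close>,
      expanded so that each factor ranges over a finite set.\<close>
    moreover have "x = cj G g v \<otimes> cj G ?u (inv ?u \<otimes> cj G g ?u) \<otimes> inv v"
      using gh vc by (simp add: cj_def gsimps)
    ultimately show "x \<in> (\<Union>v\<in>V. (\<lambda>(p, s). p \<otimes> s \<otimes> inv v) ` (cc v \<times> S))" using v(1) s by auto
  qed
  moreover have "finite (\<Union>v\<in>V. (\<lambda>(p, s). p \<otimes> s \<otimes> inv v) ` (cc v \<times> S))"
    using V fin finS by (intro finite_UN_I finite_imageI finite_cartesian_product) auto
  ultimately show ?thesis by (rule finite_subset)
qed

lemma lprod_closed: "set xs \<subseteq> carrier G \<Longrightarrow> lprod xs \<in> carrier G" by (induction xs) auto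

lemma lprod_append: "set xs \<subseteq> carrier G \<Longrightarrow> set ys \<subseteq> carrier G \<Longrightarrow> lprod (xs @ ys) = lprod xs \<otimes> lprod ys"
  by (induction xs) (auto simp: lprod_closed m_assoc)

lemma lprod_replicate: "c \<in> carrier G \<Longrightarrow> lprod (replicate n c) = c [^] n"
  by (induction n) (simp_all add: nat_pow_Suc2[symmetric] del: nat_pow_Suc)

lemma cj_pow: "g \<in> carrier G \<Longrightarrow> c \<in> carrier G \<Longrightarrow> cj G g (c [^] (n::nat)) = cj G g c [^] n"
  by (induction n) (simp_all add: cj_mult_hom, simp add: cj_def)

text \<open>A high power of a commutator is a product of fewer commutators: this bounds the length
  of words in finitely many commutators.\<close>

lemma commutator_power:
  assumes g: "g \<in> carrier G" "h \<in> carrier G" and c: "c = g \<otimes> h \<otimes> inv g \<otimes> inv h"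
      and com: "c [^] Suc n \<otimes> h = h \<otimes> c [^] Suc n"
  shows "c [^] Suc (Suc n) = (g \<otimes> (h \<otimes> h) \<otimes> inv g \<otimes> inv (h \<otimes> h)) \<otimes> cj G h (c [^] n)"
proof -
  have cc: "c \<in> carrier G" using g c by simp
  have "inv h \<otimes> (c [^] Suc n \<otimes> h) \<otimes> inv h = inv h \<otimes> (h \<otimes> c [^] Suc n) \<otimes> inv h" using com by simp
  then have 1: "inv h \<otimes> c [^] Suc n = c [^] Suc n \<otimes> inv h" using g cc by (simp add: gsimps del: nat_pow_Suc)
  have "c [^] Suc (Suc n) = c \<otimes> c [^] Suc n" by (rule nat_pow_Suc2[OF cc])
  also have "\<dots> = g \<otimes> h \<otimes> inv g \<otimes> (inv h \<otimes> c [^] Suc n)" using g cc c by (simp add: m_assoc del: nat_pow_Suc)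
  also have "\<dots> = g \<otimes> h \<otimes> inv g \<otimes> (c \<otimes> c [^] n \<otimes> inv h)" unfolding 1 by (simp only: nat_pow_Suc2[OF cc])
  also have "\<dots> = (g \<otimes> (h \<otimes> h) \<otimes> inv g \<otimes> inv (h \<otimes> h)) \<otimes> cj G h (c [^] n)"
    using g cc by (subst (1) c) (simp add: cj_def gsimps)
  finally show ?thesis .
qed

text \<open>Moving an occurrence of \<open>c\<close> to the front conjugates the letters that it
  passes. They remain in \<open>X\<close>, so the length of the word is unchanged.\<close>

lemma collect_power:
  assumes X: "X \<subseteq> carrier G" "\<And>g x. g \<in> carrier G \<Longrightarrow> x \<in> X \<Longrightarrow> cj G g x \<in> X" and c: "c \<in> X"
  shows "set xs \<subseteq> X \<Longrightarrow> k \<le> count_list xs c \<Longrightarrow>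
    \<exists>ys. set ys \<subseteq> X \<and> length xs = length ys + k \<and> lprod xs = c [^] k \<otimes> lprod ys"
proof (induction xs arbitrary: k)
  case Nil
  then show ?case by simp
next
  case (Cons x xs)
  have cc: "c \<in> carrier G" using X c by auto
  have xc: "x \<in> carrier G" using Cons.prems X by auto
  show ?case
  proof (cases k)
    case 0
    then show ?thesis using Cons.prems(1) lprod_closed[OF subset_trans[OF _ X(1)], of xs] xc
        by (intro exI[of _ "x # xs"]) simp
  next
    case (Suc k')
    show ?thesis
    proof (cases "x = c")
      case True
      then obtain ys where ys: "set ys \<subseteq> X" "length xs = length ys + k'" "lprod xs = c [^] k' \<otimes> lprod ys"
        using Cons.IH[of k'] Cons.prems Suc by auto
      moreover have "c \<otimes> c [^] k' = c [^] k' \<otimes> c" using nat_pow_Suc2[OF cc, of k'] by simp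
      ultimately show ?thesis using True Suc cc X lprod_closed[of ys]
        by (intro exI[of _ ys]) (simp add: m_assoc[symmetric] subset_trans[OF ys(1) X(1)])
    next
      case False
      then obtain ys where ys: "set ys \<subseteq> X" "length xs = length ys + k" "lprod xs = c [^] k \<otimes> lprod ys"
        using Cons.IH[of k] Cons.prems by auto
      let ?p = "c [^] k"
      have "x \<otimes> (?p \<otimes> lprod ys) = ?p \<otimes> (cj G (inv ?p) x \<otimes> lprod ys)"
        using xc cc lprod_closed[OF subset_trans[OF ys(1) X(1)]] by (simp add: cj_def gsimps)
      moreover have "cj G (inv ?p) x \<in> X" using X(2)[of "inv ?p" x] Cons.prems cc by simp
      ultimately show ?thesis using ys by (intro exI[of _ "cj G (inv ?p) x # ys"]) simp
    qed
  qed
qed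

text \<open>The remaining part of Neumann's theorem: from finitely many commutators to a finite
  group generated by them. A word longer than \<open>n * card X\<close> contains some commutator
  more than \<open>n\<close> times, and \<open>commutator_power\<close> then shortens it, because
  \<open>n\<close>-th powers are central.\<close>

lemma finite_derived:
  fixes B :: nat
  assumes fin: "\<And>x. x \<in> carrier G \<Longrightarrow> finite (cc x)" and B: "\<And>x. x \<in> carrier G \<Longrightarrow> card (cc x) \<le> B"
  shows "finite (derived G (carrier G))"
proof -
  define X where "X = derived_set G (carrier G)"
  have finX: "finite X" unfolding X_def by (rule finite_commutators[OF fin B])
  have Xc: "X \<subseteq> carrier G" unfolding X_def by (rule derived_set_in_carrier[OF subset_refl])
  have XI: "g \<otimes> h \<otimes> inv g \<otimes> inv h \<in> X" if "g \<in> carrier G" "h \<in> carrier G" for g h using that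
      by (auto simp: X_def)
  have XE: "\<exists>g h. g \<in> carrier G \<and> h \<in> carrier G \<and> x = g \<otimes> h \<otimes> inv g \<otimes> inv h" if "x \<in> X" for x using that
      by (auto simp: X_def)
  have Xcj: "cj G k x \<in> X" if k: "k \<in> carrier G" and x: "x \<in> X" for k x
  proof -
    obtain g h where gh: "g \<in> carrier G" "h \<in> carrier G" "x = g \<otimes> h \<otimes> inv g \<otimes> inv h" using XE[OF x] by blast
    have "cj G k x = cj G k g \<otimes> cj G k h \<otimes> inv (cj G k g) \<otimes> inv (cj G k h)" using k gh
        by (simp add: cj_def gsimps)
    then show ?thesis using XI[of "cj G k g" "cj G k h"] k gh by simp
  qed
  have Xinv: "inv x \<in> X" if x: "x \<in> X" for x
  proof -
    obtain g h where gh: "g \<in> carrier G" "h \<in> carrier G" "x = g \<otimes> h \<otimes> inv g \<otimes> inv h" using XE[OF x] by blast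
    have "inv x = h \<otimes> g \<otimes> inv h \<otimes> inv g" using gh by (simp add: gsimps)
    then show ?thesis using XI[OF gh(2,1)] by simp
  qed
  \<comment> \<open>Among the first \<open>B + 1\<close> powers of \<open>c\<close>, two conjugate
    \<open>h\<close> to the same element, so some \<open>c [^] d\<close> with
    \<open>1 \<le> d \<le> B\<close> commutes with \<open>h\<close>. Every such \<open>d\<close>
    divides \<open>fact B\<close>.\<close>
  define n :: nat where "n = fact B"
  have com: "c [^] n \<otimes> h = h \<otimes> c [^] n" if c: "c \<in> carrier G" and h: "h \<in> carrier G" for c h
  proof -
    let ?f = "\<lambda>k::nat. cj G (c [^] k) h"
    have "?f ` {..B} \<subseteq> cc h" using c by (auto simp: cc_def)
    then have "card (?f ` {..B}) \<le> B" using card_mono[OF fin[OF h]] B[OF h] le_trans by blast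
    then have "\<not> inj_on ?f {..B}" by (intro pigeonhole) simp
    then obtain i j where ij: "i < j" "j \<le> B" "?f i = ?f j" unfolding inj_on_def
        by (metis atMost_iff linorder_neqE_nat)
    define d where "d = j - i"
    have d: "1 \<le> d" "d \<le> B" "j = i + d" using ij by (auto simp: d_def)
    have "cj G (inv (c [^] i)) (?f i) = cj G (inv (c [^] i)) (?f j)" using ij(3) by simp
    moreover have "?f j = ?f i" using ij(3) by simp
    moreover have "?f j = cj G (c [^] i) (cj G (c [^] d) h)" using c h
        by (simp add: d(3) nat_pow_mult[symmetric] cj_cj)
    ultimately have e: "cj G (c [^] d) h = h" using c h by (metis cj_closed cj_inv_cancel(1) nat_pow_closed)
    have "c [^] d \<otimes> h = cj G (c [^] d) h \<otimes> c [^] d" using c h by (simp add: cj_def m_assoc)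
    then have "c [^] d \<in> cen G h" using e c by (simp add: cen_def)
    moreover obtain q where "n = d * q" using dvd_fact[OF d(1,2)] by (auto simp: n_def dvd_def)
    moreover have "(c [^] d) [^] q \<in> cen G h" if "c [^] d \<in> cen G h" for q :: nat
      by (induction q) (use that subgroup.one_closed[OF cen_subgroup[OF h]] subgroup.m_closed[OF cen_subgroup[OF h]] in auto)
    ultimately have "c [^] n \<in> cen G h" using c by (simp add: nat_pow_pow)
    then show ?thesis by (simp add: cen_def)
  qed
  obtain n' where n': "n = Suc n'" using fact_gt_zero[of B]
      by (metis n_def not0_implies_Suc less_irrefl of_nat_fact of_nat_0_less_iff)
  have short: "\<exists>ys. set ys \<subseteq> X \<and> length ys \<le> n * card X \<and> lprod ys = lprod xs" if "set xs \<subseteq> X" for xs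
    using that
  proof (induction "length xs" arbitrary: xs rule: less_induct)
    case less
    show ?case
    proof (cases "length xs \<le> n * card X")
      case True then show ?thesis using less.prems by blast
    next
      case False
      have "\<exists>c\<in>X. n < count_list xs c"
      proof (rule ccontr)
        assume "\<not> ?thesis"
        then have "sum (count_list xs) X \<le> (\<Sum>c\<in>X. n)" by (intro sum_mono) (simp add: not_less)
        then show False using False sum_count_set[OF less.prems finX] by (simp add: mult.commute)
      qed
      then obtain c where c: "c \<in> X" "n < count_list xs c" by blast
      obtain g h where gh: "g \<in> carrier G" "h \<in> carrier G" "c = g \<otimes> h \<otimes> inv g \<otimes> inv h" using XE[OF c(1)]
          by blast
      have cc: "c \<in> carrier G" using c Xc by auto
      obtain ys where ys: "set ys \<subseteq> X" "length xs = length ys + Suc n" "lprod xs = c [^] Suc n \<otimes> lprod ys"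
        using collect_power[OF Xc Xcj c(1) less.prems, of "Suc n"] c(2) by auto
      \<comment> \<open>A word of \<open>n\<close> letters that replaces the \<open>n + 1\<close>
        collected copies of \<open>c\<close>.\<close>
      let ?zs = "(g \<otimes> (h \<otimes> h) \<otimes> inv g \<otimes> inv (h \<otimes> h)) # replicate n' (cj G h c)"
      have zX: "set ?zs \<subseteq> X" using XI[OF gh(1), of "h \<otimes> h"] Xcj[OF gh(2) c(1)] gh by auto
      have "lprod (replicate n' (cj G h c)) = cj G h (c [^] n')"
        using lprod_replicate[of "cj G h c" n'] cj_pow[OF gh(2) cc, of n'] gh(2) cc by simp
      then have "c [^] Suc n = lprod ?zs"
        using commutator_power[OF gh(1,2,3), of n'] com[OF cc gh(2)] unfolding n'
            by (simp del: nat_pow_Suc foldr_replicate)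
      then have e: "lprod (?zs @ ys) = lprod xs"
        using lprod_append[OF subset_trans[OF zX Xc] subset_trans[OF ys(1) Xc]] ys(3) by simp
      have "length (?zs @ ys) < length xs" using ys(2) n' by simp
      from less.hyps[OF this] obtain ws where "set ws \<subseteq> X" "length ws \<le> n * card X" "lprod ws =
          lprod (?zs @ ys)"
        using zX ys(1) by auto
      then show ?thesis using e by auto
    qed
  qed
  have "x \<in> lprod ` {xs. set xs \<subseteq> X}" if "x \<in> generate G X" for x
    using that
  proof induction
    case one then show ?case by (intro image_eqI[of _ _ "[]"]) auto
  next
    case (incl h) then show ?case using Xc by (intro image_eqI[of _ _ "[h]"]) auto
  next
    case (inv h) then show ?case using Xc Xinv by (intro image_eqI[of _ _ "[inv h]"]) auto
  next
    case (eng h1 h2)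
    then obtain xs ys where "h1 = lprod xs" "set xs \<subseteq> X" "h2 = lprod ys" "set ys \<subseteq> X" by auto
    then show ?case using lprod_append[of xs ys] Xc by (intro image_eqI[of _ _ "xs @ ys"]) auto
  qed
  then have gen: "generate G X \<subseteq> lprod ` {xs. set xs \<subseteq> X}" by blast
  have "generate G X \<subseteq> lprod ` {xs. set xs \<subseteq> X \<and> length xs \<le> n * card X}"
  proof
    fix x assume "x \<in> generate G X"
    then obtain xs where "set xs \<subseteq> X" "x = lprod xs" using gen by blast
    moreover then obtain ys where "set ys \<subseteq> X" "length ys \<le> n * card X" "lprod ys = lprod xs"
        using short by blast
    ultimately show "x \<in> lprod ` {xs. set xs \<subseteq> X \<and> length xs \<le> n * card X}"
      by (intro image_eqI[of _ _ ys]) simp_all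
  qed
  moreover have "finite (lprod ` {xs. set xs \<subseteq> X \<and> length xs \<le> n * card X})"
    by (intro finite_imageI finite_lists_length_le finX)
  ultimately show ?thesis unfolding derived_def X_def[symmetric] by (rule finite_subset)
qed

end

section \<open>Derived subgroups of sections\<close>

context section_group begin

text \<open>Neumann's theorem for the quotient \<open>A/N\<close>. The set \<open>F\<close> is the
  preimage of its derived subgroup, which keeps all later arguments inside \<open>G\<close>.\<close>

lemma section_derived:
  fixes B :: nat
  assumes fin: "\<And>x. x \<in> A \<Longrightarrow> finite (cls (K x) eq)" and B: "\<And>x. x \<in> A \<Longrightarrow> card (cls (K x) eq) \<le> B"
  obtains F where "subgroup F G" "N \<subseteq> F" "F \<subseteq> A" "finite (cls F eq)"
    "\<And>x y. x \<in> A \<Longrightarrow> y \<in> A \<Longrightarrow> x \<otimes> y \<otimes> inv x \<otimes> inv y \<in> F" "\<And>a f. a \<in> A \<Longrightarrow> f \<in> F \<Longrightarrow> cjg a f \<in> F"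
proof -
  let ?A = "G\<lparr>carrier := A\<rparr>"
  interpret A: group ?A by (rule subgroup_imp_group[OF A])
  have inv_A: "inv\<^bsub>?A\<^esub> x = inv x" if "x \<in> A" for x by (rule m_inv_consistent[OF A that])
  have sN: "subgroup N ?A" by (rule subgroup_incl[OF N A NA])
  interpret NN: normal N ?A
    unfolding A.normal_inv_iff using sN nrm inv_A by (simp add: cj_def)
  let ?Q = "?A Mod N"
  interpret Q: group ?Q by (rule NN.factorgroup_is_group)
  define p where "p a = N #>\<^bsub>?A\<^esub> a" for a
  have Qc: "carrier ?Q = p ` A" by (auto simp: carrier_FactGroup p_def)
  interpret h: group_hom ?A ?Q p
    using NN.r_coset_hom_Mod by unfold_locales (simp add: p_def[abs_def])
  have pm: "p (x \<otimes> y) = p x \<otimes>\<^bsub>?Q\<^esub> p y" if "x \<in> A" "y \<in> A" for x y using h.hom_mult[of x y] that by simp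
  have pinv: "p (inv x) = inv\<^bsub>?Q\<^esub> p x" if "x \<in> A" for x using h.hom_inv[of x] that inv_A by simp
  have pc: "p x \<in> carrier ?Q" if "x \<in> A" for x using that Qc by blast
  have p1: "p x = \<one>\<^bsub>?Q\<^esub> \<longleftrightarrow> x \<in> N" if "x \<in> A" for x
    using A.coset_join1[OF _ _ sN, of x] A.coset_join2[OF _ sN, of x] that by (auto simp: p_def)
  have peq: "p x = p y \<longleftrightarrow> eq x y" if "x \<in> A" "y \<in> A" for x y
  proof -
    have "p (inv x \<otimes> y) = inv\<^bsub>?Q\<^esub> p x \<otimes>\<^bsub>?Q\<^esub> p y" using that pm pinv by simp
    then have "p (inv x \<otimes> y) = \<one>\<^bsub>?Q\<^esub> \<longleftrightarrow> p x = p y"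
      using pc[OF that(1)] pc[OF that(2)] by (metis Q.inv_equality Q.inv_inv Q.inv_closed Q.l_inv)
    then show ?thesis using p1[of "inv x \<otimes> y"] that by (simp add: lco_def)
  qed
  have pcj: "cj ?Q (p g) (p x) = p (cjg g x)" if "g \<in> A" "x \<in> A" for g x using that
      by (simp add: cj_def pm pinv)
  have bnd: "finite (Q.cc w) \<and> card (Q.cc w) \<le> B" if "w \<in> carrier ?Q" for w
  proof -
    obtain x where x: "x \<in> A" "w = p x" using \<open>w \<in> carrier ?Q\<close> Qc by auto
    define f where "f c = p (SOME z. z \<in> c)" for c
    have "Q.cc w \<subseteq> f ` cls (K x) eq"
    proof
      fix v assume "v \<in> Q.cc w"
      then obtain g where g: "g \<in> A" "v = p (cjg g x)" using pcj x by (auto simp: Q.cc_def Qc)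
      let ?z = "cjg g x" and ?c = "{z' \<in> K x. eq (cjg g x) z'}"
      have zK: "?z \<in> K x" and zA: "?z \<in> A" using K_cj[OF x(1) g(1)] x g by auto
      have "?z \<in> ?c" using zK zA by simp
      then have s: "(SOME z. z \<in> ?c) \<in> ?c" by (rule someI)
      then have "(SOME z. z \<in> ?c) \<in> A" "eq ?z (SOME z. z \<in> ?c)" using KA by blast+
      then have "f ?c = v" unfolding f_def g(2) using peq[OF zA] by metis
      moreover have "?c \<in> cls (K x) eq" using zK by (auto simp: cls_def)
      ultimately show "v \<in> f ` cls (K x) eq" by blast
    qed
    moreover have "finite (f ` cls (K x) eq)" "card (f ` cls (K x) eq) \<le> B"
      using fin[OF x(1)] B[OF x(1)] card_image_le[OF fin[OF x(1)], of f] by auto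
    ultimately show ?thesis using finite_subset card_mono order_trans by metis
  qed
  let ?D = "derived ?Q (carrier ?Q)"
  have finD: "finite ?D" using Q.finite_derived[of B] bnd by blast
  have sD: "subgroup ?D ?Q" by (rule Q.derived_is_subgroup[OF subset_refl])
  have nD: "?D \<lhd> ?Q" by (rule Q.derived_self_is_normal)
  define F where "F = {a \<in> A. p a \<in> ?D}"
  show ?thesis
  proof (rule that[of F])
    show "subgroup F G"
      by (rule subgroup.intro)
        (use subgroup.m_closed[OF sD] subgroup.m_inv_closed[OF sD] subgroup.one_closed[OF sD] p1[OF A1] in \<open>auto simp: F_def pm pinv\<close>)
    show "N \<subseteq> F"
    proof
      fix x assume x: "x \<in> N"
      have "p x = \<one>\<^bsub>?Q\<^esub>" using iffD2[OF p1[OF NA'[OF x]] x] .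
      then show "x \<in> F" using subgroup.one_closed[OF sD] x by (simp add: F_def)
    qed
    show FA: "F \<subseteq> A" by (auto simp: F_def)
    show "finite (cls F eq)"
      using cls_bound[OF equA[OF FA] finD, of p] peq FA by (auto simp: F_def)
    show "x \<otimes> y \<otimes> inv x \<otimes> inv y \<in> F" if "x \<in> A" "y \<in> A" for x y
    proof -
      have "p (x \<otimes> y \<otimes> inv x \<otimes> inv y) = p x \<otimes>\<^bsub>?Q\<^esub> p y \<otimes>\<^bsub>?Q\<^esub> inv\<^bsub>?Q\<^esub> p x \<otimes>\<^bsub>?Q\<^esub> inv\<^bsub>?Q\<^esub> p y"
        using that by (simp add: pm pinv)
      moreover have "\<dots> \<in> ?D" unfolding derived_def by (rule generate.incl) (use pc that in blast)
      ultimately show ?thesis using that by (simp add: F_def)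
    qed
    show "cjg a f \<in> F" if "a \<in> A" "f \<in> F" for a f
      using nD that pcj[of a f, symmetric] pc[of a] unfolding Q.normal_inv_iff by (auto simp: F_def cj_def)
  qed
qed

lemma C_cong: "f \<in> A \<Longrightarrow> f' \<in> A \<Longrightarrow> eq f f' \<Longrightarrow> C f = C f'"
proof -
  have *: "C f \<subseteq> C f'" if f: "f \<in> A" "f' \<in> A" "eq f f'" for f f'
  proof
    fix y assume "y \<in> C f"
    then have y: "y \<in> A" "eq f (cjg y f)" by (auto simp: CN_def)
    have "eq (cjg y f) (cjg y f')" by (rule eq_cj[OF f(1,2) y(1) f(3)])
    with eq_trans[OF f(1) cj_A[OF y(1) f(1)] cj_A[OF y(1) f(2)] y(2)] have "eq f (cjg y f')" .
    with eq_trans[OF f(2,1) cj_A[OF y(1) f(2)] eq_sym[OF f]] have "eq f' (cjg y f')" .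
    then show "y \<in> C f'" using y by (simp add: CN_def)
  qed
  assume "f \<in> A" "f' \<in> A" "eq f f'"
  then show ?thesis using *[of f f'] *[of f' f] eq_sym by blast
qed

end

section \<open>Normal cores and criteria for solubility by finite\<close>

context group begin

lemma lco_finite_INT:
  assumes "finite I" "subgroup X G" "\<And>i. i \<in> I \<Longrightarrow> subgroup (H i) G" "\<And>i. i \<in> I \<Longrightarrow>
      finite (cls X (lco G (H i)))"
  shows "subgroup (X \<inter> (\<Inter>i\<in>I. H i)) G \<and> finite (cls X (lco G (X \<inter> (\<Inter>i\<in>I. H i))))"
  using assms(1,3,4)
proof (induction I)
  case empty
  have "{y \<in> X. lco G X x y} = X" if "x \<in> X" for x
    using that subgroup.m_closed[OF assms(2) subgroup.m_inv_closed[OF assms(2) that]]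
        by (auto simp: lco_def)
  then show ?case using assms(2) by (simp add: cls_def image_constant_conv)
next
  case (insert i I)
  have e: "X \<inter> (\<Inter>j\<in>insert i I. H j) = (X \<inter> (\<Inter>j\<in>I. H j)) \<inter> H i" by auto
  show ?case unfolding e using insert subgroups_Inter_pair lco_finite_Int[OF _ _ subgroup.subset[OF assms(2)]] by simp
qed

lemma normal_cj: "M \<lhd> G \<longleftrightarrow> subgroup M G \<and> (\<forall>g\<in>carrier G. \<forall>x\<in>M. cj G g x \<in> M)"
  unfolding normal_inv_iff cj_def ..

text \<open>A conjugate of \<open>T\<close> depends only on the coset of the conjugating element, so
  the normal core is an intersection of finitely many conjugates.\<close>

lemma finite_index_core:
  assumes T: "subgroup T G" and f: "finite (cls (carrier G) (lco G T))"
  obtains M where "M \<lhd> G" "M \<subseteq> T" "finite (cls (carrier G) (lco G M))"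
proof -
  define H where "H g = {x \<in> carrier G. cj G g x \<in> T}" for g
  have sH: "subgroup (H g) G" if g: "g \<in> carrier G" for g
    by (rule subgroup.intro) (use g subgroup.m_closed[OF T] subgroup.m_inv_closed[OF T] subgroup.one_closed[OF T] in
      \<open>auto simp: H_def cj_mult_hom cj_inv_hom, simp add: cj_def\<close>)
  have fH: "finite (cls (carrier G) (lco G (H g)))" if g: "g \<in> carrier G" for g
  proof -
    have "finite (cls (carrier G) (lco G (H g))) \<and>
        card (cls (carrier G) (lco G (H g))) \<le> card (cls (carrier G) (lco G T))"
    proof (rule cls_bound[OF equ_lco'[OF sH[OF g] subset_refl] f, of "\<lambda>a. {z \<in> carrier G. lco G T (cj G g a) z}"])
      show "{z \<in> carrier G. lco G T (cj G g a) z} \<in> cls (carrier G) (lco G T)" if "a \<in> carrier G" for a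
        using that g by (auto simp: cls_def)
      fix a b assume ab: "a \<in> carrier G" "b \<in> carrier G"
        "{z \<in> carrier G. lco G T (cj G g a) z} = {z \<in> carrier G. lco G T (cj G g b) z}"
      have "lco G T (cj G g a) (cj G g b)"
        by (rule cls_eqD[OF equ_lco'[OF T subset_refl] subset_refl _ _ ab(3)]) (use ab g in simp_all)
      then show "lco G (H g) a b" using ab g by (simp add: lco_def H_def cj_mult_hom cj_inv_hom)
    qed
    then show ?thesis ..
  qed
  obtain r :: nat and u where u: "\<And>i. i < r \<Longrightarrow> u i \<in> carrier G" "\<And>x. x \<in> carrier G \<Longrightarrow> \<exists>i<r. lco G T (u i) x"
    using finite_representatives[OF equ_lco'[OF T subset_refl] f] by metis
  have cjT: "cj G y z \<in> T" if "y \<in> T" "z \<in> T" for y z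
    using subgroup.m_closed[OF T subgroup.m_closed[OF T that] subgroup.m_inv_closed[OF T that(1)]]
        by (simp add: cj_def)
  \<comment> \<open>\<open>H (inv (u i))\<close> is the conjugate of \<open>T\<close> by
    \<open>u i\<close>. Representatives of the left cosets suffice, as \<open>T\<close> normalises
    itself.\<close>
  define M where "M = carrier G \<inter> (\<Inter>i\<in>{..<r}. H (inv (u i)))"
  have M: "subgroup M G \<and> finite (cls (carrier G) (lco G M))" unfolding M_def
    by (rule lco_finite_INT) (use u(1) sH fH subgroup_self in auto)
  have M_iff: "x \<in> M \<longleftrightarrow> x \<in> carrier G \<and> (\<forall>g\<in>carrier G. cj G g x \<in> T)" for x
  proof
    assume x: "x \<in> M"
    then have xc: "x \<in> carrier G" by (simp add: M_def)
    have "cj G g x \<in> T" if g: "g \<in> carrier G" for g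
    proof -
      obtain i where i: "i < r" "lco G T (u i) (inv g)" using u(2)[of "inv g"] g by auto
      let ?t = "inv (u i) \<otimes> inv g"
      have t: "?t \<in> T" using i(2) by (simp add: lco_def)
      have uc: "u i \<in> carrier G" by (rule u(1)[OF i(1)])
      have "cj G (inv (u i)) x \<in> T" using x i(1) by (auto simp: M_def H_def)
      then have "cj G (inv ?t) (cj G (inv (u i)) x) \<in> T"
        using cjT[OF subgroup.m_inv_closed[OF T t]] by blast
      moreover have "cj G (inv ?t) (cj G (inv (u i)) x) = cj G g x" using uc g xc
          by (simp add: cj_def gsimps)
      ultimately show ?thesis by simp
    qed
    then show "x \<in> carrier G \<and> (\<forall>g\<in>carrier G. cj G g x \<in> T)" using xc by blast
  next
    assume "x \<in> carrier G \<and> (\<forall>g\<in>carrier G. cj G g x \<in> T)"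
    then show "x \<in> M" using u(1) by (simp add: M_def H_def)
  qed
  show ?thesis
  proof (rule that[of M])
    show "M \<lhd> G" unfolding normal_cj using M M_iff by (simp add: cj_cj)
    have "x \<in> T" if "x \<in> M" for x
    proof -
      have x: "x \<in> carrier G" "cj G \<one> x \<in> T" using that unfolding M_iff by auto
      then show ?thesis by (simp add: cj_def)
    qed
    then show "M \<subseteq> T" by blast
  qed (use M in blast)
qed

text \<open>\<open>Mod\<close> is built from right cosets and \<open>lco\<close> describes left
  ones; for normal \<open>M\<close> they coincide.\<close>

lemma finite_quotient:
  assumes M: "M \<lhd> G" and f: "finite (cls (carrier G) (lco G M))"
  shows "finite_group (G Mod M)"
proof -
  have sM: "subgroup M G" using M by (simp add: normal_cj)
  have "M #> x = {y \<in> carrier G. lco G M x y}" if x: "x \<in> carrier G" for x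
  proof -
    have "M #> x = x <# M" using normal.coset_eq[OF M] x by blast
    also have "\<dots> = {y \<in> carrier G. lco G M x y}"
    proof (intro equalityI subsetI)
      fix y assume "y \<in> x <# M"
      then obtain m where m: "m \<in> M" "y = x \<otimes> m" by (auto simp: l_coset_def)
      then have "m \<in> carrier G" using subgroup.mem_carrier[OF sM] by blast
      then show "y \<in> {y \<in> carrier G. lco G M x y}" using m x by (simp add: lco_def inv_mult_cancel)
    next
      fix y assume "y \<in> {y \<in> carrier G. lco G M x y}"
      then have "inv x \<otimes> y \<in> M" "y = x \<otimes> (inv x \<otimes> y)" using x by (auto simp: lco_def mult_inv_cancel)
      then show "y \<in> x <# M" by (auto simp: l_coset_def)
    qed
    finally show ?thesis .
  qed
  then have "carrier (G Mod M) = cls (carrier G) (lco G M)" by (simp add: carrier_FactGroup cls_def)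
  then show ?thesis using f normal.factorgroup_is_group[OF M] by (simp add: finite_group_def)
qed

lemma derived_le:
  assumes "subgroup K G" "\<And>x y. x \<in> H \<Longrightarrow> y \<in> H \<Longrightarrow> x \<otimes> y \<otimes> inv x \<otimes> inv y \<in> K" shows "derived G H \<subseteq> K"
  unfolding derived_def by (rule generate_subgroup_incl[OF _ assms(1)]) (use assms(2) in blast)

text \<open>The conjugates of an element of \<open>F\<close> stay in \<open>F\<close>, so its
  centraliser has at most \<open>card F\<close> cosets.\<close>

lemma finite_index_cen:
  assumes F: "finite F" "F \<lhd> G"
  shows "subgroup (carrier G \<inter> (\<Inter>f\<in>F. cen G f)) G" "finite (cls (carrier G) (lco G (carrier G \<inter> (\<Inter>f\<in>F. cen G f))))"
proof -
  have Fc: "f \<in> carrier G" if "f \<in> F" for f using F(2) that subgroup.mem_carrier unfolding normal_cj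
      by metis
  have "finite (cls (carrier G) (lco G (cen G f)))" if f: "f \<in> F" for f
  proof -
    have fc: "f \<in> carrier G" by (rule Fc[OF f])
    have "finite (cls (carrier G) (lco G (cen G f))) \<and> card (cls (carrier G) (lco G (cen G f))) \<le> card F"
    proof (rule cls_bound[OF equ_lco'[OF cen_subgroup[OF fc] subset_refl] F(1), of "\<lambda>a. cj G a f"])
      show "cj G a f \<in> F" if "a \<in> carrier G" for a using F(2) f that unfolding normal_cj by blast
      fix a b assume ab: "a \<in> carrier G" "b \<in> carrier G" "cj G a f = cj G b f"
      then have "cj G (inv a) (cj G b f) = f" using fc by (metis cj_inv_cancel(1))
      then have e: "cj G (inv a \<otimes> b) f = f" using ab fc by (simp add: cj_cj)
      let ?c = "inv a \<otimes> b"
      have c: "?c \<in> carrier G" using ab by simp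
      have "?c \<otimes> f = cj G ?c f \<otimes> ?c" using c fc by (simp add: cj_def m_assoc del: inv_mult_group)
      then show "lco G (cen G f) a b" using e c by (simp add: lco_def cen_def)
    qed
    then show ?thesis ..
  qed
  then show "subgroup (carrier G \<inter> (\<Inter>f\<in>F. cen G f)) G" "finite (cls (carrier G) (lco G (carrier G \<inter> (\<Inter>f\<in>F. cen G f))))"
    using lco_finite_INT[OF F(1) subgroup_self, of "cen G"] cen_subgroup[OF Fc] by blast+
qed

lemma comm_cen:
  assumes "x \<in> carrier G" "y \<in> cen G x" shows "x \<otimes> y \<otimes> inv x \<otimes> inv y = \<one>"
  using assms by (simp add: cen_def m_assoc mult_inv_cancel)

lemma derived_central:
  assumes "K \<subseteq> carrier G \<inter> (\<Inter>f\<in>K. cen G f)" shows "derived G K \<subseteq> {\<one>}"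
proof (rule derived_le[OF triv_subgroup])
  fix x y assume "x \<in> K" "y \<in> K"
  then have "x \<in> carrier G" "y \<in> cen G x" using assms by auto
  then show "x \<otimes> y \<otimes> inv x \<otimes> inv y \<in> {\<one>}" using comm_cen by simp
qed

end

text \<open>The subgroup \<open>T\<close> need not be normal, but its core still has finite index
  and inherits the bound on the derived length.\<close>

lemma soluble_by_finiteI:
  fixes G :: "'a monoid" (structure)
  assumes grp: "group G" and T: "subgroup T G" and f: "finite (cls (carrier G) (lco G T))"
      and s: "(derived G ^^ n) T \<subseteq> {\<one>}"
  shows "soluble_by_finite G"
proof -
  interpret group G by (rule grp)
  obtain M where M: "M \<lhd> G" "M \<subseteq> T" "finite (cls (carrier G) (lco G M))"
      by (rule finite_index_core[OF T f]) (rule that)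
  have sM: "subgroup M G" using M(1) by (simp add: normal_cj)
  have sn: "subgroup ((derived G ^^ k) M) G" for k by (rule exp_of_derived_is_subgroup[OF sM])
  have "(derived G ^^ n) M \<subseteq> {\<one>}" using mono_exp_of_derived[OF M(2)] s by blast
  then have 1: "(derived G ^^ n) M = {\<one>}" using subgroup.one_closed[OF sn] by blast
  let ?M = "G\<lparr>carrier := M\<rparr>"
  interpret M: group ?M by (rule subgroup_imp_group[OF sM])
  have "(derived ?M ^^ k) M = (derived G ^^ k) M \<and> (derived G ^^ k) M \<subseteq> M" for k
  proof (induction k)
    case (Suc k)
    then show ?case using derived_consistent[OF _ sM, of "(derived G ^^ k) M"] derived_incl[OF _ sM] by simp
  qed simp
  then have "(derived ?M ^^ n) (carrier ?M) = {\<one>\<^bsub>?M\<^esub>}" using 1 by simp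
  then have "solvable ?M" using M.solvable_iff_trivial_derived_seq by blast
  then show ?thesis unfolding soluble_by_finite_def P_by_Q_def using M(1) finite_quotient[OF M(1,3)]
      by blast
qed

text \<open>The centraliser of the finite group \<open>derived G M\<close> has finite index.
  Intersecting it with \<open>M\<close> leaves a group whose derived subgroup is abelian, as it
  consists of elements of \<open>derived G M\<close> that centralise
  \<open>derived G M\<close>.\<close>

lemma finite_index_finite_derived:
  fixes G :: "'a monoid" (structure)
  assumes grp: "group G" and M: "M \<lhd> G" "finite (cls (carrier G) (lco G M))" and F: "finite (derived G M)"
  shows "soluble_by_finite G" "finite_by_abelian_by_finite G"
proof -
  interpret group G by (rule grp)
  let ?F = "derived G M"
  have sM: "subgroup M G" using M(1) by (simp add: normal_cj)
  have sF: "subgroup ?F G" by (rule derived_is_subgroup[OF subgroup.subset[OF sM]])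
  have nF: "?F \<lhd> G" by (rule derived_is_normal[OF M(1)])
  let ?C = "carrier G \<inter> (\<Inter>f\<in>?F. cen G f)"
  have C: "subgroup ?C G" "finite (cls (carrier G) (lco G ?C))" using finite_index_cen[OF F nF] by blast+
  have T: "subgroup (M \<inter> ?C) G" "finite (cls (carrier G) (lco G (M \<inter> ?C)))"
    using subgroups_Inter_pair[OF sM C(1)] lco_finite_Int[OF sM C(1) subset_refl M(2) C(2)] by blast+
  have 1: "derived G (M \<inter> ?C) \<subseteq> ?F \<inter> (M \<inter> ?C)"
    using mono_derived[of "M \<inter> ?C" M] derived_incl[OF subset_refl T(1)] by blast
  have 2: "derived G (?F \<inter> (M \<inter> ?C)) \<subseteq> {\<one>}"
    by (rule derived_central) blast
  have "(derived G ^^ Suc (Suc 0)) (M \<inter> ?C) \<subseteq> {\<one>}"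
    using subset_trans[OF mono_derived[OF 1] 2] by simp
  then show "soluble_by_finite G" by (rule soluble_by_finiteI[OF grp T])
  let ?M = "G\<lparr>carrier := M\<rparr>"
  interpret M: group ?M by (rule subgroup_imp_group[OF sM])
  have "?F \<lhd> ?M" by (rule derived_subgroup_is_normal[OF sM])
  moreover have "?F \<subseteq> M" by (rule derived_incl[OF subset_refl sM])
  moreover have "?M\<lparr>carrier := ?F\<rparr> = G\<lparr>carrier := ?F\<rparr>" by simp
  moreover have "finite_group (G\<lparr>carrier := ?F\<rparr>)" using subgroup_imp_group[OF sF] F
      by (simp add: finite_group_def)
  moreover have "comm_group (?M Mod ?F)" by (rule derived_quot_of_subgroup_is_comm_group[OF sM])
  ultimately have "P_by_Q finite_group comm_group ?M" unfolding P_by_Q_def by auto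
  then show "finite_by_abelian_by_finite G"
    unfolding finite_by_abelian_by_finite_def P_by_Q_def[of "P_by_Q finite_group comm_group"]
        using M(1) finite_quotient[OF M] by blast
qed

text \<open>Let \<open>?T\<close> consist of the elements of \<open>A\<close> that centralise
  \<open>F/N\<close>, given by finitely many representatives, and also the finite group
  \<open>derived G N\<close>. It has finite index, and its derived series passes through
  \<open>F\<close>, \<open>N\<close> and \<open>derived G N\<close> to the trivial group in four
  steps.\<close>

lemma section_soluble:
  fixes G :: "'a monoid" (structure)
  assumes grp: "group G" and N: "N \<lhd> G" "finite (derived G N)" and sec: "secn G A N"
      and A: "finite (cls (carrier G) (lco G A))"
    and F: "subgroup F G" "N \<subseteq> F" "F \<subseteq> A" "finite (cls F (lco G N))"
      "\<And>x y. x \<in> A \<Longrightarrow> y \<in> A \<Longrightarrow> x \<otimes> y \<otimes> inv x \<otimes> inv y \<in> F" "\<And>a f. a \<in> A \<Longrightarrow> f \<in> F \<Longrightarrow> cj G a f \<in> F"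
  shows "soluble_by_finite G"
proof -
  interpret group G by (rule grp)
  interpret S: section_group G A N using sec by unfold_locales
  have Ac: "A \<subseteq> carrier G" by (rule subgroup.subset[OF S.A])
  obtain r :: nat and u where u: "\<And>i. i < r \<Longrightarrow> u i \<in> F" "\<And>x. x \<in> F \<Longrightarrow> \<exists>i<r. S.eq (u i) x"
    using finite_representatives[OF S.equA[OF F(3)] F(4)] by metis
  let ?I = "A \<inter> (\<Inter>i\<in>{..<r}. S.C (u i))"
  have uA: "u i \<in> A" if "i < r" for i using u(1)[OF that] F(3) by blast
  have "finite (cls A (lco G (S.C (u i))))" if i: "i < r" for i
  proof -
    have "S.K (u i) \<subseteq> F"
    proof
      fix z assume "z \<in> S.K (u i)"
      then obtain y where y: "z \<in> A" "y \<in> A" "S.eq (S.cjg y (u i)) z" by (auto simp: Kl_def)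
      have "S.cjg y (u i) \<in> F" by (rule F(6)[OF y(2) u(1)[OF i]])
      moreover have "inv (S.cjg y (u i)) \<otimes> z \<in> F" using y(3) F(2) by (auto simp: lco_def)
      ultimately have "S.cjg y (u i) \<otimes> (inv (S.cjg y (u i)) \<otimes> z) \<in> F" by (rule subgroup.m_closed[OF F(1)])
      then show "z \<in> F" using y uA[OF i] by (simp add: mult_inv_cancel)
    qed
    then have "finite (cls (S.K (u i)) S.eq)" by (rule finite_cls_subset[OF S.equA[OF F(3)] _ F(4)])
    then show ?thesis using S.finite_K_iff[OF uA[OF i]] by blast
  qed
  then have I: "subgroup ?I G" "finite (cls A (lco G ?I))"
    using lco_finite_INT[of "{..<r}" A "\<lambda>i. S.C (u i)"] S.A S.C_subgroup[OF uA] by auto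
  let ?F = "derived G N"
  have nF: "?F \<lhd> G" by (rule derived_is_normal[OF N(1)])
  let ?C = "carrier G \<inter> (\<Inter>f\<in>?F. cen G f)"
  have C: "subgroup ?C G" "finite (cls (carrier G) (lco G ?C))" using finite_index_cen[OF N(2) nF] by blast+
  let ?T = "?I \<inter> ?C"
  have fI: "finite (cls (carrier G) (lco G ?I))" using lco_finite_mult[OF S.A I(1) _ subset_refl A I(2)]
      by blast
  have T: "subgroup ?T G" "finite (cls (carrier G) (lco G ?T))"
    using subgroups_Inter_pair[OF I(1) C(1)] lco_finite_Int[OF I(1) C(1) subset_refl fI C(2)] by blast+
  have 1: "derived G ?T \<subseteq> F \<inter> ?T"
    using derived_le[OF F(1), of ?T] F(5) derived_incl[OF subset_refl T(1)] by blast
  have com: "x \<otimes> y \<otimes> inv x \<otimes> inv y \<in> N" if xy: "x \<in> F \<inter> ?T" "y \<in> F \<inter> ?T" for x y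
  proof -
    obtain i where i: "i < r" "S.eq (u i) y" using u(2)[of y] xy by blast
    have yA: "y \<in> A" and xA: "x \<in> A" using xy by auto
    have "x \<in> S.C (u i)" using xy(1) i(1) by blast
    then have "x \<in> S.C y" using S.C_cong[OF uA[OF i(1)] yA i(2)] by simp
    then have "inv y \<otimes> (x \<otimes> y \<otimes> inv x) \<in> N" by (simp add: CN_def lco_def cj_def)
    then have "S.cjg y (inv y \<otimes> (x \<otimes> y \<otimes> inv x)) \<in> N" by (rule S.nrm[OF yA])
    then show ?thesis using xA yA by (simp add: cj_def gsimps)
  qed
  have 2: "derived G (F \<inter> ?T) \<subseteq> N \<inter> ?T"
    using derived_le[OF S.N com] derived_incl[OF _ T(1), of "F \<inter> ?T"] by blast
  have 3: "derived G (N \<inter> ?T) \<subseteq> ?F \<inter> ?T"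
    using mono_derived[of "N \<inter> ?T" N] derived_incl[OF _ T(1), of "N \<inter> ?T"] by blast
  have 4: "derived G (?F \<inter> ?T) \<subseteq> {\<one>}"
    by (rule derived_central) blast
  have "derived G (derived G (derived G (derived G ?T))) \<subseteq> {\<one>}"
    by (rule subset_trans[OF mono_derived[OF subset_trans[OF mono_derived[OF subset_trans[OF mono_derived[OF 1] 2]] 3]] 4])
  then have "(derived G ^^ Suc (Suc (Suc (Suc 0)))) ?T \<subseteq> {\<one>}" by simp
  then show ?thesis by (rule soluble_by_finiteI[OF grp T])
qed

context group begin

lemma nge_lco_one: "X \<subseteq> carrier G \<Longrightarrow> nge n X (lco G {\<one>}) \<longleftrightarrow> nge n X (=)"
  using nge_iff[OF equ_lco'[OF triv_subgroup, of X], of n] nge_iff[OF equ_eq[of X], of n] cls_lco_one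
      by simp

text \<open>Classes under conjugation by \<open>B\<close> lie inside those under \<open>A\<close>,
  so the bound for \<open>A\<close> serves the section \<open>B/N\<close>.\<close>

lemma finite_derived_bounded:
  assumes sec: "secn G A N" "secn G B N" "B \<subseteq> A" and D: "\<And>x. x \<in> B \<Longrightarrow> \<not> nge D (Kl G A N x) (lco G N)"
  obtains F where "subgroup F G" "N \<subseteq> F" "F \<subseteq> B" "finite (cls F (lco G N))"
    "\<And>x y. x \<in> B \<Longrightarrow> y \<in> B \<Longrightarrow> x \<otimes> y \<otimes> inv x \<otimes> inv y \<in> F" "\<And>a f. a \<in> B \<Longrightarrow> f \<in> F \<Longrightarrow> cj G a f \<in> F"
proof -
  interpret S: section_group G A N using sec(1) by unfold_locales
  interpret T: section_group G B N using sec(2) by unfold_locales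
  have b: "finite (cls (T.K x) T.eq) \<and> card (cls (T.K x) T.eq) \<le> D" if x: "x \<in> B" for x
  proof -
    have c: "finite (cls (S.K x) S.eq)" "card (cls (S.K x) S.eq) < D"
      using D[OF x] not_nge[OF S.equA[OF S.KA]] by auto
    have "T.K x \<subseteq> S.K x" using sec(3) by (auto simp: Kl_def)
    then show ?thesis using lco_finite_subset[OF S.N _ subset_trans[OF S.KA subgroup.subset[OF S.A]] c(1)] c(2)
      by (meson le_trans less_imp_le)
  qed
  show ?thesis by (rule T.section_derived[of D]) (use b in blast, use b in blast, rule that)
qed

lemma finite_derived_bounded_one:
  assumes A: "subgroup A G" "subgroup B G" "B \<subseteq> A" and D: "\<And>x. x \<in> B \<Longrightarrow> \<not> nge D (Kl G A {\<one>} x) (lco G {\<one>})"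
  shows "finite (derived G B)"
proof -
  obtain F where F: "subgroup F G" "finite (cls F (lco G {\<one>}))"
    "\<And>x y. x \<in> B \<Longrightarrow> y \<in> B \<Longrightarrow> x \<otimes> y \<otimes> inv x \<otimes> inv y \<in> F"
    by (rule finite_derived_bounded[OF secn_one[OF A(1)] secn_one[OF A(2)] A(3) D]) (assumption, rule that)
  have "derived G B \<subseteq> F" by (rule derived_le[OF F(1,3)])
  then show ?thesis using F(2) finite_cls_lco_one[OF subgroup.subset[OF F(1)]] finite_subset by simp
qed

text \<open>Conjugation by an element of \<open>G\<close> preserves \<open>N\<close> and so carries
  \<open>N\<close>-classes to \<open>N\<close>-classes of the same size.\<close>

lemma Zd_normal:
  assumes N: "N \<lhd> G" and Z: "subgroup (Zd D G N {\<one>}) G"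
  shows "Zd D G N {\<one>} \<lhd> G"
  unfolding normal_cj
proof (intro conjI ballI Z)
  fix g x assume g: "g \<in> carrier G" and x: "x \<in> Zd D G N {\<one>}"
  have sN: "subgroup N G" and Ncj: "\<And>a n. a \<in> carrier G \<Longrightarrow> n \<in> N \<Longrightarrow> cj G a n \<in> N" using N
      by (auto simp: normal_cj)
  have Nc: "n \<in> carrier G" if "n \<in> N" for n using that subgroup.mem_carrier[OF sN] by blast
  have xN: "x \<in> N" using x by (simp add: Zd_def)
  have K: "Kl G N {\<one>} w = (\<lambda>y. cj G y w) ` N" if "w \<in> N" for w
    using lco_one that Nc Ncj unfolding Kl_def by (fastforce simp: image_iff)
  have Kc: "Kl G N {\<one>} w \<subseteq> carrier G" for w using Nc by (auto simp: Kl_def)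
  have "\<not> nge D (Kl G N {\<one>} x) (=)" using x nge_lco_one[OF Kc] by (simp add: Zd_def)
  then have f: "finite (Kl G N {\<one>} x)" "card (Kl G N {\<one>} x) < D" by (auto simp: nge_card)
  have "Kl G N {\<one>} (cj G g x) \<subseteq> cj G g ` Kl G N {\<one>} x"
    unfolding K[OF xN] K[OF Ncj[OF g xN]]
  proof
    fix w assume "w \<in> (\<lambda>y. cj G y (cj G g x)) ` N"
    then obtain y where y: "y \<in> N" "w = cj G y (cj G g x)" by auto
    have "w = cj G g (cj G (cj G (inv g) y) x)" using y g Nc[OF y(1)] Nc[OF xN] by (simp add: cj_def gsimps)
    then show "w \<in> cj G g ` (\<lambda>y. cj G y x) ` N" using Ncj[of "inv g" y] y g by blast
  qed
  then have "finite (Kl G N {\<one>} (cj G g x))" "card (Kl G N {\<one>} (cj G g x)) \<le> card (Kl G N {\<one>} x)"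
    using f(1) finite_subset surj_card_le by blast+
  then have "\<not> nge D (Kl G N {\<one>} (cj G g x)) (=)" using f(2) by (simp add: nge_card)
  then show "cj G g x \<in> Zd D G N {\<one>}" using nge_lco_one[OF Kc] Ncj[OF g xN] by (simp add: Zd_def)
qed

end

section \<open>Solubility and the dichotomy\<close>

context dim2 begin

text \<open>First \<open>N\<close> is replaced by \<open>?N\<close>, its elements with boundedly
  many conjugates under \<open>N\<close>, which is normal in \<open>G\<close>, infinite, and has
  finite derived subgroup. Being infinite it has dimension at least 1, so if its index in
  \<open>G\<close> is infinite, \<open>section_centre\<close> applies again, now to \<open>G\<close>
  modulo \<open>?N\<close> with \<open>d = 1\<close>.\<close>

lemma line_soluble:
  assumes N: "N \<lhd> G" "mdef G N" "infinite N" "\<not> dge G N (Suc (Suc 0))"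
  shows "soluble_by_finite G"
proof -
  have sN: "subgroup N G" using N(1) by (simp add: normal_cj)
  obtain F b where F: "fof F" "env G b" "N = F G b" using N(2) by (rule mdef_fof)
  define one where "one = (\<lambda>(M::'a monoid) (s::nat\<Rightarrow>'a). if group M then {\<one>\<^bsub>M\<^esub>} else {})"
  have one: "fof one" unfolding one_def by (rule fof_one)
  have o: "one G b = {\<one>\<^bsub>G\<^esub>}" unfolding one_def by (simp_all only: grp if_True)
  have sec: "secn G (F G b) (one G b)" unfolding o F(3)[symmetric] by (rule secn_one[OF sN])
  have d: "dge G (one G b) 0" using dge_0[OF model_G fof_mdef[OF one F(2)]] by (simp add: o)
  have i: "infinite (cls (F G b) (lco G (one G b)))"
    using finite_cls_lco_one[OF subgroup.subset[OF sN]] N(3) by (simp add: o F(3)[symmetric])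
  obtain D where D: "subgroup (Zd D G (F G b) (one G b)) G" "infinite (cls (Zd D G (F G b) (one G b)) (lco G (one G b)))"
    "finite (cls (F G b) (lco G (Zd D G (F G b) (one G b))))"
    by (rule section_centre[OF pf F(2,1) one sec d N(4)[unfolded F(3)] i]) (rule that)
  let ?N = "Zd D G N {\<one>\<^bsub>G\<^esub>}"
  define f where "f = (\<lambda>(M::'a monoid) s. Zd D M (F M s) (one M s))"
  have f: "fof f" unfolding f_def by (rule fof_Zd[OF F(1) one])
  have fN: "f G b = ?N" by (simp add: f_def o F(3)[symmetric])
  have sN0: "subgroup ?N G" using D(1) by (simp add: o F(3)[symmetric])
  have nN0: "?N \<lhd> G" by (rule Zd_normal[OF N(1) sN0])
  have "infinite ?N" using D(2) finite_cls_lco_one[OF subgroup.subset[OF sN0]]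
      by (simp add: o F(3)[symmetric])
  then have d1: "dge G (f G b) (Suc 0)" using dge_1[OF model_G fof_mdef[OF f F(2)]] by (simp add: fN)
  have der: "finite (derived G ?N)"
    by (rule finite_derived_bounded_one[OF sN sN0, of D]) (auto simp: Zd_def)
  show ?thesis
  proof (cases "finite (cls (carrier G) (lco G ?N))")
    case True
    then show ?thesis by (rule finite_index_finite_derived(1)[OF grp nN0 _ der])
  next
    case False
    have sec': "secn G (carrier G) (f G b)" using nN0 sN0 subgroup_self subgroup.subset[OF sN0]
      by (auto simp: secn_def fN normal_cj)
    have i': "infinite (cls (carrier G) (lco G (f G b)))" using False by (simp add: fN)
    obtain E where E: "subgroup (Zd E G (carrier G) (f G b)) G" "f G b \<subseteq> Zd E G (carrier G) (f G b)"
      "finite (cls (carrier G) (lco G (Zd E G (carrier G) (f G b))))"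
      by (rule section_centre[OF pf F(2) fof_carrier f sec' d1 not3 i']) (rule that)
    let ?Y = "Zd E G (carrier G) ?N"
    have Yc: "?Y \<subseteq> carrier G" by (auto simp: Zd_def)
    have Y: "subgroup ?Y G" "?N \<subseteq> ?Y" "finite (cls (carrier G) (lco G ?Y))" using E by (simp_all add: fN)
    have secY: "secn G ?Y ?N" using nN0 sN0 Y Yc by (auto simp: secn_def normal_cj)
    have sec0: "secn G (carrier G) ?N" using sec' by (simp add: fN)
    obtain F' where F': "subgroup F' G" "?N \<subseteq> F'" "F' \<subseteq> ?Y" "finite (cls F' (lco G ?N))"
      "\<And>x y. x \<in> ?Y \<Longrightarrow> y \<in> ?Y \<Longrightarrow> x \<otimes>\<^bsub>G\<^esub> y \<otimes>\<^bsub>G\<^esub> inv\<^bsub>G\<^esub> x \<otimes>\<^bsub>G\<^esub> inv\<^bsub>G\<^esub> y \<in> F'" "\<And>a f. a \<in> ?Y \<Longrightarrow> f \<in> F' \<Longrightarrow>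
          cj G a f \<in> F'"
    proof (rule finite_derived_bounded[OF sec0 secY Yc, of E])
      show "x \<in> ?Y \<Longrightarrow> \<not> nge E (Kl G (carrier G) ?N x) (lco G ?N)" for x by (simp add: Zd_def)
    qed (rule that)
    show ?thesis by (rule section_soluble[OF grp nN0 der secY Y(3) F'])
  qed
qed

lemma dichotomy:
  "soluble_by_finite G \<and> finite_by_abelian_by_finite G \<or>
   (\<exists>N. N \<lhd> G \<and> mdef G N \<and> infinite N \<and> \<not> dge G N (Suc (Suc 0)))"
proof -
  obtain D1 where D1: "D1 \<ge> 2" "Zd D1 G (carrier G) {\<one>\<^bsub>G\<^esub>} = FC" using FC_Zd by blast
  have cjF: "cj G g z \<in> FC" if "g \<in> carrier G" "z \<in> FC" for g z
    using Zd_cj[of g z D1] that subgroup.mem_carrier[OF FC_subgroup] by (simp add: D1(2))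
  have nF: "FC \<lhd> G" using FC_subgroup cjF by (simp add: normal_cj)
  define one where "one = (\<lambda>(M::'a monoid) (s::nat\<Rightarrow>'a). if group M then {\<one>\<^bsub>M\<^esub>} else {})"
  have one: "fof one" unfolding one_def by (rule fof_one)
  define f where "f = (\<lambda>(M::'a monoid) s. Zd D1 M (carrier M) (one M s))"
  have f: "fof f" unfolding f_def by (rule fof_Zd[OF fof_carrier one])
  have fF: "f G s = FC" for s unfolding f_def one_def by (simp only: grp if_True D1(2))
  define b where "b = (\<lambda>_::nat. \<one>\<^bsub>G\<^esub>)"
  have b: "env G b" by (simp add: b_def env_def)
  show ?thesis
  proof (cases "finite (cls (carrier G) (lco G FC))")
    case True
    have "\<not> nge D1 (Kl G (carrier G) {\<one>\<^bsub>G\<^esub>} x) (lco G {\<one>\<^bsub>G\<^esub>})" if "x \<in> FC" for x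
      using that unfolding D1(2)[symmetric] by (simp add: Zd_def)
    then have "finite (derived G FC)"
      by (rule finite_derived_bounded_one[OF subgroup_self FC_subgroup subgroup.subset[OF FC_subgroup]])
    then show ?thesis using finite_index_finite_derived[OF grp nF True] by blast
  next
    case i: False
    show ?thesis
    proof (cases "finite FC")
      case False
      have "\<not> dge G FC (Suc (Suc 0))"
      proof
        assume d: "dge G FC (Suc (Suc 0))"
        have "dge G (carrier G) (Suc (Suc (Suc 0)))"
          using fof_dge_cosets[OF model_G b fof_carrier f, of "Suc (Suc 0)"] d i FC_subgroup
            subgroup.mem_carrier[OF FC_subgroup] by (simp add: fF)
        then show False using not3 by simp
      qed
      moreover have "mdef G FC" using fof_mdef[OF f b] by (simp add: fF)
      ultimately show ?thesis using nF False by blast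
    next
      case True
      obtain D where D: "\<And>x y. x \<in> carrier G \<Longrightarrow> y \<in> carrier G \<Longrightarrow> \<not> nge D (carrier G) (lco G (cen G x)) \<or>
        \<not> nge D (cen G x) (lco G (cen G x \<inter> cen G y)) \<or> \<not> nge D (cen G x \<inter> cen G y) (=)"
        using centraliser_bound by blast
      interpret L: lines G dm D D1 by unfold_locales (rule D, assumption, assumption, rule D1, rule D1, rule True)
      obtain x where x: "x \<in> L.L" "Nx D G x = carrier G" using L.normal_line by blast
      have "cj G g w \<in> Ax D G x" if "g \<in> carrier G" "w \<in> Ax D G x" for g w
        using NxD[of g D x w] that L.Ac x(2) by blast
      then have "Ax D G x \<lhd> G" using L.A_subgroup[OF x(1)] by (simp add: normal_cj)
      moreover have "mdef G (Ax D G x)"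
        using fof_mdef[OF fof_Ax[OF ft_var[of 0]], of G "\<lambda>_. x" D] L.L_carrier[OF x(1)]
            by (simp add: env_def)
      moreover have "infinite (Ax D G x)" using L.infinite_A[OF x(1)] by blast
      ultimately show ?thesis using L.not_dge_A[OF x(1)] by blast
    qed
  qed
qed

end

theorem theorem1p2:
  fixes G :: "'a monoid"
    and dm :: "'a monoid \<Rightarrow> 'a list set set \<Rightarrow> ereal"
  assumes "pseudofinite G"
    and "dimension G dm"
    and "additive_dim G dm"
    and "fine_dim G dm"
    and "dm G (home (carrier G)) = 2"
  shows "soluble_by_finite G \<and>
    (\<not> finite_by_abelian_by_finite G \<longrightarrow>
      (\<exists>N. N \<lhd> G \<and> definable G N \<and> dm G (home N) = 1))"
proof -
  have grp: "group G" and inf: "infinite (carrier G)" using assms(1) by (simp_all add: pseudofinite_def)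
  interpret T: dim_theory G dm by (rule dim_theory.intro) (use assms grp inf in simp_all)
  interpret T: dim2 G dm
    by (rule dim2.intro[OF T.dim_theory_axioms dim2_axioms.intro]) (use assms in \<open>simp_all add: T.dge_def\<close>)
  show ?thesis
  proof (cases "soluble_by_finite G \<and> finite_by_abelian_by_finite G")
    case False
    then obtain N where N: "N \<lhd> G" "mdef G N" "infinite N" "\<not> T.dge G N (Suc (Suc 0))"
      using T.dichotomy by blast
    have "T.dge G N (Suc 0)" using T.dge_1[OF T.model_G N(2)] N(3) by simp
    then have "dm G (home N) = 1" using T.dge_value[OF T.model_G N(2) _ N(4)] by simp
    then show ?thesis using N T.line_soluble[OF N] mdef_definable[OF grp N(2)] by blast
  qed blast
qed

end
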